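(* The following five problems all have the same time complexity as functions of their input size, up to polylogarithmic factors: \textsc{EdgeTriangleCounting} (input size $m$, the number of edges), and the offline versions of \textsc{RangeEqPairsQuery}, \textsc{2RangeEqPairsQuery}, \textsc{RangeInversionsQuery}, \textsc{2RangeInversionsQuery} restricted to instances with $q=\Theta(n)$ queries (input size $n$). That is, if any one of these problems can be solved in $T(N)$ time on inputs of size $N$, then each of the others can be solved in $T(N)\cdot \mathrm{polylog}(N)$ time (more precisely, in $\tilde O(T(N))$ time, where $\tilde O$ hides polylogarithmic factors).
   Context: \textsc{EdgeTriangleCounting}: given an undirected graph $G=(V,E)$ with $n$ nodes and $m$ edges (no isolated vertices), compute for every edge $e\in E$ the number of triangles of $G$ containing $e$. In all the following range query problems the input is an array of integers $A[1..n]$ and a sequence of $q$ queries; "offline" means all queries are given in advance. \textsc{RangeInversionsQuery}: each query is a range $[l,r]$ and the answer is $|\{(i,j): l\le i<j\le r,\ A[i]>A[j]\}|$. \textsc{RangeEqPairsQuery}: each query is a range $[l,r]$ and the answer is $|\{(i,j): l\le i<j\le r,\ A[i]=A[j]\}|$. \textsc{2RangeInversionsQuery}: each query is a pair of nonoverlapping ranges $([l',r'],[l'',r''])$ with $r'<l''$, and the answer is $|\{(i,j): l'\le i\le r',\ l''\le j\le r'',\ A[i]>A[j]\}|$. \textsc{2RangeEqPairsQuery}: same as the previous but counting pairs with $A[i]=A[j]$. *)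

theory Defs
  imports Complex_Main "HOL-Library.Landau_Symbols"
begin

section \<open>The word RAM\<close>

text \<open>
  Running times are counted on a deterministic unit-cost word RAM. For word size \<open>w\<close>, words are
  the naturals below \<open>2 ^ w\<close>, which also serve as the addresses of a single flat memory. A program
  is a fixed structured program over finitely many registers; every instruction and every
  evaluation of a loop or branch condition costs one step.
\<close>

datatype binop = Add | Sub | Mul | Div | Mod | And | Or | Xor | Shl | Shr | Less | Equal

fun apply_op :: "nat \<Rightarrow> binop \<Rightarrow> nat \<Rightarrow> nat \<Rightarrow> nat" where
  "apply_op w Add x y = take_bit w (x + y)"
| "apply_op w Sub x y = nat (take_bit w (int x - int y))"
| "apply_op w Mul x y = take_bit w (x * y)"
| "apply_op w Div x y = take_bit w (x div y)"
| "apply_op w Mod x y = take_bit w (x mod y)"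
| "apply_op w And x y = take_bit w (Bit_Operations.and x y)"
| "apply_op w Or x y = take_bit w (Bit_Operations.or x y)"
| "apply_op w Xor x y = take_bit w (Bit_Operations.xor x y)"
| "apply_op w Shl x y = take_bit w (push_bit y x)"
| "apply_op w Shr x y = take_bit w (drop_bit y x)"
| "apply_op w Less x y = take_bit w (of_bool (x < y))"
| "apply_op w Equal x y = take_bit w (of_bool (x = y))"

type_synonym reg = nat

text \<open>In \<open>Load x y\<close> and \<open>Store y x\<close> the register \<open>y\<close> holds the address.\<close>

datatype prog =
    Skip
  | Const reg nat
  | BinOp reg binop reg reg
  | Load reg reg
  | Store reg reg
  | Seq prog prog
  | IfNZ reg prog prog
  | WhileNZ reg prog

record state =
  regs :: "reg \<Rightarrow> nat"
  mem :: "nat \<Rightarrow> nat"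

text \<open>\<open>exec w p s t s'\<close>: with word size \<open>w\<close>, \<open>p\<close> started in \<open>s\<close> halts in \<open>s'\<close> after \<open>t\<close> steps.\<close>

inductive exec :: "nat \<Rightarrow> prog \<Rightarrow> state \<Rightarrow> nat \<Rightarrow> state \<Rightarrow> bool" for w :: nat where
  Skip: "exec w Skip s 1 s"
| Const: "exec w (Const x k) s 1 (s\<lparr>regs := (regs s)(x := take_bit w k)\<rparr>)"
| BinOp: "exec w (BinOp x f y z) s 1
            (s\<lparr>regs := (regs s)(x := apply_op w f (regs s y) (regs s z))\<rparr>)"
| Load: "exec w (Load x y) s 1 (s\<lparr>regs := (regs s)(x := mem s (regs s y))\<rparr>)"
| Store: "exec w (Store y x) s 1 (s\<lparr>mem := (mem s)(regs s y := regs s x)\<rparr>)"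
| Seq: "exec w p s t s' \<Longrightarrow> exec w q s' u s'' \<Longrightarrow> exec w (Seq p q) s (t + u) s''"
| IfTrue: "regs s x \<noteq> 0 \<Longrightarrow> exec w p s t s' \<Longrightarrow> exec w (IfNZ x p q) s (1 + t) s'"
| IfFalse: "regs s x = 0 \<Longrightarrow> exec w q s t s' \<Longrightarrow> exec w (IfNZ x p q) s (1 + t) s'"
| WhileTrue: "regs s x \<noteq> 0 \<Longrightarrow> exec w p s t s' \<Longrightarrow> exec w (WhileNZ x p) s' u s''
               \<Longrightarrow> exec w (WhileNZ x p) s (1 + t + u) s''"
| WhileFalse: "regs s x = 0 \<Longrightarrow> exec w (WhileNZ x p) s 1 s"

definition initial_state :: "nat list \<Rightarrow> state" where
  "initial_state inp =
     \<lparr>regs = (\<lambda>_. 0), mem = (\<lambda>i. if i < length inp then inp ! i else 0)\<rparr>"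

definition outputs :: "state \<Rightarrow> nat list \<Rightarrow> bool" where
  "outputs s out \<longleftrightarrow> (\<forall>i < length out. mem s i = out ! i)"


section \<open>Problems and their time complexity\<close>

text \<open>
  \<open>P w N inp out\<close> says that the word list \<open>inp\<close> encodes, for word size \<open>w\<close>, an instance of size
  \<open>N\<close> of the problem \<open>P\<close> and that \<open>out\<close> is its answer.
\<close>

type_synonym problem = "nat \<Rightarrow> nat \<Rightarrow> nat list \<Rightarrow> nat list \<Rightarrow> bool"

text \<open>
  The condition \<open>(N + 2) ^ c \<le> 2 ^ w\<close> is the usual assumption \<open>w = \<Omega>(log N)\<close>. The algorithm chooses
  \<open>c\<close>, large enough for the instance, the answers and its own addresses to fit into words; its
  running time may depend on the input size only, not on \<open>w\<close>.
\<close>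

definition solvable_in_time :: "problem \<Rightarrow> (nat \<Rightarrow> real) \<Rightarrow> bool" where
  "solvable_in_time P T \<longleftrightarrow>
     (\<exists>p c. \<forall>w N inp out. P w N inp out \<and> (N + 2) ^ c \<le> 2 ^ w \<longrightarrow>
        (\<exists>t s. exec w p (initial_state inp) t s \<and> outputs s out \<and> real t \<le> T N))"

definition soft_O :: "(nat \<Rightarrow> real) \<Rightarrow> (nat \<Rightarrow> real) set" where
  "soft_O T = {T'. \<exists>k. T' \<in> O(\<lambda>N. T N * ln (real N) ^ k)}"


section \<open>Counting triangles\<close>

definition simple_graph :: "'v set \<Rightarrow> 'v set set \<Rightarrow> bool" where
  "simple_graph V E \<longleftrightarrow> finite V \<and> (\<forall>e \<in> E. e \<subseteq> V \<and> card e = 2)"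

definition no_isolated_vertices :: "'v set \<Rightarrow> 'v set set \<Rightarrow> bool" where
  "no_isolated_vertices V E \<longleftrightarrow> (\<forall>v \<in> V. \<exists>e \<in> E. v \<in> e)"

definition is_triangle :: "'v set set \<Rightarrow> 'v set \<Rightarrow> bool" where
  "is_triangle E t \<longleftrightarrow> card t = 3 \<and> (\<forall>x \<in> t. \<forall>y \<in> t. x \<noteq> y \<longrightarrow> {x, y} \<in> E)"

definition triangles_at :: "'v set set \<Rightarrow> 'v set \<Rightarrow> nat" where
  "triangles_at E e = card {t. is_triangle E t \<and> e \<subseteq> t}"

definition edge_triangle_counting :: problem where
  "edge_triangle_counting w m inp out \<longleftrightarrow>
     (\<exists>n es. let edges = map (\<lambda>(u, v). {u, v}) es; V = {1..n}; E = set edges in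
        simple_graph V E \<and> no_isolated_vertices V E \<and>
        distinct edges \<and> length edges = m \<and>
        inp = [n, m] @ concat (map (\<lambda>(u, v). [u, v]) es) \<and>
        out = map (triangles_at E) edges)"


section \<open>Offline range queries\<close>

text \<open>Arrays are indexed from 1, hence the shift in \<open>A ! (i - 1)\<close>.\<close>

definition range_pairs :: "(int \<Rightarrow> int \<Rightarrow> bool) \<Rightarrow> int list \<Rightarrow> nat \<times> nat \<Rightarrow> nat" where
  "range_pairs R A = (\<lambda>(l, r).
     card {(i, j). l \<le> i \<and> i < j \<and> j \<le> r \<and> R (A ! (i - 1)) (A ! (j - 1))})"

definition two_range_pairs ::
    "(int \<Rightarrow> int \<Rightarrow> bool) \<Rightarrow> int list \<Rightarrow> (nat \<times> nat) \<times> (nat \<times> nat) \<Rightarrow> nat" where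
  "two_range_pairs R A = (\<lambda>((l1, r1), (l2, r2)).
     card {(i, j). l1 \<le> i \<and> i \<le> r1 \<and> l2 \<le> j \<and> j \<le> r2 \<and> R (A ! (i - 1)) (A ! (j - 1))})"

text \<open>Array entries are arbitrary integers fitting into a word, in two's complement.\<close>

definition fits_word :: "nat \<Rightarrow> int \<Rightarrow> bool" where
  "fits_word w a \<longleftrightarrow> - (2 ^ w) \<le> 2 * a \<and> 2 * a < 2 ^ w"

definition encode_int :: "nat \<Rightarrow> int \<Rightarrow> nat" where
  "encode_int w a = nat (take_bit w a)"

text \<open>
  The parameters \<open>\<alpha>\<close> and \<open>\<beta>\<close> below are the constants hidden in \<open>q = \<Theta>(n)\<close>. The second half of
  \<open>linear_bounds\<close> only excludes constants such as \<open>\<alpha> = \<beta> = 1/2\<close>, for which there are no instances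
  at all for infinitely many sizes \<open>n\<close>.
\<close>

definition linear_bounds :: "real \<Rightarrow> real \<Rightarrow> bool" where
  "linear_bounds \<alpha> \<beta> \<longleftrightarrow>
     0 < \<alpha> \<and> (\<forall>\<^sub>F n in sequentially. \<exists>q::nat. \<alpha> * real n \<le> real q \<and> real q \<le> \<beta> * real n)"

definition range_query :: "(int \<Rightarrow> int \<Rightarrow> bool) \<Rightarrow> real \<Rightarrow> real \<Rightarrow> problem" where
  "range_query R \<alpha> \<beta> w n inp out \<longleftrightarrow>
     (\<exists>A qs. length A = n \<and> (\<forall>a \<in> set A. fits_word w a) \<and>
        (\<forall>(l, r) \<in> set qs. 1 \<le> l \<and> l \<le> r \<and> r \<le> n) \<and>
        \<alpha> * real n \<le> real (length qs) \<and> real (length qs) \<le> \<beta> * real n \<and>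
        inp = [n, length qs] @ map (encode_int w) A @ concat (map (\<lambda>(l, r). [l, r]) qs) \<and>
        out = map (range_pairs R A) qs)"

definition two_range_query :: "(int \<Rightarrow> int \<Rightarrow> bool) \<Rightarrow> real \<Rightarrow> real \<Rightarrow> problem" where
  "two_range_query R \<alpha> \<beta> w n inp out \<longleftrightarrow>
     (\<exists>A qs. length A = n \<and> (\<forall>a \<in> set A. fits_word w a) \<and>
        (\<forall>((l1, r1), (l2, r2)) \<in> set qs. 1 \<le> l1 \<and> l1 \<le> r1 \<and> r1 < l2 \<and> l2 \<le> r2 \<and> r2 \<le> n) \<and>
        \<alpha> * real n \<le> real (length qs) \<and> real (length qs) \<le> \<beta> * real n \<and>
        inp = [n, length qs] @ map (encode_int w) A @
              concat (map (\<lambda>((l1, r1), (l2, r2)). [l1, r1, l2, r2]) qs) \<and>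
        out = map (two_range_pairs R A) qs)"

definition range_eq_pairs_query :: "real \<Rightarrow> real \<Rightarrow> problem" where
  "range_eq_pairs_query = range_query (=)"

definition two_range_eq_pairs_query :: "real \<Rightarrow> real \<Rightarrow> problem" where
  "two_range_eq_pairs_query = two_range_query (=)"

definition range_inversions_query :: "real \<Rightarrow> real \<Rightarrow> problem" where
  "range_inversions_query = range_query (>)"

definition two_range_inversions_query :: "real \<Rightarrow> real \<Rightarrow> problem" where
  "two_range_inversions_query = two_range_query (>)"

definition five_problems :: "real \<Rightarrow> real \<Rightarrow> problem set" where
  "five_problems \<alpha> \<beta> =
     {edge_triangle_counting,
      range_eq_pairs_query \<alpha> \<beta>, two_range_eq_pairs_query \<alpha> \<beta>,
      range_inversions_query \<alpha> \<beta>, two_range_inversions_query \<alpha> \<beta>}"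

end

(*
  The five problems lie on a cycle of reductions: triangles are counted by two-range queries for equal
  pairs in adjacency lists; a two-range query combines four one-range queries; pairs that are not equal
  are inversions of the array or of its negation; the pairs within a range split into pairs from sibling
  dyadic blocks; and two-range inversions become triangles on nodes for dyadic blocks of positions and
  of values, with multiplicities expanded in binary.
*)

theory Submission
  imports Defs "HOL-Library.FuncSet"
begin

section \<open>Simulating a word RAM with a smaller word size\<close>

text \<open>Two obstacles shape the proof. Nothing relates the values of \<open>T\<close> at
  different sizes, so every instance handed to a solver must have size exactly
  \<open>max N n0\<close>: large data are cut into chunks, small instances are padded with harmless
  queries or disjoint edges, and only the number of calls grows. Moreover, a solver is an arbitrary
  program that may address all of memory and expects it to be zero. It is therefore run at a word
  size \<open>z = d * lg n\<close> below the real one, which confines it to a window of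
  \<open>2 ^ z\<close> words. Memory is treated as a matrix whose rows are such windows, and every
  call gets a fresh row, since clearing a used one could cost \<open>2 ^ z\<close>. The short words
  in turn force array entries to be replaced by their ranks. Building the instances takes nearly
  linear time, so a time bound carries over only if \<open>T\<close> is at least linear; this
  follows from the number of memory cells that any solver has to overwrite on suitable
  instances.\<close>

lemma apply_op_lt: "apply_op w f x y < 2 ^ w"
 by (cases f) (simp_all add: nat_less_iff del: take_bit_and take_bit_or take_bit_xor)

text \<open>Both word sizes truncate the same unbounded result of the same operands. Hence masking
  after the instruction is enough even for \<open>Div\<close>, \<open>Shr\<close> and
  \<open>Less\<close>, which do not respect congruence modulo \<open>2 ^ z\<close>.\<close>

lemma apply_op_take_bit: "z <= w ==> apply_op z f x y = take_bit z (apply_op w f x y)"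
 by (cases f) (simp_all add: min_def take_bit_nat_eq)

fun prog_regs :: "prog => reg set" where
 "prog_regs Skip = {}"
| "prog_regs (Const x k) = {x}"
| "prog_regs (BinOp x f y z) = {x, y, z}"
| "prog_regs (Load x y) = {x, y}"
| "prog_regs (Store y x) = {x, y}"
| "prog_regs (Seq p q) = prog_regs p \<union> prog_regs q"
| "prog_regs (IfNZ x p q) = {x} \<union> prog_regs p \<union> prog_regs q"
| "prog_regs (WhileNZ x p) = {x} \<union> prog_regs p"

lemma finite_prog_regs: "finite (prog_regs p)"
 by (induction p) auto

text \<open>
 Registers congruent to 0 modulo 3 hold the variables of our own programs, those congruent to 1
 their temporaries, those congruent to 2 the registers of a simulated program. Register 3 holds
 the mask \<open>2 ^ z - 1\<close>, and during a simulation register 1 holds the base address.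
\<close>

fun sim :: "prog => prog" where
 "sim Skip = Skip"
| "sim (Const x k) = Seq (Const (3 * x + 2) k) (BinOp (3 * x + 2) And (3 * x + 2) 3)"
| "sim (BinOp x f y z) =
	Seq (BinOp (3 * x + 2) f (3 * y + 2) (3 * z + 2)) (BinOp (3 * x + 2) And (3 * x + 2) 3)"
| "sim (Load x y) = Seq (BinOp 4 Add (3 * y + 2) 1) (Load (3 * x + 2) 4)"
| "sim (Store y x) = Seq (BinOp 4 Add (3 * y + 2) 1) (Store 4 (3 * x + 2))"
| "sim (Seq p q) = Seq (sim p) (sim q)"
| "sim (IfNZ x p q) = IfNZ (3 * x + 2) (sim p) (sim q)"
| "sim (WhileNZ x p) = WhileNZ (3 * x + 2) (sim p)"

definition bounded_state :: "nat => state => bool" where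
 "bounded_state z s \<longleftrightarrow> (ALL r. regs s r < 2 ^ z) & (ALL a. mem s a < 2 ^ z)"

text \<open>Only the registers in \<open>X\<close>, later those that the program mentions, are
  tracked: a finite program can reset no more than finitely many before a call.\<close>

definition simulates :: "nat => nat => reg set => state => state => bool" where
 "simulates z b X s sg \<longleftrightarrow>
	(\<forall>r\<in>X. regs sg (3 * r + 2) = regs s r) & (ALL a<2 ^ z. mem sg (b + a) = mem s a) &
	regs sg 3 = 2 ^ z - 1 & regs sg 1 = b"

text \<open>Register 4 is exempt because \<open>sim\<close> forms addresses in it; it is one of the
  temporaries, which hold nothing across commands.\<close>

definition sim_frame :: "nat => nat => state => state => bool" where
 "sim_frame z b sg sg' \<longleftrightarrow>
	(ALL r. r mod 3 ~= 2 --> r ~= 4 --> regs sg' r = regs sg r) &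
	(ALL a. \<not> (b <= a & a < b + 2 ^ z) --> mem sg' a = mem sg a)"

lemma sim_frame_trans: "sim_frame z b sg sg' ==> sim_frame z b sg' sg'' ==> sim_frame z b sg sg''"
 by (simp add: sim_frame_def)

lemma and_mask: "Bit_Operations.and x (2 ^ z - Suc 0) = take_bit z (x :: nat)"
 by (simp add: take_bit_eq_mask mask_eq_exp_minus_1)

lemma mod3_eqs [simp]:
 "3 * (a::nat) + 2 ~= 3 * b + 1" "3 * (a::nat) + 1 ~= 3 * b + 2"
 "3 * (a::nat) + 2 ~= 3 * b" "3 * (a::nat) ~= 3 * b + 2"
 "3 * (a::nat) + 1 ~= 3 * b" "3 * (a::nat) ~= 3 * b + 1"
 "Suc (3 * a) ~= 3 * b" "3 * (a::nat) ~= Suc (3 * b)"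
 "Suc (Suc (3 * a)) ~= 3 * b" "3 * (a::nat) ~= Suc (Suc (3 * b))"
 "Suc (3 * a) ~= 3" "Suc (Suc (3 * a)) ~= 3" "3 ~= Suc (3 * a)" "3 ~= Suc (Suc (3 * a))"
 "Suc (Suc (3 * a)) ~= 4" "4 ~= Suc (Suc (3 * a))" "Suc (3 * a) ~= 0" "3 * a ~= Suc 0" "Suc 0 ~= 3 * a"
 "3 * a ~= 2" "2 ~= 3 * a" "Suc (Suc (3 * a)) mod 3 = 2" "Suc (3 * a) mod 3 = 1" "3 * a mod 3 = 0" by presburger+

text \<open>The factor 2 pays for the mask after an arithmetic instruction or the address
  computation before a memory access. \<open>bounded_state\<close> is carried along because
  simulated addresses below \<open>2 ^ z\<close> are what keeps all accesses inside the
  window.\<close>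

lemma sim_correct:
 assumes "exec z p s t s'" and "z <= w" and "b + 2 ^ z <= 2 ^ w"
	and "prog_regs p <= X" and "bounded_state z s" and "simulates z b X s sg"
 shows "bounded_state z s' & (EX t' sg'. exec w (sim p) sg t' sg' & t' <= 2 * t &
	simulates z b X s' sg' & sim_frame z b sg sg')" using assms
proof (induction arbitrary: sg rule: exec.induct)
 case (Skip s)
 thus ?case by (auto intro!: exI[of _ 1] exI[of _ sg] exec.Skip simp: sim_frame_def)
next
 case (Const x k s)
 let ?r = "3 * x + 2"
 let ?sg = "sg(|regs := ((regs sg)(?r := take_bit w k))(?r := take_bit z k)|)"
 have "exec w (sim (Const x k)) sg (1 + 1) ?sg" using exec.Seq[OF exec.Const[of w ?r k sg] exec.BinOp[of w ?r And ?r 3]] Const by (simp add: simulates_def and_mask min.absorb1 min.absorb2 del: take_bit_and)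
 moreover have "bounded_state z (s(|regs := (regs s)(x := take_bit z k)|))" using Const by (simp add: bounded_state_def)
 ultimately show ?case using Const by (intro conjI exI[of _ "1 + 1"] exI[of _ ?sg]) (auto simp: simulates_def sim_frame_def)
next
 case (BinOp x f y v s)
 let ?r = "3 * x + 2"
 let ?o = "apply_op w f (regs s y) (regs s v)"
 let ?sg = "sg(|regs := ((regs sg)(?r := ?o))(?r := apply_op z f (regs s y) (regs s v))|)"
 have "exec w (sim (BinOp x f y v)) sg (1 + 1) ?sg" using exec.Seq[OF exec.BinOp[of w ?r f "3 * y + 2" "3 * v + 2" sg] exec.BinOp[of w ?r And ?r 3]] BinOp
	 apply_op_take_bit[OF \<open>z <= w\<close>, of f "regs s y" "regs s v"] apply_op_lt[of w f "regs s y" "regs s v"] by (simp add: simulates_def and_mask min.absorb1 min.absorb2 del: take_bit_and)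
 moreover have "bounded_state z (s(|regs := (regs s)(x := apply_op z f (regs s y) (regs s v))|))" using BinOp by (simp add: bounded_state_def apply_op_lt)
 ultimately show ?case using BinOp by (intro conjI exI[of _ "1 + 1"] exI[of _ ?sg]) (auto simp: simulates_def sim_frame_def)
next
 case (Load x y s)
 let ?a = "b + regs s y"
 let ?sg = "sg(|regs := (regs sg)(4 := ?a, 3 * x + 2 := mem s (regs s y))|)"
 have lt: "regs s y < 2 ^ z" using Load by (simp add: bounded_state_def)
 have "exec w (sim (Load x y)) sg (1 + 1) ?sg" using exec.Seq[OF exec.BinOp[of w 4 Add "3 * y + 2" 1 sg] exec.Load[of w "3 * x + 2" 4]] Load lt by (simp add: simulates_def take_bit_nat_eq_self add.commute[of "regs s y" b])
 moreover have "bounded_state z (s(|regs := (regs s)(x := mem s (regs s y))|))" using Load by (simp add: bounded_state_def)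
 ultimately show ?case using Load by (intro conjI exI[of _ "1 + 1"] exI[of _ ?sg]) (auto simp: simulates_def sim_frame_def)
next
 case (Store y x s)
 let ?a = "b + regs s y"
 let ?sg = "sg(|regs := (regs sg)(4 := ?a), mem := (mem sg)(?a := regs s x)|)"
 have lt: "regs s y < 2 ^ z" using Store by (simp add: bounded_state_def)
 have "exec w (sim (Store y x)) sg (1 + 1) ?sg" using exec.Seq[OF exec.BinOp[of w 4 Add "3 * y + 2" 1 sg] exec.Store[of w 4 "3 * x + 2"]] Store lt by (simp add: simulates_def take_bit_nat_eq_self add.commute[of "regs s y" b])
 moreover have "bounded_state z (s(|mem := (mem s)(regs s y := regs s x)|))" using Store by (simp add: bounded_state_def)
 ultimately show ?case using Store lt by (intro conjI exI[of _ "1 + 1"] exI[of _ ?sg]) (auto simp: simulates_def sim_frame_def)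
next
 case (Seq p s t s' q u s'')
 from Seq.prems have X: "prog_regs p <= X" "prog_regs q <= X" by auto
 note 1 = Seq.IH(1)[OF Seq.prems(1,2) X(1) Seq.prems(4,5)]
 then obtain t1 sg1 where 2: "exec w (sim p) sg t1 sg1" "t1 <= 2 * t" "simulates z b X s' sg1" "sim_frame z b sg sg1" by auto
 note 3 = Seq.IH(2)[OF Seq.prems(1,2) X(2) conjunct1[OF 1] 2(3)]
 then obtain t2 sg2 where 4: "exec w (sim q) sg1 t2 sg2" "t2 <= 2 * u" "simulates z b X s'' sg2" "sim_frame z b sg1 sg2" by auto
 have "exec w (sim (Seq p q)) sg (t1 + t2) sg2" using exec.Seq[OF 2(1) 4(1)] by simp
 with 2 3 4 show ?case by (intro conjI exI[of _ "t1 + t2"] exI[of _ sg2]) (auto intro: sim_frame_trans)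
next
 case (IfTrue s x p t s' q)
 from IfTrue.prems have X: "prog_regs p <= X" and nz: "regs sg (3 * x + 2) ~= 0" using IfTrue.hyps by (auto simp: simulates_def)
 note 1 = IfTrue.IH[OF IfTrue.prems(1,2) X IfTrue.prems(4,5)]
 then obtain t1 sg1 where 2: "exec w (sim p) sg t1 sg1" "t1 <= 2 * t" "simulates z b X s' sg1" "sim_frame z b sg sg1" by auto
 have "exec w (sim (IfNZ x p q)) sg (1 + t1) sg1" using exec.IfTrue[OF nz 2(1)] by simp
 with 1 2 show ?case by (intro conjI exI[of _ "1 + t1"] exI[of _ sg1]) auto
next
 case (IfFalse s x q t s' p)
 from IfFalse.prems have X: "prog_regs q <= X" and nz: "regs sg (3 * x + 2) = 0" using IfFalse.hyps by (auto simp: simulates_def)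
 note 1 = IfFalse.IH[OF IfFalse.prems(1,2) X IfFalse.prems(4,5)]
 then obtain t1 sg1 where 2: "exec w (sim q) sg t1 sg1" "t1 <= 2 * t" "simulates z b X s' sg1" "sim_frame z b sg sg1" by auto
 have "exec w (sim (IfNZ x p q)) sg (1 + t1) sg1" using exec.IfFalse[OF nz 2(1)] by simp
 with 1 2 show ?case by (intro conjI exI[of _ "1 + t1"] exI[of _ sg1]) auto
next
 case (WhileTrue s x p t s' u s'')
 from WhileTrue.prems have X: "prog_regs p <= X" and nz: "regs sg (3 * x + 2) ~= 0" using WhileTrue.hyps by (auto simp: simulates_def)
 note 1 = WhileTrue.IH(1)[OF WhileTrue.prems(1,2) X(1) WhileTrue.prems(4,5)]
 then obtain t1 sg1 where 2: "exec w (sim p) sg t1 sg1" "t1 <= 2 * t" "simulates z b X s' sg1" "sim_frame z b sg sg1" by auto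
 note 3 = WhileTrue.IH(2)[OF WhileTrue.prems(1,2,3) conjunct1[OF 1] 2(3)]
 then obtain t2 sg2 where 4: "exec w (sim (WhileNZ x p)) sg1 t2 sg2" "t2 <= 2 * u" "simulates z b X s'' sg2" "sim_frame z b sg1 sg2" by auto
 have "exec w (sim (WhileNZ x p)) sg (1 + t1 + t2) sg2" using exec.WhileTrue[OF nz 2(1)] 4(1) by simp
 with 2 3 4 show ?case by (intro conjI exI[of _ "1 + t1 + t2"] exI[of _ sg2]) (auto intro: sim_frame_trans)
next
 case (WhileFalse s x p)
 hence nz: "regs sg (3 * x + 2) = 0" by (auto simp: simulates_def)
 thus ?case using exec.WhileFalse[OF nz, of w "sim p"] WhileFalse by (intro conjI exI[of _ 1] exI[of _ sg]) (auto simp: sim_frame_def)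
qed

section \<open>A structured language for the word RAM\<close>

datatype aexp = Num nat | Var nat | Bop binop aexp aexp | Get aexp aexp | Cnd aexp aexp aexp

text \<open>The only loop is a counting loop up to the value of a variable, so that running times
  can be read off the syntax.\<close>

datatype cmd =
	Nop
 | Asg nat aexp
 | Put aexp aexp aexp
 | Sqn cmd cmd (infixr ";;" 60)
 | Ite aexp cmd cmd
 | For nat nat cmd

record ast =
 va :: "nat => nat"
 ar :: "nat => nat => nat"

text \<open>Every read is truncated. This makes the semantics total and lets it agree with the
  compiled code without side conditions; the rules \<open>ev\<close> later remove the truncations
  where size bounds are known.\<close>

fun eval :: "nat => nat => ast => aexp => nat" where
 "eval w z s (Num k) = take_bit w k"
| "eval w z s (Var x) = take_bit w (va s x)"
| "eval w z s (Bop f a b) = apply_op w f (eval w z s a) (eval w z s b)"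
| "eval w z s (Get a b) = take_bit w (ar s (take_bit z (eval w z s a)) (take_bit z (eval w z s b)))"
| "eval w z s (Cnd c a b) = (if eval w z s c ~= 0 then eval w z s a else eval w z s b)"

definition set_va :: "nat => nat => ast => ast" where
 "set_va x v s = s(|va := (va s)(x := v)|)"

definition set_ar :: "nat => nat => nat => ast => ast" where
 "set_ar r i v s = s(|ar := (ar s)(r := (ar s r)(i := v))|)"

text \<open>The outer \<open>set_va\<close> in the case of \<open>For\<close> is the value with
  which the compiled loop leaves its counter.\<close>

fun run :: "nat => nat => cmd => ast => ast" where
 "run w z Nop s = s"
| "run w z (Asg x e) s = set_va x (eval w z s e) s"
| "run w z (Put a b e) s =
	set_ar (take_bit z (eval w z s a)) (take_bit z (eval w z s b)) (eval w z s e) s"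
| "run w z (c ;; d) s = run w z d (run w z c s)"
| "run w z (Ite e c d) s = (if eval w z s e ~= 0 then run w z c s else run w z d s)"
| "run w z (For x p c) s =
	set_va x (va s p) (fold (%i s. run w z c (set_va x i s)) [0..<va s p] s)"

lemma eval_lt: "eval w z s e < 2 ^ w"
 by (induction e) (auto simp: apply_op_lt)

lemma va_simps [simp]:
 "va (set_va x v s) = (va s)(x := v)" "ar (set_va x v s) = ar s"
 "va (set_ar r i v s) = va s" "ar (set_ar r i v s) = (ar s)(r := (ar s r)(i := v))" by (simp_all add: set_va_def set_ar_def)

fun assigned :: "cmd => nat set" where
 "assigned Nop = {}"
| "assigned (Asg x e) = {x}"
| "assigned (Put a b e) = {}"
| "assigned (c ;; d) = assigned c \<union> assigned d"
| "assigned (Ite e c d) = assigned c \<union> assigned d"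
| "assigned (For x p c) = insert x (assigned c)"

text \<open>\<open>P\<close> is the set of read-only variables. Since all loop bounds lie in
  \<open>P\<close>, the cost of a command depends on their values alone and not on the states that
  arise during the run.\<close>

fun wf_cmd :: "nat set => cmd => bool" where
 "wf_cmd P (c ;; d) \<longleftrightarrow> wf_cmd P c & wf_cmd P d"
| "wf_cmd P (Ite e c d) \<longleftrightarrow> wf_cmd P c & wf_cmd P d"
| "wf_cmd P (Asg x e) \<longleftrightarrow> x ~: P"
| "wf_cmd P (For x p c) \<longleftrightarrow> wf_cmd P c & x ~: P & p : P & x ~: assigned c"
| "wf_cmd P c \<longleftrightarrow> True"

lemma run_va_unassigned: "y ~: assigned c ==> va (run w z c s) y = va s y"
proof (induction c arbitrary: s)
 case (For x p c)
 have "va (fold (%i s. run w z c (set_va x i s)) ks s) y = va s y" for ks using For by (induction ks arbitrary: s) auto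
 with For show ?case by auto
qed auto

lemma wf_cmd_assigned: "wf_cmd P c ==> assigned c \<inter> P = {}"
 by (induction c) auto

lemma run_va_param: "wf_cmd P c ==> p : P ==> va (run w z c s) p = va s p"
 using wf_cmd_assigned[of P c] run_va_unassigned[of p c w z s] by auto

section \<open>Cost bounds and compilation\<close>

fun cost_exp :: "aexp => nat" where
 "cost_exp (Num k) = 1"
| "cost_exp (Var x) = 1"
| "cost_exp (Bop f a b) = cost_exp a + cost_exp b + 1"
| "cost_exp (Get a b) = cost_exp a + cost_exp b + 6"
| "cost_exp (Cnd c a b) = cost_exp c + cost_exp a + cost_exp b + 1"

fun cost :: "(nat => nat) => cmd => nat" where
 "cost v Nop = 1"
| "cost v (Asg x e) = cost_exp e + 1"
| "cost v (Put a b e) = cost_exp a + cost_exp b + cost_exp e + 5"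
| "cost v (c ;; d) = cost v c + cost v d"
| "cost v (Ite e c d) = cost_exp e + 1 + cost v c + cost v d"
| "cost v (For x p c) = 3 + v p * (cost v c + 4)"

text \<open>The temporary with number \<open>k\<close> is the register \<open>3 * k + 1\<close>.\<close>

definition combine_address :: "nat => prog" where
 "combine_address k =
	Seq (BinOp (3 * k + 1) And (3 * k + 1) 3)
	(Seq (BinOp (3 * k + 1) Shl (3 * k + 1) 0)
	(Seq (BinOp (3 * (k + 1) + 1) And (3 * (k + 1) + 1) 3)
		(BinOp (3 * k + 1) Add (3 * k + 1) (3 * (k + 1) + 1))))"

fun compile_exp :: "nat => aexp => prog" where
 "compile_exp k (Num n) = Const (3 * k + 1) n"
| "compile_exp k (Var x) = BinOp (3 * k + 1) Or (3 * x) (3 * x)"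
| "compile_exp k (Bop f a b) =
	Seq (compile_exp k a) (Seq (compile_exp (k + 1) b) (BinOp (3 * k + 1) f (3 * k + 1) (3 * (k + 1) + 1)))"
| "compile_exp k (Get a b) =
	Seq (compile_exp k a) (Seq (compile_exp (k + 1) b) (Seq (combine_address k)
	(Seq (Load (3 * k + 1) (3 * k + 1)) (BinOp (3 * k + 1) Or (3 * k + 1) (3 * k + 1)))))"
| "compile_exp k (Cnd c a b) =
	Seq (compile_exp k c) (IfNZ (3 * k + 1) (compile_exp k a) (compile_exp k b))"

fun compile :: "cmd => prog" where
 "compile Nop = Skip"
| "compile (Asg x e) = Seq (compile_exp 0 e) (BinOp (3 * x) Or 1 1)"
| "compile (Put a b e) =
	Seq (compile_exp 0 a) (Seq (compile_exp 1 b) (Seq (compile_exp 2 e)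
	(Seq (combine_address 0) (Store 1 (3 * 2 + 1)))))"
| "compile (c ;; d) = Seq (compile c) (compile d)"
| "compile (Ite e c d) = Seq (compile_exp 0 e) (IfNZ 1 (compile c) (compile d))"
| "compile (For x p c) =
	Seq (Const (3 * x) 0) (Seq (BinOp 1 Less (3 * x) (3 * p))
	 (WhileNZ 1 (Seq (compile c) (Seq (Const 1 1)
		(Seq (BinOp (3 * x) Add (3 * x) 1) (BinOp 1 Less (3 * x) (3 * p)))))))"

text \<open>A pair of \<open>z\<close>-bit indices becomes one address, which is a word because
  \<open>2 * z <= w\<close>. Variables 0 and 1 keep the data from which
  \<open>combine_address\<close> forms it.\<close>

definition represents :: "nat => nat => ast => state => bool" where
 "represents w z s sg \<longleftrightarrow> 2 * z <= w & va s 0 = z & va s 1 = 2 ^ z - 1 &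
	(ALL x. regs sg (3 * x) = va s x) &
	(ALL r<2 ^ z. ALL i<2 ^ z. mem sg (r * 2 ^ z + i) = ar s r i)"

definition temp_frame :: "nat => state => state => bool" where
 "temp_frame k sg sg' \<longleftrightarrow> mem sg' = mem sg &
	(ALL r. r mod 3 ~= 1 | r < 3 * k + 1 --> regs sg' r = regs sg r)"

lemma temp_frame_represents: "represents w z s sg ==> temp_frame k sg sg' ==> represents w z s sg'"
 by (simp add: represents_def temp_frame_def)

lemma temp_frame_trans: "temp_frame k sg sg' ==> temp_frame l sg' sg'' ==> k <= l ==> temp_frame k sg sg''"
 unfolding temp_frame_def by fastforce

lemma address_lt:
 fixes r i :: nat
 assumes "r < 2 ^ z" "i < 2 ^ z" "2 * z <= w"
 shows "r * 2 ^ z + i < 2 ^ w"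
proof -
 have "r * 2 ^ z + i < (r + 1) * 2 ^ z" using assms by simp
 also have "... <= 2 ^ z * 2 ^ z" using assms by (intro mult_right_mono) auto
 also have "... = 2 ^ (2 * z)" by (simp add: mult_2 power_add)
 also have "... <= 2 ^ w" using assms by (intro power_increasing) auto
 finally show ?thesis .
qed

lemma address_inj:
 fixes r i r' i' :: nat
 assumes "r * 2 ^ z + i = r' * 2 ^ z + i'" "i < 2 ^ z" "i' < 2 ^ z"
 shows "r = r' & i = i'"
proof -
 have "r = (r * 2 ^ z + i) div 2 ^ z" "r' = (r' * 2 ^ z + i') div 2 ^ z" using assms(2,3) by simp_all
 with assms(1) have "r = r'" by metis
 with assms(1) show ?thesis by simp
qed

lemma combine_address:
 assumes "represents w z s sg"
 shows "EX sg'. exec w (combine_address k) sg 4 sg' & temp_frame k sg sg' &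
	regs sg' (3 * k + 1) =
	 take_bit z (regs sg (3 * k + 1)) * 2 ^ z + take_bit z (regs sg (3 * (k + 1) + 1)) &
	(\<forall>j \<ge> k + 2. regs sg' (3 * j + 1) = regs sg (3 * j + 1))"
proof -
 let ?k = "3 * k + 1" and ?l = "3 * (k + 1) + 1"
 let ?a = "take_bit z (regs sg ?k)" and ?b = "take_bit z (regs sg ?l)"
 have r: "regs sg 0 = z" "regs sg 3 = 2 ^ z - 1" "2 * z <= w" using assms unfolding represents_def by (metis mult_0_right, metis mult.right_neutral, blast)
 have lt: "?a * 2 ^ z + ?b < 2 ^ w" using r by (intro address_lt) auto
 let ?sg = "sg(|regs := (regs sg)(?k := ?a, ?k := ?a * 2 ^ z, ?l := ?b, ?k := ?a * 2 ^ z + ?b)|)"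
 have "exec w (combine_address k) sg (1 + (1 + (1 + 1))) ?sg" unfolding combine_address_def using exec.Seq[OF exec.BinOp[of w ?k And ?k 3 sg]
	 exec.Seq[OF exec.BinOp[of w ?k Shl ?k 0] exec.Seq[OF exec.BinOp[of w ?l And ?l 3] exec.BinOp[of w ?k Add ?k ?l]]]]
	 r lt by (simp add: and_mask take_bit_nat_eq_self push_bit_eq_mult min.absorb1 min.absorb2 del: take_bit_and)
 moreover have "1 + (1 + (1 + 1)) = (4 :: nat)" by simp
 ultimately have "exec w (combine_address k) sg 4 ?sg" by metis
 thus ?thesis by (intro exI[of _ ?sg]) (auto simp: temp_frame_def)
qed

lemma compile_exp:
 assumes "represents w z s sg"
 shows "EX t sg'. exec w (compile_exp k e) sg t sg' & t <= cost_exp e &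
	temp_frame k sg sg' & regs sg' (3 * k + 1) = eval w z s e" using assms
proof (induction e arbitrary: k sg)
 case (Num n)
 thus ?case using exec.Const[of w "3 * k + 1" n sg] by (intro exI conjI) (auto simp: temp_frame_def)
next
 case (Var x)
 thus ?case using exec.BinOp[of w "3 * k + 1" Or "3 * x" "3 * x" sg] by (intro exI conjI) (auto simp: temp_frame_def represents_def)
next
 case (Bop f a b)
 obtain t1 sg1 where 1: "exec w (compile_exp k a) sg t1 sg1" "t1 <= cost_exp a"
	"temp_frame k sg sg1" "regs sg1 (3 * k + 1) = eval w z s a" using Bop.IH(1)[OF Bop.prems] by blast
 obtain t2 sg2 where 2: "exec w (compile_exp (k + 1) b) sg1 t2 sg2" "t2 <= cost_exp b"
	"temp_frame (k + 1) sg1 sg2" "regs sg2 (3 * (k + 1) + 1) = eval w z s b" using Bop.IH(2)[OF temp_frame_represents[OF Bop.prems 1(3)]] by blast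
 have 3: "regs sg2 (3 * k + 1) = eval w z s a" using 1(4) 2(3) by (simp add: temp_frame_def)
 have "temp_frame k sg sg2" using temp_frame_trans[OF 1(3) 2(3)] by simp
 thus ?case using exec.Seq[OF 1(1) exec.Seq[OF 2(1) exec.BinOp[of w "3 * k + 1" f "3 * k + 1" "3 * (k + 1) + 1"]]] 1 2 3 by - (intro exI conjI, unfold compile_exp.simps, assumption, (auto simp: temp_frame_def))
next
 case (Get a b)
 obtain t1 sg1 where 1: "exec w (compile_exp k a) sg t1 sg1" "t1 <= cost_exp a"
	"temp_frame k sg sg1" "regs sg1 (3 * k + 1) = eval w z s a" using Get.IH(1)[OF Get.prems] by blast
 obtain t2 sg2 where 2: "exec w (compile_exp (k + 1) b) sg1 t2 sg2" "t2 <= cost_exp b"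
	"temp_frame (k + 1) sg1 sg2" "regs sg2 (3 * (k + 1) + 1) = eval w z s b" using Get.IH(2)[OF temp_frame_represents[OF Get.prems 1(3)]] by blast
 have 3: "regs sg2 (3 * k + 1) = eval w z s a" using 1(4) 2(3) by (simp add: temp_frame_def)
 have 4: "temp_frame k sg sg2" using temp_frame_trans[OF 1(3) 2(3)] by simp
 note rep = temp_frame_represents[OF Get.prems 4]
 obtain sg3 where 5: "exec w (combine_address k) sg2 4 sg3" "temp_frame k sg2 sg3"
	"regs sg3 (3 * k + 1) = take_bit z (eval w z s a) * 2 ^ z + take_bit z (eval w z s b)" using combine_address[OF rep, of k] 2(4) 3 by auto
 note rep3 = temp_frame_represents[OF rep 5(2)]
 have "mem sg3 (regs sg3 (3 * k + 1)) = ar s (take_bit z (eval w z s a)) (take_bit z (eval w z s b))" using rep3 5(3) by (simp add: represents_def)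
 moreover have "temp_frame k sg sg3" using temp_frame_trans[OF 4 5(2)] by simp
 ultimately show ?case using exec.Seq[OF 1(1) exec.Seq[OF 2(1) exec.Seq[OF 5(1) exec.Seq[OF exec.Load[of w "3 * k + 1" "3 * k + 1"]
	 exec.BinOp[of w "3 * k + 1" Or "3 * k + 1" "3 * k + 1"]]]]] 1 2 by - (intro exI conjI, unfold compile_exp.simps, assumption, (auto simp: temp_frame_def))
next
 case (Cnd c a b)
 obtain t1 sg1 where 1: "exec w (compile_exp k c) sg t1 sg1" "t1 <= cost_exp c"
	"temp_frame k sg sg1" "regs sg1 (3 * k + 1) = eval w z s c" using Cnd.IH(1)[OF Cnd.prems] by blast
 note rep = temp_frame_represents[OF Cnd.prems 1(3)]
 show ?case
 proof (cases "eval w z s c = 0")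
	case True
	obtain t2 sg2 where 2: "exec w (compile_exp k b) sg1 t2 sg2" "t2 <= cost_exp b"
	 "temp_frame k sg1 sg2" "regs sg2 (3 * k + 1) = eval w z s b" using Cnd.IH(3)[OF rep] by blast
	have "regs sg1 (3 * k + 1) = 0" using 1 True by simp
	from exec.Seq[OF 1(1) exec.IfFalse[OF this 2(1)]] True 1 2 temp_frame_trans[OF 1(3) 2(3)] show ?thesis by - (intro exI conjI, unfold compile_exp.simps, assumption, auto)
 next
	case False
	obtain t2 sg2 where 2: "exec w (compile_exp k a) sg1 t2 sg2" "t2 <= cost_exp a"
	 "temp_frame k sg1 sg2" "regs sg2 (3 * k + 1) = eval w z s a" using Cnd.IH(2)[OF rep] by blast
	have "regs sg1 (3 * k + 1) ~= 0" using 1 False by simp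
	from exec.Seq[OF 1(1) exec.IfTrue[OF this 2(1)]] False 1 2 temp_frame_trans[OF 1(3) 2(3)] show ?thesis by - (intro exI conjI, unfold compile_exp.simps, assumption, auto)
 qed
qed

lemma compile_exp0:
 assumes "represents w z s sg"
 obtains t sg' where "exec w (compile_exp 0 e) sg t sg'" "t <= cost_exp e"
	"represents w z s sg'" "regs sg' (Suc 0) = eval w z s e" using compile_exp[OF assms, of 0 e] temp_frame_represents[OF assms] by fastforce

definition params_agree :: "nat set => (nat => nat) => ast => bool" where
 "params_agree P v s \<longleftrightarrow> (\<forall>p\<in>P. va s p = v p)"

lemma params_agree_run: "wf_cmd P c ==> params_agree P v s ==> params_agree P v (run w z c s)"
 by (simp add: params_agree_def run_va_param)

theorem compile_correct:
 assumes "wf_cmd P c" and "{0, 1} <= P" and "\<forall>p\<in>P. v p < 2 ^ w"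
	and "params_agree P v s" and "represents w z s sg"
 shows "EX t sg'. exec w (compile c) sg t sg' & t <= cost v c & represents w z (run w z c s) sg'"
 using assms
proof (induction c arbitrary: s sg)
 case Nop
 thus ?case using exec.Skip[of w sg] by (intro exI conjI) auto
next
 case (Asg x e)
 obtain t sg' where 1: "exec w (compile_exp 0 e) sg t sg'" "t <= cost_exp e"
	"represents w z s sg'" "regs sg' 1 = eval w z s e" using compile_exp0[OF Asg.prems(5)] by (metis One_nat_def)
 have "x ~: P" "0 : P" "Suc 0 : P" using Asg.prems(1,2) by auto
 hence "x ~= 0" "x ~= Suc 0" by metis+
 thus ?case using exec.Seq[OF 1(1) exec.BinOp[of w "3 * x" Or 1 1]] 1 eval_lt[of w z s e] by - (intro exI conjI, unfold compile.simps, assumption, (auto simp: represents_def take_bit_nat_eq_self))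
next
 case (Put a b e)
 obtain t1 sg1 where 1: "exec w (compile_exp 0 a) sg t1 sg1" "t1 <= cost_exp a"
	"temp_frame 0 sg sg1" "regs sg1 (3 * 0 + 1) = eval w z s a" using compile_exp[OF Put.prems(5), of 0] by blast
 note rep1 = temp_frame_represents[OF Put.prems(5) 1(3)]
 obtain t2 sg2 where 2: "exec w (compile_exp 1 b) sg1 t2 sg2" "t2 <= cost_exp b"
	"temp_frame 1 sg1 sg2" "regs sg2 (3 * 1 + 1) = eval w z s b" using compile_exp[OF rep1, of 1] by blast
 note rep2 = temp_frame_represents[OF rep1 2(3)]
 obtain t3 sg3 where 3: "exec w (compile_exp 2 e) sg2 t3 sg3" "t3 <= cost_exp e"
	"temp_frame 2 sg2 sg3" "regs sg3 (3 * 2 + 1) = eval w z s e" using compile_exp[OF rep2, of 2] by blast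
 note rep3 = temp_frame_represents[OF rep2 3(3)]
 have "regs sg3 1 = eval w z s a" "regs sg3 4 = eval w z s b" using 1 2 3 by (simp_all add: temp_frame_def)
 then obtain sg4 where 4: "exec w (combine_address 0) sg3 4 sg4" "temp_frame 0 sg3 sg4"
	"regs sg4 1 = take_bit z (eval w z s a) * 2 ^ z + take_bit z (eval w z s b)"
	"regs sg4 (3 * 2 + 1) = eval w z s e" using combine_address[OF rep3, of 0] 3(4) by fastforce
 note rep4 = temp_frame_represents[OF rep3 4(2)]
 let ?s = "run w z (Put a b e) s"
 let ?sg = "sg4(|mem := (mem sg4)(regs sg4 1 := regs sg4 (3 * 2 + 1))|)"
 have "represents w z ?s ?sg" unfolding represents_def
 proof (intro conjI allI impI)
	fix r i assume ri: "r < (2::nat) ^ z" "i < (2::nat) ^ z"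
	show "mem ?sg (r * 2 ^ z + i) = ar ?s r i"
	proof (cases "r * 2 ^ z + i = regs sg4 1")
	 case True
	 hence "r = take_bit z (eval w z s a) & i = take_bit z (eval w z s b)" unfolding 4(3) by (rule address_inj) (use ri in auto)
	 thus ?thesis using 4 by simp
	next
	 case False
	 hence "\<not> (r = take_bit z (eval w z s a) & i = take_bit z (eval w z s b))" using 4 by auto
	 with False rep4 ri show ?thesis by (auto simp: represents_def)
	qed
 qed (use rep4 in \<open>auto simp: represents_def\<close>)
 with 1 2 3 4 show ?case using exec.Seq[OF 1(1) exec.Seq[OF 2(1) exec.Seq[OF 3(1) exec.Seq[OF 4(1) exec.Store[of w 1 "3 * 2 + 1" sg4]]]]] by - (intro exI conjI, unfold compile.simps, assumption, auto)
next
 case (Sqn c d)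
 hence wf: "wf_cmd P c" "wf_cmd P d" by auto
 obtain t1 sg1 where 1: "exec w (compile c) sg t1 sg1" "t1 <= cost v c" "represents w z (run w z c s) sg1" using Sqn.IH(1)[OF wf(1) Sqn.prems(2-5)] by blast
 obtain t2 sg2 where 2: "exec w (compile d) sg1 t2 sg2" "t2 <= cost v d"
	"represents w z (run w z d (run w z c s)) sg2" using Sqn.IH(2)[OF wf(2) Sqn.prems(2,3) params_agree_run[OF wf(1) Sqn.prems(4)] 1(3)] by blast
 show ?case using exec.Seq[OF 1(1) 2(1)] 1 2 by - (intro exI conjI, unfold compile.simps, assumption, auto)
next
 case (Ite e c d)
 hence wf: "wf_cmd P c" "wf_cmd P d" by auto
 obtain t1 sg1 where 1: "exec w (compile_exp 0 e) sg t1 sg1" "t1 <= cost_exp e"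
	"represents w z s sg1" "regs sg1 1 = eval w z s e" using compile_exp0[OF Ite.prems(5)] by (metis One_nat_def)
 show ?case
 proof (cases "eval w z s e = 0")
	case True
	obtain t2 sg2 where 2: "exec w (compile d) sg1 t2 sg2" "t2 <= cost v d" "represents w z (run w z d s) sg2" using Ite.IH(2)[OF wf(2) Ite.prems(2-4) 1(3)] by blast
	have "regs sg1 1 = 0" using 1 True by simp
	from exec.Seq[OF 1(1) exec.IfFalse[OF this 2(1)]] 1 2 True show ?thesis by - (intro exI conjI, unfold compile.simps, assumption, auto)
 next
	case False
	obtain t2 sg2 where 2: "exec w (compile c) sg1 t2 sg2" "t2 <= cost v c" "represents w z (run w z c s) sg2" using Ite.IH(1)[OF wf(1) Ite.prems(2-4) 1(3)] by blast
	have "regs sg1 1 ~= 0" using 1 False by simp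
	from exec.Seq[OF 1(1) exec.IfTrue[OF this 2(1)]] 1 2 False show ?thesis by - (intro exI conjI, unfold compile.simps, assumption, auto)
 qed
next
 case (For x p c)
 hence wf: "wf_cmd P c" "x ~: P" "p : P" "x ~: assigned c" and "0 : P" "1 : P" by auto
 hence x: "x ~= 0" "x ~= 1" "x ~= p" by metis+
 define n where "n = v p"
 have n: "n < 2 ^ w" "va s p = n" using For.prems wf by (auto simp: n_def params_agree_def)
 let ?f = "%i s. run w z c (set_va x i s)"
 let ?loop = "WhileNZ 1 (Seq (compile c) (Seq (Const 1 1)
		(Seq (BinOp (3 * x) Add (3 * x) 1) (BinOp 1 Less (3 * x) (3 * p)))))"
 \<comment> \<open>Induction on the number \<open>k\<close> of iterations that remain; the
   hypotheses pin down the counter and the flag in register 1 on entry.\<close>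
 have loop: "EX t sg'. exec w ?loop sg t sg' & t <= 1 + k * (cost v c + 4) &
	 represents w z (set_va x n (fold ?f [n - k..<n] s)) sg'"
	if "k <= n" "represents w z (set_va x (n - k) s) sg" "regs sg 1 = of_bool (n - k < n)" "params_agree P v s"
	for k s sg using that
 proof (induction k arbitrary: s sg)
	case 0
	hence "regs sg 1 = 0" by simp
	from exec.WhileFalse[OF this] 0 show ?case by (intro exI conjI) auto
 next
	case (Suc k)
	let ?i = "n - Suc k"
	have i: "?i < n" "Suc ?i = n - k" using Suc.prems by auto
	hence i3: "[?i..<n] = ?i # [n - k..<n]" by (metis upt_conv_Cons)
	have pa: "params_agree P v (set_va x ?i s)" using Suc.prems wf by (auto simp: params_agree_def)
	obtain t1 sg1 where 1: "exec w (compile c) sg t1 sg1" "t1 <= cost v c"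
	 "represents w z (run w z c (set_va x ?i s)) sg1" using For.IH[OF wf(1) For.prems(2,3) pa Suc.prems(2)] by blast
	let ?s1 = "?f ?i s"
	have pa1: "params_agree P v ?s1" by (rule params_agree_run[OF wf(1) pa])
	have vx: "va ?s1 x = ?i" "va ?s1 p = n" using run_va_unassigned[OF wf(4)] pa1 wf n_def by (auto simp: params_agree_def)
	have r1: "regs sg1 (3 * x) = ?i" "regs sg1 (3 * p) = n" using 1(3) vx by (auto simp: represents_def)
	let ?sg = "sg1(|regs := (regs sg1)(1 := 1, 3 * x := n - k, 1 := of_bool (n - k < n))|)"
	\<comment> \<open>An iteration is left, so the bound is positive and \<open>w\<close> is not 0;
	  hence a flag 1 survives truncation.\<close>
	have w1: "1 < (2::nat) ^ w" using n i by (cases w) auto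
	have "apply_op w Add ?i 1 = n - k" using i n by (metis Suc_eq_plus1 apply_op.simps(1) diff_le_self le_less_trans take_bit_nat_eq_self)
	moreover have "apply_op w Less (n - k) n = of_bool (n - k < n)" "take_bit w 1 = (1::nat)" using w1 by (cases w; simp add: take_bit_nat_eq_self)+
	ultimately have b: "exec w (Seq (compile c) (Seq (Const 1 1)
		(Seq (BinOp (3 * x) Add (3 * x) 1) (BinOp 1 Less (3 * x) (3 * p))))) sg (t1 + (1 + (1 + 1))) ?sg" using exec.Seq[OF 1(1) exec.Seq[OF exec.Const[of w 1 1] exec.Seq[OF exec.BinOp[of w "3 * x" Add "3 * x" 1]
		exec.BinOp[of w 1 Less "3 * x" "3 * p"]]]] x r1 by (simp del: apply_op.simps)
	have "represents w z (set_va x (n - k) ?s1) ?sg" using 1(3) x by (auto simp: represents_def)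
	from Suc.IH[OF _ this _ pa1] Suc.prems obtain t2 sg2 where 2: "exec w ?loop ?sg t2 sg2" "t2 <= 1 + k * (cost v c + 4)"
	 "represents w z (set_va x n (fold ?f [n - k..<n] ?s1)) sg2" by auto
	have "regs sg 1 ~= 0" using Suc.prems i by auto
	from exec.WhileTrue[OF this b 2(1)] 1 2 i i3 show ?case by - (intro exI conjI, assumption, auto)
 qed
 let ?sg = "sg(|regs := (regs sg)(3 * x := 0, 1 := of_bool (0 < n))|)"
 have w1: "0 < n ==> 1 < (2::nat) ^ w" using n by (cases w) auto
 have rp: "regs sg (3 * p) = n" using For.prems n by (auto simp: represents_def)
 have b: "exec w (Const (3 * x) 0) sg 1 (sg(|regs := (regs sg)(3 * x := 0)|))"
	"exec w (BinOp 1 Less (3 * x) (3 * p)) (sg(|regs := (regs sg)(3 * x := 0)|)) 1 ?sg" using exec.Const[of w "3 * x" 0 sg]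
	 exec.BinOp[of w 1 Less "3 * x" "3 * p" "sg(|regs := (regs sg)(3 * x := 0)|)"] w1 rp x by (simp_all add: take_bit_nat_eq_self fun_upd_twist)
 have "represents w z (set_va x (n - n) s) ?sg" using For.prems x by (auto simp: represents_def)
 from loop[OF _ this] For.prems obtain t sg2 where
	2: "exec w ?loop ?sg t sg2" "t <= 1 + n * (cost v c + 4)"
	 "represents w z (set_va x n (fold ?f [0..<n] s)) sg2" by auto
 from exec.Seq[OF b(1) exec.Seq[OF b(2) 2(1)]] 2 n n_def show ?case by - (intro exI conjI, unfold compile.simps, assumption, auto)
qed

section \<open>Reductions with polylogarithmically many calls\<close>

text \<open>The summand 2 makes \<open>lg n\<close> positive and gives polynomial bounds in
  \<open>n + 2\<close> a base of at least 2, for every \<open>n\<close>.\<close>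

definition lg :: "nat => nat" where
 "lg n = (LEAST l. n + 2 <= 2 ^ l)"

lemma lg_ge: "n + 2 <= 2 ^ lg n"
 unfolding lg_def by (rule LeastI[of _ "n + 2"]) (use less_exp[of "n + 2"] in linarith)

lemma lg_least: "l < lg n ==> 2 ^ l < n + 2"
 unfolding lg_def using not_less_Least[of l "%l. n + 2 <= 2 ^ l"] by auto

lemma lg_pos: "0 < lg n"
 using lg_ge[of n] by (cases "lg n") auto

lemma lg_le: "2 ^ lg n <= 2 * (n + 1)"
 using lg_least[of "lg n - 1" n] lg_pos[of n] by (cases "lg n") auto

definition start :: "nat => nat => nat list => ast" where
 "start z n inp = (|va = (%_. 0)(0 := z, 1 := 2 ^ z - 1, 3 := n, 4 := lg n),
	ar = (%r i. if r = 0 & i < length inp then inp ! i else 0)|)"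

text \<open>
 The size of the instance is found at address \<open>k\<close>. The prelude leaves the machine word size \<open>z\<close>
 used for the simulation and its mask in registers 0 and 3, the size of the instances of the
 target problem in register 9, and its logarithm in register 12.
\<close>

definition prelude_loop :: prog where
 "prelude_loop = WhileNZ 4 (Seq (BinOp 12 Add 12 1) (BinOp 4 Shr 7 12))"

definition prelude :: "nat => nat => nat => prog" where
 "prelude k d n0 =
	Seq (Seq (Const 1 k) (Seq (Load 9 1) (Seq (Const 1 n0) (BinOp 4 Less 9 1))))
 (Seq (IfNZ 4 (BinOp 9 Or 1 1) Skip)
 (Seq (Seq (Const 12 0) (Seq (Const 1 1) (Seq (BinOp 7 Add 9 1) (BinOp 4 Shr 7 12))))
 (Seq prelude_loop
		(Seq (Const 1 d) (Seq (BinOp 0 Mul 12 1) (Seq (Const 1 1)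
		 (Seq (BinOp 3 Shl 1 0) (BinOp 3 Sub 3 1))))))))"

text \<open>\<open>lg n\<close> is the least shift that takes \<open>n + 1\<close> to 0, so it is
  found by counting shifts.\<close>

lemma prelude_loop:
 assumes "j <= lg n" "n + 2 < 2 ^ w" "lg n < 2 ^ w"
	and "regs sg 12 = lg n - j" "regs sg 7 = n + 1" "regs sg 1 = 1" "regs sg 4 = drop_bit (lg n - j) (n + 1)"
 shows "exec w prelude_loop sg (1 + 3 * j) (sg(|regs := (regs sg)(12 := lg n, 4 := 0)|))"
 using assms
proof (induction j arbitrary: sg)
 case 0
 have "n + 1 < 2 ^ lg n" using lg_ge[of n] by linarith
 hence z: "regs sg 4 = 0" using 0 by (simp add: drop_bit_eq_div)
 hence "sg(|regs := (regs sg)(12 := lg n, 4 := 0)|) = sg" using 0 by (cases sg) (auto simp: fun_eq_iff)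
 thus ?case using exec.WhileFalse[OF z] unfolding prelude_loop_def by (metis mult_0_right add.right_neutral)
next
 case (Suc j)
 have "2 ^ (lg n - Suc j) <= n + 1" using lg_least[of "lg n - Suc j" n] Suc.prems by simp
 hence nz: "regs sg 4 ~= 0" using Suc.prems div_greater_zero_iff[of "n+1" "2 ^ (lg n - Suc j)"] by (simp add: drop_bit_eq_div)
 let ?sg = "sg(|regs := (regs sg)(12 := lg n - j, 4 := drop_bit (lg n - j) (n + 1))|)"
 have "drop_bit (lg n - j) (n + 1) <= n + 1" by (simp add: drop_bit_eq_div)
 hence lt: "drop_bit (lg n - j) (n + 1) < 2 ^ w" using Suc.prems by linarith
 have "lg n - Suc j + 1 = lg n - j" "lg n - j < 2 ^ w" using Suc.prems by auto
 hence b: "exec w (Seq (BinOp 12 Add 12 1) (BinOp 4 Shr 7 12)) sg (1 + 1) ?sg" using exec.Seq[OF exec.BinOp[of w 12 Add 12 1 sg] exec.BinOp[of w 4 Shr 7 12]] Suc.prems lt by (simp add: take_bit_nat_eq_self)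
 have "exec w prelude_loop ?sg (1 + 3 * j) (?sg(|regs := (regs ?sg)(12 := lg n, 4 := 0)|))" by (rule Suc.IH) (use Suc.prems in auto)
 moreover have "?sg(|regs := (regs ?sg)(12 := lg n, 4 := 0)|) = sg(|regs := (regs sg)(12 := lg n, 4 := 0)|)" by (cases sg) (auto simp: fun_eq_iff)
 moreover have "1 + (1 + 1) + (1 + 3 * j) = 1 + 3 * Suc j" by simp
 ultimately show ?case using exec.WhileTrue[OF nz b] unfolding prelude_loop_def by metis
qed

lemma prelude:
 assumes inp: "k < length inp" "inp ! k = N" and n: "n = max N n0" and z: "z = d * lg n"
	and "2 * z <= w" "0 < d" and len: "length inp <= 2 ^ z" and w: "n + 2 < 2 ^ w" "k < 2 ^ w" "lg n < 2 ^ w" "d < 2 ^ w"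
 shows "EX t sg. exec w (prelude k d n0) (initial_state inp) t sg & t <= 20 + 3 * lg n &
	represents w z (start z n inp) sg"
proof -
 have zpos: "0 < z" using z \<open>0 < d\<close> lg_pos by simp
 have z2: "2 ^ z < (2::nat) ^ w" "z < 2 ^ w" using zpos \<open>2 * z <= w\<close> less_exp[of w] by (simp_all del: less_exp)
 have w1: "Suc 0 < 2 ^ w" "0 < w" using w zpos \<open>2 * z <= w\<close> by linarith+
 let ?sg0 = "initial_state inp"
 let ?r1 = "(regs ?sg0)(9 := N, 1 := n0, 4 := of_bool (N < n0))"
 have 1: "exec w (Seq (Const 1 k) (Seq (Load 9 1) (Seq (Const 1 n0) (BinOp 4 Less 9 1)))) ?sg0 (1 + (1 + (1 + 1)))
	(?sg0(|regs := ?r1|))" using exec.Seq[OF exec.Const[of w 1 k ?sg0] exec.Seq[OF exec.Load[of w 9 1]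
	 exec.Seq[OF exec.Const[of w 1 n0] exec.BinOp[of w 4 Less 9 1]]]] inp n w w1 by (simp add: take_bit_nat_eq_self initial_state_def fun_upd_twist)
 let ?r2 = "?r1(9 := n)"
 have 2: "exec w (IfNZ 4 (BinOp 9 Or 1 1) Skip) (?sg0(|regs := ?r1|)) (1 + 1) (?sg0(|regs := ?r2|))"
 proof (cases "N < n0")
	case True
	thus ?thesis using exec.IfTrue[OF _ exec.BinOp[of w 9 Or 1 1], of "?sg0(|regs := ?r1|)" 4 Skip] n w by (simp add: take_bit_nat_eq_self initial_state_def)
 next
	case False
	hence "?r2 = ?r1" using n by auto
	with False show ?thesis using exec.IfFalse[OF _ exec.Skip[of w], of "?sg0(|regs := ?r1|)" 4 "BinOp 9 Or 1 1"] n by (simp add: initial_state_def)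
 qed
 let ?r3 = "?r2(12 := 0, 1 := 1, 7 := n + 1, 4 := n + 1)"
 have 3: "exec w (Seq (Const 12 0) (Seq (Const 1 1) (Seq (BinOp 7 Add 9 1) (BinOp 4 Shr 7 12))))
	 (?sg0(|regs := ?r2|)) (1 + (1 + (1 + 1))) (?sg0(|regs := ?r3|))" using exec.Seq[OF exec.Const[of w 12 0 "?sg0(|regs := ?r2|)"] exec.Seq[OF exec.Const[of w 1 1]
	 exec.Seq[OF exec.BinOp[of w 7 Add 9 1] exec.BinOp[of w 4 Shr 7 12]]]] w w1 by (simp add: take_bit_nat_eq_self fun_upd_twist)
 let ?r4 = "?r3(12 := lg n, 4 := 0)"
 have 4: "exec w prelude_loop (?sg0(|regs := ?r3|)) (1 + 3 * lg n) (?sg0(|regs := ?r4|))" using prelude_loop[of "lg n" n w "?sg0(|regs := ?r3|)"] w by simp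
 let ?r5 = "?r4(0 := z, 1 := 1, 3 := 2 ^ z - 1)"
 have sub: "nat (take_bit w (int (2 ^ z) - int (Suc 0))) = 2 ^ z - 1"
 proof -
	have "int (2 ^ z) - int (Suc 0) = int (2 ^ z - 1)" by (simp add: of_nat_diff)
	moreover have "take_bit w (2 ^ z - 1) = (2 ^ z - 1 :: nat)" by (rule take_bit_nat_eq_self) (use z2 in linarith)
	hence "take_bit w (int (2 ^ z - 1)) = int (2 ^ z - 1)" by (metis take_bit_of_nat)
	ultimately show ?thesis by (metis nat_int)
 qed
 have 5: "exec w (Seq (Const 1 d) (Seq (BinOp 0 Mul 12 1) (Seq (Const 1 1)
		 (Seq (BinOp 3 Shl 1 0) (BinOp 3 Sub 3 1))))) (?sg0(|regs := ?r4|)) (1 + (1 + (1 + (1 + 1)))) (?sg0(|regs := ?r5|))" using exec.Seq[OF exec.Const[of w 1 d "?sg0(|regs := ?r4|)"] exec.Seq[OF exec.BinOp[of w 0 Mul 12 1]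
	 exec.Seq[OF exec.Const[of w 1 1] exec.Seq[OF exec.BinOp[of w 3 Shl 1 0] exec.BinOp[of w 3 Sub 3 1]]]]]
	 w w1 z2 z sub by (simp add: take_bit_nat_eq_self fun_upd_twist push_bit_eq_mult mult.commute)
 note e = exec.Seq[OF 1 exec.Seq[OF 2 exec.Seq[OF 3 exec.Seq[OF 4 5]]], folded prelude_def]
 have r: "represents w z (start z n inp) (?sg0(|regs := ?r5|))" unfolding represents_def
 proof (intro conjI allI impI)
	fix x :: nat
	have "3 * x = 4 \<longleftrightarrow> False" "3 * x = 7 \<longleftrightarrow> False" "3 * x = 1 \<longleftrightarrow> False"
	 "3 * x = 0 \<longleftrightarrow> x = 0" "3 * x = 3 \<longleftrightarrow> x = 1" "3 * x = 9 \<longleftrightarrow> x = 3" "3 * x = 12 \<longleftrightarrow> x = 4" by presburger+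
	thus "regs (?sg0(|regs := ?r5|)) (3 * x) = va (start z n inp) x" by (simp add: start_def initial_state_def)
 next
	fix r i assume ri: "r < (2::nat) ^ z" "i < (2::nat) ^ z"
	\<comment> \<open>The input has at most \<open>2 ^ z\<close> words, so it lies within row 0 and all
	  other rows are still zero.\<close>
	show "mem (?sg0(|regs := ?r5|)) (r * 2 ^ z + i) = ar (start z n inp) r i"
	proof (cases "r = 0")
	 case False
	 hence "2 ^ z <= r * 2 ^ z + i" by (cases r) auto
	 with False len show ?thesis by (simp add: start_def initial_state_def)
	qed (simp add: start_def initial_state_def)
 qed (use assms in \<open>auto simp: start_def\<close>)
 from e r show ?thesis by (intro exI[of _ "1 + (1 + (1 + 1)) + (1 + 1 + (1 + (1 + (1 + 1)) + (1 + 3 * lg n + (1 + (1 + (1 + (1 + 1)))))))"] exI[of _ "?sg0(|regs := ?r5|)"] conjI) auto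
qed

section \<open>Calling a solver inside one row of memory\<close>

definition reset_regs :: "reg list => prog" where
 "reset_regs xs = foldr (%x q. Seq (Const (3 * x + 2) 0) q) xs Skip"

lemma reset_regs:
 "EX sg'. exec w (reset_regs xs) sg (length xs + 1) sg' & mem sg' = mem sg &
	(\<forall>x\<in>set xs. regs sg' (3 * x + 2) = 0) & (ALL r. r mod 3 ~= 2 --> regs sg' r = regs sg r) &
	(ALL r. regs sg r = 0 --> regs sg' r = 0)"
proof (induction xs arbitrary: sg)
 case Nil
 thus ?case using exec.Skip by (auto simp: reset_regs_def)
next
 case (Cons x xs)
 let ?sg = "sg(|regs := (regs sg)(3 * x + 2 := 0)|)"
 obtain sg' where 1: "exec w (reset_regs xs) ?sg (length xs + 1) sg'" "mem sg' = mem ?sg"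
	"\<forall>x\<in>set xs. regs sg' (3 * x + 2) = 0" "ALL r. r mod 3 ~= 2 --> regs sg' r = regs ?sg r"
	"ALL r. regs ?sg r = 0 --> regs sg' r = 0" using Cons.IH by blast
 have "exec w (Const (3 * x + 2) 0) sg 1 ?sg" using exec.Const[of w "3 * x + 2" 0] by simp
 from exec.Seq[OF this 1(1)] have "exec w (reset_regs (x # xs)) sg (length (x # xs) + 1) sg'" by (simp add: reset_regs_def)
 moreover have "regs sg' (3 * x + 2) = 0" using 1(5) by simp
 ultimately show ?case using 1 by (intro exI[of _ sg']) (auto split: if_splits)
qed

definition call :: "prog => reg list => prog" where
 "call p xs = Seq (reset_regs xs) (Seq (BinOp 1 Shl 6 0) (sim p))"

text \<open>A row with the instance followed by zeros, together with cleared registers, is exactly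
  the initial state that the solver expects. The whole row is then surrendered to whatever the
  solver leaves in it.\<close>

lemma call_correct:
 assumes rep: "represents w z s sg" and r: "va s 2 < 2 ^ z" and xs: "set xs = prog_regs p"
	and content: "ALL i<2 ^ z. ar s (va s 2) i = (if i < length inp then inp ! i else 0)"
	and inp: "set inp <= {..<2 ^ z}" and ex: "exec z p (initial_state inp) t s'"
 shows "EX t' sg'. exec w (call p xs) sg t' sg' & t' <= 2 * t + length xs + 2 &
	represents w z (s(|ar := (ar s)(va s 2 := mem s')|)) sg'"
proof -
 have r0: "!!x. regs sg (3 * x) = va s x" "va s 0 = z" "va s 1 = 2 ^ z - 1" "2 * z <= w" using rep unfolding represents_def by blast+
 from r0(1)[of 0] r0(1)[of 1] r0(1)[of 2] r0(2,3)
 have sgr: "regs sg 0 = z" "regs sg 3 = 2 ^ z - 1" "regs sg 6 = va s 2" by simp_all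
 define b where "b = va s 2 * 2 ^ z"
 have le: "b + 2 ^ z <= 2 ^ w"
 proof -
	have "b + 2 ^ z = (va s 2 + 1) * 2 ^ z" by (simp add: b_def)
	also have "... <= 2 ^ z * 2 ^ z" using r by (intro mult_right_mono) auto
	also have "... <= 2 ^ w" using r0(4) by (simp flip: power_add)
	finally show ?thesis .
 qed
 have b_lt: "b < 2 ^ w" using le by (metis add_lessD1 le_neq_implies_less less_add_same_cancel1 zero_less_numeral zero_less_power)
 obtain sg1 where 1: "exec w (reset_regs xs) sg (length xs + 1) sg1" "mem sg1 = mem sg"
	"\<forall>x\<in>set xs. regs sg1 (3 * x + 2) = 0" "ALL r. r mod 3 ~= 2 --> regs sg1 r = regs sg r" using reset_regs by blast
 let ?sg2 = "sg1(|regs := (regs sg1)(1 := b)|)"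
 have 2: "exec w (BinOp 1 Shl 6 0) sg1 1 ?sg2" using exec.BinOp[of w 1 Shl 6 0 sg1] 1(4) sgr b_lt by (simp add: push_bit_eq_mult b_def[symmetric] take_bit_nat_eq_self)
 have bd: "bounded_state z (initial_state inp)" using inp by (auto simp: bounded_state_def initial_state_def subset_iff)
 have "simulates z b (prog_regs p) (initial_state inp) ?sg2" unfolding simulates_def
 proof (intro conjI ballI allI impI)
	fix a assume "a < (2::nat) ^ z"
	thus "mem ?sg2 (b + a) = mem (initial_state inp) a" using rep content r 1(2) by (simp add: represents_def b_def initial_state_def)
 qed (use 1 xs sgr in \<open>auto simp: initial_state_def\<close>)
 from sim_correct[OF ex _ le subset_refl bd this] r0(4)
 obtain t' sg' where 3: "exec w (sim p) ?sg2 t' sg'" "t' <= 2 * t"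
	"simulates z b (prog_regs p) s' sg'" "sim_frame z b ?sg2 sg'" by auto
 have "represents w z (s(|ar := (ar s)(va s 2 := mem s')|)) sg'" unfolding represents_def
 proof (intro conjI allI impI)
	fix x :: nat
	have "3 * x ~= 4" by presburger
	thus "regs sg' (3 * x) = va (s(|ar := (ar s)(va s 2 := mem s')|)) x" using 3(4) 1(4) r0 by (simp add: sim_frame_def)
 next
	fix q i assume qi: "q < (2::nat) ^ z" "i < (2::nat) ^ z"
	show "mem sg' (q * 2 ^ z + i) = ar (s(|ar := (ar s)(va s 2 := mem s')|)) q i"
	proof (cases "q = va s 2")
	 case True
	 thus ?thesis using 3(3) qi by (simp add: simulates_def b_def)
	next
	 case False
	 have "\<not> (b <= q * 2 ^ z + i & q * 2 ^ z + i < b + 2 ^ z)"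
	 proof
		assume *: "b <= q * 2 ^ z + i & q * 2 ^ z + i < b + 2 ^ z"
		hence "q * 2 ^ z + i = va s 2 * 2 ^ z + (q * 2 ^ z + i - b)" "q * 2 ^ z + i - b < 2 ^ z" by (auto simp: b_def)
		from address_inj[OF this(1) qi(2) this(2)] False show False by simp
	 qed
	 thus ?thesis using 3(4) 1(2) False qi rep by (simp add: sim_frame_def represents_def)
	qed
 qed (use r0 in auto)
 with exec.Seq[OF 1(1) exec.Seq[OF 2 3(1)], folded call_def] 3(2) show ?thesis by (intro exI[of _ "length xs + 1 + (1 + t')"] exI[of _ sg']) auto
qed

text \<open>The compiled counting loop once more, now around an arbitrary RAM program, because a
  body that contains a call is not a \<open>cmd\<close>.\<close>

lemma ram_for:
 assumes step: "!!i sg. i < n ==> I i sg ==> regs sg (3 * x) = i ==> regs sg (3 * p) = n ==>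
	 EX t sg'. exec w body sg t sg' & t <= B & regs sg' (3 * x) = i & regs sg' (3 * p) = n &
		I (i + 1) (sg'(|regs := (regs sg')(1 := of_bool (i + 1 < n), 3 * x := i + 1)|))"
	and n: "n < 2 ^ w" "x ~= p"
	and "regs sg (3 * p) = n" and "I 0 (sg(|regs := (regs sg)(1 := of_bool (0 < n), 3 * x := 0)|))"
 shows "EX t sg'. exec w (Seq (Const (3 * x) 0) (Seq (BinOp 1 Less (3 * x) (3 * p))
	 (WhileNZ 1 (Seq body (Seq (Const 1 1)
		(Seq (BinOp (3 * x) Add (3 * x) 1) (BinOp 1 Less (3 * x) (3 * p)))))))) sg t sg' &
	 t <= 3 + n * (B + 4) & I n sg'"
proof -
 let ?loop = "WhileNZ 1 (Seq body (Seq (Const 1 1)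
		(Seq (BinOp (3 * x) Add (3 * x) 1) (BinOp 1 Less (3 * x) (3 * p)))))"
 have loop: "EX t sg'. exec w ?loop sg t sg' & t <= 1 + k * (B + 4) & I n sg'"
	if "k <= n" "I (n - k) sg" "regs sg 1 = of_bool (n - k < n)" "regs sg (3 * x) = n - k" "regs sg (3 * p) = n"
	for k sg using that
 proof (induction k arbitrary: sg)
	case 0
	hence "regs sg 1 = 0" by simp
	from exec.WhileFalse[OF this] 0 show ?case by (intro exI conjI) auto
 next
	case (Suc k)
	let ?i = "n - Suc k"
	have i: "?i < n" "?i + 1 = n - k" using Suc.prems by auto
	obtain t1 sg1 where 1: "exec w body sg t1 sg1" "t1 <= B" "regs sg1 (3 * x) = ?i" "regs sg1 (3 * p) = n"
	 "I (n - k) (sg1(|regs := (regs sg1)(1 := of_bool (n - k < n), 3 * x := n - k)|))" using step[OF i(1)] Suc.prems unfolding i(2) by blast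
	let ?sg = "sg1(|regs := (regs sg1)(1 := of_bool (n - k < n), 3 * x := n - k)|)"
	have w1: "1 < (2::nat) ^ w" using n i by (cases w) auto
	have "apply_op w Add ?i 1 = n - k" using i n by (metis apply_op.simps(1) diff_le_self le_less_trans take_bit_nat_eq_self)
	moreover have "apply_op w Less (n - k) n = of_bool (n - k < n)" "take_bit w 1 = (1::nat)" using w1 by (cases w; simp add: take_bit_nat_eq_self)+
	ultimately have b: "exec w (Seq body (Seq (Const 1 1)
		(Seq (BinOp (3 * x) Add (3 * x) 1) (BinOp 1 Less (3 * x) (3 * p))))) sg (t1 + (1 + (1 + 1))) ?sg" using exec.Seq[OF 1(1) exec.Seq[OF exec.Const[of w 1 1] exec.Seq[OF exec.BinOp[of w "3 * x" Add "3 * x" 1]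
		exec.BinOp[of w 1 Less "3 * x" "3 * p"]]]] 1 n(2) by (simp del: apply_op.simps add: fun_upd_twist)
	obtain t2 sg2 where 2: "exec w ?loop ?sg t2 sg2" "t2 <= 1 + k * (B + 4)" "I n sg2" using Suc.IH[of ?sg] Suc.prems 1 n(2) by auto
	have "regs sg 1 ~= 0" using Suc.prems i by auto
	from exec.WhileTrue[OF this b 2(1)] 1 2 show ?case by - (intro exI conjI, assumption, auto)
 qed
 let ?sg = "sg(|regs := (regs sg)(1 := of_bool (0 < n), 3 * x := 0)|)"
 have w1: "0 < n ==> 1 < (2::nat) ^ w" using n by (cases w) auto
 have b: "exec w (Const (3 * x) 0) sg 1 (sg(|regs := (regs sg)(3 * x := 0)|))"
	"exec w (BinOp 1 Less (3 * x) (3 * p)) (sg(|regs := (regs sg)(3 * x := 0)|)) 1 ?sg" using exec.Const[of w "3 * x" 0 sg]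
	 exec.BinOp[of w 1 Less "3 * x" "3 * p" "sg(|regs := (regs sg)(3 * x := 0)|)"] w1 n assms(4) by (simp_all add: take_bit_nat_eq_self fun_upd_twist)
 obtain t sg2 where 2: "exec w ?loop ?sg t sg2" "t <= 1 + n * (B + 4)" "I n sg2" using loop[of n ?sg] assms by auto
 from exec.Seq[OF b(1) exec.Seq[OF b(2) 2(1)]] 2 show ?thesis by - (intro exI conjI, assumption, auto)
qed

text \<open>\<open>I r\<close> describes the state after \<open>r\<close> calls. A solver guarantees
  only the first \<open>length Y\<close> words of its memory, so the invariant has to survive for
  every \<open>f\<close> with this prefix.\<close>

definition correct_pieces ::
 "problem => nat set => nat => nat => nat => cmd => cmd => cmd => cmd => ast => nat list => bool" where
 "correct_pieces P V w z n c1 c2 c3 c4 s0 out \<longleftrightarrow> (EX I.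
	I 0 (run w z c1 s0) &
	(ALL r s. r < va s0 6 --> I r s --> params_agree V (va s0) s -->
	 (EX X Y. let s' = run w z c2 (set_va 5 r s) in
		P z n X Y & set X <= {..<2 ^ z} & va s' 2 < 2 ^ z &
		(ALL i<2 ^ z. ar s' (va s' 2) i = (if i < length X then X ! i else 0)) &
		(ALL f. (ALL i<length Y. f i = Y ! i) -->
		 I (r + 1) (set_va 5 (r + 1) (run w z c3 (s'(|ar := (ar s')(va s' 2 := f)|))))))) &
	(ALL s. I (va s0 6) s --> params_agree V (va s0) s -->
	 (ALL i<length out. ar (run w z c4 (set_va 5 (va s0 6) s)) 0 i = out ! i)))"

text \<open>Registers 15 and 18 are variables 5 and 6, the number of the current call and the number
  of all calls.\<close>

lemma pieces_exec:
 assumes wf: "wf_cmd {0, 1, 3, 4} c0" "wf_cmd V c1" "wf_cmd V c2" "wf_cmd V c3" "wf_cmd V c4"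
	and V: "{0, 1, 3, 4, 6} <= V" "5 ~: V" "5 ~: assigned c2" "5 ~: assigned c3" "V <= {0, 1, 3, 4} \<union> assigned c0"
	and pre: "exec w pr (initial_state inp) t0 sg" "represents w z (start z n inp) sg"
	and small: "z < 2 ^ w" "n < 2 ^ w" "lg n < 2 ^ w"
	and s0: "s0 = run w z c0 (start z n inp)"
	and s0_lt: "\<forall>p\<in>V. va s0 p < 2 ^ w"
	and pc: "correct_pieces P V w z n c1 c2 c3 c4 s0 out" and out: "length out <= 2 ^ z"
	and solver: "!!X Y. P z n X Y ==> EX t s. exec z p (initial_state X) t s & outputs s Y & t <= tp"
	and xs: "set xs = prog_regs p"
 shows "EX t s. exec w (Seq pr (Seq (compile c0) (Seq (compile c1) (Seq
	(Seq (Const 15 0) (Seq (BinOp 1 Less 15 18)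
	 (WhileNZ 1 (Seq (Seq (compile c2) (Seq (call p xs) (compile c3))) (Seq (Const 1 1)
		(Seq (BinOp 15 Add 15 1) (BinOp 1 Less 15 18)))))))
	(compile c4))))) (initial_state inp) t s & outputs s out &
	t <= t0 + cost (va (start z n inp)) c0 + cost (va s0) c1 +
	 (3 + va s0 6 * (cost (va s0) c2 + (2 * tp + length xs + 2) + cost (va s0) c3 + 4)) + cost (va s0) c4"
proof -
 have zw: "2 * z <= w" using pre(2) by (simp add: represents_def)
 have "(2::nat) ^ z <= 2 ^ w" using zw by (intro power_increasing) auto
 hence z2: "2 ^ z - 1 < (2::nat) ^ w" using zero_less_power[of "2::nat" z] by linarith
 have st_lt: "\<forall>p\<in>{0, 1, 3, 4}. va (start z n inp) p < 2 ^ w" using small z2 by (simp add: start_def)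
 have pa0: "params_agree {0, 1, 3, 4} (va (start z n inp)) (start z n inp)" by (simp add: params_agree_def)
 obtain t1 sg1 where 1: "exec w (compile c0) sg t1 sg1" "t1 <= cost (va (start z n inp)) c0"
	 "represents w z s0 sg1" using compile_correct[OF wf(1) _ st_lt pa0 pre(2)] s0 by auto
 have V01: "{0, 1} <= V" using V by auto
 have pa1: "params_agree V (va s0) s0" by (simp add: params_agree_def)
 let ?s1 = "run w z c1 s0"
 obtain t2 sg2 where 2: "exec w (compile c1) sg1 t2 sg2" "t2 <= cost (va s0) c1"
	 "represents w z ?s1 sg2" using compile_correct[OF wf(2) V01 s0_lt pa1 1(3)] by auto
 obtain I where I: "I 0 ?s1"
	"!!r s. r < va s0 6 ==> I r s ==> params_agree V (va s0) s ==>
	 (EX X Y. let s' = run w z c2 (set_va 5 r s) in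
		P z n X Y & set X <= {..<2 ^ z} & va s' 2 < 2 ^ z &
		(ALL i<2 ^ z. ar s' (va s' 2) i = (if i < length X then X ! i else 0)) &
		(ALL f. (ALL i<length Y. f i = Y ! i) -->
		 I (r + 1) (set_va 5 (r + 1) (run w z c3 (s'(|ar := (ar s')(va s' 2 := f)|))))))"
	"!!s. I (va s0 6) s ==> params_agree V (va s0) s ==>
	 (ALL i<length out. ar (run w z c4 (set_va 5 (va s0 6) s)) 0 i = out ! i)" using pc unfolding correct_pieces_def by blast
 \<comment> \<open>The invariant lifted to machine states, with the counter of calls already set to
   \<open>r\<close>.\<close>
 define J where "J r sg \<longleftrightarrow> (EX s. I r s & params_agree V (va s0) s & represents w z (set_va 5 r s) sg)"
	for r sg
 have step: "EX t sg'. exec w (Seq (compile c2) (Seq (call p xs) (compile c3))) sg t sg' &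
	 t <= cost (va s0) c2 + (2 * tp + length xs + 2) + cost (va s0) c3 & regs sg' (3 * 5) = r & regs sg' (3 * 6) = va s0 6 &
		J (r + 1) (sg'(|regs := (regs sg')(1 := of_bool (r + 1 < va s0 6), 3 * 5 := r + 1)|))"
	if r: "r < va s0 6" and Jr: "J r sg" for r sg
 proof -
	from Jr obtain s where s: "I r s" "params_agree V (va s0) s" "represents w z (set_va 5 r s) sg" unfolding J_def by blast
	have pas: "params_agree V (va s0) (set_va 5 r s)" using s(2) V(2) by (auto simp: params_agree_def)
	let ?s' = "run w z c2 (set_va 5 r s)"
	obtain t1 sg1 where 1: "exec w (compile c2) sg t1 sg1" "t1 <= cost (va s0) c2" "represents w z ?s' sg1" using compile_correct[OF wf(3) V01 s0_lt pas s(3)] by auto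
	have pas': "params_agree V (va s0) ?s'" by (rule params_agree_run[OF wf(3) pas])
	from I(2)[OF r s(1,2), unfolded Let_def] obtain X Y where step: "P z n X Y" "set X <= {..<2 ^ z}" "va ?s' 2 < 2 ^ z"
		"ALL i<2 ^ z. ar ?s' (va ?s' 2) i = (if i < length X then X ! i else 0)"
		"ALL f. (ALL i<length Y. f i = Y ! i) -->
		 I (r + 1) (set_va 5 (r + 1) (run w z c3 (?s'(|ar := (ar ?s')(va ?s' 2 := f)|))))" by blast
	from step solver obtain tq s2 where q: "exec z p (initial_state X) tq s2" "outputs s2 Y" "tq <= tp" by blast
	let ?s'' = "?s'(|ar := (ar ?s')(va ?s' 2 := mem s2)|)"
	obtain t2 sg2 where 2: "exec w (call p xs) sg1 t2 sg2" "t2 <= 2 * tq + length xs + 2" "represents w z ?s'' sg2" using call_correct[OF 1(3) _ xs _ _ q(1)] step by blast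
	have pas'': "params_agree V (va s0) ?s''" using pas' by (simp add: params_agree_def)
	obtain t3 sg3 where 3: "exec w (compile c3) sg2 t3 sg3" "t3 <= cost (va s0) c3" "represents w z (run w z c3 ?s'') sg3" using compile_correct[OF wf(4) V01 s0_lt pas'' 2(3)] by auto
	let ?s3 = "run w z c3 ?s''"
	have v5: "va ?s3 5 = r" using V by (simp add: run_va_unassigned)
	have pa3: "params_agree V (va s0) ?s3" by (rule params_agree_run[OF wf(4) pas''])
	hence v6: "va ?s3 6 = va s0 6" using V by (auto simp: params_agree_def)
	have "I (r + 1) (set_va 5 (r + 1) ?s3)" using step q(2) by (simp add: outputs_def)
	moreover have "params_agree V (va s0) (set_va 5 (r + 1) ?s3)" using pa3 V(2) by (auto simp: params_agree_def)
	moreover have "represents w z (set_va 5 (r + 1) (set_va 5 (r + 1) ?s3))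
		(sg3(|regs := (regs sg3)(1 := of_bool (r + 1 < va s0 6), 3 * 5 := r + 1)|))" using 3(3) unfolding represents_def by auto
	ultimately have "J (r + 1) (sg3(|regs := (regs sg3)(1 := of_bool (r + 1 < va s0 6), 3 * 5 := r + 1)|))" unfolding J_def by blast
	moreover have "regs sg3 (3 * 5) = r" "regs sg3 (3 * 6) = va s0 6" using 3(3) v5 v6 unfolding represents_def by metis+
	ultimately show ?thesis using exec.Seq[OF 1(1) exec.Seq[OF 2(1) 3(1)]] 1(2) 2(2) 3(2) q(3) by (intro exI[of _ "t1 + (t2 + t3)"] exI[of _ sg3]) auto
 qed
 have pas1: "params_agree V (va s0) ?s1" by (rule params_agree_run[OF wf(2) pa1])
 have "represents w z (set_va 5 0 ?s1) (sg2(|regs := (regs sg2)(1 := of_bool (0 < va s0 6), 3 * 5 := 0)|))" using 2(3) unfolding represents_def by auto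
 hence J0: "J 0 (sg2(|regs := (regs sg2)(1 := of_bool (0 < va s0 6), 3 * 5 := 0)|))" using I(1) pas1 unfolding J_def by blast
 have "regs sg2 (3 * 6) = va ?s1 6" using 2(3) unfolding represents_def by blast
 hence r6: "regs sg2 (3 * 6) = va s0 6" "va s0 6 < 2 ^ w" using pas1 V s0_lt unfolding params_agree_def by auto
 obtain t3 sg3 where 3: "exec w (Seq (Const 15 0) (Seq (BinOp 1 Less 15 18)
	 (WhileNZ 1 (Seq (Seq (compile c2) (Seq (call p xs) (compile c3))) (Seq (Const 1 1)
		(Seq (BinOp 15 Add 15 1) (BinOp 1 Less 15 18))))))) sg2 t3 sg3"
	 "t3 <= 3 + va s0 6 * (cost (va s0) c2 + (2 * tp + length xs + 2) + cost (va s0) c3 + 4)" "J (va s0 6) sg3" using ram_for[of "va s0 6" J 5 6 w "Seq (compile c2) (Seq (call p xs) (compile c3))"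
		"cost (va s0) c2 + (2 * tp + length xs + 2) + cost (va s0) c3" sg2, OF step r6(2) _ r6(1) J0] by auto
 then obtain s where s: "I (va s0 6) s" "params_agree V (va s0) s" "represents w z (set_va 5 (va s0 6) s) sg3" unfolding J_def by blast
 have pas3: "params_agree V (va s0) (set_va 5 (va s0 6) s)" using s(2) V(2) by (auto simp: params_agree_def)
 obtain t4 sg4 where 4: "exec w (compile c4) sg3 t4 sg4" "t4 <= cost (va s0) c4"
	 "represents w z (run w z c4 (set_va 5 (va s0 6) s)) sg4" using compile_correct[OF wf(5) V01 s0_lt pas3 s(3)] by auto
 have "outputs sg4 out" unfolding outputs_def
 proof (intro allI impI)
	fix i assume i: "i < length out"
	have "ALL r<2 ^ z. ALL i<2 ^ z. mem sg4 (r * 2 ^ z + i) = ar (run w z c4 (set_va 5 (va s0 6) s)) r i" using 4(3) unfolding represents_def by blast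
	from this[rule_format, of 0 i] I(3)[OF s(1,2)] i out show "mem sg4 i = out ! i" by simp
 qed
 with exec.Seq[OF pre(1) exec.Seq[OF 1(1) exec.Seq[OF 2(1) exec.Seq[OF 3(1) 4(1)]]]] 1(2) 2(2) 3(2) 4(2)
 show ?thesis by - (intro exI conjI, assumption, auto)
qed

text \<open>All calls have size \<open>max N n0\<close>, where \<open>n0\<close> is the size from
  which the constructions work. \<open>T\<close> is an arbitrary real function, hence the maximum
  with 0.\<close>

definition reduction_time :: "nat => nat => (nat => real) => nat => nat => real" where
 "reduction_time a k T n0 N =
	real a * (max 0 (T (max N n0)) + real (max N n0) + 1) * real (lg (max N n0) + 1) ^ k"

text \<open>\<open>2 ^ lg n <= 2 * (n + 1) <= n * n\<close> and \<open>ln 2 >= 1 / 2\<close> give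
  \<open>lg n <= 4 * ln n\<close>; the remaining 1 is at most \<open>2 * ln n\<close> because
  \<open>ln 4 >= 1\<close>.\<close>

lemma lg_le_ln:
 assumes "4 <= n"
 shows "real (lg n + 1) <= 6 * ln (real n)"
proof -
 have "2 ^ lg n <= 2 * (n + 1)" by (rule lg_le)
 also have "... <= n * n" by (rule le_trans[OF _ mult_le_mono1[OF assms, of n]]) (use assms in simp)
 finally have "real (2 ^ lg n) <= real (n * n)" by linarith
 hence "ln (2 ^ lg n) <= ln (real n * real n)" by (subst ln_le_cancel_iff) (use assms in auto)
 hence 1: "real (lg n) * ln 2 <= 2 * ln (real n)" using assms by (simp add: ln_realpow ln_mult)
 have "1 / 2 <= ln (2 :: real)" using exp_half_le2 ln_ge_iff[of 2 "1 / 2"] by linarith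
 hence "real (lg n) * (1 / 2) <= real (lg n) * ln 2" by (intro mult_left_mono) auto
 with 1 have 2: "real (lg n) <= 4 * ln (real n)" by linarith
 have "ln 4 <= ln (real n)" using assms by simp
 moreover have "ln (4::real) = 2 * ln 2" using ln_realpow[of 2 2] by simp
 ultimately have "1 <= ln (real n)" using \<open>1 / 2 <= ln 2\<close> by linarith
 with 2 show ?thesis by simp
qed

text \<open>The linear lower bound turns the cost of building instances into a multiple of
  \<open>T N\<close>, and for large \<open>N\<close> the maximum with \<open>n0\<close>
  disappears.\<close>

lemma reduction_time_soft_O:
 assumes "0 < epl" and "\<forall>\<^sub>F N in sequentially. epl * real N <= T N"
 shows "reduction_time a k T n0 : soft_O T"
proof -
 let ?C = "real a * (1 + 2 / epl) * 6 ^ k"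
 have "\<forall>\<^sub>F N in sequentially. norm (reduction_time a k T n0 N) <= ?C * norm (T N * ln (real N) ^ k)" using assms(2) eventually_ge_at_top[of "max n0 4"]
 proof eventually_elim
	case (elim N)
	hence N: "max N n0 = N" "4 <= N" by auto
	have "0 <= epl * real N" using assms by simp
	hence T0: "0 <= T N" using elim by linarith
	have "real N + 1 <= 2 * real N" using N by simp
	also have "... <= 2 / epl * T N" using elim assms by (simp add: field_simps)
	finally have 1: "max 0 (T N) + real N + 1 <= (1 + 2 / epl) * T N" using T0 by (simp add: algebra_simps)
	have "0 <= ln (real N)" using N by simp
	have 2: "real (lg N + 1) ^ k <= (6 * ln (real N)) ^ k" by (intro power_mono lg_le_ln N) auto
	have "reduction_time a k T n0 N <= (real a * ((1 + 2 / epl) * T N)) * (6 * ln (real N)) ^ k" unfolding reduction_time_def N using 1 2 T0 by (intro mult_mono) auto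
	also have "... = ?C * norm (T N * ln (real N) ^ k)" using T0 \<open>0 <= ln (real N)\<close> by (simp add: power_mult_distrib mult_ac)
	finally show ?case unfolding reduction_time_def by (auto simp: abs_mult)
 qed
 hence "reduction_time a k T n0 : O(%N. T N * ln (real N) ^ k)" by (rule bigoI)
 thus ?thesis by (auto simp: soft_O_def)
qed

text \<open>The five commands set the read-only variables, prepare, write an instance, evaluate its
  answers, and write the output. The sizes in \<open>main\<close> have to fit only for
  \<open>z = d * lg n\<close> with a large multiplier \<open>d\<close>, and the real word size
  leaves room for four such words.\<close>

theorem reduction:
 assumes solver: "solvable_in_time P T"
	and lower: "0 < epl" "\<forall>\<^sub>F N in sequentially. epl * real N <= T N"
	and size: "!!w N inp out. Q w N inp out ==> k < length inp & inp ! k = N" "k <= 1"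
	and wf: "wf_cmd {0, 1, 3, 4} c0" "wf_cmd V c1" "wf_cmd V c2" "wf_cmd V c3" "wf_cmd V c4"
	and V: "{0, 1, 3, 4, 6} <= V" "5 ~: V" "5 ~: assigned c2" "5 ~: assigned c3" "V <= {0, 1, 3, 4} \<union> assigned c0"
	and main: "!!d w z N n inp out s0. Q w N inp out ==> d0 <= d ==> n = max N n0 ==> z = d * lg n ==> 4 * z <= w ==>
		s0 = run w z c0 (start z n inp) ==>
		length inp <= 2 ^ z & length out <= 2 ^ z & (\<forall>p\<in>V. va s0 p < 2 ^ w) &
		va s0 6 <= a * (lg n + 1) ^ e & cost (va (start z n inp)) c0 <= a * (n + 1) * (lg n + 1) ^ e &
		(\<forall>c \<in> {c1, c2, c3, c4}. cost (va s0) c <= a * (n + 1) * (lg n + 1) ^ e) &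
		correct_pieces P V w z n c1 c2 c3 c4 s0 out"
 shows "\<exists>T' \<in> soft_O T. solvable_in_time Q T'"
proof -
 obtain p c where pc: "!!w N inp out. P w N inp out ==> (N + 2) ^ c <= 2 ^ w ==>
	 EX t s. exec w p (initial_state inp) t s & outputs s out & real t <= T N" using solver unfolding solvable_in_time_def by metis
 \<comment> \<open>The multiplier must satisfy the reduction (\<open>d0\<close>) as well as the word
   size that the solver asks for (\<open>c\<close>), and be positive.\<close>
 define d where "d = d0 + c + 1"
 obtain xs where xs: "set xs = prog_regs p" using finite_list[OF finite_prog_regs] by blast
 \<comment> \<open>\<open>(N + 2) ^ c'\<close> has to dominate \<open>2 ^ (4 * z)\<close>; the
   factor \<open>n0 + 3\<close> pays for passing from \<open>N\<close> to
   \<open>max N n0\<close>.\<close>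
 define c' where "c' = (n0 + 3) * (4 * d)"
 define A where "A = 50 + 10 * a + a * (10 + 10 * a + length xs)"
 define pr where "pr = Seq (prelude k d n0) (Seq (compile c0) (Seq (compile c1) (Seq
	(Seq (Const 15 0) (Seq (BinOp 1 Less 15 18)
	 (WhileNZ 1 (Seq (Seq (compile c2) (Seq (call p xs) (compile c3))) (Seq (Const 1 1)
		(Seq (BinOp 15 Add 15 1) (BinOp 1 Less 15 18)))))))
	(compile c4))))"
 \<comment> \<open>One factor of exponent \<open>e\<close> counts the calls, one is the cost of
   building for each call, and the last \<open>lg n + 1\<close> is the prelude.\<close>
 have "solvable_in_time Q (reduction_time A (2 * e + 1) T n0)" unfolding solvable_in_time_def
 proof (rule exI[of _ pr], rule exI[of _ c'], intro allI impI)
	fix w N inp out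
	assume "Q w N inp out & (N + 2) ^ c' <= 2 ^ w"
	hence Q: "Q w N inp out" and w: "(N + 2) ^ c' <= 2 ^ w" by auto
	define n where "n = max N n0"
	define z where "z = d * lg n"
	define s0 where "s0 = run w z c0 (start z n inp)"
	have d: "1 <= d" "d0 <= d" "c <= d" by (auto simp: d_def)
	have "2 ^ lg n <= 2 * (n + 1)" by (rule lg_le)
	also have "... <= 2 * ((N + 1) * (n0 + 1))" by (auto simp: n_def max_def algebra_simps)
	also have "... <= (N + 2) * 2 ^ (n0 + 2)"
	proof -
	 have "2 * (n0 + 1) <= 2 ^ (n0 + 2)" using less_exp[of "n0 + 1"] by simp
	 hence "(N + 1) * (2 * (n0 + 1)) <= (N + 2) * 2 ^ (n0 + 2)" by (intro mult_mono) auto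
	 thus ?thesis by (simp add: algebra_simps)
	qed
	also have "... <= (N + 2) * (N + 2) ^ (n0 + 2)" by (intro mult_left_mono power_mono) auto
	finally have "2 ^ lg n <= (N + 2) ^ (n0 + 3)" by (simp add: numeral_3_eq_3)
	hence "(2 ^ lg n) ^ (4 * d) <= ((N + 2) ^ (n0 + 3)) ^ (4 * d)" by (intro power_mono) auto
	also have "... = (N + 2) ^ c'" by (simp only: c'_def power_mult)
	finally have "(2 ^ lg n) ^ (4 * d) <= (2::nat) ^ w" using w by (rule le_trans)
	moreover have "(2 ^ lg n) ^ (4 * d) = (2::nat) ^ (4 * z)" unfolding z_def by (simp only: mult_ac flip: power_mult)
	ultimately have "(2::nat) ^ (4 * z) <= 2 ^ w" by metis
	hence zw: "4 * z <= w" by simp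
	have lgz: "lg n <= z" "d <= z" using d lg_pos[of n] by (auto simp: z_def)
	hence zpos: "1 <= z" using d by linarith
	have nz: "n + 2 <= 2 ^ z" using lg_ge[of n] power_increasing[OF lgz(1), of "2::nat"] by linarith
	have z2: "(2::nat) ^ z < 2 ^ w" using zw zpos by (intro power_strict_increasing) auto
	have zlt: "z < 2 ^ z" by simp
	note m = main[OF Q d(2) n_def z_def zw s0_def]
	have "2 <= (2::nat) ^ z" using zpos power_increasing[of 1 z "2::nat"] by simp
	hence small: "k < 2 ^ w" "n + 2 < 2 ^ w" "lg n < 2 ^ w" "d < 2 ^ w" "z < 2 ^ w" "n < 2 ^ w" using size(2) z2 nz zlt lgz by linarith+
	obtain t0 sg where pre: "exec w (prelude k d n0) (initial_state inp) t0 sg" "t0 <= 20 + 3 * lg n"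
		"represents w z (start z n inp) sg" using prelude[of k inp N n n0 z d w] size(1)[OF Q] n_def z_def zw d m small by auto
	\<comment> \<open>Step counts are naturals, so the real bound \<open>T n\<close> may be rounded
	  down.\<close>
	have solv: "EX t s. exec z p (initial_state X) t s & outputs s Y & t <= nat \<lfloor>T n\<rfloor>" if "P z n X Y" for X Y
	proof -
	 have "(n + 2) ^ c <= (2 ^ lg n) ^ d" using lg_ge[of n] d by (meson add_leE le_trans one_le_numeral power_increasing power_mono zero_le one_le_power lg_ge add_leE trans_le_add2)
	 hence "(n + 2) ^ c <= 2 ^ z" by (simp add: z_def mult.commute flip: power_mult)
	 from pc[OF that this] show ?thesis by (metis le_nat_floor)
	qed
	let ?B = "a * (n + 1) * (lg n + 1) ^ e"
	let ?R = "t0 + cost (va (start z n inp)) c0 + cost (va s0) c1 +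
	 (3 + va s0 6 * (cost (va s0) c2 + (2 * nat \<lfloor>T n\<rfloor> + length xs + 2) + cost (va s0) c3 + 4)) + cost (va s0) c4"
	have "?R <= 20 + 3 * lg n + ?B + ?B + (3 + (a * (lg n + 1) ^ e) *
		(?B + (2 * nat \<lfloor>T n\<rfloor> + length xs + 2) + ?B + 4)) + ?B" using pre(2) m by (intro add_mono mult_mono) auto
	also have "... <= A * (nat \<lfloor>T n\<rfloor> + n + 1) * (lg n + 1) ^ (2 * e + 1)"
	proof -
	 define t where "t = nat \<lfloor>T n\<rfloor>"
	 define M where "M = (lg n + 1) ^ e"
	 \<comment> \<open>A common bound for all the products that arise when the total cost is
	   expanded.\<close>
	 define U where "U = (t + n + 1) * (M * M * (lg n + 1))"
	 have M: "1 <= M" by (simp add: M_def)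
	 have le: "x * y <= U" if "x <= t + n + 1" "y <= M * M * (lg n + 1)" for x y unfolding U_def using that by (rule mult_le_mono)
	 have MM: "M <= M * M" using M by simp
	 have q: "M * M <= M * M * (lg n + 1)" by simp
	 have "1 * 1 <= M * M" using M by (intro mult_le_mono)
	 hence l: "lg n + 1 <= M * M * (lg n + 1)" using mult_le_mono1[of 1 "M * M" "lg n + 1"] by simp
	 have 1: "1 * (lg n + 1) <= U" "(n + 1) * M <= U" "(n + 1) * (M * M) <= U" "t * M <= U" "1 * M <= U" using MM q l by (intro le; linarith)+
	 have "20 + 3 * lg n + a * (n + 1) * M + a * (n + 1) * M + (3 + (a * M) *
		(a * (n + 1) * M + (2 * t + length xs + 2) + a * (n + 1) * M + 4)) + a * (n + 1) * M
		= 23 + 3 * lg n + (3 * a) * ((n + 1) * M) + (2 * a * a) * ((n + 1) * (M * M)) + (2 * a) * (t * M)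
		 + (a * (length xs + 6)) * (1 * M)" by (simp add: algebra_simps)
	 also have "... <= 23 * U + (3 * a) * U + (2 * a * a) * U + (2 * a) * U + (a * (length xs + 6)) * U" using 1 by (intro add_mono mult_left_mono) auto
	 also have "... = (23 + 3 * a + 2 * a * a + 2 * a + a * (length xs + 6)) * U" by (simp add: algebra_simps)
	 also have "... <= A * U" unfolding A_def by (intro mult_right_mono) (auto simp: algebra_simps)
	 moreover have "(lg n + 1) ^ (2 * e + 1) = M * M * (lg n + 1)" by (simp only: M_def power_add mult_2 power_one_right)
	 ultimately show ?thesis unfolding t_def[symmetric] M_def[symmetric] U_def by (simp only: mult.assoc)
	qed
	finally have R: "?R <= A * (nat \<lfloor>T n\<rfloor> + n + 1) * (lg n + 1) ^ (2 * e + 1)" .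
	have "real (nat \<lfloor>T n\<rfloor>) <= max 0 (T n)" by linarith
	hence "real A * (real (nat \<lfloor>T n\<rfloor>) + real n + 1) * real (lg n + 1) ^ (2 * e + 1) <=
	 real A * (max 0 (T n) + real n + 1) * real (lg n + 1) ^ (2 * e + 1)" by (intro mult_mono) auto
	also have "... = reduction_time A (2 * e + 1) T n0 N" by (simp add: reduction_time_def n_def)
	finally have R2: "real (A * (nat \<lfloor>T n\<rfloor> + n + 1) * (lg n + 1) ^ (2 * e + 1)) <= reduction_time A (2 * e + 1) T n0 N" by (simp only: of_nat_mult of_nat_add of_nat_power of_nat_1)
	have "EX t s. exec w pr (initial_state inp) t s & outputs s out & t <= ?R" unfolding pr_def by (rule pieces_exec[OF wf V pre(1,3) small(5,6,3) s0_def _ _ _ solv xs]) (use m in auto)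
	with R R2 show "EX t s. exec w pr (initial_state inp) t s & outputs s out & real t <= reduction_time A (2 * e + 1) T n0 N" by (meson le_trans of_nat_le_iff order_trans)
 qed
 with reduction_time_soft_O[OF lower] show ?thesis by blast
qed

section \<open>Range queries and lower bounds\<close>

text \<open>A common form of the four query problems, with queries as lists of \<open>d\<close>
  words, so that reductions to and from them are set up only once.\<close>

definition gquery ::
	"nat => (nat => nat list => bool) => (int list => nat list => nat) => real => real => problem" where
 "gquery d valid F alp bet w n inp out \<longleftrightarrow>
	(EX A qs. length A = n & (\<forall>a \<in> set A. fits_word w a) &
		(\<forall>q \<in> set qs. length q = d & valid n q) &
		alp * real n <= real (length qs) & real (length qs) <= bet * real n &
		inp = [n, length qs] @ map (encode_int w) A @ concat qs &
		out = map (F A) qs)"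

definition valid1 :: "nat => nat list => bool" where
 "valid1 n q \<longleftrightarrow> 1 <= q ! 0 & q ! 0 <= q ! 1 & q ! 1 <= n"

definition valid2 :: "nat => nat list => bool" where
 "valid2 n q \<longleftrightarrow> 1 <= q ! 0 & q ! 0 <= q ! 1 & q ! 1 < q ! 2 & q ! 2 <= q ! 3 & q ! 3 <= n"

definition pairs1 :: "(int => int => bool) => int list => nat list => nat" where
 "pairs1 R A q = range_pairs R A (q ! 0, q ! 1)"

definition pairs2 :: "(int => int => bool) => int list => nat list => nat" where
 "pairs2 R A q = two_range_pairs R A ((q ! 0, q ! 1), (q ! 2, q ! 3))"

lemma length_2_conv: "length q = 2 \<longleftrightarrow> (EX a b. q = [a, b])"
 by (auto simp: numeral_2_eq_2 length_Suc_conv)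

lemma length_4_conv: "length q = 4 \<longleftrightarrow> (EX a b c d. q = [a, b, c, d])"
 by (auto simp: eval_nat_numeral length_Suc_conv)

lemma range_query_gquery: "range_query R = gquery 2 valid1 (pairs1 R)"
proof (intro ext iffI)
 fix alp bet w n inp out
 assume "range_query R alp bet w n inp out"
 then obtain A qs where "length A = n & (\<forall>a \<in> set A. fits_word w a) &
		(\<forall>(l, r) \<in> set qs. 1 <= l & l <= r & r <= n) &
		alp * real n <= real (length qs) & real (length qs) <= bet * real n &
		inp = [n, length qs] @ map (encode_int w) A @ concat (map (%(l, r). [l, r]) qs) &
		out = map (range_pairs R A) qs" unfolding range_query_def by blast
 thus "gquery 2 valid1 (pairs1 R) alp bet w n inp out" unfolding gquery_def by (intro exI[of _ A] exI[of _ "map (%(l, r). [l, r]) qs"])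
	 (auto simp: valid1_def pairs1_def split_beta)
next
 fix alp bet w n inp out
 assume "gquery 2 valid1 (pairs1 R) alp bet w n inp out"
 then obtain A qs where *: "length A = n & (\<forall>a \<in> set A. fits_word w a) &
		(\<forall>q \<in> set qs. length q = 2 & valid1 n q) &
		alp * real n <= real (length qs) & real (length qs) <= bet * real n &
		inp = [n, length qs] @ map (encode_int w) A @ concat qs &
		out = map (pairs1 R A) qs" unfolding gquery_def by blast
 hence "map ((%(l, r). [l, r]) \<circ> (%q. (q ! 0, q ! 1))) qs = map (%q. q) qs" by (intro map_cong) (auto simp: length_2_conv)
 with * show "range_query R alp bet w n inp out" unfolding range_query_def by (intro exI[of _ A] exI[of _ "map (%q. (q ! 0, q ! 1)) qs"])
	 (auto simp: valid1_def pairs1_def)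
qed

lemma two_range_query_gquery: "two_range_query R = gquery 4 valid2 (pairs2 R)"
proof (intro ext iffI)
 fix alp bet w n inp out
 assume "two_range_query R alp bet w n inp out"
 then obtain A qs where "length A = n & (\<forall>a \<in> set A. fits_word w a) &
		(\<forall>((l1, r1), (l2, r2)) \<in> set qs. 1 <= l1 & l1 <= r1 & r1 < l2 & l2 <= r2 & r2 <= n) &
		alp * real n <= real (length qs) & real (length qs) <= bet * real n &
		inp = [n, length qs] @ map (encode_int w) A @
			 concat (map (%((l1, r1), (l2, r2)). [l1, r1, l2, r2]) qs) &
		out = map (two_range_pairs R A) qs" unfolding two_range_query_def by blast
 thus "gquery 4 valid2 (pairs2 R) alp bet w n inp out" unfolding gquery_def by (intro exI[of _ A] exI[of _ "map (%((l1, r1), (l2, r2)). [l1, r1, l2, r2]) qs"])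
	 (fastforce simp: valid2_def pairs2_def split_beta)
next
 fix alp bet w n inp out
 assume "gquery 4 valid2 (pairs2 R) alp bet w n inp out"
 then obtain A qs where *: "length A = n & (\<forall>a \<in> set A. fits_word w a) &
		(\<forall>q \<in> set qs. length q = 4 & valid2 n q) &
		alp * real n <= real (length qs) & real (length qs) <= bet * real n &
		inp = [n, length qs] @ map (encode_int w) A @ concat qs &
		out = map (pairs2 R A) qs" unfolding gquery_def by blast
 let ?f = "%q. ((q ! 0, q ! 1), (q ! 2, q ! 3))"
 from * have "map ((%((l1, r1), (l2, r2)). [l1, r1, l2, r2]) \<circ> ?f) qs = map (%q. q) qs" by (intro map_cong) (auto simp: length_4_conv)
 with * show "two_range_query R alp bet w n inp out" unfolding two_range_query_def by (intro exI[of _ A] exI[of _ "map ?f qs"]) (auto simp: valid2_def pairs2_def)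
qed

lemma nth_concat_const:
 assumes "\<forall>x\<in>set xs. length x = d" "j < length xs" "k < d"
 shows "concat xs ! (d * j + k) = xs ! j ! k"
 using assms
proof (induction xs arbitrary: j)
 case (Cons x xs)
 thus ?case by (cases j) (auto simp: nth_append)
qed auto

lemma length_concat_const: "\<forall>x\<in>set xs. length x = d ==> length (concat xs) = d * length xs"
 by (induction xs) auto

lemma card_pairs_le:
 fixes S :: "(nat \<times> nat) set"
 assumes "S <= {1..n} \<times> {1..n}"
 shows "card S <= n * n"
 using card_mono[OF _ assms] by simp

lemma pairs1_le: "valid1 n q ==> pairs1 R A q <= n * n"
 unfolding pairs1_def range_pairs_def valid1_def by (simp, rule card_pairs_le) auto

lemma pairs2_le: "valid2 n q ==> pairs2 R A q <= n * n"
 unfolding pairs2_def two_range_pairs_def valid2_def by (simp, rule card_pairs_le) auto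

section \<open>Batches of queries of rational density\<close>

definition batch_size :: "nat => nat => nat => nat" where
 "batch_size a b n = a * n div b"

text \<open>A program cannot compute with the real densities, so a rational \<open>a / b\<close>
  between them is fixed. If they coincide, two consecutive sizes with instances show that the
  density is a natural number; otherwise a rational strictly between them leaves room for the
  rounding in \<open>div\<close>. The last property bounds the number of batches.\<close>

lemma linear_bounds_batch:
 assumes "linear_bounds alp bet"
 obtains a b n0 where "0 < b" "!!n. n0 <= n ==> alp * real n <= real (batch_size a b n)"
	"!!n. n0 <= n ==> real (batch_size a b n) <= bet * real n"
	"!!n. n0 <= n ==> 0 < batch_size a b n"
	"!!n. n0 <= n ==> n <= 2 * b * batch_size a b n"
proof -
 from assms have alp: "0 < alp" and "\<forall>\<^sub>F n in sequentially. \<exists>q::nat. alp * real n <= real q & real q <= bet * real n" by (auto simp: linear_bounds_def)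
 then obtain m where m: "!!n. m <= n ==> \<exists>q::nat. alp * real n <= real q & real q <= bet * real n" by (auto simp: eventually_at_top_linorder)
 have "alp * real (m + 1) <= bet * real (m + 1)" using m[OF le_add1] by (meson order_trans)
 hence le: "alp <= bet" by simp
 have "EX a b k. 0 < b & 0 < a & (\<forall>n\<ge>k. alp * real n <= real (batch_size a b n) & real (batch_size a b n) <= bet * real n)"
 proof (cases "alp = bet")
	case True
	obtain q1 q2 :: nat where "real q1 = alp * real m" "real q2 = alp * real (m + 1)" using m[of m] m[of "m + 1"] True by force
	hence 1: "alp = real q2 - real q1" by (simp add: algebra_simps)
	hence "alp = real (q2 - q1)" using alp by (simp add: of_nat_diff)
	thus ?thesis using True alp by (intro exI[of _ "q2 - q1"] exI[of _ 1] exI[of _ 0]) (auto simp: batch_size_def)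
 next
	case False
	with le obtain r where r: "r : \<rat>" "alp < r" "r < bet" using Rats_dense_in_real[of alp bet] by auto
	then obtain a b :: nat where ab: "b ~= 0" "\<bar>r\<bar> = real a / real b" using Rats_abs_nat_div_natE[OF r(1)] by metis
	hence rab: "r = real a / real b" using r alp by simp
	obtain k :: nat where k: "1 / (r - alp) <= real k" using real_arch_simple by blast
	have "alp * real n <= real (batch_size a b n) & real (batch_size a b n) <= bet * real n" if "k <= n" for n
	proof
	 have "real (a * n div b) >= real (a * n) / real b - 1"
	 proof -
		have "a * n < b * (a * n div b) + b" using ab by (metis add_strict_left_mono mod_less_divisor mult_div_mod_eq neq0_conv)
		hence "real (a * n) < real (b * (a * n div b) + b)" by linarith
		thus ?thesis using ab by (simp add: field_simps)
	 qed
	 hence "r * real n - 1 <= real (batch_size a b n)" by (simp add: batch_size_def rab)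
	 moreover have "1 <= (r - alp) * real k" using k r by (simp add: field_simps)
	 hence "1 <= (r - alp) * real n" using that r by (smt (verit) mult_left_mono of_nat_le_iff)
	 ultimately show "alp * real n <= real (batch_size a b n)" by (simp add: algebra_simps)
	 have "real (a * n div b) <= real (a * n) / real b"
	 proof -
		have "real (b * (a * n div b)) <= real (a * n)" by (subst of_nat_le_iff) simp
		thus ?thesis using ab by (simp add: field_simps)
	 qed
	 hence "real (batch_size a b n) <= r * real n" by (simp add: batch_size_def rab)
	 also have "... <= bet * real n" using r by (intro mult_right_mono) auto
	 finally show "real (batch_size a b n) <= bet * real n" .
	qed
	moreover have "0 < a" using r alp rab by (metis gr0I div_0 of_nat_0 less_trans less_irrefl)
	ultimately show ?thesis using ab by blast
 qed
 then obtain a b k where abk: "0 < b" "0 < a"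
	"!!n. k <= n ==> alp * real n <= real (batch_size a b n) & real (batch_size a b n) <= bet * real n" by blast
 \<comment> \<open>For \<open>n >= b\<close> the remainder is less than
   \<open>b <= b * (n div b)\<close>, hence the factor 2.\<close>
 have 2: "0 < batch_size a b n & n <= 2 * b * batch_size a b n" if "b <= n" for n
 proof -
	have "n <= a * n" using abk by simp
	hence "n div b <= batch_size a b n" unfolding batch_size_def by (rule div_le_mono)
	moreover have "1 <= n div b" using that abk by (simp add: Suc_leI div_greater_zero_iff)
	moreover have "n < b * (n div b) + b" using abk by (metis add_strict_left_mono mod_less_divisor mult_div_mod_eq)
	ultimately show ?thesis using abk by (smt (verit) One_nat_def add_mono_thms_linordered_semiring(1) le_trans less_imp_le_nat less_le_trans mult.assoc mult.right_neutral mult_2 mult_le_mono2 zero_less_one nat_mult_1)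
 qed
 show thesis by (rule that[of b "max k b" a]) (use abk 2 in auto)
qed

section \<open>Linear lower bounds on running times\<close>

lemma exec_mem_changes:
 assumes "exec w p s t s'"
 shows "finite {i. mem s' i ~= mem s i} & card {i. mem s' i ~= mem s i} <= t"
 using assms
proof induction
 case (Store y x s)
 have "{i. mem (s(|mem := (mem s)(regs s y := regs s x)|)) i ~= mem s i} <= {regs s y}" by auto
 from card_mono[OF _ this] finite_subset[OF this] show ?case by simp
next
 case (Seq p s t s' q u s'')
 have "{i. mem s'' i ~= mem s i} <= {i. mem s' i ~= mem s i} \<union> {i. mem s'' i ~= mem s' i}" by auto
 with Seq.IH card_mono[OF _ this] card_Un_le[of "{i. mem s' i ~= mem s i}" "{i. mem s'' i ~= mem s' i}"]
	finite_subset[OF this] show ?case by force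
next
 case (WhileTrue s x p t s' u s'')
 have "{i. mem s'' i ~= mem s i} <= {i. mem s' i ~= mem s i} \<union> {i. mem s'' i ~= mem s' i}" by auto
 with WhileTrue.IH card_mono[OF _ this] card_Un_le[of "{i. mem s' i ~= mem s i}" "{i. mem s'' i ~= mem s' i}"]
	finite_subset[OF this] show ?case by force
qed auto

text \<open>Every output word that differs from the initial memory contents costs at least one step.\<close>

lemma lower_bound:
 assumes "solvable_in_time P T"
	and inst: "!!c. \<forall>\<^sub>F N in sequentially. EX w inp out. P w N inp out & (N + 2) ^ c <= 2 ^ w &
	 epl * real N <= real (card {i. i < length out & (if i < length inp then inp ! i else 0) ~= out ! i})"
 shows "\<forall>\<^sub>F N in sequentially. epl * real N <= T N"
proof -
 obtain p c where pc: "!!w N inp out. P w N inp out ==> (N + 2) ^ c <= 2 ^ w ==>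
	 EX t s. exec w p (initial_state inp) t s & outputs s out & real t <= T N" using assms(1) unfolding solvable_in_time_def by metis
 show ?thesis using inst[of c]
 proof eventually_elim
	case (elim N)
	then obtain w inp out where 1: "P w N inp out" "(N + 2) ^ c <= 2 ^ w"
	 "epl * real N <= real (card {i. i < length out & (if i < length inp then inp ! i else 0) ~= out ! i})" by blast
	from pc[OF 1(1,2)] obtain t s where
	 2: "exec w p (initial_state inp) t s" "outputs s out" "real t <= T N" by blast
	have "{i. i < length out & (if i < length inp then inp ! i else 0) ~= out ! i} <=
		{i. mem s i ~= mem (initial_state inp) i}" using 2(2) by (auto simp: outputs_def initial_state_def)
	from card_mono[OF _ this] exec_mem_changes[OF 2(1)]
	have "card {i. i < length out & (if i < length inp then inp ! i else 0) ~= out ! i} <= t" by linarith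
	hence "real (card {i. i < length out & (if i < length inp then inp ! i else 0) ~= out ! i}) <= real t" by linarith
	with 1 2 show ?case by linarith
 qed
qed

text \<open>All queries are equal and have a nonzero answer, while the array is zero after its first
  entry. The array starts at address 2, so each answer that falls on an address from 3 to
  \<open>N + 1\<close> replaces a zero.\<close>

lemma gquery_lower_bound:
 assumes sol: "solvable_in_time (gquery d valid F alp bet) T" and lb: "linear_bounds alp bet"
	and q: "length q = d" "!!n. 2 <= n ==> valid n q" and x: "0 <= x" "x <= 1"
	and F: "!!n. 2 <= n ==> F (x # replicate (n - 1) 0) q ~= 0"
 shows "\<exists>epl>0. \<forall>\<^sub>F N in sequentially. epl * real N <= T N"
proof -
 obtain a b n0 where ab: "0 < b" "!!n. n0 <= n ==> alp * real n <= real (batch_size a b n)"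
	"!!n. n0 <= n ==> real (batch_size a b n) <= bet * real n"
	"!!n. n0 <= n ==> 0 < batch_size a b n"
	"!!n. n0 <= n ==> n <= 2 * b * batch_size a b n" using linear_bounds_batch[OF lb] by metis
 \<comment> \<open>At least \<open>N / (2 * b)\<close> answers exist; losing the first three
   addresses costs at most half of them as soon as \<open>12 * b <= N\<close>.\<close>
 let ?epl = "1 / (4 * real b)"
 have "\<forall>\<^sub>F N in sequentially. ?epl * real N <= T N"
 proof (rule lower_bound[OF sol])
	fix c
	show "\<forall>\<^sub>F N in sequentially. EX w inp out. gquery d valid F alp bet w N inp out & (N + 2) ^ c <= 2 ^ w &
	 ?epl * real N <= real (card {i. i < length out & (if i < length inp then inp ! i else 0) ~= out ! i})" using eventually_ge_at_top[of "max n0 (12 * b + 2)"]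
	proof eventually_elim
	 case (elim N)
	 hence N: "n0 <= N" "12 * b + 2 <= N" "2 <= N" by auto
	 define q0 where "q0 = batch_size a b N"
	 define w where "w = (N + 2) ^ c + 2"
	 define A where "A = x # replicate (N - 1) 0"
	 define inp where "inp = [N, q0] @ map (encode_int w) A @ concat (replicate q0 q)"
	 define out where "out = map (F A) (replicate q0 q)"
	 have "(N + 2) ^ c <= 2 ^ ((N + 2) ^ c)" by (intro less_imp_le less_exp)
	 also have "... <= 2 ^ w" unfolding w_def by (intro power_increasing) auto
	 finally have "(N + 2) ^ c <= 2 ^ w" .
	 moreover have "gquery d valid F alp bet w N inp out" unfolding gquery_def
	 proof (intro exI[of _ A] exI[of _ "replicate q0 q"] conjI)
		show "length A = N" using N by (simp add: A_def)
		have "(2::int) < 2 ^ w" using power_strict_increasing[of 1 w "2::int"] by (simp add: w_def)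
		thus "\<forall>a\<in>set A. fits_word w a" using x by (auto simp: A_def fits_word_def intro: order.trans[of _ 0])
	 qed (use q N ab in \<open>auto simp: inp_def out_def q0_def\<close>)
	 moreover have "?epl * real N <= real (card {i. i < length out & (if i < length inp then inp ! i else 0) ~= out ! i})"
	 proof -
		have "{3..<min q0 (N + 2)} <= {i. i < length out & (if i < length inp then inp ! i else 0) ~= out ! i}"
		proof
		 fix i assume i: "i : {3..<min q0 (N + 2)}"
		 then obtain k where k: "i = Suc (Suc k)" "0 < k" "k < N" by (cases i; cases "i - 1") auto
		 have "length A = N" using N by (simp add: A_def)
		 with k have "inp ! i = encode_int w (A ! (i - 2))" "i < length inp" by (simp_all add: inp_def nth_append)
		 moreover have "A ! (i - 2) = 0" using k by (simp add: A_def nth_Cons')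
		 moreover have "out ! i = F A q" using i by (simp add: out_def)
		 ultimately show "i : {i. i < length out & (if i < length inp then inp ! i else 0) ~= out ! i}" using i F[OF N(3)] by (simp add: out_def A_def encode_int_def)
		qed
		hence "card {3..<min q0 (N + 2)} <= card {i. i < length out & (if i < length inp then inp ! i else 0) ~= out ! i}" by (intro card_mono) auto
		moreover have "N <= 4 * b * card {3..<min q0 (N + 2)}"
		proof (cases "q0 <= N + 2")
		 case True
		 have "N <= 2 * b * q0" using ab(5)[OF N(1)] by (simp add: q0_def)
		 moreover have "4 * b * (q0 - 3) = 4 * b * q0 - 12 * b" by (simp add: right_diff_distrib')
		 ultimately show ?thesis using True N by simp
		next
		 case False
		 have "1 * (N - 1) <= b * (N - 1)" using ab(1) by (intro mult_right_mono) auto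
		 hence "4 * (N - 1) <= 4 * b * (N - 1)" by simp
		 moreover have "N <= 4 * (N - 1)" using N by linarith
		 moreover have "card {3..<min q0 (N + 2)} = N - 1" using False by simp
		 ultimately show ?thesis by (metis le_trans)
		qed
		ultimately have "N <= 4 * b * card {i. i < length out & (if i < length inp then inp ! i else 0) ~= out ! i}" by (meson le_trans mult_le_mono2)
		hence "real N <= real (4 * b * card {i. i < length out & (if i < length inp then inp ! i else 0) ~= out ! i})" by linarith
		thus ?thesis using ab(1) by (simp add: field_simps)
	 qed
	 ultimately show ?case by blast
	qed
 qed
 moreover have "0 < ?epl" using ab by simp
 ultimately show ?thesis by blast
qed

lemma lower_bound1:
 assumes "solvable_in_time (range_query R alp bet) T" "linear_bounds alp bet" "R = (=) | R = (>)"
 shows "\<exists>epl>0. \<forall>\<^sub>F N in sequentially. epl * real N <= T N"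
proof (rule gquery_lower_bound[OF assms(1)[unfolded range_query_gquery] assms(2), of "[1, 2]" "if R = (=) then 0 else 1"])
 fix n :: nat assume n: "2 <= n"
 \<comment> \<open>With a leading 0 the first two entries are equal, with a leading 1 they form an
   inversion.\<close>
 let ?A = "(if R = (=) then 0 else 1) # replicate (n - 1) (0::int)"
 have "{(i, j). 1 <= i & i < j & j <= 2 & R (?A ! (i - 1)) (?A ! (j - 1))} = {(1, 2::nat)}"
 proof -
	have "1 <= i & i < j & j <= 2 \<longleftrightarrow> i = 1 & j = 2" for i j :: nat by auto
	moreover have "R (?A ! 0) (?A ! 1)"
	proof -
	 have "R (if R = (=) then 0 else 1) (0::int)" using assms(3) by auto
	 thus ?thesis using n by simp
	qed
	ultimately show ?thesis by force
 qed
 thus "pairs1 R ?A [1, 2] ~= 0" by (simp add: pairs1_def range_pairs_def)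
qed (auto simp: valid1_def)

lemma lower_bound2:
 assumes "solvable_in_time (two_range_query R alp bet) T" "linear_bounds alp bet" "R = (=) | R = (>)"
 shows "\<exists>epl>0. \<forall>\<^sub>F N in sequentially. epl * real N <= T N"
proof (rule gquery_lower_bound[OF assms(1)[unfolded two_range_query_gquery] assms(2), of "[1, 1, 2, 2]" "if R = (=) then 0 else 1"])
 fix n :: nat assume n: "2 <= n"
 let ?A = "(if R = (=) then 0 else 1) # replicate (n - 1) (0::int)"
 have "{(i, j). 1 <= i & i <= 1 & 2 <= j & j <= 2 & R (?A ! (i - 1)) (?A ! (j - 1))} = {(1, 2::nat)}"
 proof -
	have "1 <= i & i <= 1 & 2 <= j & j <= 2 \<longleftrightarrow> i = 1 & j = 2" for i j :: nat by auto
	moreover have "R (?A ! 0) (?A ! 1)"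
	proof -
	 have "R (if R = (=) then 0 else 1) (0::int)" using assms(3) by auto
	 thus ?thesis using n by simp
	qed
	ultimately show ?thesis by force
 qed
 thus "pairs2 R ?A [1, 1, 2, 2] ~= 0" by (simp add: pairs2_def two_range_pairs_def)
qed (auto simp: valid2_def)

text \<open>A perfect matching has only zeros as answers, while all words of the input are positive,
  so each of the \<open>m\<close> answers changes a cell.\<close>

lemma triangle_lower_bound:
 assumes "solvable_in_time edge_triangle_counting T"
 shows "\<exists>epl>0. \<forall>\<^sub>F N in sequentially. epl * real N <= T N"
proof -
 have "\<forall>\<^sub>F N in sequentially. 1 * real N <= T N"
 proof (rule lower_bound[OF assms], rule eventuallyI)
	fix c m :: nat
	define es where "es = map (%i. (2 * i + 1, 2 * i + 2)) [0..<m]"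
	define edges where "edges = map (%(u, v). {u, v}) es"
	define inp where "inp = [2 * m, m] @ concat (map (%(u, v). [u, v]) es)"
	define out where "out = map (triangles_at (set edges)) edges"
	have edges: "edges = map (%i. {2 * i + 1, 2 * i + 2}) [0..<m]" by (simp add: edges_def es_def)
	have set_edges: "set edges = (%i. {2 * i + 1, 2 * i + 2}) ` {..<m}" unfolding edges by (auto simp: atLeast0LessThan)
	have "edge_triangle_counting 0 m inp out" unfolding edge_triangle_counting_def Let_def edges_def[symmetric]
	proof (intro exI[of _ "2 * m"] exI[of _ es], unfold edges_def[symmetric], intro conjI)
	 show "simple_graph {1..2 * m} (set edges)" by (auto simp: simple_graph_def set_edges)
	 have "EX i<m. v = 2 * i + 1 | v = 2 * i + 2" if "1 <= v" "v <= 2 * m" for v using that by (intro exI[of _ "(v - 1) div 2"]) auto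
	 thus "no_isolated_vertices {1..2 * m} (set edges)" unfolding no_isolated_vertices_def set_edges by fastforce
	 show "distinct edges" unfolding edges distinct_map
	 proof (intro conjI inj_onI)
		fix i j :: nat assume eq: "{2 * i + 1, 2 * i + 2} = {2 * j + 1, 2 * j + 2}"
		have "2 * i + 1 : {2 * j + 1, 2 * j + 2}" unfolding eq[symmetric] by blast
		thus "i = j" by auto
	 qed auto
	qed (simp_all add: edges inp_def out_def)
	hence P: "edge_triangle_counting ((m + 2) ^ c) m inp out" by (simp add: edge_triangle_counting_def)
	have "\<not> is_triangle (set edges) t" for t
	proof
	 assume t: "is_triangle (set edges) t"
	 then obtain x y z where xyz: "t = {x, y, z}" "x ~= y" "x ~= z" "y ~= z" by (auto simp: is_triangle_def card_3_iff)
	 hence "{x, y} : set edges" "{x, z} : set edges" using t by (auto simp: is_triangle_def)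
	 then obtain i j where ij: "{x, y} = {2 * i + 1, 2 * i + 2}" "{x, z} = {2 * j + 1, 2 * j + 2}" unfolding set_edges by blast
	 hence "x : {2 * i + 1, 2 * i + 2}" "x : {2 * j + 1, 2 * j + 2}" by blast+
	 hence "i = j" by auto
	 with ij have "{x, y} = {x, z}" by simp
	 with xyz show False by (metis doubleton_eq_iff)
	qed
	hence "triangles_at (set edges) e = 0" for e by (simp add: triangles_at_def)
	moreover have "length edges = m" by (simp add: edges)
	ultimately have out: "out = replicate m 0" by (auto simp: out_def intro!: nth_equalityI)
	have pos: "0 < inp ! i" if "i < m" for i
	proof -
	 have "0 ~: set inp" using that by (auto simp: inp_def es_def)
	 moreover have "length inp = 2 + 2 * m" by (simp add: inp_def es_def length_concat o_def split_beta sum_list_triv)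
	 ultimately show ?thesis using that nth_mem[of i inp] by (metis gr0I trans_less_add2 mult_2)
	qed
	have "length inp = 2 + 2 * m" by (simp add: inp_def es_def length_concat o_def split_beta sum_list_triv)
	hence "{i. i < length out & (if i < length inp then inp ! i else 0) ~= out ! i} = {..<m}" using pos less_irrefl unfolding out by fastforce
	hence "1 * real m <= real (card {i. i < length out & (if i < length inp then inp ! i else 0) ~= out ! i})" by simp
	moreover have "(m + 2) ^ c <= 2 ^ ((m + 2) ^ c)" using less_exp less_imp_le by blast
	ultimately show "EX w inp out. edge_triangle_counting w m inp out & (m + 2) ^ c <= 2 ^ w &
		1 * real m <= real (card {i. i < length out & (if i < length inp then inp ! i else 0) ~= out ! i})" using P by blast
 qed
 thus ?thesis using zero_less_one by blast
qed

lemma soft_O_trans: "T' : soft_O T ==> T'' : soft_O T' ==> T'' : soft_O T"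
proof -
 assume "T' : soft_O T" "T'' : soft_O T'"
 then obtain k j where 1: "T' : O(%N. T N * ln (real N) ^ k)" and 2: "T'' : O(%N. T' N * ln (real N) ^ j)" by (auto simp: soft_O_def)
 have "(%N. T' N * ln (real N) ^ j) : O(%N. T N * ln (real N) ^ k * ln (real N) ^ j)" by (rule landau_o.big.mult_right[OF 1])
 from landau_o.big_trans[OF 2 this] show "T'' : soft_O T" unfolding soft_O_def by (auto simp: mult.assoc simp flip: power_add)
qed

section \<open>Reductions to range queries\<close>

text \<open>Powers of two are kept opaque so that bounds stay linear.\<close>

definition pow2 :: "nat => nat" where
 "pow2 k = 2 ^ k"

abbreviation Plus (infixl "[+]" 65) where "a [+] b \<equiv> Bop Add a b"
abbreviation Minus (infixl "[-]" 65) where "a [-] b \<equiv> Bop Sub a b"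
abbreviation Times (infixl "[*]" 70) where "a [*] b \<equiv> Bop Mul a b"
abbreviation Quot (infixl "[div]" 70) where "a [div] b \<equiv> Bop Div a b"
abbreviation Rem (infixl "[mod]" 70) where "a [mod] b \<equiv> Bop Mod a b"
abbreviation Lt (infix "[<]" 50) where "a [<] b \<equiv> Bop Less a b"
abbreviation Eq (infix "[=]" 50) where "a [=] b \<equiv> Bop Equal a b"
abbreviation ShiftR (infixl "[>>]" 75) where "a [>>] b \<equiv> Bop Shr a b"
abbreviation ShiftL (infixl "[<<]" 75) where "a [<<] b \<equiv> Bop Shl a b"

lemma eval_lt_pow2: "eval w z s e < pow2 w"
 using eval_lt by (simp add: pow2_def)

lemma take_bit_pow2: "x < pow2 w ==> take_bit w x = x"
 by (simp add: pow2_def take_bit_nat_eq_self)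

lemma ev_Num: "k < pow2 w ==> eval w z s (Num k) = k"
 by (simp add: take_bit_pow2)

lemma ev_Var: "va s x < pow2 w ==> eval w z s (Var x) = va s x"
 by (simp add: take_bit_pow2)

lemma ev_Add: "eval w z s a + eval w z s b < pow2 w ==> eval w z s (a [+] b) = eval w z s a + eval w z s b"
 by (simp add: take_bit_pow2)

lemma ev_Mul: "eval w z s a * eval w z s b < pow2 w ==> eval w z s (a [*] b) = eval w z s a * eval w z s b"
 by (simp add: take_bit_pow2)

lemma apply_op_Sub: "y <= x ==> x < pow2 w ==> apply_op w Sub x y = x - y"
proof -
 assume "y <= x" "x < pow2 w"
 hence "int x - int y = int (x - y)" "take_bit w (x - y) = x - y" by (simp_all add: take_bit_pow2)
 thus ?thesis by (metis apply_op.simps(2) nat_int take_bit_of_nat)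
qed

lemma ev_Sub: "eval w z s b <= eval w z s a ==> eval w z s (a [-] b) = eval w z s a - eval w z s b"
 using apply_op_Sub eval_lt_pow2 by simp

lemma ev_Div: "eval w z s (a [div] b) = eval w z s a div eval w z s b"
 using le_less_trans[OF div_le_dividend eval_lt_pow2] by (simp add: take_bit_pow2)

lemma ev_Mod: "eval w z s (a [mod] b) = eval w z s a mod eval w z s b"
 using le_less_trans[OF mod_less_eq_dividend eval_lt_pow2] by (simp add: take_bit_pow2)

lemma ev_Shr: "eval w z s (a [>>] b) = eval w z s a div pow2 (eval w z s b)"
 using le_less_trans[OF div_le_dividend eval_lt_pow2] by (simp add: take_bit_pow2 drop_bit_eq_div pow2_def)

lemma ev_Shl: "eval w z s a * pow2 (eval w z s b) < pow2 w ==>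
	eval w z s (a [<<] b) = eval w z s a * pow2 (eval w z s b)" by (simp add: take_bit_pow2 push_bit_eq_mult pow2_def[symmetric])

lemma ev_Less: "eval w z s (a [<] b) = of_bool (eval w z s a < eval w z s b)"
 using eval_lt[of w z s a] eval_lt[of w z s b] by (cases w) auto

lemma ev_Equal: "1 < pow2 w ==> eval w z s (a [=] b) = of_bool (eval w z s a = eval w z s b)"
 by (simp add: take_bit_pow2 pow2_def)

lemma ev_Get:
 "eval w z s a < pow2 z ==> eval w z s b < pow2 z ==> ar s (eval w z s a) (eval w z s b) < pow2 w ==>
	eval w z s (Get a b) = ar s (eval w z s a) (eval w z s b)" by (simp add: take_bit_pow2)

lemmas ev = ev_Num ev_Var ev_Add ev_Mul ev_Sub ev_Div ev_Mod ev_Shr ev_Shl ev_Less ev_Equal ev_Get eval.simps(5)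

declare eval.simps [simp del]

lemma run_Put:
 "eval w z s a < pow2 z ==> eval w z s b < pow2 z ==>
	run w z (Put a b e) s = set_ar (eval w z s a) (eval w z s b) (eval w z s e) s" by (simp add: take_bit_pow2)

declare run.simps(3) [simp del]

lemma run_For_inv:
 assumes "I 0 s" and "!!i s'. i < va s p ==> I i s' ==> I (Suc i) (run w z c (set_va x i s'))"
 shows "EX s'. I (va s p) s' & run w z (For x p c) s = set_va x (va s p) s'"
proof -
 have "I k (fold (%i s. run w z c (set_va x i s)) [0..<k] s)" if "k <= va s p" for k using that by (induction k) (auto intro: assms)
 thus ?thesis by auto
qed

declare run.simps(6) [simp del]

definition fill :: "nat => nat => nat => (nat => nat) => ast => ast" where
 "fill r off n f s = s(|ar := (ar s)(r := (%i. if off <= i & i < off + n then f (i - off) else ar s r i))|)"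

lemma fill_simps [simp]:
 "va (fill r off n f s) = va s"
 "ar (fill r off n f s) = (ar s)(r := (%i. if off <= i & i < off + n then f (i - off) else ar s r i))" by (simp_all add: fill_def)

lemma fill_0 [simp]: "fill r off 0 f s = s"
proof -
 have "(%i. if off <= i & i < off + 0 then f (i - off) else ar s r i) = ar s r" by auto
 thus ?thesis by (simp add: fill_def)
qed

lemma run_fill:
 assumes p: "va s p = n" and r: "r < pow2 z" "off + n <= pow2 z"
	and step: "!!i s'. i < n ==> (ALL y. y ~= x --> va s' y = va s y) ==> va s' x = i ==>
	 (ALL q. q ~= r --> ar s' q = ar s q) ==> (ALL k. k < off --> ar s' r k = ar s r k) ==>
	 eval w z s' re = r & eval w z s' oe = off + i & eval w z s' e = f i"
 shows "run w z (For x p (Put re oe e)) s = set_va x n (fill r off n f s)"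
proof -
 \<comment> \<open>The value of the loop variable is left open, because the loop overwrites it
   before every use.\<close>
 let ?I = "%i s'. EX k. s' = set_va x k (fill r off i f s) | s' = fill r off i f s"
 have "EX s'. ?I (va s p) s' & run w z (For x p (Put re oe e)) s = set_va x (va s p) s'"
 proof (rule run_For_inv)
	show "?I 0 s" by simp
 next
	fix i s' assume i: "i < va s p" and "?I i s'"
	hence eq: "set_va x i s' = set_va x i (fill r off i f s)" by (auto simp: set_va_def)
	have "eval w z (set_va x i s') re = r & eval w z (set_va x i s') oe = off + i & eval w z (set_va x i s') e = f i" unfolding eq by (rule step) (use i p in auto)
	hence "run w z (Put re oe e) (set_va x i s') = set_ar r (off + i) (f i) (set_va x i s')" using i p r by (subst run_Put) auto
	also have "... = set_va x i (fill r off (Suc i) f s)" unfolding eq by (auto simp: set_va_def set_ar_def fill_def fun_eq_iff)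
	finally show "?I (Suc i) (run w z (Put re oe e) (set_va x i s'))" by blast
 qed
 with p show ?thesis by (auto simp: set_va_def)
qed

lemma pow2_mono: "i <= j ==> pow2 i <= pow2 j"
 by (simp add: pow2_def)

lemma pow2_add: "pow2 (i + j) = pow2 i * pow2 j"
 by (simp add: pow2_def power_add)

text \<open>\<open>2 ^ z\<close> is at least \<open>(n + 2) ^ d\<close>, and the coefficient is paid
  by further powers since \<open>c <= 2 ^ c <= (n + 2) ^ c\<close>. This is how polynomial sizes are
  made to fit into words by enlarging the multiplier of \<open>lg n\<close>.\<close>

lemma poly_le_pow2:
 assumes "k + c <= d" and "z = d * lg n"
 shows "c * (n + 2) ^ k <= pow2 z"
proof -
 have "c <= 2 ^ c" by (intro less_imp_le less_exp)
 also have "... <= (n + 2) ^ c" by (intro power_mono) auto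
 finally have "c * (n + 2) ^ k <= (n + 2) ^ (k + c)" by (simp add: power_add mult.commute)
 also have "... <= (n + 2) ^ d" using assms by (intro power_increasing) auto
 also have "... <= (2 ^ lg n) ^ d" using lg_ge[of n] by (intro power_mono) auto
 also have "... = pow2 z" using assms by (simp add: pow2_def mult.commute flip: power_mult)
 finally show ?thesis .
qed

text \<open>Unrolled over the components of one query. Variable 12 is the number of the query among
  all queries of the input, whose count is in variable 7; positions beyond the last query are padded
  with the constants \<open>ms\<close>.\<close>

fun put_query :: "nat => nat => aexp list => nat list => cmd" where
 "put_query d k (e # es) (m # ms) =
	(Put (Var 2) (Num (2 + k) [+] Var 3 [+] Num d [*] Var 11) (Cnd (Var 12 [<] Var 7) e (Num m)) ;;
	 put_query d (Suc k) es ms)"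
| "put_query d k _ _ = Nop"

lemma put_query_static:
 "assigned (put_query d k es ms) = {}" "wf_cmd P (put_query d k es ms)"
 "cost v (put_query d k es ms) = cost (%_. 0) (put_query d k es ms)" by (induction d k es ms rule: put_query.induct) auto

lemma run_put_query:
 assumes "!!s'. va s' = va s ==> ALL q. q ~= va s 2 --> ar s' q = ar s q ==>
	 map (%e. eval w z s' (Cnd (Var 12 [<] Var 7) (fst e) (Num (snd e)))) (zip es ms) = qs"
	and "length es = length ms" and "va s 2 < pow2 z" and "2 + k + va s 3 + d * va s 11 + length es <= pow2 z" and "pow2 z <= pow2 w"
 shows "run w z (put_query d k es ms) s = fill (va s 2) (2 + k + va s 3 + d * va s 11) (length es) (%i. qs ! i) s"
 using assms
proof (induction d k es ms arbitrary: s qs rule: put_query.induct)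
 case (1 d k e es m ms)
 let ?off = "2 + k + va s 3 + d * va s 11"
 let ?c = "%e m. Cnd (Var 12 [<] Var 7) e (Num m)"
 have b: "?off < pow2 z" "va s 2 < pow2 w" "d * va s 11 < pow2 w" "?off < pow2 w" "k + 2 < pow2 w"
	"d = 0 | va s 11 <= d * va s 11" using "1.prems" by (auto simp: trans_le_add2)
 obtain q qs' where qs: "qs = q # qs'" "eval w z s (?c e m) = q" using "1.prems"(1)[of s] by auto
 have off: "eval w z s (Num (2 + k) [+] Var 3 [+] Num d [*] Var 11) = ?off"
 proof (cases "d = 0")
	case True
	hence "eval w z s (Num d [*] Var 11) = 0" using b by (simp add: eval.simps)
	thus ?thesis using b True by (simp add: ev add_ac)
 next
	case False
	hence le: "va s 11 <= d * va s 11" by simp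
	have lt: "va s 11 < pow2 w" by (rule le_less_trans[OF le b(3)])
	have "d <= d * va s 11 | va s 11 = 0" by auto
	hence "eval w z s (Num d [*] Var 11) = d * va s 11"
	proof (elim disjE)
	 assume "va s 11 = 0"
	 thus ?thesis using b by (simp add: eval.simps)
	next
	 assume "d <= d * va s 11"
	 hence "d < pow2 w" using b(3) by (rule le_less_trans)
	 thus ?thesis using b(3) lt by (simp add: ev)
	qed
	thus ?thesis using b by (simp add: ev add_ac)
 qed
 let ?s = "set_ar (va s 2) ?off q s"
 have "run w z (put_query d k (e # es) (m # ms)) s = run w z (put_query d (Suc k) es ms) ?s" using b off qs "1.prems"(3) by (simp add: run_Put ev_Var)
 also have "... = fill (va ?s 2) (2 + Suc k + va ?s 3 + d * va ?s 11) (length es) (%i. qs' ! i) ?s"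
 proof (rule "1.IH")
	fix s' :: ast assume "va s' = va ?s" "ALL q. q ~= va ?s 2 --> ar s' q = ar ?s q"
	thus "map (%e. eval w z s' (?c (fst e) (snd e))) (zip es ms) = qs'" using "1.prems"(1)[of s'] qs by simp
 qed (use "1.prems" in auto)
 also have "... = fill (va s 2) ?off (length (e # es)) (%i. qs ! i) s" by (auto simp: fill_def set_ar_def fun_eq_iff qs nth_Cons')
 finally show ?case .
next
 case ("2_1" d k ms)
 thus ?case by simp
next
 case ("2_2" d k es)
 thus ?case by simp
qed

text \<open>Variables 7 and 8 take the two header words of the input, 9 the batch size, 10 the
  number of batches, 6 the number of calls, and 17 the power of two to which arrays are padded for
  sorting.\<close>

definition q_params :: "nat => nat => nat => cmd" where
 "q_params a b K =
	Asg 7 (Get (Num 0) (Num 1)) ;; Asg 8 (Get (Num 0) (Num 0)) ;;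
	Asg 9 (Num a [*] Var 3 [div] Num b) ;; Asg 10 (Var 7 [div] Var 9 [+] Num 1) ;;
	Asg 6 (Num K [*] Var 10) ;; Asg 17 (Num 1 [<<] Var 4)"

text \<open>Call \<open>r\<close> serves kind \<open>r mod K\<close> of batch
  \<open>r div K\<close>. Its row \<open>r + 16\<close> is still untouched; rows below 16 are shared
  by all calls.\<close>

definition q_build :: "nat => aexp => aexp list => nat list => nat => cmd" where
 "q_build d ea es ms K =
	Asg 2 (Var 5 [+] Num 16) ;; Asg 13 (Var 5 [mod] Num K) ;; Asg 14 (Var 5 [div] Num K) ;;
	Put (Var 2) (Num 0) (Var 3) ;; Put (Var 2) (Num 1) (Var 9) ;;
	For 11 3 (Put (Var 2) (Num 2 [+] Var 11) ea) ;;
	For 11 9 (Asg 12 (Var 14 [*] Var 9 [+] Var 11) ;; put_query d 0 es ms)"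

text \<open>Row 7 has one accumulator per query. Variable 15 receives the new answer and 16 the old
  accumulator, from which \<open>e\<close> forms the next one.\<close>

definition q_collect :: "aexp => cmd" where
 "q_collect e =
	For 11 9 (Asg 12 (Var 14 [*] Var 9 [+] Var 11) ;;
	 Ite (Var 12 [<] Var 7)
		(Asg 15 (Get (Var 2) (Var 11)) ;; Asg 16 (Get (Num 7) (Var 12)) ;; Put (Num 7) (Var 12) e) Nop)"

definition q_final :: cmd where
 "q_final = For 11 7 (Put (Num 0) (Var 11) (Get (Num 7) (Var 11)))"

definition q_vars :: "nat set" where
 "q_vars = {0, 1, 3, 4, 6, 7, 8, 9, 10, 17}"

text \<open>The row must equal the encoding of an instance including the zeros behind it, which is
  why its earlier freshness is assumed.\<close>

lemma run_q_build:
 fixes s :: ast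
 assumes v: "va s 5 = r" "va s 3 = n" "va s 9 = q0" "va s 7 = nq" "0 < K"
	and bounds: "r + 16 < pow2 z" "pow2 z <= pow2 w" "2 + n + d * q0 <= pow2 z" "r div K * q0 + q0 < pow2 z" "K < pow2 w"
	and fresh: "ar s (r + 16) = (%_. 0)" and len: "length es = d" "length ms = d" "0 < d"
	and ea: "!!i s'. i < n ==> (ALL y. y ~: {2, 11, 13, 14} --> va s' y = va s y) ==> va s' 13 = r mod K ==>
	 va s' 11 = i ==> (ALL q. q ~= r + 16 --> ar s' q = ar s q) ==> eval w z s' ea = fa i"
	and es: "!!i s'. i < q0 ==> (ALL y. y ~: {2, 11, 12, 13, 14} --> va s' y = va s y) ==> va s' 13 = r mod K ==>
	 va s' 12 = r div K * q0 + i ==> (ALL q. q ~= r + 16 --> ar s' q = ar s q) ==>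
	 map (%e. eval w z s' (Cnd (Var 12 [<] Var 7) (fst e) (Num (snd e)))) (zip es ms) = qs i"
	and s': "s' = run w z (q_build d ea es ms K) s"
 shows "(ALL y. y ~: {2, 11, 12, 13, 14} --> va s' y = va s y) & va s' 2 = r + 16 & va s' 13 = r mod K & va s' 14 = r div K &
	(ALL q. q ~= r + 16 --> ar s' q = ar s q) &
	ar s' (r + 16) = (%i. if i < 2 + n + d * q0 then ([n, q0] @ map fa [0..<n] @ concat (map qs [0..<q0])) ! i else 0)"
proof -
 let ?ro = "r + 16" and ?b = "r div K"
 have b: "r < pow2 w" "16 < pow2 w" "r + 16 < pow2 w" "n < pow2 z" "q0 < pow2 z" "n < pow2 w" "q0 < pow2 w"
	"?b < pow2 w" "?b * q0 < pow2 w" "2 < pow2 w" "1 < pow2 z" "1 < pow2 w" "0 < pow2 z" "n + 2 <= pow2 z"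
 proof -
	have "q0 <= d * q0" using len by simp
	thus "n < pow2 z" "q0 < pow2 z" "n < pow2 w" "q0 < pow2 w" "n + 2 <= pow2 z" using bounds by linarith+
	have "?b <= r" by simp
	thus "?b < pow2 w" using bounds by linarith
 qed (use bounds in linarith)+
 define s1 where "s1 = set_ar ?ro 1 q0 (set_ar ?ro 0 n (set_va 14 ?b (set_va 13 (r mod K) (set_va 2 ?ro s))))"
 have s1: "run w z (Asg 2 (Var 5 [+] Num 16) ;; Asg 13 (Var 5 [mod] Num K) ;; Asg 14 (Var 5 [div] Num K) ;;
	Put (Var 2) (Num 0) (Var 3) ;; Put (Var 2) (Num 1) (Var 9)) s = s1" using b v bounds by (simp add: ev run_Put s1_def)
 have vs1: "va s1 2 = ?ro" "va s1 3 = n" "va s1 9 = q0" "va s1 13 = r mod K" "va s1 14 = ?b" "va s1 7 = nq" using v by (simp_all add: s1_def)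
 have fs1: "ALL y. y ~: {2, 13, 14} --> va s1 y = va s y" "ALL q. q ~= ?ro --> ar s1 q = ar s q" by (simp_all add: s1_def)
 define s2 where "s2 = set_va 11 n (fill ?ro 2 n fa s1)"
 have s2: "run w z (For 11 3 (Put (Var 2) (Num 2 [+] Var 11) ea)) s1 = s2" unfolding s2_def
 proof (rule run_fill)
	fix i and s' :: ast assume i: "i < n" "ALL y. y ~= 11 --> va s' y = va s1 y" "va s' 11 = i"
	 "ALL q. q ~= ?ro --> ar s' q = ar s1 q"
	have "eval w z s' ea = fa i" by (rule ea) (use i fs1 vs1 in auto)
	thus "eval w z s' (Var 2) = ?ro & eval w z s' (Num 2 [+] Var 11) = 2 + i & eval w z s' ea = fa i" using i vs1 b bounds by (simp add: ev)
 qed (use vs1 bounds b in auto)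
 have vs2: "va s2 2 = ?ro" "va s2 3 = n" "va s2 9 = q0" "va s2 13 = r mod K" "va s2 14 = ?b" "va s2 7 = nq" using vs1 by (simp_all add: s2_def)
 have fs2: "ALL y. y ~: {2, 11, 13, 14} --> va s2 y = va s y" "ALL q. q ~= ?ro --> ar s2 q = ar s q" using fs1 by (simp_all add: s2_def)
 let ?body = "Asg 12 (Var 14 [*] Var 9 [+] Var 11) ;; put_query d 0 es ms"
 let ?I = "%i s'. (ALL y. y ~: {11, 12} --> va s' y = va s2 y) & (ALL q. q ~= ?ro --> ar s' q = ar s q) &
	(ALL k. ar s' ?ro k = (if 2 + n <= k & k < 2 + n + d * i then qs ((k - 2 - n) div d) ! ((k - 2 - n) mod d) else ar s2 ?ro k))"
 have "EX s'. ?I (va s2 9) s' & run w z (For 11 9 ?body) s2 = set_va 11 (va s2 9) s'"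
 proof (rule run_For_inv)
	show "?I 0 s2" using fs2 by simp
 next
	fix i and t :: ast assume i: "i < va s2 9" and I: "?I i t"
	define t1 where "t1 = set_va 12 (?b * q0 + i) (set_va 11 i t)"
	have iq: "i < q0" using i vs2 by simp
	have "d * (i + 1) <= d * q0" using iq by (intro mult_left_mono) auto
	hence di: "d * i + d <= d * q0" by simp
	have "run w z (Asg 12 (Var 14 [*] Var 9 [+] Var 11)) (set_va 11 i t) = t1" using I vs2 b bounds iq by (simp add: ev t1_def)
	hence "run w z ?body (set_va 11 i t) = run w z (put_query d 0 es ms) t1" by simp
	also have "... = fill (va t1 2) (2 + 0 + va t1 3 + d * va t1 11) (length es) (%k. qs i ! k) t1"
	proof (rule run_put_query)
	 fix s' :: ast assume s': "va s' = va t1" "ALL q. q ~= va t1 2 --> ar s' q = ar t1 q"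
	 show "map (%e. eval w z s' (Cnd (Var 12 [<] Var 7) (fst e) (Num (snd e)))) (zip es ms) = qs i" by (rule es[OF iq]) (use s' I vs2 fs2 in \<open>auto simp: t1_def\<close>)
	qed (use len I vs2 bounds di in \<open>auto simp: t1_def\<close>)
	finally have r: "run w z ?body (set_va 11 i t) = fill ?ro (2 + n + d * i) d (%k. qs i ! k) t1" using I vs2 len by (simp add: t1_def)
	show "?I (Suc i) (run w z ?body (set_va 11 i t))" unfolding r
	proof (intro conjI allI impI)
	 fix k
	 show "ar (fill ?ro (2 + n + d * i) d (%k. qs i ! k) t1) ?ro k =
		(if 2 + n <= k & k < 2 + n + d * Suc i then qs ((k - 2 - n) div d) ! ((k - 2 - n) mod d) else ar s2 ?ro k)"
	 proof (cases "2 + n + d * i <= k & k < 2 + n + d * i + d")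
		case True
		then obtain l where l: "k = 2 + n + d * i + l" "l < d" by (metis le_Suc_ex add_less_cancel_left)
		hence "(k - 2 - n) div d = i" "(k - 2 - n) mod d = l" using len by (simp_all add: add.assoc)
		thus ?thesis using l by simp
	 next
		case False
		hence "(2 + n <= k & k < 2 + n + d * Suc i) = (2 + n <= k & k < 2 + n + d * i)" by auto
		moreover have "ar (fill ?ro (2 + n + d * i) d (%k. qs i ! k) t1) ?ro k = ar t ?ro k" using False by (auto simp: t1_def)
		ultimately show ?thesis using I by simp
	 qed
	qed (use I in \<open>auto simp: t1_def\<close>)
 qed
 then obtain t where t: "?I q0 t" "run w z (For 11 9 ?body) s2 = set_va 11 q0 t" using vs2 by auto
 have s't: "s' = set_va 11 q0 t" using s1 s2 t(2) unfolding s' q_build_def by simp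
 have len_qs: "length (qs i) = d" if "i < q0" for i
 proof -
	have "map (%e. eval w z (set_va 12 (?b * q0 + i) s2) (Cnd (Var 12 [<] Var 7) (fst e) (Num (snd e)))) (zip es ms) = qs i" by (rule es[OF that]) (use fs2 vs2 in auto)
	hence "length (zip es ms) = length (qs i)" by (metis length_map)
	with len show ?thesis by simp
 qed
 have "ar s' ?ro k = (if k < 2 + n + d * q0 then ([n, q0] @ map fa [0..<n] @ concat (map qs [0..<q0])) ! k else 0)" for k
 proof -
	have s2k: "ar s2 ?ro k = (if k = 0 then n else if k = 1 then q0 else if k < 2 + n then fa (k - 2) else 0)" using fresh by (auto simp: s2_def s1_def)
	have "concat (map qs [0..<q0]) ! (d * (l div d) + l mod d) = qs (l div d) ! (l mod d)" if "l < d * q0" for l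
	proof -
	 have "l div d < q0" using that len by (simp add: less_mult_imp_div_less mult.commute)
	 thus ?thesis using len len_qs by (subst nth_concat_const) auto
	qed
	hence c: "concat (map qs [0..<q0]) ! l = qs (l div d) ! (l mod d)" if "l < d * q0" for l using that by simp
	consider "k = 0" | "k = 1" | "2 <= k" "k < 2 + n" | "2 + n <= k" "k < 2 + n + d * q0" | "2 + n + d * q0 <= k" by linarith
	thus ?thesis
	proof cases
	 case 3
	 then obtain l where "k = Suc (Suc l)" "l < n" by (metis add_2_eq_Suc le_Suc_ex nat_add_left_cancel_less)
	 thus ?thesis using t(1) s2k by (simp add: s't nth_append)
	next
	 case 4
	 then obtain l where l: "k = Suc (Suc (n + l))" "l < d * q0" by (metis add_2_eq_Suc le_Suc_ex nat_add_left_cancel_less add_Suc)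
	 have "Suc (Suc (n + l)) - 2 - n = l" by simp
	 thus ?thesis using t(1) c[OF l(2)] l by (simp add: s't nth_append)
	qed (use t(1) s2k in \<open>auto simp: s't\<close>)
 qed
 hence "ar s' ?ro = (%k. if k < 2 + n + d * q0 then ([n, q0] @ map fa [0..<n] @ concat (map qs [0..<q0])) ! k else 0)" by blast
 thus ?thesis using t(1) vs2 fs2 by (simp add: s't)
qed

lemma run_q_collect:
 fixes s :: ast
 assumes v: "va s 9 = q0" "va s 7 = nq" "va s 14 = b" "va s 2 = ro" "ro ~= 7"
	and bounds: "ro < pow2 z" "7 < pow2 z" "pow2 z <= pow2 w" "b * q0 + q0 < pow2 z" "nq < pow2 w"
	and ans: "!!i. i < q0 ==> b * q0 + i < nq ==> ar s ro i < pow2 w"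
	and old: "!!j. j < nq ==> ar s 7 j < pow2 w"
	and e: "!!j s'. b * q0 <= j ==> j < b * q0 + q0 ==> j < nq ==> (ALL y. y ~: {11, 12, 15, 16} --> va s' y = va s y) ==>
	 va s' 12 = j ==> va s' 15 = ar s ro (j - b * q0) ==> va s' 16 = ar s 7 j ==>
	 (ALL q. q ~= 7 --> ar s' q = ar s q) ==> eval w z s' e = f j"
	and s': "s' = run w z (q_collect e) s"
 shows "(ALL y. y ~: {11, 12, 15, 16} --> va s' y = va s y) & (ALL q. q ~= 7 --> ar s' q = ar s q) &
	(ALL j<nq. ar s' 7 j = (if b * q0 <= j & j < b * q0 + q0 then f j else ar s 7 j))"
proof -
 let ?body = "Asg 12 (Var 14 [*] Var 9 [+] Var 11) ;;
	 Ite (Var 12 [<] Var 7)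
		(Asg 15 (Get (Var 2) (Var 11)) ;; Asg 16 (Get (Num 7) (Var 12)) ;; Put (Num 7) (Var 12) e) Nop"
 let ?I = "%i t. (ALL y. y ~: {11, 12, 15, 16} --> va t y = va s y) & (ALL q. q ~= 7 --> ar t q = ar s q) &
	(ALL j<nq. ar t 7 j = (if b * q0 <= j & j < b * q0 + i then f j else ar s 7 j))"
 have "EX t. ?I (va s 9) t & run w z (For 11 9 ?body) s = set_va 11 (va s 9) t"
 proof (rule run_For_inv)
	show "?I 0 s" by simp
 next
	fix i and t :: ast assume i: "i < va s 9" and I: "?I i t"
	let ?j = "b * q0 + i"
	define t1 where "t1 = set_va 12 ?j (set_va 11 i t)"
	have q0: "b <= b * q0" "i < q0" using i v by auto
	have bs: "?j < pow2 z" "b * q0 < pow2 w" "b < pow2 w" "q0 < pow2 w" "i < pow2 w" "?j < pow2 w" "i < pow2 z" "ro < pow2 w" "7 < pow2 w" using bounds i v q0 by linarith+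
	have t1: "run w z (Asg 12 (Var 14 [*] Var 9 [+] Var 11)) (set_va 11 i t) = t1" using I v bs by (simp add: ev t1_def)
	have vt1: "va t1 12 = ?j" "va t1 7 = nq" "va t1 2 = ro" "va t1 11 = i" "va t1 14 = b" using I v by (auto simp: t1_def)
	have c: "eval w z t1 (Var 12 [<] Var 7) = of_bool (?j < nq)" using vt1 bs bounds by (simp add: ev)
	show "?I (Suc i) (run w z ?body (set_va 11 i t))"
	proof (cases "?j < nq")
	 case False
	 hence "run w z ?body (set_va 11 i t) = t1" using t1 c by simp
	 with I False show ?thesis by (auto simp: t1_def)
	next
	 case True
	 define t2 where "t2 = set_va 16 (ar s 7 ?j) (set_va 15 (ar s ro i) t1)"
	 have "ar t1 7 ?j = ar s 7 ?j" "ar t1 ro i = ar s ro i" using I True v by (auto simp: t1_def)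
	 hence t2: "run w z (Asg 15 (Get (Var 2) (Var 11)) ;; Asg 16 (Get (Num 7) (Var 12))) t1 = t2" using bs vt1 old[OF True] ans[of i] i v True bounds by (simp add: ev t2_def)
	 have "eval w z t2 e = f ?j" by (rule e) (use I True i v vt1 in \<open>auto simp: t2_def t1_def\<close>)
	 moreover have "eval w z t2 (Num 7) = 7" "eval w z t2 (Var 12) = ?j" using bs vt1 by (simp_all add: ev t2_def)
	 ultimately have "run w z (Put (Num 7) (Var 12) e) t2 = set_ar 7 ?j (f ?j) t2" using bs bounds by (simp add: run_Put)
	 hence r: "run w z ?body (set_va 11 i t) = set_ar 7 ?j (f ?j) t2" using t1 c t2 True by simp
	 show ?thesis unfolding r using I by (auto simp: t2_def t1_def)
	qed
 qed
 then obtain t where t: "?I q0 t" "s' = set_va 11 q0 t" using v s' unfolding q_collect_def by auto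
 thus ?thesis by auto
qed

lemma run_q_final:
 assumes "va s 7 = nq" "nq <= pow2 z" "7 < pow2 z" "pow2 z <= pow2 w" "!!j. j < nq ==> ar s 7 j < pow2 w"
 shows "ALL j<nq. ar (run w z q_final s) 0 j = ar s 7 j"
proof -
 have "run w z q_final s = set_va 11 nq (fill 0 0 nq (ar s 7) s)" unfolding q_final_def by (rule run_fill) (use assms in \<open>auto simp: ev\<close>)
 thus ?thesis by simp
qed

definition start_ar :: "nat list => nat => nat => nat" where
 "start_ar inp = (%r i. if r = 0 & i < length inp then inp ! i else 0)"

lemma run_q_params:
 assumes inp: "2 <= length inp" "inp ! 0 < pow2 w" "inp ! 1 < pow2 w"
	and b: "n < pow2 w" "a < pow2 w" "b < pow2 w" "a * n < pow2 w" "K < pow2 w"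
	 "inp ! 1 div batch_size a b n + 1 < pow2 w" "K * (inp ! 1 div batch_size a b n + 1) < pow2 w"
	 "pow2 (lg n) < pow2 w" "1 < pow2 z" "1 < pow2 w" "lg n < pow2 w"
 shows "run w z (q_params a b K) (start z n inp) =
	(|va = (%_. 0)(0 := z, 1 := 2 ^ z - 1, 3 := n, 4 := lg n, 7 := inp ! 1, 8 := inp ! 0, 9 := batch_size a b n,
	 10 := inp ! 1 div batch_size a b n + 1, 6 := K * (inp ! 1 div batch_size a b n + 1), 17 := pow2 (lg n)),
	ar = start_ar inp|)"
proof -
 have "batch_size a b n < pow2 w" using b(4) by (auto simp: batch_size_def intro: le_less_trans[OF div_le_dividend])
 moreover have "inp ~= []" using inp by auto
 ultimately show ?thesis using assms unfolding q_params_def by (simp add: ev start_def start_ar_def batch_size_def[symmetric] set_va_def)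
qed

definition q_start :: "nat => nat => nat => nat list => ast => bool" where
 "q_start w z n inp s \<longleftrightarrow> va s 3 = n & va s 4 = lg n & va s 7 = inp ! 1 & va s 8 = inp ! 0 &
	va s 17 = pow2 (lg n) & ar s = start_ar inp"

text \<open>What the expressions of a concrete reduction may rely on during any call: parameters and
  shared rows are as the preparation left them. Row 7 is exempt since it collects the
  answers.\<close>

definition q_background :: "ast => ast => bool" where
 "q_background s1 s \<longleftrightarrow> (\<forall>p\<in>q_vars. va s p = va s1 p) & (ALL q<16. q ~= 7 --> ar s q = ar s1 q)"

lemma wf_q_params: "wf_cmd {0, 1, 3, 4} (q_params a b K)"
 by (simp add: q_params_def)

lemma assigned_q_params: "q_vars <= {0, 1, 3, 4} \<union> assigned (q_params a b K)"
 by (auto simp: q_params_def q_vars_def)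

lemma wf_q_build: "wf_cmd q_vars (q_build d ea es ms K)" "5 ~: assigned (q_build d ea es ms K)"
 by (auto simp: q_build_def put_query_static q_vars_def)

lemma wf_q_collect: "wf_cmd q_vars (q_collect e)" "5 ~: assigned (q_collect e)"
 by (auto simp: q_collect_def q_vars_def)

lemma wf_q_final: "wf_cmd q_vars q_final"
 by (auto simp: q_final_def q_vars_def)

section \<open>The generic reduction to a query problem\<close>

lemma nat_div_mod_Suc:
 assumes "0 < (K::nat)"
 shows "Suc r div K = (if Suc (r mod K) = K then Suc (r div K) else r div K)"
	"Suc r mod K = (if Suc (r mod K) = K then 0 else Suc (r mod K))" using assms by (simp_all add: div_Suc mod_Suc)

text \<open>How many of the \<open>K\<close> kinds query \<open>j\<close> has already gone through
  after \<open>r\<close> calls, depending on whether its batch is finished, current or still to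
  come.\<close>

definition task_count :: "nat => nat => nat => nat => nat" where
 "task_count K q0 r j = (if j div q0 < r div K then K else if j div q0 = r div K then r mod K else 0)"

lemma task_count_Suc:
 assumes "0 < K"
 shows "task_count K q0 (Suc r) j = task_count K q0 r j + (if j div q0 = r div K then 1 else 0)"
proof -
 have "Suc (r mod K) <= K" using assms by (simp add: Suc_leI)
 thus ?thesis using assms unfolding task_count_def nat_div_mod_Suc[OF assms] by auto
qed

text \<open>The obligations of a concrete reduction: \<open>fa kp\<close> and \<open>fq kp\<close>
  are the array and the queries of kind \<open>kp\<close>, and \<open>R kp j\<close> is the
  accumulator of query \<open>j\<close> after \<open>kp\<close> kinds. The bound
  \<open>2 * n\<close> makes all entries fit into \<open>z\<close>-bit words.\<close>

definition q_correct ::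
 "(nat => nat list => bool) => (int list => nat list => nat) => nat => nat => nat => nat => nat list => nat list =>
	aexp => aexp list => aexp => ast => (nat => nat => nat) => (nat => nat => nat list) => (nat => nat => nat) => bool" where
 "q_correct valid F K w z n inp out ea es eacc s1 fa fq R \<longleftrightarrow>
		(\<forall>q\<ge>16. ar s1 q = (%_. 0)) & ar s1 7 = (%_. 0) &
		(ALL s kp i. q_background s1 s --> kp < K --> va s 13 = kp --> i < n --> va s 11 = i -->
			eval w z s ea = fa kp i & fa kp i <= 2 * n) &
		(ALL s kp j. q_background s1 s --> kp < K --> va s 13 = kp --> j < inp ! 1 --> va s 12 = j -->
			map (eval w z s) es = fq kp j & valid n (fq kp j)) &
		(ALL s kp j. q_background s1 s --> kp < K --> va s 13 = kp --> j < inp ! 1 --> va s 12 = j -->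
			va s 15 = F (map (%i. int (fa kp i)) [0..<n]) (fq kp j) --> va s 16 = R kp j -->
			eval w z s eacc = R (Suc kp) j) &
		(ALL j<inp ! 1. R 0 j = 0 & R K j = out ! j)"

text \<open>All instances have array length \<open>n\<close> and exactly one batch of queries. The
  input has at most \<open>C * n\<close> queries and \<open>n <= 2 * b * q0\<close> for the batch
  size \<open>q0\<close>, so \<open>2 * b * C + 1\<close> batches are enough and the number of calls
  is constant.\<close>

theorem gquery_reduction:
 fixes Q :: problem
 assumes solver: "solvable_in_time (gquery d valid F alp bet) T" and lb: "linear_bounds alp bet"
	and lower: "\<exists>epl>0. \<forall>\<^sub>F N in sequentially. epl * real N <= T N"
	and F: "!!n A q. valid n q ==> F A q <= n * n"
	and size: "!!w N inp out. Q w N inp out ==> 2 <= length inp & inp ! k = N & length out = inp ! 1 &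
	 inp ! 0 <= C * N & inp ! 1 <= C * N & length inp <= C * (N + 1)" "k <= 1"
	and len: "length es = d" "length ms = d" "0 < d" "!!n. 2 <= n ==> valid n ms" "\<forall>m\<in>set ms. m <= 4"
	 "!!n q. valid n q ==> length q = d ==> set q <= {..n}"
	and K: "0 < K"
	and wf: "wf_cmd q_vars c1"
	and cost: "!!n v. v 3 = n ==> v 4 = lg n ==> v 7 <= C * n ==> v 8 <= C * n ==> v 17 <= 2 * n + 2 ==>
	 cost v c1 <= a1 * (n + 1) * (lg n + 1) ^ e1"
	and main: "!!e w z N n inp out s0 s1. Q w N inp out ==> d0 <= e ==> N <= n ==> 2 <= n ==> z = e * lg n ==> 4 * z <= w ==>
	 q_start w z n inp s0 ==> s1 = run w z c1 s0 ==>
	 EX fa fq R. q_correct valid F K w z n inp out ea es eacc s1 fa fq R"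
 shows "\<exists>T' \<in> soft_O T. solvable_in_time Q T'"
proof -
 obtain epl where eps: "0 < epl" "\<forall>\<^sub>F N in sequentially. epl * real N <= T N" using lower by blast
 obtain a b n1 where ab: "0 < b" "!!n. n1 <= n ==> alp * real n <= real (batch_size a b n)"
	"!!n. n1 <= n ==> real (batch_size a b n) <= bet * real n"
	"!!n. n1 <= n ==> 0 < batch_size a b n"
	"!!n. n1 <= n ==> n <= 2 * b * batch_size a b n" using linear_bounds_batch[OF lb] by metis
 define n0 where "n0 = max 2 n1"
 \<comment> \<open>All size bounds below come from \<open>G * (n + 2) ^ 2 <= 2 ^ z\<close>; the
   summands of \<open>G\<close> are the coefficients that occur in them.\<close>
 define G where "G = 100 + C + a + b + K + K * (C + 1) + d * a"
 define D where "D = d0 + G + 8"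
 define kb where "kb = K * (2 * b * C + 1)"
 define c2 where "c2 = q_build d ea es ms K"
 define c3 where "c3 = q_collect eacc"
 define cp where "cp = cost (%_. 0) (put_query d 0 es ms)"
 define cf where "cf = 200 + kb + a1 + cost_exp ea + cost_exp eacc + 100 * C + a * (cp + cost_exp eacc + 100)"
 show ?thesis
 proof (rule reduction[OF solver eps, where k = k and Q = Q and V = q_vars and ?d0.0 = D and ?n0.0 = n0 and a = cf and e = e1
		and ?c0.0 = "q_params a b K" and ?c1.0 = c1 and ?c2.0 = c2 and ?c3.0 = c3 and ?c4.0 = q_final])
	fix w N inp out assume "Q w N inp out"
	from size(1)[OF this] size(2) show "k < length inp & inp ! k = N" by auto
 next
	fix e w z N n inp out s0
	assume Q: "Q w N inp out" and e: "D <= e" and n: "n = max N n0" and z: "z = e * lg n" and zw: "4 * z <= w"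
	 and s0: "s0 = run w z (q_params a b K) (start z n inp)"
	note sz = size(1)[OF Q]
	let ?q0 = "batch_size a b n" and ?nq = "inp ! 1" and ?Z = "pow2 z" and ?W = "pow2 w"
	have nn: "N <= n" "2 <= n" "n1 <= n" by (auto simp: n n0_def)
	have CN: "C * N <= C * n" using nn by simp
	have q0: "0 < ?q0" "n <= 2 * b * ?q0" using ab nn by auto
	have q0a: "?q0 <= a * n" unfolding batch_size_def by simp
	have "G * (n + 2) ^ 2 <= ?Z" by (rule poly_le_pow2[OF _ z]) (use e in \<open>simp add: D_def\<close>)
	moreover have "G * (n + 2) <= G * (n + 2) ^ 2" by (intro mult_left_mono) (auto simp: power2_eq_square)
	ultimately have Z2: "G * (n + 2) <= ?Z" "(n + 2) ^ 2 * G <= ?Z" by (auto simp: mult.commute)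
	have Gn: "G * (n + 2) = 100 * (n + 2) + C * (n + 2) + a * (n + 2) + b * (n + 2) + K * (n + 2) + K * (C + 1) * (n + 2) + d * a * (n + 2)" by (simp add: G_def algebra_simps)
	have ge: "X <= X * (n + 2)" for X :: nat by simp
	\<comment> \<open>The products with \<open>n + 2\<close> get names, so that the remaining bounds
	  are linear.\<close>
	define Cm am Km dm where "Cm = C * (n + 2)" and "am = a * (n + 2)" and "Km = K * (C + 1) * (n + 2)" and "dm = d * a * (n + 2)"
	note m_defs = Cm_def am_def Km_def dm_def
	have small: "100 * n + 200 + Cm + am + b + K + Km + dm <= ?Z" using order_trans[OF _ Z2(1), unfolded Gn, folded m_defs, of "100 * n + 200 + Cm + am + b + K + Km + dm"] ge[of b] ge[of K] by (simp add: add_mono)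
	have ZW: "?Z <= ?W" using zw by (intro pow2_mono) auto
	have nq: "?nq <= Cm" "inp ! 0 <= Cm" "length inp <= Cm" unfolding Cm_def
	proof -
	 have "C * N + C <= C * n + C * 2" using CN by linarith
	 thus "?nq <= C * (n + 2)" "inp ! 0 <= C * (n + 2)" "length inp <= C * (n + 2)" using sz unfolding distrib_left by linarith+
	qed
	have q0_le: "?q0 <= am" "d * ?q0 <= dm" unfolding am_def dm_def
	proof -
	 show 1: "?q0 <= a * (n + 2)" using q0a by (rule order_trans) simp
	 show "d * ?q0 <= d * a * (n + 2)" unfolding mult.assoc by (rule mult_le_mono2[OF 1])
	qed
	define Kb where "Kb = ?nq div ?q0 + 1"
	have Kb: "K * Kb <= Km" "Kb <= 2 * b * C + 1"
	proof -
	 have "Kb <= C * (n + 2) + 1 * (n + 2)" unfolding Kb_def by (rule add_mono[OF order_trans[OF div_le_dividend nq(1)[unfolded Cm_def]]]) simp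
	 hence "Kb <= (C + 1) * (n + 2)" by (simp only: add_mult_distrib)
	 thus "K * Kb <= Km" unfolding Km_def by (metis mult.assoc mult_le_mono2)
	 have "?nq <= C * n" using sz CN by linarith
	 also have "... <= C * (2 * b * ?q0)" using q0 by (intro mult_left_mono) auto
	 finally have "?nq div ?q0 <= (2 * b * C) * ?q0 div ?q0" by (intro div_le_mono) (simp add: mult_ac)
	 thus "Kb <= 2 * b * C + 1" using q0 by (simp add: Kb_def)
	qed
	have lgn: "lg n < ?Z" "pow2 (lg n) <= 2 * n + 2"
	proof -
	 show "pow2 (lg n) <= 2 * n + 2" using lg_le[of n] by (simp add: pow2_def)
	 moreover have "lg n < pow2 (lg n)" by (simp add: pow2_def)
	 ultimately show "lg n < ?Z" using small by linarith
	qed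
	have K1: "Kb <= Km" by (rule order_trans[OF _ Kb(1)]) (use K in simp)
	have "a * n <= am" "a <= am" using ge[of a] by (simp_all add: am_def)
	note a_le = this
	have "z < ?Z" "2 ^ z - 1 < ?Z" by (simp_all add: pow2_def)
	hence lts: "z < ?W" "2 ^ z - 1 < ?W" "n < ?W" "a < ?W" "b < ?W" "a * n < ?W" "K < ?W" "Kb < ?W" "K * Kb < ?W"
	 "lg n < ?W" "pow2 (lg n) < ?W" "1 < ?Z" "1 < ?W" "?nq < ?W" "inp ! 0 < ?W" "?q0 < ?W" using small ZW nq(1,2) lgn Kb(1) K1 a_le q0_le(1) by linarith+
	have s0_eq: "s0 = (|va = (%_. 0)(0 := z, 1 := 2 ^ z - 1, 3 := n, 4 := lg n, 7 := ?nq, 8 := inp ! 0, 9 := ?q0,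
	 10 := Kb, 6 := K * Kb, 17 := pow2 (lg n)), ar = start_ar inp|)" unfolding s0 Kb_def by (rule run_q_params) (use sz lts in \<open>simp_all add: Kb_def\<close>)
	have v0: "va s0 0 = z" "va s0 1 = 2 ^ z - 1" "va s0 3 = n" "va s0 4 = lg n" "va s0 7 = ?nq" "va s0 8 = inp ! 0" "va s0 9 = ?q0"
	 "va s0 10 = Kb" "va s0 6 = K * Kb" "va s0 17 = pow2 (lg n)" "ar s0 = start_ar inp" by (simp_all add: s0_eq)
	have v0_lt: "\<forall>p\<in>q_vars. va s0 p < ?W" using lts by (auto simp: q_vars_def s0_eq)
	have "q_start w z n inp s0" by (simp add: q_start_def v0)
	define s1 where "s1 = run w z c1 s0"
	from main[OF Q _ nn(1,2) z zw \<open>q_start w z n inp s0\<close> s1_def] e obtain fa fq R where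
	 qc: "q_correct valid F K w z n inp out ea es eacc s1 fa fq R" by (auto simp: D_def)
	have fresh: "\<forall>q\<ge>16. ar s1 q = (%_. 0)" "ar s1 7 = (%_. 0)" using qc unfolding q_correct_def by (rule conjunct1, rule conjunct1[OF conjunct2])
	have ea: "eval w z s ea = fa kp i & fa kp i <= 2 * n"
	 if "q_background s1 s" "kp < K" "va s 13 = kp" "i < n" "va s 11 = i" for s kp i using conjunct1[OF conjunct2[OF conjunct2[OF qc[unfolded q_correct_def]]]] that by blast
	have es: "map (eval w z s) es = fq kp j & valid n (fq kp j)"
	 if "q_background s1 s" "kp < K" "va s 13 = kp" "j < inp ! 1" "va s 12 = j" for s kp j using conjunct1[OF conjunct2[OF conjunct2[OF conjunct2[OF qc[unfolded q_correct_def]]]]] that by blast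
	have eacc: "eval w z s eacc = R (Suc kp) j"
	 if "q_background s1 s" "kp < K" "va s 13 = kp" "j < inp ! 1" "va s 12 = j"
		"va s 15 = F (map (%i. int (fa kp i)) [0..<n]) (fq kp j)" "va s 16 = R kp j" for s kp j using conjunct1[OF conjunct2[OF conjunct2[OF conjunct2[OF conjunct2[OF qc[unfolded q_correct_def]]]]]] that by blast
	have R: "R 0 j = 0" "R K j = out ! j" if "j < inp ! 1" for j using conjunct2[OF conjunct2[OF conjunct2[OF conjunct2[OF conjunct2[OF qc[unfolded q_correct_def]]]]]] that by blast+
	have vs1: "\<forall>p\<in>q_vars. va s1 p = va s0 p" unfolding s1_def using wf by (simp add: run_va_param)
	have tl: "\<forall>m\<in>set ms. m < ?W" using len(5) small ZW by force
	\<comment> \<open>The hypotheses describe \<open>fq\<close> only through evaluated expressions, so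
	  a suitable state is made up from \<open>s1\<close>.\<close>
	have fq: "map (eval w z (set_va 12 j (set_va 13 kp s1))) es = fq kp j" "valid n (fq kp j)" if "kp < K" "j < ?nq" for kp j using es[of "set_va 12 j (set_va 13 kp s1)" kp j] that by (auto simp: q_background_def q_vars_def)
	have fq_len: "length (fq kp j) = d" if "kp < K" "j < ?nq" for kp j using arg_cong[OF fq(1)[OF that], of length] len(1) by simp
	note fq_valid = fq(2)
	have fa_le: "fa kp i <= 2 * n" if "kp < K" "i < n" for kp i using ea[of "set_va 11 i (set_va 13 kp s1)" kp i] that by (auto simp: q_background_def q_vars_def)
	define qs where "qs r i = (let j = r div K * ?q0 + i in if j < ?nq then fq (r mod K) j else ms)" for r i
	define X where "X r = [n, ?q0] @ map (fa (r mod K)) [0..<n] @ concat (map (qs r) [0..<?q0])" for r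
	define A where "A r = map (%i. int (fa (r mod K) i)) [0..<n]" for r
	define Y where "Y r = map (F (A r)) (map (qs r) [0..<?q0])" for r
	\<comment> \<open>The rows of later calls are still zero, and every accumulator has absorbed the
	  kinds that its query has gone through.\<close>
	define I where "I r s \<longleftrightarrow> (ALL q<16. q ~= 7 --> ar s q = ar s1 q) & (\<forall>q\<ge>16 + r. ar s q = (%_. 0)) &
	 (ALL j<?nq. ar s 7 j = R (task_count K ?q0 r j) j)" for r :: nat and s :: ast
	have qs_prop: "length (qs r i) = d" "valid n (qs r i)" for r i using K fq_len fq_valid len nn by (auto simp: qs_def Let_def)
	have len_concat: "length (concat (map (qs r) [0..<?q0])) = d * ?q0" for r using qs_prop by (subst length_concat_const[of _ d]) auto
	\<comment> \<open>Except for the initial 0, each accumulator is the value of an expression in a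
	  made-up state, and such values are words.\<close>
	have Rlt: "R kp j < ?W" if "j < ?nq" "kp <= K" for kp j using that
	proof (induction kp)
	 case 0
	 thus ?case using R by (simp add: pow2_def)
	next
	 case (Suc kp)
	 let ?s = "set_va 16 (R kp j) (set_va 15 (F (map (%i. int (fa kp i)) [0..<n]) (fq kp j)) (set_va 12 j (set_va 13 kp s1)))"
	 have "eval w z ?s eacc = R (Suc kp) j" by (rule eacc) (use Suc.prems in \<open>auto simp: q_background_def q_vars_def\<close>)
	 thus ?case using eval_lt_pow2 by metis
	qed
	have task_le: "task_count K ?q0 r j <= K" for r j using K by (simp add: task_count_def less_imp_le)
	have FW: "F A' q < ?W" if "valid n q" for A' q
	proof -
	 have "F A' q <= n * n" by (rule F[OF that])
	 also have "... < (n + 2) ^ 2 * G" unfolding power2_eq_square G_def by (simp add: algebra_simps)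
	 also have "... <= ?W" using Z2 ZW by linarith
	 finally show ?thesis .
	qed
	have pieces: "correct_pieces (gquery d valid F alp bet) q_vars w z n c1 c2 c3 q_final s0 out" unfolding correct_pieces_def s1_def[symmetric]
	proof (rule exI[of _ I], intro conjI allI impI)
	 show "I 0 s1" using fresh R K by (auto simp: I_def task_count_def)
	next
	 fix s assume I: "I (va s0 6) s" and pa: "params_agree q_vars (va s0) s"
	 \<comment> \<open>Every query lies in one of the \<open>Kb\<close> batches, so at the end it has
	   gone through all \<open>K\<close> kinds.\<close>
	 have eq: "ar s 7 j = out ! j" if "j < ?nq" for j
	 proof -
		have "j div ?q0 < Kb" using that unfolding Kb_def by (simp add: div_le_mono less_Suc_eq_le)
		hence "task_count K ?q0 (K * Kb) j = K" using K by (simp add: task_count_def)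
		with I that R v0 show ?thesis by (simp add: I_def)
	 qed
	 have "ALL j<?nq. ar (run w z q_final (set_va 5 (va s0 6) s)) 0 j = ar (set_va 5 (va s0 6) s) 7 j"
	 proof (rule run_q_final)
		show "va (set_va 5 (va s0 6) s) 7 = ?nq" using pa v0 by (simp add: params_agree_def q_vars_def)
		show "ar (set_va 5 (va s0 6) s) 7 j < ?W" if "j < ?nq" for j using eq[OF that] Rlt[of j K] R that by simp
	 qed (use small nq ZW in linarith)+
	 moreover fix i assume "i < length out"
	 ultimately show "ar (run w z q_final (set_va 5 (va s0 6) s)) 0 i = out ! i" using eq sz by simp
	next
	 fix r s assume r: "r < va s0 6" and I: "I r s" and pa: "params_agree q_vars (va s0) s"
	 have rK: "r < K * Kb" using r v0 by simp
	 have rm: "r mod K < K" using K by simp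
	 let ?b = "r div K"
	 have b_lt: "?b < Kb" using rK by (simp add: less_mult_imp_div_less mult.commute)
	 hence "?b <= ?nq div ?q0" by (simp add: Kb_def)
	 hence "?b * ?q0 <= ?nq div ?q0 * ?q0" by (rule mult_right_mono) simp
	 hence bq: "?b * ?q0 <= ?nq" using order_trans[OF _ div_times_less_eq_dividend] by blast
	 have vs: "va s 3 = n" "va s 9 = ?q0" "va s 7 = ?nq" using pa v0 by (simp_all add: params_agree_def q_vars_def)
	 define s' where "s' = run w z c2 (set_va 5 r s)"
	 have bg: "q_background s1 t" if "ALL y. y ~: {2, 11, 12, 13, 14, 15, 16} --> va t y = va (set_va 5 r s) y"
		"ALL q. q ~= r + 16 & q ~= 7 --> ar t q = ar s q" for t using that pa vs1 I by (auto simp: q_background_def q_vars_def params_agree_def I_def)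
	 have b': "(ALL y. y ~: {2, 11, 12, 13, 14} --> va s' y = va (set_va 5 r s) y) & va s' 2 = r + 16 &
		va s' 13 = r mod K & va s' 14 = ?b & (ALL q. q ~= r + 16 --> ar s' q = ar (set_va 5 r s) q) &
		ar s' (r + 16) = (%i. if i < 2 + n + d * ?q0 then ([n, ?q0] @ map (fa (r mod K)) [0..<n] @ concat (map (qs r) [0..<?q0])) ! i else 0)"
	 proof (rule run_q_build[OF _ _ _ _ K _ ZW _ _ _ _ len(1,2,3) _ _ s'_def[unfolded c2_def]])
		show "va (set_va 5 r s) 5 = r" "va (set_va 5 r s) 3 = n" "va (set_va 5 r s) 9 = ?q0" "va (set_va 5 r s) 7 = ?nq" using vs by simp_all
		show "r + 16 < ?Z" using rK Kb small by linarith
		show "2 + n + d * ?q0 <= ?Z" "K < ?W" using q0_le small ZW by linarith+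
		show "?b * ?q0 + ?q0 < ?Z" using q0_le small bq nq by linarith
		show "ar (set_va 5 r s) (r + 16) = (%_. 0)" using I by (simp add: I_def)
		fix i and t :: ast assume t: "va t 13 = r mod K" "ALL q. q ~= r + 16 --> ar t q = ar (set_va 5 r s) q"
		show "eval w z t ea = fa (r mod K) i" if "i < n" "va t 11 = i" "ALL y. y ~: {2, 11, 13, 14} --> va t y = va (set_va 5 r s) y"
		proof -
		 have "q_background s1 t" by (rule bg) (use t that in auto)
		 from ea[OF this rm t(1) that(1,2)] show ?thesis by simp
		qed
		show "map (%e. eval w z t (Cnd (Var 12 [<] Var 7) (fst e) (Num (snd e)))) (zip es ms) = qs r i"
		 if "i < ?q0" "va t 12 = ?b * ?q0 + i" "ALL y. y ~: {2, 11, 12, 13, 14} --> va t y = va (set_va 5 r s) y"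
		proof -
		 have "va t 7 = ?nq" using that vs by simp
		 moreover have "?b * ?q0 + i < ?W" "?nq < ?W" using that(1) small bq nq q0_le ZW by linarith+
		 ultimately have c: "eval w z t (Var 12 [<] Var 7) = of_bool (?b * ?q0 + i < ?nq)" using that by (simp add: ev)
		 show ?thesis
		 proof (cases "?b * ?q0 + i < ?nq")
			case True
			have "q_background s1 t" by (rule bg) (use t that in auto)
			from es[OF this rm t(1) True that(2)] have "map (eval w z t) es = fq (r mod K) (?b * ?q0 + i)" by simp
			moreover have "map (%e. eval w z t (Cnd (Var 12 [<] Var 7) (fst e) (Num (snd e)))) (zip es ms) =
				map (eval w z t) (map fst (zip es ms))" using True c by (simp add: eval.simps(5))
			ultimately show ?thesis using True len by (simp add: qs_def)
		 next
			case False
			have "map (%e. eval w z t (Cnd (Var 12 [<] Var 7) (fst e) (Num (snd e)))) (zip es ms) =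
				map (%m. eval w z t (Num m)) (map snd (zip es ms))" using False c by (simp add: eval.simps(5))
			also have "... = map (%m. m) ms" using len tl by (intro map_cong) (auto simp: ev)
			finally show ?thesis using False by (simp add: qs_def)
		 qed
		qed
	 qed
	 have lenX: "length (X r) = 2 + n + d * ?q0" by (simp add: X_def len_concat)
	 have P: "gquery d valid F alp bet z n (X r) (Y r)" unfolding gquery_def
	 proof (rule exI[of _ "A r"], rule exI[of _ "map (qs r) [0..<?q0]"], intro conjI)
		have fit: "fa (r mod K) i <= 2 * n" if "i < n" for i using fa_le rm that by blast
		have "0 < z" using small by (cases z) (auto simp: pow2_def)
		have n2: "4 * int n < 2 ^ z"
		proof -
		 have "4 * n < ?Z" using small by linarith
		 hence "int (4 * n) < int (2 ^ z)" unfolding pow2_def by linarith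
		 thus ?thesis by simp
		qed
		show "\<forall>a\<in>set (A r). fits_word z a"
		proof
		 fix x assume "x : set (A r)"
		 then obtain i where i: "i < n" "x = int (fa (r mod K) i)" by (auto simp: A_def)
		 have "0 <= 2 * x" "2 * x < 2 ^ z" using fit[OF i(1)] i n2 by auto
		 moreover have "- (2 ^ z) <= (0::int)" by simp
		 ultimately show "fits_word z x" unfolding fits_word_def by linarith
		qed
		have "encode_int z (int (fa (r mod K) i)) = fa (r mod K) i" if i: "i < n" for i
		proof -
		 have "fa (r mod K) i < 2 ^ z" using fit[OF i] small unfolding pow2_def by linarith
		 thus ?thesis unfolding encode_int_def by (metis take_bit_of_nat take_bit_nat_eq_self nat_int)
		qed
		hence "map (encode_int z) (A r) = map (fa (r mod K)) [0..<n]" by (simp add: A_def)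
		thus "X r = [n, length (map (qs r) [0..<?q0])] @ map (encode_int z) (A r) @ concat (map (qs r) [0..<?q0])" by (simp add: X_def)
	 qed (use ab nn qs_prop in \<open>auto simp: A_def Y_def\<close>)
	 have X_lt: "set (X r) <= {..<2 ^ z}"
	 proof -
		have "x <= n" if "x : set (concat (map (qs r) [0..<?q0]))" for x using that qs_prop len(6) by (fastforce)
		moreover have "x <= 2 * n" if "x : set (map (fa (r mod K)) [0..<n])" for x using that fa_le rm by auto
		moreover have "n < 2 ^ z" "2 * n < 2 ^ z" "?q0 < 2 ^ z" using small q0_le unfolding pow2_def by linarith+
		ultimately show ?thesis unfolding X_def by fastforce
	 qed
	 show "EX X Y. let s' = run w z c2 (set_va 5 r s) in
		gquery d valid F alp bet z n X Y & set X <= {..<2 ^ z} & va s' 2 < 2 ^ z &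
		(ALL i<2 ^ z. ar s' (va s' 2) i = (if i < length X then X ! i else 0)) &
		(ALL f. (ALL i<length Y. f i = Y ! i) -->
		 I (r + 1) (set_va 5 (r + 1) (run w z c3 (s'(|ar := (ar s')(va s' 2 := f)|)))))"
	 proof (rule exI[of _ "X r"], rule exI[of _ "Y r"], unfold Let_def s'_def[symmetric], intro conjI allI impI)
		show "va s' 2 < 2 ^ z" using b' rK Kb small unfolding pow2_def by linarith
		show "ar s' (va s' 2) i = (if i < length (X r) then X r ! i else 0)" for i using b' lenX by (simp add: X_def)
	 next
		fix f assume f: "ALL i<length (Y r). f i = Y r ! i"
		let ?s = "s'(|ar := (ar s')(va s' 2 := f)|)"
		have fY: "f i = F (A r) (qs r i)" if "i < ?q0" for i using f that by (simp add: Y_def)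
		have Rj: "R (Suc (r mod K)) j < ?W" if "j < ?nq" for j using Rlt[OF that, of "Suc (r mod K)"] rm by simp
		have "task_count K ?q0 r j = r mod K" if "?b * ?q0 <= j" "j < ?b * ?q0 + ?q0" for j
		proof -
		 have "j div ?q0 = ?b" using that by (metis div_nat_eqI mult.commute mult_Suc_right add.commute)
		 thus ?thesis by (simp add: task_count_def)
		qed
		note tc = this
		have c3': "(ALL y. y ~: {11, 12, 15, 16} --> va (run w z c3 ?s) y = va ?s y) & (ALL q. q ~= 7 --> ar (run w z c3 ?s) q = ar ?s q) &
		 (ALL j<?nq. ar (run w z c3 ?s) 7 j = (if ?b * ?q0 <= j & j < ?b * ?q0 + ?q0 then R (Suc (r mod K)) j else ar ?s 7 j))"
		proof (rule run_q_collect[where ro = "r + 16" and e = eacc])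
		 show "ar ?s (r + 16) i < ?W" if "i < ?q0" for i using b' fY[OF that] FW qs_prop by simp
		 show "ar ?s 7 j < ?W" if "j < ?nq" for j using b' I that Rlt[OF that task_le] by (simp add: I_def)
		 show "7 < ?Z" "?nq < ?W" using small nq ZW by linarith+
		 show "?b * ?q0 + ?q0 < ?Z" using q0_le small bq nq by linarith
		 show "r + 16 < ?Z" using rK Kb small by linarith
		next
		 fix j and t :: ast
		 assume j: "?b * ?q0 <= j" "j < ?b * ?q0 + ?q0" "j < ?nq" and
			t: "ALL y. y ~: {11, 12, 15, 16} --> va t y = va ?s y" "va t 12 = j" "va t 15 = ar ?s (r + 16) (j - ?b * ?q0)"
			 "va t 16 = ar ?s 7 j" "ALL q. q ~= 7 --> ar t q = ar ?s q"
		 have "q_background s1 t" by (rule bg) (use t b' in auto)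
		 moreover have "va t 13 = r mod K" using t b' by simp
		 moreover have "va t 15 = F (map (%i. int (fa (r mod K) i)) [0..<n]) (fq (r mod K) j)"
		 proof -
			have "j - ?b * ?q0 < ?q0" using j by linarith
			from fY[OF this] show ?thesis using t(3) b' j by (simp add: qs_def A_def)
		 qed
		 moreover have "va t 16 = R (r mod K) j" using t(4) b' I j tc[OF j(1,2)] by (simp add: I_def)
		 ultimately show "eval w z t eacc = R (Suc (r mod K)) j" using eacc rm j t(2) by blast
		qed (use b' vs ZW in \<open>auto simp: c3_def\<close>)
		\<comment> \<open>Exactly the queries of the current batch advance by one kind.\<close>
		have ts: "task_count K ?q0 (Suc r) j = (if ?b * ?q0 <= j & j < ?b * ?q0 + ?q0 then Suc (r mod K) else task_count K ?q0 r j)" for j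
		proof -
		 have "(j div ?q0 = ?b) = (?b * ?q0 <= j & j < ?b * ?q0 + ?q0)" using q0(1) by (metis add.commute div_nat_eqI dividend_less_div_times div_times_less_eq_dividend mult.commute mult_Suc_right)
		 thus ?thesis using task_count_Suc[OF K, of ?q0 r j] tc by auto
		qed
		show "I (r + 1) (set_va 5 (r + 1) (run w z c3 ?s))" unfolding I_def using c3' I b' by (auto simp: I_def ts)
	 qed (use P X_lt in auto)
	qed
	have nqn: "?nq <= C * n" "inp ! 0 <= C * n" using sz order_trans[OF _ CN] by blast+
	have M: "X <= X * (lg n + 1) ^ e1" for X by simp
	show "length inp <= 2 ^ z & length out <= 2 ^ z & (\<forall>p\<in>q_vars. va s0 p < 2 ^ w) &
		va s0 6 <= cf * (lg n + 1) ^ e1 & cost (va (start z n inp)) (q_params a b K) <= cf * (n + 1) * (lg n + 1) ^ e1 &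
		(\<forall>c \<in> {c1, c2, c3, q_final}. cost (va s0) c <= cf * (n + 1) * (lg n + 1) ^ e1) &
		correct_pieces (gquery d valid F alp bet) q_vars w z n c1 c2 c3 q_final s0 out"
	proof (intro conjI)
	 show "length inp <= 2 ^ z" "length out <= 2 ^ z" using nq small sz unfolding pow2_def by linarith+
	 show "\<forall>p\<in>q_vars. va s0 p < 2 ^ w" using v0_lt by (simp add: pow2_def)
	 have "K * Kb <= kb" unfolding kb_def using Kb by (intro mult_left_mono) auto
	 also have "... <= cf" by (simp add: cf_def)
	 also note M
	 finally show "va s0 6 <= cf * (lg n + 1) ^ e1" using v0 by simp
	 have "cost (va (start z n inp)) (q_params a b K) <= 200" by (simp add: q_params_def)
	 also have "... <= cf * (n + 1)" by (simp add: cf_def)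
	 also note M
	 finally show "cost (va (start z n inp)) (q_params a b K) <= cf * (n + 1) * (lg n + 1) ^ e1" .
	 have 1: "cost (va s0) c1 <= cf * (n + 1) * (lg n + 1) ^ e1"
	 proof -
		have "cost (va s0) c1 <= a1 * (n + 1) * (lg n + 1) ^ e1" by (rule cost) (use v0 lgn nqn in simp_all)
		also have "... <= cf * (n + 1) * (lg n + 1) ^ e1" by (intro mult_right_mono) (auto simp: cf_def)
		finally show ?thesis .
	 qed
	 have qz: "?q0 * x <= a * n * x" for x using q0a by (intro mult_right_mono) auto
	 have 2: "cost (va s0) c2 <= cf * (n + 1)"
	 proof -
		have "cost (va s0) (put_query d 0 es ms) = cp" unfolding cp_def by (rule put_query_static(3))
		hence "cost (va s0) c2 <= 60 + n * (cost_exp ea + 20) + ?q0 * (cp + 20)" by (simp add: c2_def q_build_def v0 algebra_simps)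
		also have "... <= 60 + n * (cost_exp ea + 20) + a * n * (cp + 20)" by (intro add_left_mono qz)
		also have "... <= cf * (n + 1)" by (simp add: cf_def algebra_simps)
		finally show ?thesis .
	 qed
	 have 3: "cost (va s0) c3 <= cf * (n + 1)"
	 proof -
		have "cost (va s0) c3 <= 3 + ?q0 * (cost_exp eacc + 60)" by (simp add: c3_def q_collect_def v0 algebra_simps)
		also have "... <= 3 + a * n * (cost_exp eacc + 60)" by (intro add_left_mono qz)
		also have "... <= cf * (n + 1)" by (simp add: cf_def algebra_simps)
		finally show ?thesis .
	 qed
	 have 4: "cost (va s0) q_final <= cf * (n + 1)"
	 proof -
		have "cost (va s0) q_final <= 3 + ?nq * 20" by (simp add: q_final_def v0)
		also have "... <= 3 + C * n * 20" using nqn by simp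
		also have "... <= cf * (n + 1)" by (simp add: cf_def algebra_simps)
		finally show ?thesis .
	 qed
	 show "\<forall>c \<in> {c1, c2, c3, q_final}. cost (va s0) c <= cf * (n + 1) * (lg n + 1) ^ e1" using 1 order_trans[OF 2 M] order_trans[OF 3 M] order_trans[OF 4 M] by simp
	qed (rule pieces)
 qed (use size(2) wf wf_q_params wf_q_build wf_q_collect wf_q_final assigned_q_params in
	 \<open>auto simp: c2_def c3_def q_vars_def\<close>)
qed

section \<open>Rank compression\<close>

text \<open>Takes the place of the multiset of \<open>S\<close>: sorting preserves these counts for
  all \<open>x\<close>, and in a sorted sequence the count is the position searched for.\<close>

definition count_less :: "(nat => nat) => nat => nat => nat => nat" where
 "count_less S a b x = (\<Sum>p\<in>{a..<b}. of_bool (S p < x))"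

lemma count_less_empty [simp]: "count_less S a a x = 0"
 by (simp add: count_less_def)

lemma count_less_Suc: "a <= b ==> count_less S a (Suc b) x = count_less S a b x + of_bool (S b < x)"
 by (simp add: count_less_def)

lemma count_less_append: "a <= b ==> b <= c ==> count_less S a b x + count_less S b c x = count_less S a c x"
 unfolding count_less_def by (rule sum.atLeastLessThan_concat)

lemma count_less_cong: "(!!p. a <= p ==> p < b ==> S p = S' p) ==> count_less S a b x = count_less S' a b x"
 unfolding count_less_def by (intro sum.cong) auto

text \<open>This is \<open>2 ^ (w - 1)\<close>. It is computed from the largest word because a
  program does not know \<open>w\<close>.\<close>

definition TOP :: aexp where
 "TOP = ((Num 0 [-] Num 1) [>>] Num 1) [+] Num 1"

text \<open>Adding \<open>2 ^ (w - 1)\<close> modulo \<open>2 ^ w\<close> turns two's complement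
  into an unsigned number of the same order.\<close>

definition KEY :: aexp where
 "KEY = Get (Num 0) (Num 2 [+] Var 11) [+] TOP"

text \<open>The padding is the largest word, which is not smaller than any key and so never enters a
  rank.\<close>

definition c_fill :: cmd where
 "c_fill = For 11 17 (Put (Num 2) (Var 11) (Cnd (Var 11 [<] Var 8) KEY (Num 0 [-] Num 1)))"

text \<open>One output per step, so that a whole pass is a single loop of fixed length. Variables 19
  and 20 point into the two halves of the current block and are reset when it begins, 22 is the
  length of a half, 23 the offset in the block and 24 its start. Ties are taken from the
  left.\<close>

definition merge_step :: cmd where
 "merge_step =
	Asg 23 (Var 11 [mod] (Var 22 [+] Var 22)) ;;
	Ite (Var 23) Nop (Asg 19 (Var 11) ;; Asg 20 (Var 11 [+] Var 22)) ;;
	Asg 24 (Var 11 [-] Var 23) ;;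
	Ite (Cnd (Var 19 [<] Var 24 [+] Var 22)
		 (Cnd (Var 20 [<] Var 24 [+] Var 22 [+] Var 22)
			(Cnd (Get (Num 2) (Var 20) [<] Get (Num 2) (Var 19)) (Num 0) (Num 1)) (Num 1)) (Num 0))
	 (Put (Num 3) (Var 11) (Get (Num 2) (Var 19)) ;; Asg 19 (Var 19 [+] Num 1))
	 (Put (Num 3) (Var 11) (Get (Num 2) (Var 20)) ;; Asg 20 (Var 20 [+] Num 1))"

definition c_pass :: cmd where
 "c_pass = Asg 22 (Num 1 [<<] Var 18) ;; For 11 17 merge_step ;;
	For 11 17 (Put (Num 2) (Var 11) (Get (Num 3) (Var 11)))"

text \<open>Binary search with steps \<open>2 ^ (L - 1)\<close>, ..., 2, 1 for the number of smaller
  keys, where \<open>L\<close> is in variable 4; this number is the rank.\<close>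

definition c_search :: cmd where
 "c_search = For 11 8 (Asg 21 KEY ;; Asg 19 (Num 0) ;;
	For 18 4 (Asg 22 (Num 1 [<<] (Var 4 [-] Num 1 [-] Var 18)) ;;
	 Ite (Get (Num 2) (Var 19 [+] Var 22 [-] Num 1) [<] Var 21) (Asg 19 (Var 19 [+] Var 22)) Nop) ;;
	Put (Num 1) (Var 11) (Var 19))"

definition c_compress :: cmd where
 "c_compress = c_fill ;; For 18 4 c_pass ;; c_search"

abbreviation compress_vars :: "nat set" where
 "compress_vars \<equiv> {11, 18, 19, 20, 21, 22, 23, 24}"

section \<open>Correctness of merge sort\<close>

definition sorted_blocks :: "nat => nat => (nat => nat) => bool" where
 "sorted_blocks m t S \<longleftrightarrow> (ALL p q. p < q --> q < t --> p div m = q div m --> S p <= S q)"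

text \<open>
 The state of merging two halves of length \<open>h\<close> of the block starting at \<open>b\<close>: the outputs \<open>T\<close> up
 to position \<open>t\<close> have been taken from the left half up to \<open>i\<close> and from the right half up to \<open>j\<close>.
\<close>

definition merging :: "nat => nat => nat => nat => nat => (nat => nat) => (nat => nat) => bool" where
 "merging h b t i j S T \<longleftrightarrow> b <= i & i <= b + h & b + h <= j & j <= b + h + h & i + j = b + h + t &
	(ALL x. count_less T 0 t x = count_less S 0 b x + count_less S b i x + count_less S (b + h) j x) &
	(ALL p q. b <= p --> p < t --> (i <= q & q < b + h) | (j <= q & q < b + h + h) --> T p <= S q)"

text \<open>A block aligned at multiples of \<open>2 * h\<close> consists of two blocks aligned at
  multiples of \<open>h\<close>, so sortedness of the shorter blocks applies to its halves.\<close>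

lemma block_eqs:
 fixes b p :: nat
 assumes "2 * h dvd b" "0 < h" "b <= p" "p < b + h + h"
 shows "p div (2 * h) = b div (2 * h)" "p < b + h ==> p div h = b div h" "b + h <= p ==> p div h = Suc (b div h)"
proof -
 from assms(1) obtain c where c: "b = 2 * h * c" by (elim dvdE)
 obtain r where r: "p = b + r" "r < h + h" using assms(3,4) by (metis add.assoc le_Suc_ex nat_add_left_cancel_less)
 have bh: "b div (2 * h) = c" "b div h = 2 * c" using assms(2) by (simp_all add: c)
 show "p div (2 * h) = b div (2 * h)" unfolding bh by (rule div_nat_eqI) (use c r in auto)
 show "p < b + h ==> p div h = b div h" unfolding bh by (rule div_nat_eqI) (use c r in auto)
 show "b + h <= p ==> p div h = Suc (b div h)" unfolding bh by (rule div_nat_eqI) (use c r in \<open>auto simp: algebra_simps\<close>)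
qed

lemma merging_step:
 assumes m: "merging h b t i j S T" and b: "2 * h dvd b" "0 < h" "b <= t" "t < b + h + h"
	and S: "sorted_blocks h P S" "b + h + h <= P" and T: "sorted_blocks (2 * h) t T"
	and c: "left \<longleftrightarrow> i < b + h & (j < b + h + h --> \<not> S j < S i)"
	and T': "T' = T(t := (if left then S i else S j))"
 shows "merging h b (Suc t) (if left then Suc i else i) (if left then j else Suc j) S T' &
	sorted_blocks (2 * h) (Suc t) T' & (\<not> left --> j < b + h + h)"
proof -
 from m have m': "b <= i" "i <= b + h" "b + h <= j" "j <= b + h + h" "i + j = b + h + t"
	"!!x. count_less T 0 t x = count_less S 0 b x + count_less S b i x + count_less S (b + h) j x"
	"!!p q. b <= p ==> p < t ==> (i <= q & q < b + h) | (j <= q & q < b + h + h) ==> T p <= S q" unfolding merging_def by blast+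
 have right: "j < b + h + h" if "\<not> left" using that c m' b by auto
 have le1: "S i <= S q" if "i <= q" "q < b + h" for q
 proof (cases "i = q")
	case False
	have "i div h = q div h" using block_eqs(2)[OF b(1,2), of i] block_eqs(2)[OF b(1,2), of q] that m' by simp
	with False that S show ?thesis unfolding sorted_blocks_def by auto
 qed simp
 have le2: "S j <= S q" if "j <= q" "q < b + h + h" for q
 proof (cases "j = q")
	case False
	have "j div h = q div h" using block_eqs(3)[OF b(1,2), of j] block_eqs(3)[OF b(1,2), of q] that m' by simp
	with False that S show ?thesis unfolding sorted_blocks_def by auto
 qed simp
 let ?v = "if left then S i else S j"
 \<comment> \<open>The value taken is minimal among those that remain, in its own half by sortedness
   and in the other by the comparison.\<close>
 have vle: "?v <= S q" if "((if left then Suc i else i) <= q & q < b + h) | ((if left then j else Suc j) <= q & q < b + h + h)" for q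
 proof (cases left)
	case True
	hence "j < b + h + h ==> S i <= S j" using c by auto
	thus ?thesis using True that le1[of q] le2[of q] by force
 next
	case False
	hence "i < b + h ==> S j <= S i" using c right by auto
	thus ?thesis using False that le1[of q] le2[of q] by force
 qed
 have Tle: "T p <= ?v" if "b <= p" "p < t" for p using m'(7)[OF that, of "if left then i else j"] c right by auto
 have "count_less T' 0 (Suc t) x = count_less T 0 t x + of_bool (?v < x)" for x using count_less_cong[of 0 t T' T x] by (simp add: count_less_Suc T')
 moreover have "count_less S b (if left then Suc i else i) x + count_less S (b + h) (if left then j else Suc j) x =
	 count_less S b i x + count_less S (b + h) j x + of_bool (?v < x)" for x using m' by (simp add: count_less_Suc)
 ultimately have "ALL x. count_less T' 0 (Suc t) x = count_less S 0 b x + count_less S b (if left then Suc i else i) x +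
	 count_less S (b + h) (if left then j else Suc j) x" using m'(6) by (simp add: add.assoc)
 moreover have "ALL p q. b <= p --> p < Suc t --> ((if left then Suc i else i) <= q & q < b + h) |
	 ((if left then j else Suc j) <= q & q < b + h + h) --> T' p <= S q"
 proof (intro allI impI)
	fix p q assume p: "b <= p" "p < Suc t" and q: "((if left then Suc i else i) <= q & q < b + h) |
	 ((if left then j else Suc j) <= q & q < b + h + h)"
	show "T' p <= S q"
	proof (cases "p = t")
	 case True
	 thus ?thesis using vle[OF q] by (simp add: T')
	next
	 case False
	 have "(i <= q & q < b + h) | (j <= q & q < b + h + h)" using q by (auto split: if_splits)
	 from m'(7)[OF p(1) _ this] False p show ?thesis by (simp add: T')
	qed
 qed
 moreover have "sorted_blocks (2 * h) (Suc t) T'" unfolding sorted_blocks_def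
 proof (intro allI impI)
	fix p q assume pq: "p < q" "q < Suc t" "p div (2 * h) = q div (2 * h)"
	show "T' p <= T' q"
	proof (cases "q = t")
	 case True
	 hence "p div (2 * h) = b div (2 * h)" using pq block_eqs(1)[OF b] by simp
	 hence "b <= p" using b(1) by (metis div_times_less_eq_dividend dvd_div_mult_self)
	 thus ?thesis using True pq Tle by (simp add: T')
	next
	 case False
	 thus ?thesis using pq T by (simp add: sorted_blocks_def T')
	qed
 qed
 ultimately show ?thesis using m' c right b by (auto simp: merging_def)
qed

lemma merge_pass:
 fixes s :: ast
 assumes v: "va s 17 = P" "va s 22 = h" "0 < h" "2 * h dvd P"
	and bounds: "4 * P <= pow2 z" "8 <= pow2 z" "pow2 z <= pow2 w"
	and S: "S = ar s 2" "!!p. p < P ==> S p < pow2 w" "sorted_blocks h P S"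
 shows "EX s'. run w z (For 11 17 merge_step) s = s' & (ALL y. y ~: {11, 19, 20, 23, 24} --> va s' y = va s y) &
	(ALL q. q ~= 3 --> ar s' q = ar s q) & sorted_blocks (2 * h) P (ar s' 3) &
	(ALL x. count_less (ar s' 3) 0 P x = count_less S 0 P x) & (ALL p<P. ar s' 3 p < pow2 w)"
proof -
 \<comment> \<open>At a block boundary only the counts are recorded: the pointers are stale there,
   and the next step resets them.\<close>
 let ?I = "%t s'. (ALL y. y ~: {11, 19, 20, 23, 24} --> va s' y = va s y) & (ALL q. q ~= 3 --> ar s' q = ar s q) &
	sorted_blocks (2 * h) t (ar s' 3) & (ALL p<t. ar s' 3 p < pow2 w) &
	(if 2 * h dvd t then ALL x. count_less (ar s' 3) 0 t x = count_less S 0 t x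
	else merging h (t - t mod (2 * h)) t (va s' 19) (va s' 20) S (ar s' 3))"
 have "EX s'. ?I (va s 17) s' & run w z (For 11 17 merge_step) s = set_va 11 (va s 17) s'"
 proof (rule run_For_inv)
	show "?I 0 s" by (simp add: sorted_blocks_def)
 next
	fix t and s1 :: ast assume t: "t < va s 17" and I: "?I t s1"
	define b where "b = t - t mod (2 * h)"
	have b: "2 * h dvd b" "b <= t" "t < b + h + h" "t mod (2 * h) = t - b"
	proof -
	 have "t mod (2 * h) < 2 * h" using v by simp
	 moreover have "t mod (2 * h) <= t" by simp
	 ultimately show "t < b + h + h" "b <= t" "t mod (2 * h) = t - b" unfolding b_def by linarith+
	 show "2 * h dvd b" unfolding b_def by (rule dvd_minus_mod)
	qed
	have bP: "b + h + h <= P"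
	proof -
	 obtain x y where xy: "b = 2 * h * x" "P = 2 * h * y" using b(1) v(4) by (elim dvdE)
	 moreover have "b < P" using b t v by linarith
	 ultimately have "x + 1 <= y" by (cases "y <= x") (auto simp: not_le dest: mult_le_mono2[of _ _ "2 * h"])
	 hence "2 * h * (x + 1) <= 2 * h * y" by (rule mult_le_mono2)
	 thus ?thesis using xy by (simp add: algebra_simps)
	qed
	\<comment> \<open>The pointers after the reset that takes place at the start of a block.\<close>
	define i j where "i = (if t mod (2 * h) = 0 then t else va s1 19)" and "j = (if t mod (2 * h) = 0 then t + h else va s1 20)"
	have mg: "merging h b t i j S (ar s1 3)"
	proof (cases "t mod (2 * h) = 0")
	 case True
	 hence "b = t" "2 * h dvd t" by (auto simp: b_def)
	 thus ?thesis using I True by (auto simp: merging_def i_def j_def)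
	next
	 case False
	 hence "\<not> 2 * h dvd t" by auto
	 thus ?thesis using I False by (auto simp: i_def j_def b_def)
	qed
	hence ij: "i <= b + h" "j <= b + h + h" "b <= i" "b + h <= j" by (auto simp: merging_def)
	define s2 where "s2 = set_va 23 (t mod (2 * h)) (set_va 11 t s1)"
	define s3 where "s3 = (if t mod (2 * h) = 0 then set_va 20 j (set_va 19 i s2) else s2)"
	define s4 where "s4 = set_va 24 b s3"
	define left where "left \<longleftrightarrow> i < b + h & (j < b + h + h --> \<not> S j < S i)"
	have tP: "t < P" using t v by simp
	have w: "t < pow2 w" "h < pow2 w" "h + h < pow2 w" "t + h < pow2 w" "t mod (2 * h) < pow2 w" "i < pow2 w" "j < pow2 w"
	 "b < pow2 w" "b + h < pow2 w" "b + h + h < pow2 w" "i < pow2 z" "j < pow2 z" "t < pow2 z"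
	 "i + 1 < pow2 w" "j + 1 < pow2 w" "2 < pow2 w" "3 < pow2 w" "1 < pow2 w" "0 < pow2 w" "2 < pow2 z" "3 < pow2 z" using bP bounds tP ij b v by linarith+
	have v1: "va s1 22 = h" using I v by simp
	have r2: "run w z (Asg 23 (Var 11 [mod] (Var 22 [+] Var 22))) (set_va 11 t s1) = s2" using v1 w by (simp add: ev s2_def mult_2)
	have r3: "run w z (Ite (Var 23) Nop (Asg 19 (Var 11) ;; Asg 20 (Var 11 [+] Var 22))) s2 = s3" using v1 w by (simp add: ev s2_def s3_def i_def j_def)
	have v3: "va s3 11 = t" "va s3 23 = t mod (2 * h)" "va s3 19 = i" "va s3 20 = j" "va s3 22 = h" using v1 by (auto simp: s3_def s2_def i_def j_def)
	have r4: "run w z (Asg 24 (Var 11 [-] Var 23)) s3 = s4" using v3 w b by (simp add: ev s4_def)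
	have v4: "va s4 11 = t" "va s4 19 = i" "va s4 20 = j" "va s4 22 = h" "va s4 24 = b" "ar s4 = ar s1" using v3 by (auto simp: s4_def s3_def s2_def)
	have ar4: "ar s4 2 = S" using I S v4 by simp
	have Sij: "i < b + h ==> S i < pow2 w" "j < b + h + h ==> S j < pow2 w" using S(2) bP by auto
	have c: "(eval w z s4 (Cnd (Var 19 [<] Var 24 [+] Var 22)
		 (Cnd (Var 20 [<] Var 24 [+] Var 22 [+] Var 22)
			(Cnd (Get (Num 2) (Var 20) [<] Get (Num 2) (Var 19)) (Num 0) (Num 1)) (Num 1)) (Num 0)) ~= 0) = left" using w v4 ar4 Sij by (auto simp: ev left_def)
	note ms = merging_step[OF mg b(1) v(3) b(2,3) S(3) bP _ left_def refl]
	have sb: "sorted_blocks (2 * h) t (ar s1 3)" using I by blast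
	note ms = ms[OF sb]
	define s5 where "s5 = (if left then set_va 19 (i + 1) (set_ar 3 t (S i) s4) else set_va 20 (j + 1) (set_ar 3 t (S j) s4))"
	have r5: "run w z merge_step (set_va 11 t s1) = s5"
	proof -
	 have "run w z (Put (Num 3) (Var 11) (Get (Num 2) (Var 19)) ;; Asg 19 (Var 19 [+] Num 1)) s4 = s5" if left using that w v4 ar4 Sij by (simp add: ev run_Put s5_def left_def)
	 moreover have "run w z (Put (Num 3) (Var 11) (Get (Num 2) (Var 20)) ;; Asg 20 (Var 20 [+] Num 1)) s4 = s5" if "\<not> left" using that w v4 ar4 Sij ms by (simp add: ev run_Put s5_def)
	 ultimately show ?thesis unfolding merge_step_def using r2 r3 r4 c by (auto simp del: run.simps(2))
	qed
	have a5: "ar s5 3 = (ar s1 3)(t := if left then S i else S j)" "va s5 19 = (if left then Suc i else i)"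
		"va s5 20 = (if left then j else Suc j)" using v4 by (auto simp: s5_def)
	show "?I (Suc t) (run w z merge_step (set_va 11 t s1))" unfolding r5
	proof (intro conjI)
	 show "ALL y. y ~: {11, 19, 20, 23, 24} --> va s5 y = va s y" using I by (auto simp: s5_def s4_def s3_def s2_def)
	 show "ALL q. q ~= 3 --> ar s5 q = ar s q" using I v4 by (auto simp: s5_def)
	 show "sorted_blocks (2 * h) (Suc t) (ar s5 3)" using ms a5 by simp
	 show "ALL p<Suc t. ar s5 3 p < pow2 w" using I a5 Sij ms by (auto simp: less_Suc_eq left_def)
	 show "if 2 * h dvd Suc t then ALL x. count_less (ar s5 3) 0 (Suc t) x = count_less S 0 (Suc t) x
		else merging h (Suc t - Suc t mod (2 * h)) (Suc t) (va s5 19) (va s5 20) S (ar s5 3)"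
	 proof (cases "2 * h dvd Suc t")
		case True
		have st: "Suc t = b + h + h"
		proof -
		 have "2 * h dvd Suc t - b" using True b(1) by (rule dvd_diff_nat)
		 moreover have "0 < Suc t - b" "Suc t - b <= 2 * h" using b by linarith+
		 ultimately have "Suc t - b = 2 * h" by (meson dvd_imp_le le_antisym)
		 thus ?thesis using b by linarith
		qed
		from ms have m5: "merging h b (Suc t) (va s5 19) (va s5 20) S (ar s5 3)" using a5 by simp
		hence "va s5 19 = b + h" "va s5 20 = b + h + h" using st unfolding merging_def by linarith+
		hence "count_less (ar s5 3) 0 (Suc t) x = count_less S 0 b x + count_less S b (b + h) x + count_less S (b + h) (b + h + h) x" for x using m5 unfolding merging_def by simp
		hence "count_less (ar s5 3) 0 (Suc t) x = count_less S 0 (Suc t) x" for x unfolding st by (simp add: count_less_append)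
		with True show ?thesis by simp
	 next
		case False
		have "Suc t - Suc t mod (2 * h) = b"
		proof -
		 have "Suc t ~= b + h + h" using False b(1) by auto
		 hence "Suc t < b + h + h" using b by linarith
		 hence "Suc t div (2 * h) = b div (2 * h)" using block_eqs(1)[OF b(1) v(3), of "Suc t"] b by simp
		 thus ?thesis using b(1) by (simp add: minus_mod_eq_div_mult)
		qed
		with False ms a5 show ?thesis by simp
	 qed
	qed
 qed
 then obtain s' where s': "?I P s'" "run w z (For 11 17 merge_step) s = set_va 11 P s'" using v by auto
 hence "ALL x. count_less (ar s' 3) 0 P x = count_less S 0 P x" using v(4) by simp
 with s' show ?thesis by (intro exI[of _ "set_va 11 P s'"]) auto
qed

lemma run_c_pass:
 fixes s :: ast
 assumes v: "va s 17 = pow2 L" "va s 18 = l" "l < L"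
	and bounds: "4 * pow2 L <= pow2 z" "8 <= pow2 z" "pow2 z <= pow2 w" "L < pow2 w"
	and S: "!!p. p < pow2 L ==> ar s 2 p < pow2 w" "sorted_blocks (pow2 l) (pow2 L) (ar s 2)"
	and s': "s' = run w z c_pass s"
 shows "(ALL y. y ~: {11, 19, 20, 22, 23, 24} --> va s' y = va s y) &
	(ALL q. q ~= 2 --> q ~= 3 --> ar s' q = ar s q) & sorted_blocks (pow2 (Suc l)) (pow2 L) (ar s' 2) &
	(ALL x. count_less (ar s' 2) 0 (pow2 L) x = count_less (ar s 2) 0 (pow2 L) x) & (ALL p<pow2 L. ar s' 2 p < pow2 w)"
proof -
 let ?P = "pow2 L" and ?h = "pow2 l"
 have "?h <= ?P" using v by (intro pow2_mono) simp
 hence w: "?h < pow2 w" "1 < pow2 w" "l < pow2 w" "2 < pow2 w" "3 < pow2 w" "3 < pow2 z" "2 < pow2 z" using bounds v by linarith+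
 define s1 where "s1 = set_va 22 ?h s"
 have r1: "run w z (Asg 22 (Num 1 [<<] Var 18)) s = s1" using v w by (simp add: ev s1_def)
 have "2 * ?h = pow2 (Suc l)" by (simp add: pow2_def)
 moreover have "pow2 (Suc l) dvd ?P" unfolding pow2_def using v by (intro le_imp_power_dvd) simp
 ultimately obtain s2 where s2: "run w z (For 11 17 merge_step) s1 = s2" "ALL y. y ~: {11, 19, 20, 23, 24} --> va s2 y = va s1 y"
	"ALL q. q ~= 3 --> ar s2 q = ar s1 q" "sorted_blocks (pow2 (Suc l)) ?P (ar s2 3)"
	"ALL x. count_less (ar s2 3) 0 ?P x = count_less (ar s1 2) 0 ?P x" "ALL p<?P. ar s2 3 p < pow2 w" using merge_pass[of s1 ?P ?h z w "ar s 2"] v bounds S by (auto simp: s1_def pow2_def[of l])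
 have r3: "run w z (For 11 17 (Put (Num 2) (Var 11) (Get (Num 3) (Var 11)))) s2 = set_va 11 ?P (fill 2 0 ?P (ar s2 3) s2)"
 proof (rule run_fill)
	show "va s2 17 = ?P" using s2(2) v by (simp add: s1_def)
	show "0 + ?P <= pow2 z" using bounds by linarith
	fix i and t :: ast assume t: "i < ?P" "ALL y. y ~= 11 --> va t y = va s2 y" "va t 11 = i" "ALL q. q ~= 2 --> ar t q = ar s2 q"
	have "i < pow2 z" "i < pow2 w" using t bounds by linarith+
	thus "eval w z t (Num 2) = 2 & eval w z t (Var 11) = 0 + i & eval w z t (Get (Num 3) (Var 11)) = ar s2 3 i" using t w s2(6) by (simp add: ev)
 qed (rule w)
 have s'_eq: "s' = set_va 11 ?P (fill 2 0 ?P (ar s2 3) s2)" using r1 s2(1) r3 unfolding s' c_pass_def by simp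
 have "sorted_blocks (pow2 (Suc l)) ?P (ar s' 2)" using s2(4) unfolding s'_eq sorted_blocks_def by auto
 moreover have "count_less (ar s' 2) 0 ?P x = count_less (ar s2 3) 0 ?P x" for x by (rule count_less_cong) (simp add: s'_eq)
 ultimately show ?thesis using s2 by (auto simp: s'_eq s1_def)
qed

lemma run_sort:
 fixes s :: ast
 assumes v: "va s 17 = pow2 L" "va s 4 = L"
	and bounds: "4 * pow2 L <= pow2 z" "8 <= pow2 z" "pow2 z <= pow2 w" "L < pow2 w"
	and S: "!!p. p < pow2 L ==> ar s 2 p < pow2 w"
	and s': "s' = run w z (For 18 4 c_pass) s"
 shows "(ALL y. y ~: compress_vars --> va s' y = va s y) &
	(ALL q. q ~= 2 --> q ~= 3 --> ar s' q = ar s q) & (ALL p q. p < q --> q < pow2 L --> ar s' 2 p <= ar s' 2 q) &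
	(ALL x. count_less (ar s' 2) 0 (pow2 L) x = count_less (ar s 2) 0 (pow2 L) x) & (ALL p<pow2 L. ar s' 2 p < pow2 w)"
proof -
 let ?I = "%l t. (ALL y. y ~: compress_vars --> va t y = va s y) &
	(ALL q. q ~= 2 --> q ~= 3 --> ar t q = ar s q) & sorted_blocks (pow2 l) (pow2 L) (ar t 2) &
	(ALL x. count_less (ar t 2) 0 (pow2 L) x = count_less (ar s 2) 0 (pow2 L) x) & (ALL p<pow2 L. ar t 2 p < pow2 w)"
 have "EX t. ?I (va s 4) t & run w z (For 18 4 c_pass) s = set_va 18 (va s 4) t"
 proof (rule run_For_inv)
	show "?I 0 s" using S by (simp add: sorted_blocks_def pow2_def)
 next
	fix l and t :: ast assume l: "l < va s 4" and I: "?I l t"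
	have p: "(ALL y. y ~: {11, 19, 20, 22, 23, 24} --> va (run w z c_pass (set_va 18 l t)) y = va (set_va 18 l t) y) &
	 (ALL q. q ~= 2 --> q ~= 3 --> ar (run w z c_pass (set_va 18 l t)) q = ar (set_va 18 l t) q) &
	 sorted_blocks (pow2 (Suc l)) (pow2 L) (ar (run w z c_pass (set_va 18 l t)) 2) &
	 (ALL x. count_less (ar (run w z c_pass (set_va 18 l t)) 2) 0 (pow2 L) x = count_less (ar (set_va 18 l t) 2) 0 (pow2 L) x) &
	 (ALL p<pow2 L. ar (run w z c_pass (set_va 18 l t)) 2 p < pow2 w)" by (rule run_c_pass) (use I l v bounds in auto)
	thus "?I (Suc l) (run w z c_pass (set_va 18 l t))" using I by auto
 qed
 then obtain t where t: "?I L t" "s' = set_va 18 L t" using v s' by auto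
 have "ar t 2 p <= ar t 2 q" if "p < q" "q < pow2 L" for p q using t(1) that by (simp add: sorted_blocks_def)
 with t show ?thesis by auto
qed

text \<open>In a sorted sequence the entries below \<open>x\<close> form an initial segment.\<close>

lemma sorted_less_iff:
 assumes "!!p q. p < q ==> q < P ==> S p <= S q" "p < P"
 shows "S p < x \<longleftrightarrow> p < count_less S 0 P x"
proof -
 let ?X = "{q. q < P & S q < x}"
 have "{0..<P} \<inter> {q. S q < x} = ?X" by auto
 hence c: "count_less S 0 P x = card ?X" unfolding count_less_def by simp
 have mono: "S a <= S b" if "a <= b" "b < P" for a b using assms(1)[of a b] that by (cases "a = b") auto
 show ?thesis
 proof
	assume "S p < x"
	hence "{..p} <= ?X" using mono[of _ p] assms(2) by (auto intro: le_less_trans)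
	hence "card {..p} <= card ?X" by (rule card_mono[rotated]) simp
	thus "p < count_less S 0 P x" by (simp add: c)
 next
	assume p: "p < count_less S 0 P x"
	show "S p < x"
	proof (rule ccontr)
	 assume "\<not> S p < x"
	 have "?X <= {..<p}"
	 proof -
		have "q < p" if "q < P" "S q < x" for q
		proof (rule ccontr)
		 assume "\<not> q < p"
		 hence "S p <= S q" using mono[of p q] that by simp
		 with that \<open>\<not> S p < x\<close> show False by linarith
		qed
		thus ?thesis by auto
	 qed
	 hence "card ?X <= card {..<p}" by (rule card_mono[rotated]) simp
	 with p show False by (simp add: c)
	qed
 qed
qed

section \<open>Keys and ranks\<close>

lemma ev_max: "1 < pow2 w ==> eval w z s (Num 0 [-] Num 1) = pow2 w - 1"
proof -
 assume "1 < pow2 w"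
 hence "eval w z s (Num 1) = 1" "eval w z s (Num 0) = 0" by (simp_all add: ev_Num)
 thus ?thesis by (simp add: eval.simps(3) pow2_def take_bit_minus_one_eq_mask mask_eq_exp_minus_1 nat_diff_distrib nat_power_eq)
qed

lemma ev_TOP: "1 < pow2 w ==> eval w z s TOP = pow2 (w - 1)"
proof -
 assume w: "1 < pow2 w"
 then obtain v where v: "w = Suc v" by (cases w) (auto simp: pow2_def)
 have "(pow2 w - 1) div pow2 1 = pow2 v - 1" by (simp add: v pow2_def)
 hence "eval w z s ((Num 0 [-] Num 1) [>>] Num 1) = pow2 v - 1" using w ev_max[OF w] by (simp add: ev_Shr ev_Num)
 moreover have "pow2 v - 1 + 1 = pow2 v" "pow2 v < pow2 w" by (simp_all add: pow2_def v)
 ultimately show ?thesis unfolding TOP_def using w v by (subst ev_Add) (simp_all add: ev_Num)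
qed

definition key :: "nat => int => nat" where
 "key w a = nat (a + 2 ^ (w - 1))"

lemma ev_KEY:
 assumes "1 < pow2 w" "fits_word w a" "ar s 0 (2 + va s 11) = encode_int w a" "2 + va s 11 < pow2 z" "pow2 z <= pow2 w"
 shows "eval w z s KEY = key w a"
proof -
 obtain v where v: "w = Suc v" using assms by (cases w) (auto simp: pow2_def)
 have "encode_int w a < pow2 w" unfolding encode_int_def pow2_def by (simp add: nat_less_iff)
 hence "eval w z s (Get (Num 0) (Num 2 [+] Var 11)) = encode_int w a" using assms by (simp add: ev)
 hence "eval w z s KEY = take_bit w (encode_int w a + pow2 (w - 1))" unfolding KEY_def using ev_TOP[OF assms(1)] by (simp add: eval.simps(3))
 also have "... = key w a"
 proof -
	\<comment> \<open>Modulo \<open>2 ^ w\<close> the code of \<open>a\<close> is \<open>a\<close>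
	  itself, and the shifted value is in range because \<open>a\<close> fits into a word.\<close>
	have "int (take_bit w (encode_int w a + pow2 (w - 1))) = take_bit w (take_bit w a + 2 ^ v)" by (simp add: encode_int_def pow2_def v flip: take_bit_of_nat)
	also have "... = take_bit w (a + 2 ^ v)" by (metis take_bit_add take_bit_of_exp mod_add_left_eq take_bit_eq_mod)
	also have "... = a + 2 ^ v" using assms(2) unfolding fits_word_def v by (intro take_bit_int_eq_self) auto
	finally show ?thesis unfolding key_def v by simp
 qed
 finally show ?thesis .
qed

lemma key_less: "fits_word w a ==> fits_word w b ==> 1 < pow2 w ==> key w a < key w b \<longleftrightarrow> a < b"
 unfolding key_def fits_word_def pow2_def by (cases w) auto

lemma key_lt: "fits_word w a ==> 1 < pow2 w ==> key w a < pow2 w"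
 unfolding key_def fits_word_def pow2_def by (cases w) (auto simp: nat_less_iff)

text \<open>Equal entries share a rank, so ranks preserve equality as well as order.\<close>

definition rank :: "int list => nat => nat" where
 "rank A i = card {j. j < length A & A ! j < A ! i}"

lemma rank_less: "i < length A ==> rank A i < length A"
proof -
 assume "i < length A"
 hence "{j. j < length A & A ! j < A ! i} \<subset> {..<length A}" by auto
 from psubset_card_mono[OF _ this] show ?thesis by (simp add: rank_def)
qed

lemma rank_less_iff:
 assumes "i < length A" "j < length A"
 shows "rank A i < rank A j \<longleftrightarrow> A ! i < A ! j"
proof -
 have *: "rank A i < rank A j" if "A ! i < A ! j" "i < length A" for i j
 proof -
	have "{k. k < length A & A ! k < A ! i} \<subset> {k. k < length A & A ! k < A ! j}" using that by auto
	from psubset_card_mono[OF _ this] show ?thesis by (simp add: rank_def)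
 qed
 have "rank A i = rank A j" if "A ! i = A ! j" using that by (simp add: rank_def)
 with *[of i j] *[of j i] assms show ?thesis by (cases "A ! i" "A ! j" rule: linorder_cases) auto
qed

lemma rank_eq_iff:
 assumes "i < length A" "j < length A"
 shows "rank A i = rank A j \<longleftrightarrow> A ! i = A ! j"
 using rank_less_iff[OF assms] rank_less_iff[OF assms(2,1)] by (metis less_irrefl linorder_neqE)

lemma run_compress:
 fixes s :: ast
 assumes v: "va s 17 = pow2 L" "va s 4 = L" "va s 8 = length A"
	and bounds: "4 * pow2 L <= pow2 z" "8 <= pow2 z" "pow2 z <= pow2 w" "length A + 2 <= pow2 L"
	and A: "!!i. i < length A ==> fits_word w (A ! i)" "!!i. i < length A ==> ar s 0 (2 + i) = encode_int w (A ! i)"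
	and s': "s' = run w z c_compress s"
 shows "(ALL y. y ~: compress_vars --> va s' y = va s y) & (ALL q. q ~: {1, 2, 3} --> ar s' q = ar s q) &
	(ALL i<length A. ar s' 1 i = rank A i)"
proof -
 let ?P = "pow2 L" and ?n = "length A"
 have "L < pow2 L" by (simp add: pow2_def)
 hence w: "L < pow2 w" "1 < pow2 w" "2 < pow2 w" "3 < pow2 w" "2 < pow2 z" "1 < pow2 z" "?n < pow2 w" "?P < pow2 w" using bounds by linarith+
 let ?S = "%p. if p < ?n then key w (A ! p) else pow2 w - 1"
 define s1 where "s1 = set_va 11 ?P (fill 2 0 ?P ?S s)"
 have r1: "run w z c_fill s = s1" unfolding c_fill_def s1_def
 proof (rule run_fill)
	show "0 + ?P <= pow2 z" using bounds by linarith
	fix i and t :: ast assume t: "i < ?P" "ALL y. y ~= 11 --> va t y = va s y" "va t 11 = i" "ALL q. q ~= 2 --> ar t q = ar s q"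
	have i: "i < pow2 w" "2 + i < pow2 z" using t bounds by linarith+
	have "eval w z t KEY = key w (A ! i)" if "i < ?n" by (rule ev_KEY) (use A that t w i bounds in auto)
	thus "eval w z t (Num 2) = 2 & eval w z t (Var 11) = 0 + i &
		eval w z t (Cnd (Var 11 [<] Var 8) KEY (Num 0 [-] Num 1)) = ?S i" using t w i v ev_max[OF w(2)] by (simp add: ev_Num ev_Var ev_Less eval.simps(5) del: One_nat_def)
 qed (use v w in auto)
 define s2 where "s2 = run w z (For 18 4 c_pass) s1"
 have s2: "(ALL y. y ~: compress_vars --> va s2 y = va s1 y) &
	(ALL q. q ~= 2 --> q ~= 3 --> ar s2 q = ar s1 q) & (ALL p q. p < q --> q < ?P --> ar s2 2 p <= ar s2 2 q) &
	(ALL x. count_less (ar s2 2) 0 ?P x = count_less (ar s1 2) 0 ?P x) & (ALL p<?P. ar s2 2 p < pow2 w)" by (rule run_sort) (use v bounds w A key_lt in \<open>auto simp: s1_def s2_def\<close>)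
 have cnt: "count_less (ar s2 2) 0 ?P (key w (A ! i)) = rank A i" if i: "i < ?n" for i
 proof -
	have le: "?n <= ?P" using bounds by linarith
	have "count_less (ar s2 2) 0 ?P (key w (A ! i)) = count_less ?S 0 ?P (key w (A ! i))" using s2 count_less_cong[of 0 ?P "ar s1 2" ?S] by (simp add: s1_def)
	also have "... = count_less ?S 0 ?n (key w (A ! i)) + count_less ?S ?n ?P (key w (A ! i))" using le by (simp add: count_less_append)
	also have "count_less ?S ?n ?P (key w (A ! i)) = 0" using key_lt[OF A(1)[OF i] w(2)] by (auto simp: count_less_def)
	also have "count_less ?S 0 ?n (key w (A ! i)) = (\<Sum>p\<in>{0..<?n}. of_bool (A ! p < A ! i))" unfolding count_less_def using A(1) i w(2) by (intro sum.cong) (auto simp: key_less)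
	also have "... = rank A i"
	proof -
	 have "{0..<?n} \<inter> {p. A ! p < A ! i} = {j. j < ?n & A ! j < A ! i}" by auto
	 thus ?thesis by (simp add: rank_def)
	qed
	finally show ?thesis by simp
 qed
 have v2: "va s2 8 = ?n" "va s2 4 = L" "ar s2 0 = ar s 0" using s2 v by (simp_all add: s1_def)
 let ?inner = "Asg 22 (Num 1 [<<] (Var 4 [-] Num 1 [-] Var 18)) ;;
	 Ite (Get (Num 2) (Var 19 [+] Var 22 [-] Num 1) [<] Var 21) (Asg 19 (Var 19 [+] Var 22)) Nop"
 let ?body = "Asg 21 KEY ;; Asg 19 (Num 0) ;; For 18 4 (?inner) ;; Put (Num 1) (Var 11) (Var 19)"
 let ?I = "%i t. (ALL y. y ~: compress_vars --> va t y = va s y) & (ALL q. q ~= 1 --> ar t q = ar s2 q) &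
	(ALL k<i. ar t 1 k = rank A k)"
 have "EX t. ?I (va s2 8) t & run w z (For 11 8 ?body) s2 = set_va 11 (va s2 8) t"
 proof (rule run_For_inv)
	show "?I 0 s2" using s2 by (simp add: s1_def)
 next
	fix i and t :: ast assume "i < va s2 8" and I: "?I i t"
	hence i: "i < ?n" using v2 by simp
	let ?x = "key w (A ! i)" and ?c = "rank A i"
	have xlt: "?x < pow2 w" using key_lt A(1)[OF i] w by blast
	have cn: "?c < ?n" by (rule rank_less[OF i])
	have less: "ar s2 2 p < ?x \<longleftrightarrow> p < ?c" if "p < ?P" for p using sorted_less_iff[of ?P "ar s2 2" p ?x] s2 that cnt[OF i] by auto
	define t1 where "t1 = set_va 19 0 (set_va 21 ?x (set_va 11 i t))"
	have iz: "i < pow2 w" "2 + i < pow2 z" using i bounds by linarith+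
	have "eval w z (set_va 11 i t) KEY = ?x" by (rule ev_KEY) (use A i I v2 w iz bounds in auto)
	hence r1: "run w z (Asg 21 KEY ;; Asg 19 (Num 0)) (set_va 11 i t) = t1" using w by (simp add: ev_Num t1_def)
	have v1: "va t1 4 = L" "va t1 21 = ?x" "va t1 11 = i" "ar t1 2 = ar s2 2" using I v by (simp_all add: t1_def)
	\<comment> \<open>After \<open>l\<close> rounds the rank lies in an interval of length
	  \<open>2 ^ (L - l)\<close> that starts at variable 19; keeping the interval inside the sorted row
	  makes every probe legal.\<close>
	let ?J = "%l u. (ALL y. y ~: {18, 19, 22} --> va u y = va t1 y) & ar u = ar t1 &
	 va u 19 <= ?c & ?c < va u 19 + pow2 (L - l) & va u 19 + pow2 (L - l) <= ?P"
	have "EX u. ?J (va t1 4) u & run w z (For 18 4 (?inner)) t1 = set_va 18 (va t1 4) u"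
	proof (rule run_For_inv)
	 show "?J 0 t1" using cn bounds by (simp add: t1_def)
	next
	 fix l and u :: ast assume l: "l < va t1 4" and J: "?J l u"
	 let ?h = "pow2 (L - 1 - l)" and ?p = "va u 19"
	 have Ll: "L - l = Suc (L - 1 - l)" "L - Suc l = L - 1 - l" "l < L" using l v1 by auto
	 have h2: "pow2 (L - l) = ?h + ?h" "0 < ?h" unfolding Ll(1) by (simp_all add: pow2_def)
	 have wh: "?h < pow2 w" "l < pow2 w" "?p + ?h < pow2 w" "?p + ?h - 1 < pow2 z" "?p < pow2 w" "?p + ?h - 1 < ?P" "1 <= L" "l <= L - 1"
		"1 <= ?p + ?h" using J h2 w bounds Ll by linarith+
	 define u1 where "u1 = set_va 22 ?h (set_va 18 l u)"
	 have ru: "run w z (Asg 22 (Num 1 [<<] (Var 4 [-] Num 1 [-] Var 18))) (set_va 18 l u) = u1" using J v1 w wh by (simp add: ev u1_def)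
	 have "ar s2 2 (?p + ?h - 1) < pow2 w" using s2 wh by blast
	 hence c: "eval w z u1 (Get (Num 2) (Var 19 [+] Var 22 [-] Num 1) [<] Var 21) = of_bool (?p + ?h - 1 < ?c)" using J v1 w wh xlt less[OF wh(6)] by (simp add: ev u1_def)
	 show "?J (Suc l) (run w z (?inner) (set_va 18 l u))"
	 proof (cases "?p + ?h - 1 < ?c")
		case True
		hence "run w z (?inner) (set_va 18 l u) = set_va 19 (?p + ?h) u1" using ru c wh by (simp add: ev u1_def)
		thus ?thesis using J True h2 unfolding Ll(2) by (auto simp: u1_def)
	 next
		case False
		hence "?c < ?p + ?h" using h2 by linarith
		moreover have "run w z (?inner) (set_va 18 l u) = u1" using ru c False by simp
		ultimately show ?thesis using J h2 unfolding Ll(2) by (auto simp: u1_def)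
	 qed
	qed
	then obtain u where u: "?J L u" "run w z (For 18 4 (?inner)) t1 = set_va 18 L u" using v1 by auto
	have u19: "va u 19 = ?c" using u(1) by (simp add: pow2_def)
	have "?c < pow2 w" "i < pow2 z" using cn w iz by linarith+
	hence "run w z (Put (Num 1) (Var 11) (Var 19)) (set_va 18 L u) = set_ar 1 i ?c (set_va 18 L u)" using u(1) u19 v1 iz w by (simp add: run_Put ev)
	hence "run w z ?body (set_va 11 i t) = set_ar 1 i ?c (set_va 18 L u)" using r1 u(2) by simp
	thus "?I (Suc i) (run w z ?body (set_va 11 i t))" using I u(1) by (auto simp: t1_def less_Suc_eq)
 qed
 then obtain t where t: "?I ?n t" "run w z c_search s2 = set_va 11 ?n t" unfolding c_search_def using v2 by auto
 have "s' = set_va 11 ?n t" unfolding s' c_compress_def using r1 s2_def t(2) by simp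
 thus ?thesis using t(1) s2 by (auto simp: s1_def)
qed

lemma wf_c_compress: "wf_cmd q_vars c_compress"
 by (simp add: c_compress_def c_fill_def c_pass_def merge_step_def c_search_def q_vars_def)

lemma cost_c_compress:
 assumes "v 4 = lg n" "v 8 <= C * n" "v 17 <= 2 * n + 2"
 shows "cost v c_compress <= (2000 + 1000 * C) * (n + 1) * (lg n + 1)"
proof -
 have "cost v c_compress <= 100 + 100 * v 17 + lg n * (100 + 500 * v 17) + v 8 * (100 + 100 * lg n)" by (simp add: c_compress_def c_fill_def c_pass_def merge_step_def c_search_def assms(1) KEY_def TOP_def algebra_simps)
 also have "... <= 100 + 100 * (2 * n + 2) + lg n * (100 + 500 * (2 * n + 2)) + C * n * (100 + 100 * lg n)" using assms by (intro add_mono mult_mono) auto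
 also have "... <= (2000 + 1000 * C) * (n + 1) * (lg n + 1)" by (simp add: algebra_simps)
 finally show ?thesis .
qed

section \<open>From two ranges to one range\<close>

definition inner_sum :: "(nat => nat => nat) => nat => nat => nat" where
 "inner_sum g a b = (\<Sum>j\<in>{a..<b}. \<Sum>i\<in>{a..<j}. g i j)"

definition across :: "(nat => nat => nat) => nat => nat => nat => nat => nat" where
 "across g a b c d = (\<Sum>i\<in>{a..<b}. \<Sum>j\<in>{c..<d}. g i j)"

text \<open>A pair lies left of \<open>b\<close>, right of \<open>b\<close>, or has \<open>b\<close>
  between its members.\<close>

lemma inner_sum_split:
 assumes "a <= b" "b <= c"
 shows "inner_sum g a c = inner_sum g a b + inner_sum g b c + across g a b b c"
proof -
 have "inner_sum g a c = inner_sum g a b + (\<Sum>j\<in>{b..<c}. \<Sum>i\<in>{a..<j}. g i j)" unfolding inner_sum_def using assms by (simp add: sum.atLeastLessThan_concat)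
 also have "(\<Sum>j\<in>{b..<c}. \<Sum>i\<in>{a..<j}. g i j) = (\<Sum>j\<in>{b..<c}. (\<Sum>i\<in>{a..<b}. g i j) + (\<Sum>i\<in>{b..<j}. g i j))" using assms by (intro sum.cong) (auto simp: sum.atLeastLessThan_concat)
 also have "... = across g a b b c + inner_sum g b c" unfolding inner_sum_def across_def by (simp add: sum.distrib sum.swap[of _ "{a..<b}"])
 finally show ?thesis by simp
qed

lemma across_split: "a <= b ==> b <= c ==> across g a c d e = across g a b d e + across g b c d e"
 unfolding across_def by (simp add: sum.atLeastLessThan_concat)

lemma inner_sum_add: "inner_sum (%i j. f i j + g i j) a b = inner_sum f a b + inner_sum g a b"
 by (simp add: inner_sum_def sum.distrib)

lemma inner_sum_const: "inner_sum (%_ _. 1) a b = (b - a) * (b - a - 1) div 2"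
proof (cases "a <= b")
 case True
 then obtain d where b: "b = a + d" by (metis le_Suc_ex)
 have "inner_sum (%_ _. 1) a (a + d) = d * (d - 1) div 2"
 proof (induction d)
	case (Suc d)
	have "inner_sum (%_ _. 1) a (a + Suc d) = inner_sum (%_ _. 1) a (a + d) + d" by (simp add: inner_sum_def)
	also have "... = Suc d * (Suc d - 1) div 2" using Suc by (cases d) auto
	finally show ?case .
 qed (simp add: inner_sum_def)
 thus ?thesis by (simp add: b)
qed (simp add: inner_sum_def)

text \<open>Splitting \<open>a..d\<close> and \<open>b..d\<close> at \<open>c\<close> leaves cross
  terms that differ by the pairs from \<open>a..b\<close> to \<open>c..d\<close>. Here
  \<open>b..c\<close> is the gap between the two ranges of a query.\<close>

lemma across_four:
 assumes "a <= b" "b <= c" "c <= d"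
 shows "inner_sum g a d + inner_sum g b c = inner_sum g a c + inner_sum g b d + across g a b c d"
 using inner_sum_split[of a c d g] inner_sum_split[of b c d g] across_split[of a b c g c d] assms by simp

definition rel :: "(int => int => bool) => (nat => int) => nat => nat => nat" where
 "rel R f i j = of_bool (R (f (i - 1)) (f (j - 1)))"

lemma card_filter: "finite X ==> card {x : X. P x} = (\<Sum>x\<in>X. of_bool (P x))"
 by (simp add: Int_def)

lemma pairs1_inner_sum: "pairs1 R A q = inner_sum (rel R (%i. A ! i)) (q ! 0) (Suc (q ! 1))"
proof -
 let ?l = "q ! 0" and ?r = "q ! 1"
 have "{(i, j). ?l <= i & i < j & j <= ?r & R (A ! (i - 1)) (A ! (j - 1))} =
	 (%(j, i). (i, j)) ` (SIGMA j:{?l..<Suc ?r}. {i\<in>{?l..<j}. R (A ! (i - 1)) (A ! (j - 1))})" by force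
 hence "pairs1 R A q = card (SIGMA j:{?l..<Suc ?r}. {i\<in>{?l..<j}. R (A ! (i - 1)) (A ! (j - 1))})" unfolding pairs1_def range_pairs_def by (simp add: card_image inj_on_def)
 also have "... = (\<Sum>j\<in>{?l..<Suc ?r}. card {i\<in>{?l..<j}. R (A ! (i - 1)) (A ! (j - 1))})" by (rule card_SigmaI) auto
 also have "... = inner_sum (rel R (%i. A ! i)) ?l (Suc ?r)" unfolding inner_sum_def rel_def by (intro sum.cong refl card_filter) simp
 finally show ?thesis .
qed

lemma pairs2_across: "pairs2 R A q = across (rel R (%i. A ! i)) (q ! 0) (Suc (q ! 1)) (q ! 2) (Suc (q ! 3))"
proof -
 let ?l = "q ! 0" and ?r = "q ! 1" and ?k = "q ! 2" and ?m = "q ! 3"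
 have "{(i, j). ?l <= i & i <= ?r & ?k <= j & j <= ?m & R (A ! (i - 1)) (A ! (j - 1))} =
	 (SIGMA i:{?l..<Suc ?r}. {j\<in>{?k..<Suc ?m}. R (A ! (i - 1)) (A ! (j - 1))})" by auto
 hence "pairs2 R A q = card (SIGMA i:{?l..<Suc ?r}. {j\<in>{?k..<Suc ?m}. R (A ! (i - 1)) (A ! (j - 1))})" unfolding pairs2_def two_range_pairs_def by simp
 also have "... = (\<Sum>i\<in>{?l..<Suc ?r}. card {j\<in>{?k..<Suc ?m}. R (A ! (i - 1)) (A ! (j - 1))})" by (rule card_SigmaI) auto
 also have "... = across (rel R (%i. A ! i)) ?l (Suc ?r) ?k (Suc ?m)" unfolding across_def rel_def by (intro sum.cong refl card_filter) simp
 finally show ?thesis .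
qed

lemma inner_sum_cong: "(!!i j. a <= i ==> i < j ==> j < b ==> f i j = g i j) ==> inner_sum f a b = inner_sum g a b"
 unfolding inner_sum_def by (intro sum.cong) auto

lemma across_cong: "(!!i j. a <= i ==> i < b ==> c <= j ==> j < d ==> f i j = g i j) ==> across f a b c d = across g a b c d"
 unfolding across_def by (intro sum.cong) auto

text \<open>The upper density makes the whole input linear in \<open>N\<close>, with a constant that
  does not depend on the word size; \<open>c\<close> is \<open>bet\<close> rounded up.\<close>

lemma gquery_size:
 assumes "0 < d"
 obtains C where "!!w N inp out. gquery d V F alp bet w N inp out ==> 2 <= length inp & inp ! 0 = N & length out = inp ! 1 &
	inp ! 0 <= C * N & inp ! 1 <= C * N & length inp <= C * (N + 1)"
proof -
 define c where "c = nat \<lceil>bet\<rceil>"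
 show thesis
 proof (rule that[of "3 + c + d * c"])
	fix w N inp out assume "gquery d V F alp bet w N inp out"
	then obtain A qs where A: "length A = N" "\<forall>q\<in>set qs. length q = d" "real (length qs) <= bet * real N"
	 "inp = [N, length qs] @ map (encode_int w) A @ concat qs" "out = map (F A) qs" unfolding gquery_def by blast
	have "bet <= real c" unfolding c_def by linarith
	hence "bet * real N <= real c * real N" by (intro mult_right_mono) auto
	with A(3) have "real (length qs) <= real (c * N)" by simp
	hence q: "length qs <= c * N" by linarith
	hence dq: "d * length qs <= d * c * N" unfolding mult.assoc by (rule mult_le_mono2)
	define X Y where "X = (3 + c + d * c) * N" and "Y = (3 + c + d * c) * (N + 1)"
	have "X = 3 * N + c * N + d * c * N" "Y = 3 * N + c * N + d * c * N + 3 + c + d * c" by (simp_all add: X_def Y_def algebra_simps)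
	moreover have "length inp = 2 + N + d * length qs" "inp ! 0 = N" "inp ! 1 = length qs" "length out = length qs" using A length_concat_const[of qs d] by simp_all
	ultimately show "2 <= length inp & inp ! 0 = N & length out = inp ! 1 & inp ! 0 <= (3 + c + d * c) * N &
		inp ! 1 <= (3 + c + d * c) * N & length inp <= (3 + c + d * c) * (N + 1)" unfolding X_def[symmetric] Y_def[symmetric] using q dq by (intro conjI) linarith+
 qed
qed

text \<open>The state after preparation from which the reductions of query problems work, with the
  ranks in row 1. Rows 1 to 6 are exempt from the frame condition as work space of the
  preparation.\<close>

definition compressed :: "nat => nat => nat => nat => nat list => int list => nat list list => ast => bool" where
 "compressed d w z n inp A qs s \<longleftrightarrow>
	(ALL i<length A. ar s 1 i = rank A i) & (ALL q. q ~: {1, 2, 3, 4, 5, 6} --> ar s q = start_ar inp q) &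
	va s 3 = n & va s 4 = lg n & va s 7 = length qs & va s 8 = length A &
	length A <= n & 2 <= n & (\<forall>q\<in>set qs. length q = d) &
	inp = [length A, length qs] @ map (encode_int w) A @ concat qs &
	100 * n + 200 + length inp <= pow2 z & 100 * (n + 2) ^ 2 <= pow2 z & pow2 z <= pow2 w"

lemma run_compressed:
 assumes Q: "gquery d V F alp bet w N inp out" and C: "length inp <= C * (N + 1)" and e: "C + 400 <= e"
	and n: "N <= n" "2 <= n" and z: "z = e * lg n" "4 * z <= w"
	and s0: "q_start w z n inp s0" and s1: "s1 = run w z c_compress s0"
 obtains A qs where "compressed d w z n inp A qs s1" "length A = N" "out = map (F A) qs" "\<forall>q\<in>set qs. V N q" "inp ! 1 = length qs"
	"ALL q. q ~: {1, 2, 3} --> ar s1 q = start_ar inp q"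
proof -
 from Q obtain A qs where A: "length A = N" "\<forall>q\<in>set qs. length q = d & V N q" "\<forall>a\<in>set A. fits_word w a"
	 "inp = [N, length qs] @ map (encode_int w) A @ concat qs" "out = map (F A) qs" unfolding gquery_def by blast
 have zw: "pow2 z <= pow2 w" using z by (intro pow2_mono) auto
 have p2: "(C + 300) * (n + 2) ^ 2 <= pow2 z" by (rule poly_le_pow2[OF _ z(1)]) (use e in simp)
 have "300 * (n + 2) ^ 2 <= (C + 300) * (n + 2) ^ 2" by (rule mult_right_mono) simp_all
 with p2 have p3: "300 * (n + 2) ^ 2 <= pow2 z" by (rule order_trans[rotated])
 have len: "100 * n + 200 + length inp <= pow2 z"
 proof -
	have "(C + 300) * (n + 2) <= (C + 300) * (n + 2) ^ 2" by (intro mult_left_mono) (auto simp: power2_eq_square)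
	moreover have "C * (N + 1) <= C * (n + 2)" using n by (intro mult_left_mono) auto
	moreover have "(C + 300) * (n + 2) = C * (n + 2) + 300 * n + 600" by (simp add: algebra_simps)
	ultimately show ?thesis using p2 C by linarith
 qed
 have P: "pow2 (lg n) <= 2 * n + 2" "n + 2 <= pow2 (lg n)" using lg_le[of n] lg_ge[of n] by (simp_all add: pow2_def)
 have c: "(ALL y. y ~: compress_vars --> va s1 y = va s0 y) & (ALL q. q ~: {1, 2, 3} --> ar s1 q = ar s0 q) &
	(ALL i<length A. ar s1 1 i = rank A i)"
 proof (rule run_compress[of s0 "lg n" A z w])
	show "va s0 17 = pow2 (lg n)" "va s0 4 = lg n" "va s0 8 = length A" using s0 A by (simp_all add: q_start_def)
	show "4 * pow2 (lg n) <= pow2 z" "8 <= pow2 z" "pow2 z <= pow2 w" "length A + 2 <= pow2 (lg n)" using P len zw A n by linarith+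
	fix i assume i: "i < length A"
	show "fits_word w (A ! i)" using A(3) i by simp
	show "ar s0 0 (2 + i) = encode_int w (A ! i)" using s0 i A(4) by (simp add: q_start_def start_ar_def nth_append)
 qed (rule s1)
 have "100 * (n + 2) ^ 2 <= 300 * (n + 2) ^ 2" by (rule mult_right_mono) simp_all
 also note p3
 finally have p4: "100 * (n + 2) ^ 2 <= pow2 z" .
 have cp: "compressed d w z n inp A qs s1" unfolding compressed_def using c s0 A n len zw p4 by (auto simp: q_start_def)
 show thesis by (rule that[OF cp]) (use A c s0 in \<open>auto simp: q_start_def\<close>)
qed

text \<open>Reads component \<open>k\<close> of query number \<open>Var 12\<close> from the input,
  where two header words and the \<open>Var 8\<close> array entries precede the queries.\<close>

definition QC :: "nat => nat => aexp" where
 "QC d k = Get (Num 0) (Num (2 + k) [+] Var 8 [+] Num d [*] Var 12)"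

lemma compressed_bg:
 assumes "compressed d w z n inp A qs s1" "q_background s1 s"
 shows "va s 3 = n" "va s 4 = lg n" "va s 7 = length qs" "va s 8 = length A" "i < length A ==> ar s 1 i = rank A i"
	"ar s 0 = start_ar inp 0" "ar s 4 = ar s1 4" "ar s 5 = ar s1 5" "length A <= n" "2 <= n"
	"100 * n + 200 <= pow2 z" "length A <= pow2 z" "length qs <= pow2 z | d = 0" "pow2 z <= pow2 w"
proof -
 have "length inp = 2 + length A + d * length qs" using assms(1) length_concat_const[of qs d] unfolding compressed_def by simp
 moreover have "length qs <= d * length qs | d = 0" by (cases d) auto
 moreover have "100 * n + 200 + length inp <= pow2 z" using assms(1) unfolding compressed_def by blast
 ultimately show "100 * n + 200 <= pow2 z" "length A <= pow2 z" "length qs <= pow2 z | d = 0" by linarith+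
qed (use assms in \<open>auto simp: compressed_def q_background_def q_vars_def\<close>)

lemma ev_QC:
 assumes c: "compressed d w z n inp A qs s1" and bg: "q_background s1 s"
	and j: "va s 12 = j" "j < length qs" "k < d" and lt: "qs ! j ! k <= n"
 shows "eval w z s (QC d k) = qs ! j ! k"
proof -
 note b = compressed_bg[OF c bg]
 have len: "length inp = 2 + length A + d * length qs" using c length_concat_const[of qs d] unfolding compressed_def by simp
 have "d * (j + 1) <= d * length qs" using j by (intro mult_left_mono) auto
 hence lj: "d * j + k < d * length qs" using j by simp
 have li: "length inp + 200 <= pow2 z" "pow2 z <= pow2 w" using c unfolding compressed_def by linarith+
 have "d <= d * length qs" using j by (cases "length qs") auto
 moreover have "j <= d * j" using j by simp
 ultimately have sm: "d < pow2 w" "j < pow2 w" "d * j < pow2 w" "length A < pow2 w" "2 + k < pow2 w"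
	"2 + k + length A < pow2 w" "2 + k + length A + d * j < pow2 w" "2 + k + length A + d * j < pow2 z" "0 < pow2 z" "0 < pow2 w" using li len lj by linarith+
 have off: "eval w z s (Num (2 + k) [+] Var 8 [+] Num d [*] Var 12) = 2 + k + length A + d * j" using sm b j by (simp add: ev)
 have "ar s 0 (2 + k + length A + d * j) = qs ! j ! k"
 proof -
	have "concat qs ! (d * j + k) = qs ! j ! k" using c j by (intro nth_concat_const) (auto simp: compressed_def)
	hence "inp ! (2 + (length A + (d * j + k))) = qs ! j ! k" using c unfolding compressed_def by (auto simp: nth_append)
	thus ?thesis using b(6) len lj by (simp add: start_ar_def add_ac)
 qed
 moreover have "qs ! j ! k < pow2 w" using lt b by linarith
 ultimately show ?thesis unfolding QC_def using off sm by (simp add: ev_Get ev_Num)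
qed

text \<open>The array is lengthened to \<open>n\<close> entries by zeros, which are not reached by
  any query whose answer counts.\<close>

definition RK :: aexp where
 "RK = Cnd (Var 11 [<] Var 8) (Get (Num 1) (Var 11)) (Num 0)"

definition rk :: "int list => nat => nat" where
 "rk A i = (if i < length A then rank A i else 0)"

lemma rk_le: "rk A i <= length A"
 using rank_less[of i A] by (auto simp: rk_def)

lemma ev_RK:
 assumes c: "compressed d w z n inp A qs s1" and bg: "q_background s1 s" and i: "va s 11 = i" "i < n"
 shows "eval w z s RK = rk A i"
proof -
 note b = compressed_bg[OF c bg]
 have sm: "i < pow2 w" "i < pow2 z" "length A < pow2 w" "1 < pow2 z" "1 < pow2 w" "0 < pow2 w" "rk A i < pow2 w" using b i rk_le[of A i] by linarith+
 thus ?thesis unfolding RK_def rk_def using i b by (simp add: ev split: if_splits)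
qed

lemma rel_rk:
 assumes "R = (=) | R = (>)" "1 <= i" "i <= length A" "1 <= j" "j <= length A" "length A <= n"
 shows "rel R (%i. map (%i. int (rk A i)) [0..<n] ! i) i j = rel R (%i. A ! i) i j"
proof -
 have ij: "i - 1 < length A" "j - 1 < length A" using assms by auto
 thus ?thesis using assms(1,6) rank_less_iff[OF ij] rank_less_iff[OF ij(2,1)] rank_eq_iff[OF ij] by (auto simp: rel_def rk_def)
qed

lemma pairs1_rk:
 assumes "R = (=) | R = (>)" "1 <= l" "r <= length A" "length A <= n"
 shows "pairs1 R (map (%i. int (rk A i)) [0..<n]) [l, r] = inner_sum (rel R (%i. A ! i)) l (Suc r)"
 unfolding pairs1_inner_sum using assms by (auto intro!: inner_sum_cong rel_rk)

lemma pairs2_rk: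
 assumes "R = (=) | R = (>)" "1 <= l" "r <= length A" "1 <= l'" "r' <= length A" "length A <= n"
 shows "pairs2 R (map (%i. int (rk A i)) [0..<n]) [l, r, l', r'] = across (rel R (%i. A ! i)) l (Suc r) l' (Suc r')"
 unfolding pairs2_across using assms by (auto intro!: across_cong rel_rk simp: numeral_3_eq_3)

lemma inner_sum_le: "(!!i j. g i j <= 1) ==> inner_sum g a b <= (b - a) * (b - a)"
proof -
 assume g: "!!i j. g i j <= 1"
 have "(\<Sum>i\<in>{a..<j}. g i j) <= b - a" if "j : {a..<b}" for j
 proof -
	have "(\<Sum>i\<in>{a..<j}. g i j) <= (\<Sum>i\<in>{a..<j}. 1)" by (rule sum_mono) (rule g)
	also have "... <= b - a" using that by (simp add: diff_le_mono)
	finally show ?thesis .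
 qed
 hence "inner_sum g a b <= (\<Sum>j\<in>{a..<b}. b - a)" unfolding inner_sum_def by (rule sum_mono)
 thus ?thesis by simp
qed

lemma rel_le: "rel R f i j <= 1"
 by (simp add: rel_def)

lemma valid_set: "valid1 n q ==> length q = 2 ==> set q <= {..n}" "valid2 n q ==> length q = 4 ==> set q <= {..n}"
 by (auto simp: valid1_def valid2_def length_2_conv length_4_conv)

lemma list_2_nth: "length q = 2 ==> q = [q ! 0, q ! 1]"
 by (auto simp: length_2_conv)

text \<open>\<open>across_four\<close> with the full span, the gap, and the two spans that omit one
  range. The two positive terms come first, since accumulators are naturals. An empty gap is
  replaced by the range \<open>[1, 1]\<close>, which contains no pair.\<close>

theorem two_range_to_range:
 assumes solver: "solvable_in_time (range_query (=) alp bet) T" and lb: "linear_bounds alp bet"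
 shows "\<exists>T' \<in> soft_O T. solvable_in_time (two_range_query (=) alp' bet') T'"
proof -
 obtain C where C: "!!w N inp out. gquery 4 valid2 (pairs2 (=)) alp' bet' w N inp out ==> 2 <= length inp & inp ! 0 = N &
	length out = inp ! 1 & inp ! 0 <= C * N & inp ! 1 <= C * N & length inp <= C * (N + 1)" using gquery_size[of 4] by (metis zero_less_numeral)
 let ?l1 = "QC 4 0" and ?r1 = "QC 4 1" and ?l2 = "QC 4 2" and ?r2 = "QC 4 3"
 let ?gap = "?r1 [+] Num 1 [<] ?l2"
 let ?el = "Cnd (Var 13 [=] Num 0) ?l1 (Cnd (Var 13 [=] Num 1) (Cnd ?gap (?r1 [+] Num 1) (Num 1))
	 (Cnd (Var 13 [=] Num 2) ?l1 (?r1 [+] Num 1)))"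
 let ?er = "Cnd (Var 13 [=] Num 0) ?r2 (Cnd (Var 13 [=] Num 1) (Cnd ?gap (?l2 [-] Num 1) (Num 1))
	 (Cnd (Var 13 [=] Num 2) (?l2 [-] Num 1) ?r2))"
 let ?eacc = "Cnd (Var 13 [<] Num 2) (Var 16 [+] Var 15) (Var 16 [-] Var 15)"
 show ?thesis unfolding two_range_query_gquery
 proof (rule gquery_reduction[OF solver[unfolded range_query_gquery] lb, where k = 0 and C = C and K = 4 and ?c1.0 = c_compress
		and ea = RK and es = "[?el, ?er]" and ms = "[1, 1]" and eacc = ?eacc and ?d0.0 = "C + 400"
		and ?a1.0 = "2000 + 1000 * C" and ?e1.0 = 1])
	show "\<exists>epl>0. \<forall>\<^sub>F N in sequentially. epl * real N <= T N" using lower_bound1[OF solver lb] by simp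
	show "cost v c_compress <= (2000 + 1000 * C) * (n + 1) * (lg n + 1) ^ 1"
	 if "v 3 = n" "v 4 = lg n" "v 7 <= C * n" "v 8 <= C * n" "v 17 <= 2 * n + 2" for n v using cost_c_compress that by simp
 next
	fix e w z N n inp out s0 s1
	assume Q: "gquery 4 valid2 (pairs2 (=)) alp' bet' w N inp out" and e: "C + 400 <= e" and n: "N <= n" "2 <= n"
	 and z: "z = e * lg n" "4 * z <= w" and s0: "q_start w z n inp s0" and s1: "s1 = run w z c_compress s0"
	have "length inp <= C * (N + 1)" using C[OF Q] by blast
	from run_compressed[OF Q this e n z s0 s1]
	obtain A qs where c: "compressed 4 w z n inp A qs s1" and A: "length A = N" "out = map (pairs2 (=) A) qs"
		"\<forall>q\<in>set qs. valid2 N q" "inp ! 1 = length qs" and "ALL q. q ~: {1, 2, 3} --> ar s1 q = start_ar inp q" by metis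
	have rk_le_n: "rk A i <= 2 * n" for i using rk_le[of A i] A(1) n by linarith
	define fq where "fq kp j = (let l1 = qs ! j ! 0; r1 = qs ! j ! 1; l2 = qs ! j ! 2; r2 = qs ! j ! 3 in
	 if kp = 0 then [l1, r2] else if kp = 1 then (if r1 + 1 < l2 then [r1 + 1, l2 - 1] else [1, 1])
	 else if kp = 2 then [l1, l2 - 1] else [r1 + 1, r2])" for kp j :: nat
	define B where "B = map (%i. int (rk A i)) [0..<n]"
	define ans where "ans kp j = pairs1 (=) B (fq kp j)" for kp j
	define R where "R kp j = (if kp = 0 then 0 else if kp = 1 then ans 0 j else if kp = 2 then ans 0 j + ans 1 j
	 else if kp = 3 then ans 0 j + ans 1 j - ans 2 j else ans 0 j + ans 1 j - ans 2 j - ans 3 j)" for kp j :: nat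
	have q: "valid2 N (qs ! j)" "length (qs ! j) = 4" if "j < length qs" for j using that A(3) c by (auto simp: compressed_def)
	have fqv: "valid1 n (fq kp j)" "valid1 N (fq kp j)" if "j < length qs" for kp j using q[OF that] n by (auto simp: fq_def Let_def valid1_def valid2_def)
	have ansle: "ans kp j <= n * n" if "j < length qs" for kp j unfolding ans_def by (rule pairs1_le[OF fqv(1)[OF that]])
	have ans_inner_sum: "ans kp j = inner_sum (rel (=) (%i. A ! i)) (fq kp j ! 0) (Suc (fq kp j ! 1))" if "j < length qs" for kp j
	proof -
	 have "length (fq kp j) = 2" by (simp add: fq_def Let_def)
	 hence "fq kp j = [fq kp j ! 0, fq kp j ! 1]" by (rule list_2_nth)
	 thus ?thesis unfolding ans_def B_def using fqv(2)[OF that, of kp] A n by (metis pairs1_rk valid1_def)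
	qed
	have key: "ans 0 j + ans 1 j = ans 2 j + ans 3 j + pairs2 (=) A (qs ! j)" if j: "j < length qs" for j
	proof -
	 let ?q = "qs ! j" and ?g = "rel (=) (%i. A ! i)"
	 have v: "?q ! 0 <= ?q ! 1" "?q ! 1 < ?q ! 2" "?q ! 2 <= ?q ! 3" using q[OF j] by (auto simp: valid2_def)
	 have "ans 1 j = inner_sum ?g (Suc (?q ! 1)) (?q ! 2)"
	 proof (cases "Suc (?q ! 1) < ?q ! 2")
		case True
		hence "Suc (?q ! 2 - 1) = ?q ! 2" by simp
		with True show ?thesis using ans_inner_sum[OF j, of 1] by (simp add: fq_def Let_def)
	 next
		case False
		hence "?q ! 2 = Suc (?q ! 1)" using v by linarith
		thus ?thesis using ans_inner_sum[OF j, of 1] by (simp add: fq_def Let_def inner_sum_def)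
	 qed
	 moreover have "ans 0 j = inner_sum ?g (?q ! 0) (Suc (?q ! 3))" "ans 2 j = inner_sum ?g (?q ! 0) (?q ! 2)"
		"ans 3 j = inner_sum ?g (Suc (?q ! 1)) (Suc (?q ! 3))" using ans_inner_sum[OF j] v by (auto simp: fq_def Let_def)
	 ultimately show ?thesis unfolding pairs2_across using v by (simp add: across_four)
	qed
	show "EX fa fq R. q_correct valid1 (pairs1 (=)) 4 w z n inp out RK [?el, ?er] ?eacc s1 fa fq R" unfolding q_correct_def A(4)
	proof (rule exI[of _ "%_. rk A"], rule exI[of _ fq], rule exI[of _ R], intro conjI)
	 show "\<forall>q\<ge>16. ar s1 q = (%_. 0)" "ar s1 7 = (%_. 0)" using c by (auto simp: compressed_def start_ar_def)
	 show "ALL s kp i. q_background s1 s --> kp < 4 --> va s 13 = kp --> i < n --> va s 11 = i -->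
			eval w z s RK = rk A i & rk A i <= 2 * n" using ev_RK[OF c] rk_le_n by blast
	 show "ALL j<length qs. R 0 j = 0 & R 4 j = out ! j" using key A(2) by (auto simp: R_def)
	next
	 show "ALL s kp j. q_background s1 s --> kp < 4 --> va s 13 = kp --> j < length qs --> va s 12 = j -->
			map (eval w z s) [?el, ?er] = fq kp j & valid1 n (fq kp j)"
	 proof (intro allI impI conjI)
		fix s kp j assume s: "q_background s1 s" "kp < 4" "va s 13 = kp" "j < length qs" "va s 12 = j"
		show "valid1 n (fq kp j)" by (rule fqv(1)[OF s(4)])
		note b = compressed_bg[OF c s(1)]
		have v: "qs ! j ! 0 <= n" "qs ! j ! 1 <= n" "qs ! j ! 2 <= n" "qs ! j ! 3 <= n" "1 <= qs ! j ! 2" using q[OF s(4)] n by (auto simp: valid2_def)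
		have qc: "eval w z s ?l1 = qs ! j ! 0" "eval w z s ?r1 = qs ! j ! 1" "eval w z s ?l2 = qs ! j ! 2" "eval w z s ?r2 = qs ! j ! 3" using ev_QC[OF c s(1) s(5,4)] v by auto
		have sm: "kp < pow2 w" "0 < pow2 w" "1 < pow2 w" "2 < pow2 w" "qs ! j ! 1 + 1 < pow2 w" using b s v by linarith+
		show "map (eval w z s) [?el, ?er] = fq kp j" using sm qc s(3) v by (simp add: ev fq_def Let_def)
	 qed
	next
	 show "ALL s kp j. q_background s1 s --> kp < 4 --> va s 13 = kp --> j < length qs --> va s 12 = j -->
			va s 15 = pairs1 (=) (map (%i. int (rk A i)) [0..<n]) (fq kp j) --> va s 16 = R kp j --> eval w z s ?eacc = R (Suc kp) j"
	 proof (intro allI impI)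
		fix s kp j assume s: "q_background s1 s" "kp < 4" "va s 13 = kp" "j < length qs" "va s 12 = j"
		 "va s 15 = pairs1 (=) (map (%i. int (rk A i)) [0..<n]) (fq kp j)" "va s 16 = R kp j"
		note b = compressed_bg[OF c s(1)]
		have s15: "va s 15 = ans kp j" using s by (simp add: ans_def B_def)
		have nn: "4 * (n * n) < pow2 w"
		proof -
		 have "100 * (n + 2) ^ 2 <= pow2 w" using c unfolding compressed_def by linarith
		 moreover have "4 * (n * n) < 100 * (n + 2) ^ 2" by (simp add: power2_eq_square algebra_simps)
		 ultimately show ?thesis by linarith
		qed
		have al: "ans 0 j <= n * n" "ans 1 j <= n * n" "ans 2 j <= n * n" "ans 3 j <= n * n" using ansle[OF s(4)] by blast+
		have sm: "kp < pow2 w" "2 < pow2 w" using b s by linarith+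
		consider "kp = 0" | "kp = 1" | "kp = 2" | "kp = 3" using s(2) by linarith
		thus "eval w z s ?eacc = R (Suc kp) j" using sm s15 s(3,7) nn al key[OF s(4)] by cases (simp_all add: ev R_def)
	 qed
	qed
 next
	show "2 <= length inp & inp ! 0 = N & length out = inp ! 1 & inp ! 0 <= C * N & inp ! 1 <= C * N & length inp <= C * (N + 1)"
	 if "gquery 4 valid2 (pairs2 (=)) alp' bet' w N inp out" for w N inp out by (rule C[OF that])
 qed (use wf_c_compress in \<open>simp_all add: pairs1_le valid_set valid1_def\<close>)
qed

text \<open>The binary expansions of \<open>a < b\<close> first differ at a unique level \<open>k\<close>.\<close>

lemma less_levels:
 fixes a b :: nat
 assumes "b < 2 ^ L"
 shows "of_bool (a < b) = (\<Sum>k<L. of_bool (even (a div 2 ^ k) & b div 2 ^ k = Suc (a div 2 ^ k)) :: nat)"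
 using assms
proof (induction L arbitrary: a b)
 case (Suc L)
 have "(\<Sum>k<Suc L. of_bool (even (a div 2 ^ k) & b div 2 ^ k = Suc (a div 2 ^ k)) :: nat) =
	of_bool (even a & b = Suc a) + (\<Sum>k<L. of_bool (even (a div 2 div 2 ^ k) & b div 2 div 2 ^ k = Suc (a div 2 div 2 ^ k)))" by (simp add: sum.lessThan_Suc_shift div_mult2_eq del: sum.lessThan_Suc)
 also have "... = of_bool (even a & b = Suc a) + of_bool (a div 2 < b div 2)" using Suc.IH[of "b div 2" "a div 2"] Suc.prems by (simp add: less_mult_imp_div_less mult.commute)
 also have "... = of_bool (a < b)"
 proof (cases "even a & b = Suc a")
	case True
	thus ?thesis by (auto elim!: evenE)
 next
	case False
	have "a < b \<longleftrightarrow> a div 2 < b div 2"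
	proof
	 assume "a < b"
	 hence "a div 2 <= b div 2" by (simp add: div_le_mono)
	 moreover have "a div 2 ~= b div 2"
	 proof
		assume eq: "a div 2 = b div 2"
		have "a = 2 * (a div 2) + a mod 2" "b = 2 * (b div 2) + b mod 2" by simp_all
		with eq \<open>a < b\<close> have "a mod 2 = 0 & b = Suc a" by (metis One_nat_def add.right_neutral add_less_cancel_left not_mod_2_eq_0_eq_1 add_Suc_right less_one not_less_zero)
		with False show False by auto
	 qed
	 ultimately show "a div 2 < b div 2" by simp
	next
	 assume "a div 2 < b div 2"
	 thus "a < b" by (metis div_le_mono not_less)
	qed
	with False show ?thesis by auto
 qed
 finally show ?case by simp
qed simp

lemma lg_le_self: "lg n <= n + 2"
proof (rule ccontr)
 assume "\<not> lg n <= n + 2"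
 hence "2 ^ (n + 2) < n + 2" by (intro lg_least) simp
 with less_exp[of "n + 2"] show False by linarith
qed

section \<open>Equal pairs, inversions and dyadic blocks\<close>

text \<open>Subtraction from \<open>length A\<close> reverses the order like negation, without
  leaving the naturals.\<close>

definition rk_flip :: "int list => nat => nat" where
 "rk_flip A i = (if i < length A then length A - rank A i else 0)"

lemma pairs1_rk_flip:
 assumes "1 <= l" "r <= length A" "length A <= n"
 shows "pairs1 (>) (map (%i. int (rk_flip A i)) [0..<n]) [l, r] = inner_sum (rel (<) (%i. A ! i)) l (Suc r)"
 unfolding pairs1_inner_sum
proof (simp, rule inner_sum_cong)
 fix i j assume ij: "l <= i" "i < j" "j < Suc r"
 hence l: "i - 1 < length A" "j - 1 < length A" using assms by auto
 have "rank A (i - 1) < length A" "rank A (j - 1) < length A" using rank_less l by blast+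
 thus "rel (>) (%i. map (%i. int (rk_flip A i)) [0..<n] ! i) i j = rel (<) (%i. A ! i) i j" using assms l rank_less_iff[OF l] by (auto simp: rel_def rk_flip_def)
qed

theorem equal_to_inversions:
 assumes solver: "solvable_in_time (range_query (>) alp bet) T" and lb: "linear_bounds alp bet"
 shows "\<exists>T' \<in> soft_O T. solvable_in_time (range_query (=) alp' bet') T'"
proof -
 obtain C where C: "!!w N inp out. gquery 2 valid1 (pairs1 (=)) alp' bet' w N inp out ==> 2 <= length inp & inp ! 0 = N &
	length out = inp ! 1 & inp ! 0 <= C * N & inp ! 1 <= C * N & length inp <= C * (N + 1)" using gquery_size[of 2] by (metis zero_less_numeral)
 let ?l = "QC 2 0" and ?r = "QC 2 1"
 let ?ea = "Cnd (Var 13 [=] Num 0) RK (Cnd (Var 11 [<] Var 8) (Var 8 [-] RK) (Num 0))"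
 \<comment> \<open>The first round starts from the number of all pairs in the range; both rounds
   subtract the inversions found.\<close>
 let ?eacc = "Cnd (Var 13 [=] Num 0) ((?r [+] Num 1 [-] ?l) [*] (?r [-] ?l) [div] Num 2 [-] Var 15) (Var 16 [-] Var 15)"
 show ?thesis unfolding range_query_gquery
 proof (rule gquery_reduction[OF solver[unfolded range_query_gquery] lb, where k = 0 and C = C and K = 2 and ?c1.0 = c_compress
		and ea = ?ea and es = "[?l, ?r]" and ms = "[1, 1]" and eacc = ?eacc and ?d0.0 = "C + 400"
		and ?a1.0 = "2000 + 1000 * C" and ?e1.0 = 1])
	show "\<exists>epl>0. \<forall>\<^sub>F N in sequentially. epl * real N <= T N" using lower_bound1[OF solver lb] by simp
	show "cost v c_compress <= (2000 + 1000 * C) * (n + 1) * (lg n + 1) ^ 1"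
	 if "v 3 = n" "v 4 = lg n" "v 7 <= C * n" "v 8 <= C * n" "v 17 <= 2 * n + 2" for n v using cost_c_compress that by simp
	show "2 <= length inp & inp ! 0 = N & length out = inp ! 1 & inp ! 0 <= C * N & inp ! 1 <= C * N & length inp <= C * (N + 1)"
	 if "gquery 2 valid1 (pairs1 (=)) alp' bet' w N inp out" for w N inp out by (rule C[OF that])
 next
	fix e w z N n inp out s0 s1
	assume Q: "gquery 2 valid1 (pairs1 (=)) alp' bet' w N inp out" and e: "C + 400 <= e" and n: "N <= n" "2 <= n"
	 and z: "z = e * lg n" "4 * z <= w" and s0: "q_start w z n inp s0" and s1: "s1 = run w z c_compress s0"
	have "length inp <= C * (N + 1)" using C[OF Q] by blast
	from run_compressed[OF Q this e n z s0 s1]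
	obtain A qs where c: "compressed 2 w z n inp A qs s1" and A: "length A = N" "out = map (pairs1 (=) A) qs"
		"\<forall>q\<in>set qs. valid1 N q" "inp ! 1 = length qs" and "ALL q. q ~: {1, 2, 3} --> ar s1 q = start_ar inp q" by metis
	define fa where "fa kp = (if kp = 0 then rk A else rk_flip A)" for kp :: nat
	define ans where "ans kp j = pairs1 (>) (map (%i. int (fa kp i)) [0..<n]) (qs ! j)" for kp j
	define tot where "tot j = (qs ! j ! 1 + 1 - qs ! j ! 0) * (qs ! j ! 1 - qs ! j ! 0) div 2" for j
	define R where "R kp j = (if kp = 0 then 0 else if kp = 1 then tot j - ans 0 j else tot j - ans 0 j - ans 1 j)" for kp j :: nat
	have q: "valid1 N (qs ! j)" "length (qs ! j) = 2" if "j < length qs" for j using that A(3) c by (auto simp: compressed_def)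
	have qv: "valid1 n (qs ! j)" if "j < length qs" for j using q[OF that] n by (auto simp: valid1_def)
	have ansle: "ans kp j <= n * n" if "j < length qs" for kp j unfolding ans_def by (rule pairs1_le[OF qv[OF that]])
	have key: "tot j = ans 0 j + ans 1 j + pairs1 (=) A (qs ! j)" if j: "j < length qs" for j
	proof -
	 let ?q = "qs ! j" and ?g = "%R. rel R (%i. A ! i)"
	 have v: "1 <= ?q ! 0" "?q ! 0 <= ?q ! 1" "?q ! 1 <= N" using q[OF j] by (auto simp: valid1_def)
	 have q2: "?q = [?q ! 0, ?q ! 1]" using q[OF j] by (intro list_2_nth)
	 have "ans 0 j = inner_sum (?g (>)) (?q ! 0) (Suc (?q ! 1))" using pairs1_rk[of "(>)" "?q ! 0" "?q ! 1" A n] v A n q2 by (simp add: ans_def fa_def)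
	 moreover have "ans 1 j = inner_sum (?g (<)) (?q ! 0) (Suc (?q ! 1))" using pairs1_rk_flip[of "?q ! 0" "?q ! 1" A n] v A n q2 by (simp add: ans_def fa_def)
	 moreover have "(%i j. ?g (>) i j + ?g (<) i j + ?g (=) i j) = (%_ _. 1)" by (auto simp: rel_def fun_eq_iff)
	 hence "inner_sum (?g (>)) (?q ! 0) (Suc (?q ! 1)) + inner_sum (?g (<)) (?q ! 0) (Suc (?q ! 1)) +
		 inner_sum (?g (=)) (?q ! 0) (Suc (?q ! 1)) = tot j" unfolding inner_sum_add[symmetric] tot_def using inner_sum_const by simp
	 ultimately show ?thesis unfolding pairs1_inner_sum by simp
	qed
	show "EX fa fq R. q_correct valid1 (pairs1 (>)) 2 w z n inp out ?ea [?l, ?r] ?eacc s1 fa fq R" unfolding q_correct_def A(4)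
	proof (rule exI[of _ fa], rule exI[of _ "%_ j. qs ! j"], rule exI[of _ R], intro conjI)
	 show "\<forall>q\<ge>16. ar s1 q = (%_. 0)" "ar s1 7 = (%_. 0)" using c by (auto simp: compressed_def start_ar_def)
	 show "ALL j<length qs. R 0 j = 0 & R 2 j = out ! j" using key A(2) by (auto simp: R_def)
	 show "ALL s kp i. q_background s1 s --> kp < 2 --> va s 13 = kp --> i < n --> va s 11 = i -->
			eval w z s ?ea = fa kp i & fa kp i <= 2 * n"
	 proof (intro allI impI)
		fix s kp i assume s: "q_background s1 s" "kp < 2" "va s 13 = kp" "i < n" "va s 11 = i"
		note b = compressed_bg[OF c s(1)]
		have sm: "kp < pow2 w" "0 < pow2 w" "1 < pow2 w" "length A < pow2 w" "i < pow2 w" using b s by linarith+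
		have "rank A i <= length A" if "i < length A" using rank_less[OF that] by simp
		thus "eval w z s ?ea = fa kp i & fa kp i <= 2 * n" using ev_RK[OF c s(1,5,4)] sm s(3,5) b(4) rk_le[of A i] A(1) n by (auto simp: ev fa_def rk_flip_def rk_def)
	 qed
	 show "ALL s kp j. q_background s1 s --> kp < 2 --> va s 13 = kp --> j < length qs --> va s 12 = j -->
			map (eval w z s) [?l, ?r] = qs ! j & valid1 n (qs ! j)"
	 proof (intro allI impI conjI)
		fix s kp j assume s: "q_background s1 s" "kp < 2" "va s 13 = kp" "j < length qs" "va s 12 = j"
		show "valid1 n (qs ! j)" by (rule qv[OF s(4)])
		have v: "qs ! j ! 0 <= n" "qs ! j ! 1 <= n" using qv[OF s(4)] by (auto simp: valid1_def)
		hence "map (eval w z s) [?l, ?r] = [qs ! j ! 0, qs ! j ! 1]" using ev_QC[OF c s(1) s(5,4)] by simp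
		also have "... = qs ! j" using list_2_nth[OF q(2)[OF s(4)]] by simp
		finally show "map (eval w z s) [?l, ?r] = qs ! j" .
	 qed
	 show "ALL s kp j. q_background s1 s --> kp < 2 --> va s 13 = kp --> j < length qs --> va s 12 = j -->
			va s 15 = pairs1 (>) (map (%i. int (fa kp i)) [0..<n]) (qs ! j) --> va s 16 = R kp j --> eval w z s ?eacc = R (Suc kp) j"
	 proof (intro allI impI)
		fix s kp j assume s: "q_background s1 s" "kp < 2" "va s 13 = kp" "j < length qs" "va s 12 = j"
		 "va s 15 = pairs1 (>) (map (%i. int (fa kp i)) [0..<n]) (qs ! j)" "va s 16 = R kp j"
		note b = compressed_bg[OF c s(1)]
		let ?q = "qs ! j"
		have s15: "va s 15 = ans kp j" using s by (simp add: ans_def)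
		have v: "1 <= ?q ! 0" "?q ! 0 <= ?q ! 1" "?q ! 0 <= n" "?q ! 1 <= n" using qv[OF s(4)] by (auto simp: valid1_def)
		have qc: "eval w z s ?l = ?q ! 0" "eval w z s ?r = ?q ! 1" using ev_QC[OF c s(1) s(5,4)] v by auto
		have nn: "4 * (n * n) < pow2 w"
		proof -
		 have "100 * (n + 2) ^ 2 <= pow2 w" using c unfolding compressed_def by linarith
		 moreover have "4 * (n * n) < 100 * (n + 2) ^ 2" by (simp add: power2_eq_square algebra_simps)
		 ultimately show ?thesis by linarith
		qed
		have pr: "(?q ! 1 + 1 - ?q ! 0) * (?q ! 1 - ?q ! 0) <= n * n" using v by (intro mult_mono) auto
		have al: "ans 0 j <= n * n" "ans 1 j <= n * n" using ansle[OF s(4)] by blast+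
		have sm: "kp < pow2 w" "0 < pow2 w" "1 < pow2 w" "2 < pow2 w" "?q ! 1 + 1 < pow2 w" "?q ! 0 <= ?q ! 1 + 1" using b s v by linarith+
		have prw: "(?q ! 1 + 1 - ?q ! 0) * (?q ! 1 - ?q ! 0) < pow2 w" using pr nn by linarith
		have e: "eval w z s ((?r [+] Num 1 [-] ?l) [*] (?r [-] ?l) [div] Num 2) = tot j"
		proof -
		 have "eval w z s (?r [+] Num 1 [-] ?l) = ?q ! 1 + 1 - ?q ! 0" "eval w z s (?r [-] ?l) = ?q ! 1 - ?q ! 0" using qc sm v by (simp_all add: ev)
		 hence "eval w z s ((?r [+] Num 1 [-] ?l) [*] (?r [-] ?l)) = (?q ! 1 + 1 - ?q ! 0) * (?q ! 1 - ?q ! 0)" using prw by (subst ev_Mul) simp_all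
		 thus ?thesis using sm by (simp add: ev_Div ev_Num tot_def)
		qed
		have a15: "eval w z s (Var 15) = ans kp j" using s15 ansle[OF s(4), of kp] nn by (simp add: ev_Var)
		consider "kp = 0" | "kp = 1" using s(2) by linarith
		thus "eval w z s ?eacc = R (Suc kp) j"
		proof cases
		 case 1
		 hence "eval w z s ?eacc = eval w z s ((?r [+] Num 1 [-] ?l) [*] (?r [-] ?l) [div] Num 2 [-] Var 15)" using s(3) sm by (simp add: ev_Num ev_Var ev_Equal eval.simps(5))
		 also have "... = tot j - ans 0 j" using e a15 1 key[OF s(4)] by (subst ev_Sub) simp_all
		 finally show ?thesis using 1 by (simp add: R_def)
		next
		 case 2
		 have "tot j <= n * n" using pr unfolding tot_def by linarith
		 hence "va s 16 < pow2 w" using s(7) 2 nn by (simp add: R_def)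
		 thus ?thesis using 2 s(3,7) sm a15 key[OF s(4)] by (simp add: ev R_def)
		qed
	 qed
	qed
 qed (use wf_c_compress in \<open>simp_all add: pairs1_le valid_set valid1_def\<close>)
qed

text \<open>With \<open>L\<close> in variable 4, row 4 holds at \<open>u * L + k\<close> the number
  of earlier entries whose rank lies in block \<open>u\<close> of level \<open>k\<close>. The
  inversions that end at the current entry are counted over the levels at which its block is a left
  sibling, by the occupancy of the right sibling. Row 5 receives their prefix sums.\<close>

definition c_prefix :: cmd where
 "c_prefix = For 11 8 (Asg 19 (Get (Num 1) (Var 11)) ;; Asg 20 (Num 0) ;;
	For 18 4 (Asg 21 (Var 19 [>>] Var 18) ;;
	 Ite (Var 21 [mod] Num 2) Nop
		(Asg 20 (Var 20 [+] Get (Num 4) ((Var 21 [+] Num 1) [*] Var 4 [+] Var 18)))) ;;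
	For 18 4 (Asg 21 ((Var 19 [>>] Var 18) [*] Var 4 [+] Var 18) ;;
	 Put (Num 4) (Var 21) (Get (Num 4) (Var 21) [+] Num 1)) ;;
	Put (Num 5) (Var 11 [+] Num 1) (Get (Num 5) (Var 11) [+] Var 20))"

lemma mult_add_cancel:
 fixes u k :: nat
 assumes "u * L + k = u' * L + k'" "k < L" "k' < L"
 shows "u = u' & k = k'"
proof -
 have "(u * L + k) div L = u" "(u' * L + k') div L = u'" using assms(2,3) by simp_all
 with assms(1) show ?thesis by auto
qed

lemma run_c_prefix:
 assumes c: "compressed d w z n inp A qs s" and fresh: "ar s 4 = (%_. 0)" "ar s 5 = (%_. 0)"
	and s': "s' = run w z c_prefix s"
 shows "(ALL y. y ~: {11, 18, 19, 20, 21} --> va s' y = va s y) & (ALL q. q ~: {4, 5} --> ar s' q = ar s q) &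
	(\<forall>x\<le>length A. ar s' 5 x = inner_sum (rel (>) (%i. A ! i)) 1 (Suc x))"
proof -
 let ?L = "lg n" and ?N = "length A" and ?a = "rank A"
 have v: "va s 8 = ?N" "va s 4 = ?L" "?N <= n" "!!i. i < ?N ==> ar s 1 i = ?a i" using c by (auto simp: compressed_def)
 have zz: "100 * n + 200 <= pow2 z" "pow2 z <= pow2 w" "100 * (n + 2) ^ 2 <= pow2 z" using c unfolding compressed_def by linarith+
 define U where "U = (n + 2) * (n + 2)"
 have U: "100 * U <= pow2 z" using zz(3) by (simp add: U_def power2_eq_square)
 have L: "?L <= n + 2" "0 < ?L" by (rule lg_le_self lg_pos)+
 have keyb: "u * ?L + k < U" "u * ?L <= U" if "u <= n + 1" "k < ?L" for u k
 proof -
	have "u * ?L + k < u * ?L + ?L" using that by simp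
	also have "... = (u + 1) * ?L" by simp
	also have "... <= U" unfolding U_def using that L by (intro mult_le_mono) auto
	finally show "u * ?L + k < U" .
	thus "u * ?L <= U" by linarith
 qed
 have sm: "?L < pow2 w" "5 < pow2 w" "4 < pow2 w" "1 < pow2 w" "2 < pow2 w" "5 < pow2 z" "4 < pow2 z" "1 < pow2 z" "0 < pow2 w" using zz L by linarith+
 have Nn: "n < 2 ^ ?L" using lg_ge[of n] by linarith
 let ?c = "%j k u. card {i. i < j & ?a i div 2 ^ k = u}"
 let ?PI = "%x. inner_sum (rel (>) (%i. A ! i)) 1 (Suc x)"
 have cle: "?c j k u <= j" for j k u
 proof -
	have "?c j k u <= card {..<j}" by (rule card_mono) auto
	thus ?thesis by simp
 qed
 have PIle: "?PI x <= U" if "x <= n" for x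
 proof -
	have "?PI x <= (Suc x - 1) * (Suc x - 1)" by (rule inner_sum_le) (rule rel_le)
	also have "... <= U" unfolding U_def using that by (intro mult_le_mono) auto
	finally show ?thesis .
 qed
 let ?in1 = "Asg 21 (Var 19 [>>] Var 18) ;;
	 Ite (Var 21 [mod] Num 2) Nop (Asg 20 (Var 20 [+] Get (Num 4) ((Var 21 [+] Num 1) [*] Var 4 [+] Var 18)))"
 let ?in2 = "Asg 21 ((Var 19 [>>] Var 18) [*] Var 4 [+] Var 18) ;;
	 Put (Num 4) (Var 21) (Get (Num 4) (Var 21) [+] Num 1)"
 let ?body = "Asg 19 (Get (Num 1) (Var 11)) ;; Asg 20 (Num 0) ;; For 18 4 (?in1) ;; For 18 4 (?in2) ;;
	Put (Num 5) (Var 11 [+] Num 1) (Get (Num 5) (Var 11) [+] Var 20)"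
 let ?I = "%j t. (ALL y. y ~: {11, 18, 19, 20, 21} --> va t y = va s y) & (ALL q. q ~: {4, 5} --> ar t q = ar s q) &
	(ALL k<?L. ALL u. ar t 4 (u * ?L + k) = ?c j k u) & (\<forall>x\<le>j. ar t 5 x = ?PI x)"
 have "EX t. ?I (va s 8) t & run w z (For 11 8 ?body) s = set_va 11 (va s 8) t"
 proof (rule run_For_inv)
	show "?I 0 s" using fresh by (simp add: inner_sum_def)
 next
	fix j and t :: ast assume "j < va s 8" and I: "?I j t"
	hence j: "j < ?N" "j < n" "j <= n" using v by auto
	let ?x = "?a j"
	have x: "?x < ?N" "?x < n" using rank_less[OF j(1)] v by auto
	define t1 where "t1 = set_va 20 0 (set_va 19 ?x (set_va 11 j t))"
	have jz: "j < pow2 z" "j < pow2 w" "?x < pow2 w" "j + 1 < pow2 z" "j + 1 < pow2 w" using j x zz by linarith+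
	have r1: "run w z (Asg 19 (Get (Num 1) (Var 11)) ;; Asg 20 (Num 0)) (set_va 11 j t) = t1" using I v(4)[OF j(1)] jz sm by (simp add: ev t1_def)
	let ?s = "%k. \<Sum>k'<k. if even (?x div 2 ^ k') then ?c j k' (Suc (?x div 2 ^ k')) else 0"
	have sle: "?s k <= U" if "k <= ?L" for k
	proof -
	 have "?s k <= (\<Sum>k'<k. j)" by (rule sum_mono) (use cle in auto)
	 also have "... = k * j" by simp
	 also have "... <= U" unfolding U_def using that L j by (intro mult_le_mono) auto
	 finally show ?thesis .
	qed
	let ?J = "%k u. (ALL y. y ~: {18, 20, 21} --> va u y = va t1 y) & ar u = ar t1 & va u 20 = ?s k"
	have "EX u. ?J (va t1 4) u & run w z (For 18 4 (?in1)) t1 = set_va 18 (va t1 4) u"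
	proof (rule run_For_inv)
	 show "?J 0 t1" by (simp add: t1_def)
	next
	 fix k and u :: ast assume "k < va t1 4" and J: "?J k u"
	 hence k: "k < ?L" using I v by (simp add: t1_def)
	 let ?y = "?x div 2 ^ k"
	 have y: "?y <= n" using x by (meson div_le_dividend le_less_trans less_imp_le)
	 have ky: "(?y + 1) * ?L + k < U" "(?y + 1) * ?L <= U" using keyb[of "?y + 1" k] y k by simp_all
	 have kw: "k < pow2 w" "?y < pow2 w" "?y + 1 < pow2 w" "(?y + 1) * ?L < pow2 w" "(?y + 1) * ?L + k < pow2 w" "(?y + 1) * ?L + k < pow2 z"
		 "?s k + ?c j k (Suc ?y) < pow2 w" "?s k < pow2 w" "?c j k (Suc ?y) < pow2 w" using k sm y zz U ky sle[of k] cle[of j k "Suc ?y"] j by linarith+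
	 define u1 where "u1 = set_va 21 ?y (set_va 18 k u)"
	 have ru: "run w z (Asg 21 (Var 19 [>>] Var 18)) (set_va 18 k u) = u1" using J kw jz by (simp add: ev u1_def t1_def pow2_def[of k])
	 have T: "ar u1 4 ((?y + 1) * ?L + k) = ?c j k (Suc ?y)" using J I k by (simp add: u1_def t1_def del: mult_Suc)
	 have vu: "va u1 21 = ?y" "va u1 4 = ?L" "va u1 18 = k" "va u1 20 = ?s k" using J I v by (simp_all add: u1_def t1_def)
	 have e1: "eval w z u1 (Var 21 [mod] Num 2) = ?y mod 2" using vu kw sm by (simp add: ev)
	 have e2: "eval w z u1 ((Var 21 [+] Num 1) [*] Var 4 [+] Var 18) = (?y + 1) * ?L + k"
	 proof -
		have "eval w z u1 (Var 21 [+] Num 1) = ?y + 1" "eval w z u1 (Var 4) = ?L" "eval w z u1 (Var 18) = k" using vu kw sm by (simp_all add: ev)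
		moreover from this have "eval w z u1 ((Var 21 [+] Num 1) [*] Var 4) = (?y + 1) * ?L" using kw by (subst ev_Mul) simp_all
		ultimately show ?thesis using kw by (subst ev_Add) simp_all
	 qed
	 have e3: "eval w z u1 (Get (Num 4) ((Var 21 [+] Num 1) [*] Var 4 [+] Var 18)) = ?c j k (Suc ?y)"
	 proof -
		have "eval w z u1 (Num 4) = 4" using sm by (simp add: ev)
		thus ?thesis using e2 T kw sm by (subst ev_Get) simp_all
	 qed
	 have e4: "eval w z u1 (Var 20 [+] Get (Num 4) ((Var 21 [+] Num 1) [*] Var 4 [+] Var 18)) = ?s k + ?c j k (Suc ?y)" using e3 vu(4) kw by (subst ev_Add) (simp_all add: ev_Var)
	 have "run w z ?in1 (set_va 18 k u) = (if even ?y then set_va 20 (?s k + ?c j k (Suc ?y)) u1 else u1)" using ru e1 e4 by (auto simp: even_iff_mod_2_eq_zero)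
	 thus "?J (Suc k) (run w z ?in1 (set_va 18 k u))" using J vu by (auto simp: u1_def)
	qed
	then obtain u where u: "?J ?L u" "run w z (For 18 4 (?in1)) t1 = set_va 18 ?L u" using I v by (auto simp: t1_def)
	define t2 where "t2 = set_va 18 ?L u"
	have vt2: "va t2 4 = ?L" "va t2 19 = ?x" "va t2 11 = j" "ar t2 = ar t" "va t2 20 = ?s ?L" using u(1) I v by (simp_all add: t2_def t1_def)
	\<comment> \<open>While the table is updated, the levels below \<open>k\<close> already include the
	  new entry.\<close>
	let ?K = "%k u. (ALL y. y ~: {18, 21} --> va u y = va t2 y) & (ALL q. q ~= 4 --> ar u q = ar t q) &
	 (ALL k'<?L. ALL u'. ar u 4 (u' * ?L + k') = ?c j k' u' + (if k' < k & u' = ?x div 2 ^ k' then 1 else 0))"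
	have "EX u. ?K (va t2 4) u & run w z (For 18 4 (?in2)) t2 = set_va 18 (va t2 4) u"
	proof (rule run_For_inv)
	 show "?K 0 t2" using I vt2 by simp
	next
	 fix k and u :: ast assume "k < va t2 4" and K: "?K k u"
	 hence k: "k < ?L" using vt2 by simp
	 let ?y = "?x div 2 ^ k"
	 have y: "?y <= n" using x by (meson div_le_dividend le_less_trans less_imp_le)
	 have ky: "?y * ?L + k < U" "?y * ?L <= U" using keyb[of "?y" k] y k by simp_all
	 have kw: "k < pow2 w" "?y < pow2 w" "?y * ?L < pow2 w" "?y * ?L + k < pow2 w" "?y * ?L + k < pow2 z" "?c j k ?y + 1 < pow2 w"
		 "?c j k ?y < pow2 w" using k sm y zz U ky cle[of j k ?y] j by linarith+
	 have e: "eval w z (set_va 18 k u) ((Var 19 [>>] Var 18) [*] Var 4 [+] Var 18) = ?y * ?L + k"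
	 proof -
		have "eval w z (set_va 18 k u) (Var 19 [>>] Var 18) = ?y" "eval w z (set_va 18 k u) (Var 4) = ?L"
			"eval w z (set_va 18 k u) (Var 18) = k" using K vt2 kw jz sm by (simp_all add: ev pow2_def[of k])
		moreover from this have "eval w z (set_va 18 k u) ((Var 19 [>>] Var 18) [*] Var 4) = ?y * ?L" using kw by (subst ev_Mul) simp_all
		ultimately show ?thesis using kw by (subst ev_Add) simp_all
	 qed
	 have T: "ar u 4 (?y * ?L + k) = ?c j k ?y" using K k by simp
	 have "run w z ?in2 (set_va 18 k u) = set_ar 4 (?y * ?L + k) (?c j k ?y + 1) (set_va 21 (?y * ?L + k) (set_va 18 k u))" using e T kw sm by (simp add: run_Put ev)
	 thus "?K (Suc k) (run w z ?in2 (set_va 18 k u))" using K k T by (auto simp: less_Suc_eq dest: mult_add_cancel)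
	qed
	then obtain u2 where u2: "?K ?L u2" "run w z (For 18 4 (?in2)) t2 = set_va 18 ?L u2" using vt2 by auto
	define t3 where "t3 = set_va 18 ?L u2"
	have PIj: "ar u2 5 j = ?PI j" using u2(1) I by simp
	have PIw: "?PI j + ?s ?L < pow2 w" "?PI j < pow2 w" "?s ?L < pow2 w" using PIle[OF j(3)] sle[of ?L] U zz by linarith+
	have r3: "run w z (Put (Num 5) (Var 11 [+] Num 1) (Get (Num 5) (Var 11) [+] Var 20)) t3 = set_ar 5 (j + 1) (?PI j + ?s ?L) t3" using u2(1) vt2 PIj PIw jz sm by (simp add: run_Put ev t3_def)
	have run: "run w z ?body (set_va 11 j t) = set_ar 5 (j + 1) (?PI j + ?s ?L) t3" using r1 u(2) u2(2) r3 by (simp add: t2_def t3_def)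
	\<comment> \<open>\<open>less_levels\<close> sorts the earlier entries of larger rank by the one
	  level at which their block is the right sibling of that of \<open>?x\<close>.\<close>
	have inv: "?s ?L = (\<Sum>i<j. of_bool (A ! j < A ! i))"
	proof -
	 have "(\<Sum>i<j. of_bool (A ! j < A ! i) :: nat) = (\<Sum>i<j. of_bool (?x < ?a i))" using j rank_less_iff[of j A] by (intro sum.cong) auto
	 also have "... = (\<Sum>i<j. \<Sum>k<?L. of_bool (even (?x div 2 ^ k) & ?a i div 2 ^ k = Suc (?x div 2 ^ k)))"
	 proof (rule sum.cong[OF refl], rule less_levels)
		fix i assume "i : {..<j}"
		hence "?a i < ?N" using j by (intro rank_less) simp
		thus "?a i < 2 ^ ?L" using v Nn by linarith
	 qed
	 also have "... = (\<Sum>k<?L. \<Sum>i<j. of_bool (even (?x div 2 ^ k) & ?a i div 2 ^ k = Suc (?x div 2 ^ k)))" by (rule sum.swap)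
	 also have "... = ?s ?L"
	 proof (intro sum.cong refl)
		fix k
		have "{i. i < j & ?a i div 2 ^ k = Suc (?x div 2 ^ k)} = {..<j} \<inter> {i. ?a i div 2 ^ k = Suc (?x div 2 ^ k)}" by auto
		thus "(\<Sum>i<j. of_bool (even (?x div 2 ^ k) & ?a i div 2 ^ k = Suc (?x div 2 ^ k))) =
			(if even (?x div 2 ^ k) then ?c j k (Suc (?x div 2 ^ k)) else 0)" by simp
	 qed
	 finally show ?thesis by simp
	qed
	have PIS: "?PI (Suc j) = ?PI j + ?s ?L"
	proof -
	 have "?PI (Suc j) = ?PI j + (\<Sum>i\<in>{1..<Suc j}. rel (>) (%i. A ! i) i (Suc j))" by (simp add: inner_sum_def)
	 also have "(\<Sum>i\<in>{1..<Suc j}. rel (>) (%i. A ! i) i (Suc j)) = (\<Sum>i<j. of_bool (A ! j < A ! i))" unfolding One_nat_def sum.shift_bounds_Suc_ivl atLeast0LessThan rel_def diff_Suc_Suc diff_zero by (rule refl)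
	 finally show ?thesis by (simp add: inv)
	qed
	have cS: "?c (Suc j) k u = ?c j k u + (if u = ?x div 2 ^ k then 1 else 0)" for k u
	proof -
	 have "{i. i < Suc j & ?a i div 2 ^ k = u} = (if u = ?x div 2 ^ k then insert j {i. i < j & ?a i div 2 ^ k = u}
		 else {i. i < j & ?a i div 2 ^ k = u})" by (auto simp: less_Suc_eq)
	 thus ?thesis by simp
	qed
	let ?t = "set_ar 5 (j + 1) (?PI j + ?s ?L) t3"
	have "\<forall>x\<le>Suc j. ar ?t 5 x = ?PI x" using u2(1) I PIS by (simp add: t3_def le_Suc_eq)
	moreover have "ALL k<?L. ALL u. ar ?t 4 (u * ?L + k) = ?c (Suc j) k u" using u2(1) by (simp add: t3_def cS)
	moreover have "(ALL y. y ~: {11, 18, 19, 20, 21} --> va ?t y = va s y) & (ALL q. q ~: {4, 5} --> ar ?t q = ar s q)" using I u2(1) u(1) by (simp add: t3_def t2_def t1_def)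
	ultimately show "?I (Suc j) (run w z ?body (set_va 11 j t))" unfolding run by blast
 qed
 then obtain t where t: "?I ?N t" "s' = set_va 11 ?N t" using v unfolding s' c_prefix_def by auto
 thus ?thesis by auto
qed

lemma cost_c_prefix:
 assumes "v 4 = lg n" "v 8 <= C * n"
 shows "cost v c_prefix <= (100 + 100 * C) * (n + 1) * (lg n + 1)"
proof -
 have "cost v c_prefix <= 3 + v 8 * (60 + 80 * lg n)" by (simp add: c_prefix_def assms(1) algebra_simps)
 also have "... <= 3 + C * n * (60 + 80 * lg n)" using assms by (intro add_mono mult_mono) auto
 also have "... <= (100 + 100 * C) * (n + 1) * (lg n + 1)" by (simp add: algebra_simps)
 finally show ?thesis .
qed

text \<open>The inversions in \<open>[l, r]\<close> are those of the prefix up to \<open>r\<close>,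
  minus those of the prefix up to \<open>l - 1\<close>, minus those across this cut. The prefixes
  are tabulated beforehand, so one two-range query is enough. For \<open>l = 1\<close> nothing lies
  left of the cut; a dummy query is sent and its answer replaced by 0.\<close>

theorem inversions_to_two_range:
 assumes solver: "solvable_in_time (two_range_query (>) alp bet) T" and lb: "linear_bounds alp bet"
 shows "\<exists>T' \<in> soft_O T. solvable_in_time (range_query (>) alp' bet') T'"
proof -
 obtain C where C: "!!w N inp out. gquery 2 valid1 (pairs1 (>)) alp' bet' w N inp out ==> 2 <= length inp & inp ! 0 = N &
	length out = inp ! 1 & inp ! 0 <= C * N & inp ! 1 <= C * N & length inp <= C * (N + 1)" using gquery_size[of 2] by (metis zero_less_numeral)
 let ?l = "QC 2 0" and ?r = "QC 2 1"
 let ?if = "Cnd (Num 1 [<] ?l)"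
 let ?es = "[Num 1, ?if (?l [-] Num 1) (Num 1), ?if ?l (Num 2), ?if ?r (Num 2)]"
 let ?eacc = "Get (Num 5) ?r [-] (Get (Num 5) (?l [-] Num 1) [+] ?if (Var 15) (Num 0))"
 show ?thesis unfolding range_query_gquery
 proof (rule gquery_reduction[OF solver[unfolded two_range_query_gquery] lb, where k = 0 and C = C and K = 1
		and ?c1.0 = "c_compress ;; c_prefix"
		and ea = RK and es = ?es and ms = "[1, 1, 2, 2]" and eacc = ?eacc and ?d0.0 = "C + 400"
		and ?a1.0 = "3000 + 2000 * C" and ?e1.0 = 1])
	show "\<exists>epl>0. \<forall>\<^sub>F N in sequentially. epl * real N <= T N" using lower_bound2[OF solver lb] by simp
	show "cost v (c_compress ;; c_prefix) <= (3000 + 2000 * C) * (n + 1) * (lg n + 1) ^ 1"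
	 if "v 3 = n" "v 4 = lg n" "v 7 <= C * n" "v 8 <= C * n" "v 17 <= 2 * n + 2" for n v
	proof -
	 have "cost v (c_compress ;; c_prefix) <= (2000 + 1000 * C) * (n + 1) * (lg n + 1) + (100 + 100 * C) * (n + 1) * (lg n + 1)" using cost_c_compress[of v n C] cost_c_prefix[of v n C] that by simp
	 also have "... = (2000 + 1000 * C + (100 + 100 * C)) * (n + 1) * (lg n + 1)" by (simp only: add_mult_distrib)
	 also have "... <= (3000 + 2000 * C) * (n + 1) * (lg n + 1)" by (intro mult_right_mono) auto
	 finally show ?thesis by simp
	qed
	show "2 <= length inp & inp ! 0 = N & length out = inp ! 1 & inp ! 0 <= C * N & inp ! 1 <= C * N & length inp <= C * (N + 1)"
	 if "gquery 2 valid1 (pairs1 (>)) alp' bet' w N inp out" for w N inp out by (rule C[OF that])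
 next
	fix e w z N n inp out s0 s1
	assume Q: "gquery 2 valid1 (pairs1 (>)) alp' bet' w N inp out" and e: "C + 400 <= e" and n: "N <= n" "2 <= n"
	 and z: "z = e * lg n" "4 * z <= w" and s0: "q_start w z n inp s0" and s1: "s1 = run w z (c_compress ;; c_prefix) s0"
	define s2 where "s2 = run w z c_compress s0"
	have s12: "s1 = run w z c_prefix s2" by (simp add: s1 s2_def)
	have "length inp <= C * (N + 1)" using C[OF Q] by blast
	from run_compressed[OF Q this e n z s0 s2_def]
	obtain A qs where c2: "compressed 2 w z n inp A qs s2" and A: "length A = N" "out = map (pairs1 (>) A) qs"
		"\<forall>q\<in>set qs. valid1 N q" "inp ! 1 = length qs" and st: "ALL q. q ~: {1, 2, 3} --> ar s2 q = start_ar inp q" by metis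
	let ?g = "rel (>) (%i. A ! i)"
	let ?PI = "%x. inner_sum ?g 1 (Suc x)"
	have pr: "(ALL y. y ~: {11, 18, 19, 20, 21} --> va s1 y = va s2 y) & (ALL q. q ~: {4, 5} --> ar s1 q = ar s2 q) &
		(\<forall>x\<le>length A. ar s1 5 x = ?PI x)" by (rule run_c_prefix[OF c2 _ _ s12]) (use st in \<open>auto simp: start_ar_def\<close>)
	hence c: "compressed 2 w z n inp A qs s1" using c2 by (auto simp: compressed_def)
	have rk_le_n: "rk A i <= 2 * n" for i using rk_le[of A i] A(1) n by linarith
	define fq where "fq j = (if 1 < qs ! j ! 0 then [1, qs ! j ! 0 - 1, qs ! j ! 0, qs ! j ! 1] else [1, 1, 2, 2])" for j
	define ans where "ans j = pairs2 (>) (map (%i. int (rk A i)) [0..<n]) (fq j)" for j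
	define R where "R kp j = (if kp = 0 then 0 else pairs1 (>) A (qs ! j))" for kp j :: nat
	have q: "valid1 N (qs ! j)" "length (qs ! j) = 2" if "j < length qs" for j using that A(3) c by (auto simp: compressed_def)
	have qv: "valid1 n (qs ! j)" if "j < length qs" for j using q[OF that] n by (auto simp: valid1_def)
	have fqv: "valid2 n (fq j)" if "j < length qs" for j using qv[OF that] n by (auto simp: fq_def valid1_def valid2_def numeral_2_eq_2 numeral_3_eq_3)
	have key: "?PI (qs ! j ! 1) = ?PI (qs ! j ! 0 - 1) + (if 1 < qs ! j ! 0 then ans j else 0) + pairs1 (>) A (qs ! j)"
	 if j: "j < length qs" for j
	proof -
	 let ?q = "qs ! j"
	 have v: "1 <= ?q ! 0" "?q ! 0 <= ?q ! 1" "?q ! 1 <= N" using q[OF j] by (auto simp: valid1_def)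
	 show ?thesis
	 proof (cases "1 < ?q ! 0")
		case True
		have "ans j = across ?g 1 (Suc (?q ! 0 - 1)) (?q ! 0) (Suc (?q ! 1))" using True v A n unfolding ans_def fq_def by (simp add: pairs2_rk)
		moreover have "Suc (?q ! 0 - 1) = ?q ! 0" using v by simp
		ultimately show ?thesis using True v inner_sum_split[of 1 "?q ! 0" "Suc (?q ! 1)" ?g] unfolding pairs1_inner_sum by simp
	 next
		case False
		hence "?q ! 0 = 1" using v by simp
		thus ?thesis unfolding pairs1_inner_sum by (simp add: inner_sum_def[of _ "Suc 0" "Suc 0"])
	 qed
	qed
	have U: "4 * (n * n) < pow2 w"
	proof -
	 have "100 * (n + 2) ^ 2 <= pow2 w" using c unfolding compressed_def by linarith
	 moreover have "4 * (n * n) < 100 * (n + 2) ^ 2" by (simp add: power2_eq_square algebra_simps)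
	 ultimately show ?thesis by linarith
	qed
	have PIle: "?PI x <= n * n" if "x <= n" for x
	proof -
	 have "?PI x <= (Suc x - 1) * (Suc x - 1)" by (rule inner_sum_le) (rule rel_le)
	 also have "... <= n * n" using that by (intro mult_le_mono) auto
	 finally show ?thesis .
	qed
	have "\<forall>q\<ge>16. ar s1 q = (%_. 0)" "ar s1 7 = (%_. 0)" using c by (auto simp: compressed_def start_ar_def)
	moreover have "eval w z s RK = rk A i & rk A i <= 2 * n"
	 if "q_background s1 s" "va s 11 = i" "i < n" for s i using ev_RK[OF c that] rk_le_n by blast
	moreover have "R 0 j = 0 & R 1 j = out ! j" if "j < length qs" for j using that A(2) by (auto simp: R_def)
	moreover have "map (eval w z s) ?es = fq j & eval w z s ?r = qs ! j ! 1 & eval w z s (?l [-] Num 1) = qs ! j ! 0 - 1 &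
		eval w z s (?if (Var 15) (Num 0)) = (if 1 < qs ! j ! 0 then eval w z s (Var 15) else 0)"
	 if s: "q_background s1 s" "j < length qs" "va s 12 = j" for s j
	proof -
	 note b = compressed_bg[OF c s(1)]
	 have v: "qs ! j ! 0 <= n" "qs ! j ! 1 <= n" "1 <= qs ! j ! 0" using qv[OF s(2)] by (auto simp: valid1_def)
	 have qc: "eval w z s ?l = qs ! j ! 0" "eval w z s ?r = qs ! j ! 1" using ev_QC[OF c s(1) s(3,2)] v by auto
	 have "0 < pow2 w" "1 < pow2 w" "2 < pow2 w" using b by linarith+
	 thus ?thesis using qc v by (simp add: ev_Num ev_Less ev_Sub eval.simps(5) fq_def)
	qed
	note ev_es = this
	moreover have "eval w z s ?eacc = R 1 j"
	 if s: "q_background s1 s" "j < length qs" "va s 12 = j" "va s 15 = ans j" for s j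
	proof -
	 note b = compressed_bg[OF c s(1)]
	 let ?q = "qs ! j"
	 have v: "?q ! 0 <= n" "?q ! 1 <= N" "1 <= ?q ! 0" "?q ! 0 <= ?q ! 1" using q[OF s(2)] n by (auto simp: valid1_def)
	 have al: "ans j <= n * n" unfolding ans_def by (rule pairs2_le[OF fqv[OF s(2)]])
	 have sm: "5 < pow2 w" "5 < pow2 z" "?q ! 1 < pow2 z" "?q ! 0 - 1 < pow2 z" using b v n by linarith+
	 have pz: "?PI (?q ! 1) < pow2 w" "?PI (?q ! 0 - 1) < pow2 w" "ans j < pow2 w" "?PI (?q ! 0 - 1) + ans j < pow2 w" using PIle[of "?q ! 1"] PIle[of "?q ! 0 - 1"] al U v n by linarith+
	 have g5: "ar s 5 (?q ! 1) = ?PI (?q ! 1)" "ar s 5 (?q ! 0 - 1) = ?PI (?q ! 0 - 1)" using b(8) pr v A by auto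
	 note ev = ev_es[OF s(1,2,3)]
	 have n5: "eval w z s (Num 5) = 5" using sm by (simp add: ev_Num)
	 have "eval w z s (Get (Num 5) ?r) = ?PI (?q ! 1)" using sm pz g5 n5 ev by (subst ev_Get) simp_all
	 moreover have "eval w z s (Get (Num 5) (?l [-] Num 1)) = ?PI (?q ! 0 - 1)" using sm pz g5 n5 ev by (subst ev_Get) simp_all
	 moreover have c15: "eval w z s (?if (Var 15) (Num 0)) = (if 1 < ?q ! 0 then ans j else 0)" using ev s(4) pz by (simp add: ev_Var)
	 ultimately have "eval w z s (Get (Num 5) (?l [-] Num 1) [+] ?if (Var 15) (Num 0)) = ?PI (?q ! 0 - 1) + (if 1 < ?q ! 0 then ans j else 0)" using pz by (subst ev_Add) auto
	 with \<open>eval w z s (Get (Num 5) ?r) = ?PI (?q ! 1)\<close> show ?thesis using key[OF s(2)] by (subst ev_Sub) (auto simp: R_def)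
	qed
	ultimately have "q_correct valid2 (pairs2 (>)) 1 w z n inp out RK ?es ?eacc s1 (%_. rk A) (%_. fq) R" unfolding q_correct_def A(4) using fqv unfolding ans_def by (auto simp: R_def)
	thus "EX fa fq R. q_correct valid2 (pairs2 (>)) 1 w z n inp out RK ?es ?eacc s1 fa fq R" by blast
 qed (use wf_c_compress in \<open>simp_all add: pairs2_le valid_set valid2_def c_prefix_def q_vars_def numeral_2_eq_2 numeral_3_eq_3\<close>)
qed

section \<open>Counting triangles with range queries\<close>

text \<open>A triangle through an edge is determined by its third vertex, a common neighbour of the
  two ends.\<close>

lemma triangles_at_eq:
 assumes E: "!!e. e : E ==> card e = 2" and uv: "{u, v} : E" "u ~= v" and fin: "finite E"
 shows "triangles_at E {u, v} = card {x. {u, x} : E & {v, x} : E}"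
proof -
 have ne: "x ~= u & x ~= v" if "{u, x} : E" "{v, x} : E" for x using E[OF that(1)] E[OF that(2)] by auto
 have "{t. is_triangle E t & {u, v} <= t} = (%x. {u, v, x}) ` {x. {u, x} : E & {v, x} : E}"
 proof (intro set_eqI iffI)
	fix t assume t: "t : {t. is_triangle E t & {u, v} <= t}"
	hence "card t = 3" "finite t" by (auto simp: is_triangle_def intro: card_ge_0_finite)
	hence "card (t - {u, v}) = 1" using t uv by (simp add: card_Diff_subset)
	then obtain x where "t - {u, v} = {x}" by (auto simp: card_1_singleton_iff)
	hence x: "t = {u, v, x}" "x ~= u" "x ~= v" using t by auto
	with t show "t : (%x. {u, v, x}) ` {x. {u, x} : E & {v, x} : E}" by (auto simp: is_triangle_def)
 next
	fix t assume "t : (%x. {u, v, x}) ` {x. {u, x} : E & {v, x} : E}"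
	then obtain x where x: "t = {u, v, x}" "{u, x} : E" "{v, x} : E" by auto
	with ne[OF x(2,3)] uv show "t : {t. is_triangle E t & {u, v} <= t}" by (auto simp: is_triangle_def insert_commute)
 qed
 moreover have "inj_on (%x. {u, v, x}) {x. {u, x} : E & {v, x} : E}"
 proof (rule inj_onI)
	fix x y assume "x : {x. {u, x} : E & {v, x} : E}" "y : {x. {u, x} : E & {v, x} : E}" and eq: "{u, v, x} = {u, v, y}"
	hence "x ~= u" "x ~= v" using ne by auto
	moreover have "x : {u, v, y}" unfolding eq[symmetric] by simp
	ultimately show "x = y" by simp
 qed
 ultimately show ?thesis unfolding triangles_at_def by (simp add: card_image)
qed

text \<open>Loop bounds have to be read-only variables, and \<open>m\<close> is available but
  \<open>2 * m\<close> is not; so each iteration runs the command for both ends of an edge.\<close>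

lemma run_pairs:
 assumes "I 0 s" and step: "!!e t. e < 2 * m ==> I e t ==> va t 19 = e ==> I (Suc e) (run w z c t)"
	and insens: "!!e t x. I e t ==> I e (set_va 11 x t) & I e (set_va 19 x t)"
	and v: "va s p = m" "11 ~: assigned c" "2 * m + 1 < pow2 w"
 shows "EX t. I (2 * m) t &
	run w z (For 11 p (Asg 19 (Num 2 [*] Var 11) ;; c ;; Asg 19 (Num 2 [*] Var 11 [+] Num 1) ;; c)) s = set_va 11 m t"
proof -
 let ?body = "Asg 19 (Num 2 [*] Var 11) ;; c ;; Asg 19 (Num 2 [*] Var 11 [+] Num 1) ;; c"
 have "EX t. I (2 * va s p) t & run w z (For 11 p ?body) s = set_va 11 (va s p) t"
 proof (rule run_For_inv)
	show "I (2 * 0) s" using assms(1) by simp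
 next
	fix i and t :: ast assume "i < va s p" and I: "I (2 * i) t"
	hence i: "2 * i + 1 < 2 * m" using v by simp
	have sm: "2 < pow2 w" "i < pow2 w" "2 * i < pow2 w" "2 * i + 1 < pow2 w" "1 < pow2 w" using i v(3) by linarith+
	define t1 where "t1 = set_va 19 (2 * i) (set_va 11 i t)"
	have r1: "run w z (Asg 19 (Num 2 [*] Var 11)) (set_va 11 i t) = t1" using sm by (simp add: ev t1_def)
	define t2 where "t2 = run w z c t1"
	have I2: "I (2 * i + 1) t2" using step[of "2 * i" t1] insens I i by (simp add: t1_def t2_def)
	have v2: "va t2 11 = i" using v(2) by (simp add: t2_def run_va_unassigned t1_def)
	define t3 where "t3 = set_va 19 (2 * i + 1) t2"
	have r3: "run w z (Asg 19 (Num 2 [*] Var 11 [+] Num 1)) t2 = t3" using sm v2 by (simp add: ev t3_def)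
	have "I (Suc (2 * i + 1)) (run w z c t3)" by (rule step) (use i I2 insens in \<open>auto simp: t3_def\<close>)
	moreover have "run w z ?body (set_va 11 i t) = run w z c t3" using r1 r3 by (simp add: t2_def)
	ultimately show "I (2 * Suc i) (run w z ?body (set_va 11 i t))" by simp
 qed
 thus ?thesis using v(1) by simp
qed

lemma bij_betw_index:
 fixes X :: "nat set"
 assumes "finite X"
 shows "bij_betw (%e. card {e' : X. e' < e}) X {..<card X}"
proof -
 have lt: "card {e' : X. e' < e} < card {e' : X. e' < f}" if "e : X" "e < f" for e f
 proof (rule psubset_card_mono)
	show "{e' : X. e' < e} \<subset> {e' : X. e' < f}" using that by auto
 qed (use assms in simp)
 have inj: "inj_on (%e. card {e' : X. e' < e}) X"
 proof (rule inj_onI)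
	fix e f assume ef: "e : X" "f : X" "card {e' : X. e' < e} = card {e' : X. e' < f}"
	thus "e = f" using lt[of e f] lt[of f e] by (cases e f rule: linorder_cases) auto
 qed
 have "(%e. card {e' : X. e' < e}) ` X <= {..<card X}"
 proof safe
	fix e assume e: "e : X"
	have "{e' : X. e' < e} \<subset> X" using e by auto
	from psubset_card_mono[OF assms this] show "card {e' : X. e' < e} < card X" .
 qed
 moreover have "card ((%e. card {e' : X. e' < e}) ` X) = card {..<card X}" by (simp add: card_image[OF inj])
 ultimately have "(%e. card {e' : X. e' < e}) ` X = {..<card X}" by (intro card_subset_eq) auto
 with inj show ?thesis by (simp add: bij_betw_def)
qed

text \<open>
 The edges listed in the input are read as \<open>2 * m\<close> directed edges; the source of the \<open>e\<close>-th one
 is \<open>inp ! (2 + e)\<close> and its target is the source of its mate.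
\<close>

definition src :: "nat list => nat => nat" where
 "src inp e = inp ! (2 + e)"

definition mate :: "nat => nat" where
 "mate e = (if even e then e + 1 else e - 1)"

definition graph_input :: "nat list => nat list => nat set set => bool" where
 "graph_input inp out E \<longleftrightarrow> (let m = inp ! 1 in
	length inp = 2 + 2 * m & inp ! 0 <= 2 * m & (ALL e<2 * m. 1 <= src inp e & src inp e <= inp ! 0) &
	inj_on (%i. {src inp (2 * i), src inp (2 * i + 1)}) {..<m} & (ALL i<m. src inp (2 * i) ~= src inp (2 * i + 1)) &
	E = (%i. {src inp (2 * i), src inp (2 * i + 1)}) ` {..<m} &
	out = map (%i. triangles_at E {src inp (2 * i), src inp (2 * i + 1)}) [0..<m])"

lemma triangle_graph_input:
 assumes "edge_triangle_counting w m inp out"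
 obtains E where "graph_input inp out E" "inp ! 1 = m"
proof -
 from assms obtain n es where es: "simple_graph {1..n} (set (map (%(u, v). {u, v}) es))"
	 "no_isolated_vertices {1..n} (set (map (%(u, v). {u, v}) es))"
	 "distinct (map (%(u, v). {u, v}) es)" "length es = m"
	 "inp = [n, m] @ concat (map (%(u, v). [u, v]) es)"
	 "out = map (triangles_at (set (map (%(u, v). {u, v}) es))) (map (%(u, v). {u, v}) es)" unfolding edge_triangle_counting_def Let_def by auto
 define E where "E = set (map (%(u, v). {u, v}) es)"
 have l2: "\<forall>x\<in>set (map (%(u, v). [u, v]) es). length x = 2" by auto
 have len: "length inp = 2 + 2 * m" using es(4,5) length_concat_const[OF l2] by simp
 have src: "src inp (2 * i) = fst (es ! i)" "src inp (2 * i + 1) = snd (es ! i)" if "i < m" for i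
 proof -
	have "concat (map (%(u, v). [u, v]) es) ! (2 * i + k) = map (%(u, v). [u, v]) es ! i ! k" if "k < 2" for k by (rule nth_concat_const[OF l2]) (use \<open>i < m\<close> that es(4) in auto)
	from this[of 0] this[of 1] show "src inp (2 * i) = fst (es ! i)" "src inp (2 * i + 1) = snd (es ! i)" using that es(4) unfolding src_def es(5) by (auto simp: split_beta)
 qed
 have edge: "(%(u, v). {u, v}) (es ! i) = {src inp (2 * i), src inp (2 * i + 1)}" if "i < m" for i using src[OF that] by (simp add: split_beta)
 have map_es: "map (%(u, v). {u, v}) es = map (%i. {src inp (2 * i), src inp (2 * i + 1)}) [0..<m]" using es(4) edge by (intro nth_equalityI) auto
 have E: "E = (%i. {src inp (2 * i), src inp (2 * i + 1)}) ` {..<m}" unfolding E_def map_es by (auto simp: atLeast0LessThan)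
 have card2: "card {src inp (2 * i), src inp (2 * i + 1)} = 2 & {src inp (2 * i), src inp (2 * i + 1)} <= {1..n}" if "i < m" for i using es(1) E that unfolding E_def[symmetric] simple_graph_def by auto
 have "1 <= src inp e & src inp e <= n" if "e < 2 * m" for e
 proof -
	have i: "e div 2 < m" using that by auto
	have "e = 2 * (e div 2) | e = 2 * (e div 2) + 1" by auto
	with card2[OF i] show ?thesis by (metis atLeastAtMost_iff insert_subset)
 qed
 moreover have "src inp (2 * i) ~= src inp (2 * i + 1)" if "i < m" for i using card2[OF that] by auto
 moreover have "inj_on (%i. {src inp (2 * i), src inp (2 * i + 1)}) {..<m}" using es(3) unfolding map_es distinct_map by (simp add: atLeast0LessThan)
 \<comment> \<open>Without isolated vertices every vertex is an end of some edge, which keeps the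
   number of vertices linear in \<open>m\<close>.\<close>
 moreover have "n <= 2 * m"
 proof -
	have "{1..n} <= src inp ` {..<2 * m}"
	proof
	 fix v assume "v : {1..n}"
	 then obtain e where "e : E" "v : e" using es(2) unfolding E_def[symmetric] no_isolated_vertices_def by blast
	 then obtain i where "i < m" "v = src inp (2 * i) | v = src inp (2 * i + 1)" unfolding E by auto
	 thus "v : src inp ` {..<2 * m}" by (elim disjE) auto
	qed
	from card_mono[OF _ this] card_image_le[of "{..<2 * m}" "src inp"] show ?thesis by simp
 qed
 moreover have "inp ! 0 = n" "inp ! 1 = m" using es(5) by simp_all
 moreover have "out = map (%i. triangles_at E {src inp (2 * i), src inp (2 * i + 1)}) [0..<m]" using es(6)[folded E_def, unfolded map_es] by simp
 ultimately have "graph_input inp out E" unfolding graph_input_def Let_def using len E by simp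
 with \<open>inp ! 1 = m\<close> show thesis by (rule that[rotated])
qed

lemma mate: "e < 2 * m ==> mate e < 2 * m" "mate (mate e) = e" "mate e ~= e" "mate e div 2 = e div 2"
 unfolding mate_def by (auto elim!: oddE evenE)

definition out_edges :: "nat list => nat => nat set" where
 "out_edges inp u = {e. e < 2 * (inp ! 1) & src inp e = u}"

text \<open>The listed edges are distinct, so among the directed edges that leave \<open>u\<close>
  each is identified by its target.\<close>

lemma out_edges_neighbours:
 assumes "graph_input inp out E"
 shows "bij_betw (%e. src inp (mate e)) (out_edges inp u) {x. {u, x} : E}"
proof -
 let ?m = "inp ! 1"
 have edge: "{src inp e, src inp (mate e)} = {src inp (2 * (e div 2)), src inp (2 * (e div 2) + 1)}" if "e < 2 * ?m" for e by (cases "even e") (auto simp: mate_def elim!: evenE oddE)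
 have g: "E = (%i. {src inp (2 * i), src inp (2 * i + 1)}) ` {..<?m}"
	"inj_on (%i. {src inp (2 * i), src inp (2 * i + 1)}) {..<?m}" "!!i. i < ?m ==> src inp (2 * i) ~= src inp (2 * i + 1)" using assms by (auto simp: graph_input_def Let_def)
 have ne: "src inp e ~= src inp (mate e)" if "e < 2 * ?m" for e
 proof -
	have "e div 2 < ?m" using that by auto
	from g(3)[OF this] show ?thesis by (cases "even e") (auto simp: mate_def elim!: evenE oddE)
 qed
 show ?thesis unfolding bij_betw_def
 proof (intro conjI inj_onI set_eqI iffI)
	fix e f assume e: "e : out_edges inp u" and f: "f : out_edges inp u" and eq: "src inp (mate e) = src inp (mate f)"
	hence ef: "e < 2 * ?m" "f < 2 * ?m" "src inp e = u" "src inp f = u" by (auto simp: out_edges_def)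
	hence "e div 2 = f div 2" using edge[OF ef(1)] edge[OF ef(2)] eq inj_onD[OF g(2), of "e div 2" "f div 2"] by auto
	hence "f = e | f = mate e" unfolding mate_def by (cases "even e"; cases "even f") (auto elim!: evenE oddE)
	thus "e = f" using ne[OF ef(1)] ef by auto
 next
	fix x assume "x : (%e. src inp (mate e)) ` out_edges inp u"
	then obtain e where e: "e < 2 * ?m" "u = src inp e" "x = src inp (mate e)" by (auto simp: out_edges_def)
	hence "e div 2 < ?m" by auto
	with e edge[OF e(1)] show "x : {x. {u, x} : E}" unfolding g(1) by auto
 next
	fix x assume "x : {x. {u, x} : E}"
	then obtain i where i: "i < ?m" "{u, x} = {src inp (2 * i), src inp (2 * i + 1)}" unfolding g(1) by auto
	then consider "u = src inp (2 * i)" "x = src inp (2 * i + 1)" | "u = src inp (2 * i + 1)" "x = src inp (2 * i)" by (auto simp: doubleton_eq_iff)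
	thus "x : (%e. src inp (mate e)) ` out_edges inp u"
	proof cases
	 case 1
	 thus ?thesis using i by (intro image_eqI[of _ _ "2 * i"]) (auto simp: mate_def out_edges_def)
	next
	 case 2
	 thus ?thesis using i by (intro image_eqI[of _ _ "2 * i + 1"]) (auto simp: mate_def out_edges_def)
	qed
 qed
qed

text \<open>A neighbour occurs once in each adjacency list, so common neighbours are the pairs of
  equal entries of two lists.\<close>

lemma common_neighbours:
 assumes g: "graph_input inp out E" and j: "j < inp ! 1" and uv: "u = src inp (2 * j)" "v = src inp (2 * j + 1)"
 shows "out ! j = (\<Sum>e\<in>out_edges inp u. \<Sum>f\<in>out_edges inp v. of_bool (src inp (mate e) = src inp (mate f)))"
proof -
 let ?N = "%u. {x. {u, x} : E}"
 have fin_o: "finite (out_edges inp u)" for u by (simp add: out_edges_def)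
 have fin: "finite (?N u)" for u using out_edges_neighbours[OF g] fin_o by (rule bij_betw_finite[THEN iffD1])
 have E: "E = (%i. {src inp (2 * i), src inp (2 * i + 1)}) ` {..<inp ! 1}" "u ~= v"
	"!!e. e : E ==> card e = 2" using g j uv by (auto simp: graph_input_def Let_def card_insert_if)
 have "(\<Sum>e\<in>out_edges inp u. \<Sum>f\<in>out_edges inp v. of_bool (src inp (mate e) = src inp (mate f))) =
	 (\<Sum>x\<in>?N u. \<Sum>f\<in>out_edges inp v. of_bool (x = src inp (mate f)))" by (rule sum.reindex_bij_betw[OF out_edges_neighbours[OF g]])
 also have "... = (\<Sum>x\<in>?N u. \<Sum>y\<in>?N v. of_bool (x = y))" by (intro sum.cong refl sum.reindex_bij_betw[OF out_edges_neighbours[OF g]])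
 also have "... = (\<Sum>x\<in>?N u. of_bool (x : ?N v))" using fin by (intro sum.cong refl) (simp add: of_bool_def sum.delta)
 also have "... = card {x : ?N u. x : ?N v}" using fin by (subst card_filter) auto
 also have "{x : ?N u. x : ?N v} = {x. {u, x} : E & {v, x} : E}" by auto
 also have "card ... = triangles_at E {u, v}" using j uv E by (intro triangles_at_eq[symmetric]) auto
 also have "... = out ! j" using g j uv by (simp add: graph_input_def Let_def)
 finally show ?thesis by simp
qed

section \<open>Adjacency lists by counting sort\<close>

definition adj_count :: cmd where
 "adj_count = Asg 20 (Get (Num 0) (Num 2 [+] Var 19)) ;; Asg 21 (Get (Num 4) (Var 20)) ;;
	Put (Num 5) (Var 19) (Var 21) ;; Put (Num 4) (Var 20) (Var 21 [+] Num 1)"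

text \<open>The target of edge \<open>e\<close> stands at address \<open>2 + mate e\<close>, which
  is \<open>e + 1\<close> for odd and \<open>e + 3\<close> for even \<open>e\<close>.\<close>

definition adj_place :: cmd where
 "adj_place = Asg 20 (Get (Num 0) (Num 2 [+] Var 19)) ;;
	Put (Num 1) (Get (Num 6) (Var 20) [+] Get (Num 5) (Var 19))
	 (Get (Num 0) (Cnd (Var 19 [mod] Num 2) (Var 19 [+] Num 1) (Var 19 [+] Num 3)))"

definition each_end :: "cmd => cmd" where
 "each_end c = For 11 7 (Asg 19 (Num 2 [*] Var 11) ;; c ;; Asg 19 (Num 2 [*] Var 11 [+] Num 1) ;; c)"

text \<open>Row 4 ends with the degrees, row 5 numbers each directed edge among those with the same
  source, row 6 gets the starts of the lists and row 1 the lists themselves. Vertices are numbered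
  from 1, hence the offsets; the start of the first list is the 0 that is already there.\<close>

definition c_adj :: cmd where
 "c_adj = each_end adj_count ;;
	For 11 8 (Put (Num 6) (Var 11 [+] Num 2) (Get (Num 6) (Var 11 [+] Num 1) [+] Get (Num 4) (Var 11 [+] Num 1))) ;;
	each_end adj_place"

text \<open>The adjacency lists are laid out one after the other; the list of \<open>u\<close> starts at \<open>first u\<close>.\<close>

definition first :: "nat list => nat => nat" where
 "first inp u = card {e. e < 2 * (inp ! 1) & src inp e < u}"

lemma first_Suc: "first inp (Suc u) = first inp u + card (out_edges inp u)"
proof -
 have "{e. e < 2 * (inp ! 1) & src inp e < Suc u} = {e. e < 2 * (inp ! 1) & src inp e < u} \<union> out_edges inp u" by (auto simp: out_edges_def)
 thus ?thesis unfolding first_def by (simp add: card_Un_disjoint out_edges_def disjoint_iff)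
qed

lemma first_le: "first inp u <= 2 * (inp ! 1)"
proof -
 have "first inp u <= card {..<2 * (inp ! 1)}" unfolding first_def by (rule card_mono) auto
 thus ?thesis by simp
qed

lemma first_mono: "u <= v ==> first inp u <= first inp v"
 unfolding first_def by (rule card_mono) auto

definition place :: "nat list => nat => nat" where
 "place inp e = first inp (src inp e) + card {e' : out_edges inp (src inp e). e' < e}"

lemma place_bij: "bij_betw (place inp) (out_edges inp u) {first inp u..<first inp (Suc u)}"
proof -
 have fin: "finite (out_edges inp u)" by (simp add: out_edges_def)
 have "bij_betw (%k. first inp u + k) {..<card (out_edges inp u)} {first inp u..<first inp (Suc u)}" unfolding first_Suc by (rule bij_betwI[where g = "%k. k - first inp u"]) auto
 from bij_betw_trans[OF bij_betw_index[OF fin] this]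
 have "bij_betw (%e. first inp u + card {e' : out_edges inp u. e' < e}) (out_edges inp u) {first inp u..<first inp (Suc u)}" by (simp add: o_def)
 thus ?thesis by (subst bij_betw_cong[of _ _ "%e. first inp u + card {e' : out_edges inp u. e' < e}"])
	 (auto simp: place_def out_edges_def)
qed

text \<open>Edges with different sources fall into disjoint intervals of positions.\<close>

lemma place_inj:
 assumes "e < 2 * (inp ! 1)" "f < 2 * (inp ! 1)" "place inp e = place inp f"
 shows "e = f"
proof -
 have e: "e : out_edges inp (src inp e)" "f : out_edges inp (src inp f)" using assms by (auto simp: out_edges_def)
 hence "place inp e : {first inp (src inp e)..<first inp (Suc (src inp e))}"
	 "place inp f : {first inp (src inp f)..<first inp (Suc (src inp f))}" using place_bij bij_betwE by blast+
 hence "src inp e = src inp f" using assms(3) first_mono[of "Suc (src inp e)" "src inp f" inp] first_mono[of "Suc (src inp f)" "src inp e" inp] by (cases "src inp e" "src inp f" rule: linorder_cases) auto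
 with e assms(3) place_bij[of inp "src inp e"] show ?thesis by (auto simp: bij_betw_def inj_on_def)
qed

lemma run_adj:
 fixes s :: ast
 assumes g: "graph_input inp out E" and m: "m = inp ! 1" and v: "va s 7 = m" "va s 8 = inp ! 0"
	and ar: "ar s = start_ar inp" and bounds: "8 * m + 100 <= pow2 z" "pow2 z <= pow2 w"
	and s': "s' = run w z c_adj s"
 shows "(ALL y. y ~: {11, 19, 20, 21} --> va s' y = va s y) & (ALL q. q ~: {1, 4, 5, 6} --> ar s' q = ar s q) &
	(ALL u. 1 <= u --> u <= inp ! 0 + 1 --> ar s' 6 u = first inp u) &
	(ALL e<2 * m. ar s' 1 (place inp e) = src inp (mate e)) &
	(ALL x. x ~: place inp ` {..<2 * m} --> ar s' 1 x = 0)"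
proof -
 let ?n = "inp ! 0"
 have gi: "length inp = 2 + 2 * m" "?n <= 2 * m" "!!e. e < 2 * m ==> 1 <= src inp e & src inp e <= ?n" using g m by (auto simp: graph_input_def Let_def)
 let ?occ = "%e. card {e' : out_edges inp (src inp e). e' < e}"
 let ?cnt = "%e u. card {e' : out_edges inp u. e' < e}"
 have cnt_le: "?cnt e u <= 2 * m" for e u
 proof -
	have "?cnt e u <= card {..<2 * m}" by (rule card_mono) (auto simp: out_edges_def m)
	thus ?thesis by simp
 qed
 have fl: "first inp u <= 2 * m" for u using first_le[of inp u] m by simp
 have sm: "6 < pow2 z" "5 < pow2 z" "4 < pow2 z" "1 < pow2 z" "0 < pow2 z" "6 < pow2 w" "5 < pow2 w" "4 < pow2 w" "3 < pow2 w"
	"2 < pow2 w" "1 < pow2 w" "0 < pow2 w" "2 * m + 1 < pow2 w" using bounds by linarith+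
 let ?I = "%e t. (ALL y. y ~: {11, 19, 20, 21} --> va t y = va s y) & (ALL q. q ~: {4, 5} --> ar t q = ar s q) &
	(ALL u. ar t 4 u = ?cnt e u) & (ALL f<e. ar t 5 f = ?occ f)"
 have "EX t. ?I (2 * m) t & run w z (each_end adj_count) s = set_va 11 m t" unfolding each_end_def
 proof (rule run_pairs)
	show "?I 0 s" using ar by (simp add: start_ar_def)
	show "va s 7 = m" "11 ~: assigned adj_count" "2 * m + 1 < pow2 w" using v sm by (simp_all add: adj_count_def)
	show "?I e (set_va 11 x t) & ?I e (set_va 19 x t)" if "?I e t" for e and t :: ast and x using that by simp
 next
	fix e and t :: ast assume e: "e < 2 * m" and I: "?I e t" and t: "va t 19 = e"
	let ?u = "src inp e"
	have u: "?u <= 2 * m" using gi(2) gi(3)[OF e] by linarith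
	have b: "e < pow2 w" "e < pow2 z" "2 + e < pow2 w" "2 + e < pow2 z" "?u < pow2 w" "?u < pow2 z" "?cnt e ?u + 1 < pow2 w" "?cnt e ?u < pow2 w" using bounds e u cnt_le[of ?u e] by linarith+
	have "ar t 0 (2 + e) = ?u" using I ar e gi(1) by (simp add: start_ar_def src_def)
	hence r: "run w z adj_count t = set_ar 4 ?u (?cnt e ?u + 1) (set_ar 5 e (?cnt e ?u) (set_va 21 (?cnt e ?u) (set_va 20 ?u t)))" using I t b sm by (simp add: ev run_Put adj_count_def)
	have "?cnt (Suc e) u = ?cnt e u + (if u = ?u then 1 else 0)" for u
	proof -
	 have "{e' : out_edges inp u. e' < Suc e} = (if u = ?u then insert e {e' : out_edges inp u. e' < e} else {e' : out_edges inp u. e' < e})" using e m by (auto simp: out_edges_def less_Suc_eq)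
	 thus ?thesis by (simp add: out_edges_def)
	qed
	thus "?I (Suc e) (run w z adj_count t)" unfolding r using I by (auto simp: less_Suc_eq)
 qed
 then obtain t1 where t1: "?I (2 * m) t1" "run w z (each_end adj_count) s = set_va 11 m t1" by blast
 have deg: "?cnt (2 * m) u = card (out_edges inp u)" for u by (rule arg_cong[of _ _ card]) (auto simp: out_edges_def m)
 let ?J = "%i t. (ALL y. y ~= 11 --> va t y = va t1 y) & (ALL q. q ~= 6 --> ar t q = ar t1 q) & (ALL u. 1 <= u --> u <= i + 1 --> ar t 6 u = first inp u)"
 let ?c2 = "Put (Num 6) (Var 11 [+] Num 2) (Get (Num 6) (Var 11 [+] Num 1) [+] Get (Num 4) (Var 11 [+] Num 1))"
 have "EX t. ?J (va (set_va 11 m t1) 8) t & run w z (For 11 8 ?c2) (set_va 11 m t1) = set_va 11 (va (set_va 11 m t1) 8) t"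
 proof (rule run_For_inv)
	have "first inp 1 = 0" using gi(3) m by (force simp: first_def)
	moreover have "ar t1 6 1 = 0" using t1(1) ar by (simp add: start_ar_def)
	ultimately show "?J 0 (set_va 11 m t1)" by (auto simp: le_Suc_eq)
 next
	fix i and t :: ast assume "i < va (set_va 11 m t1) 8" and J: "?J i t"
	hence i: "i < ?n" using t1(1) v by simp
	have b: "i < pow2 w" "i + 1 < pow2 w" "i + 2 < pow2 w" "i + 1 < pow2 z" "i + 2 < pow2 z" using i gi(2) bounds by linarith+
	have a: "ar t 6 (i + 1) = first inp (i + 1)" "ar t 4 (i + 1) = card (out_edges inp (i + 1))" using J t1(1) deg by simp_all
	have f2: "first inp (i + 1) + card (out_edges inp (i + 1)) = first inp (i + 2)" using first_Suc[of inp "i + 1"] by simp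
	have b2: "first inp (i + 1) < pow2 w" "card (out_edges inp (i + 1)) < pow2 w" "first inp (i + 2) < pow2 w" using fl[of "i + 1"] fl[of "i + 2"] f2 bounds by linarith+
	have r: "run w z ?c2 (set_va 11 i t) = set_ar 6 (i + 2) (first inp (i + 2)) (set_va 11 i t)" using a f2 b b2 sm by (simp add: ev run_Put)
	show "?J (Suc i) (run w z ?c2 (set_va 11 i t))" unfolding r using J by (auto simp: le_Suc_eq)
 qed
 then obtain t2 where t2: "?J ?n t2" "run w z (For 11 8 ?c2) (set_va 11 m t1) = set_va 11 ?n t2" using t1(1) v by auto
 define s2 where "s2 = set_va 11 ?n t2"
 have s2: "ALL y. y ~: {11, 19, 20, 21} --> va s2 y = va s y" "ALL q. q ~: {4, 5, 6} --> ar s2 q = ar s q"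
	"!!u. 1 <= u ==> u <= ?n + 1 ==> ar s2 6 u = first inp u" "!!e. e < 2 * m ==> ar s2 5 e = ?occ e" using t1(1) t2(1) by (auto simp: s2_def)
 let ?H = "%e t. (ALL y. y ~: {11, 19, 20, 21} --> va t y = va s y) & (ALL q. q ~= 1 --> ar t q = ar s2 q) &
	(ALL f<e. ar t 1 (place inp f) = src inp (mate f)) & (ALL x. x ~: place inp ` {..<e} --> ar t 1 x = 0)"
 have "EX t. ?H (2 * m) t & run w z (each_end adj_place) s2 = set_va 11 m t" unfolding each_end_def
 proof (rule run_pairs)
	show "?H 0 s2" using s2(1,2) ar by (simp add: start_ar_def)
	show "va s2 7 = m" "11 ~: assigned adj_place" "2 * m + 1 < pow2 w" using v s2(1) sm by (simp_all add: adj_place_def)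
	show "?H e (set_va 11 x t) & ?H e (set_va 19 x t)" if "?H e t" for e and t :: ast and x using that by simp
 next
	fix e and t :: ast assume e: "e < 2 * m" and H: "?H e t" and t: "va t 19 = e"
	let ?u = "src inp e" and ?v = "src inp (mate e)" and ?o = "if e mod 2 ~= 0 then e + 1 else e + 3"
	have me: "mate e < 2 * m" "2 + mate e = ?o" using mate(1)[OF e] by (auto simp: mate_def odd_iff_mod_2_eq_one elim!: oddE)
	have u: "?u <= 2 * m" "?v <= 2 * m" "1 <= ?u" "?u <= ?n" using gi(2) gi(3)[OF e] gi(3)[OF me(1)] by linarith+
	have a: "ar t 0 (2 + e) = ?u" "ar t 6 ?u = first inp ?u" "ar t 5 e = ?occ e" "ar t 0 ?o = ?v" using H s2 ar e me gi(1) u by (auto simp: start_ar_def src_def simp flip: me(2))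
	have b: "e < pow2 w" "e < pow2 z" "2 + e < pow2 w" "2 + e < pow2 z" "?u < pow2 w" "?u < pow2 z" "?v < pow2 w"
		"first inp ?u < pow2 w" "?occ e < pow2 w" "place inp e < pow2 w" "place inp e < pow2 z" "e + 3 < pow2 w" "e + 3 < pow2 z" "e + 1 < pow2 w"
		"e + 1 < pow2 z" "?o < pow2 z" using bounds e u cnt_le[of ?u e] fl[of ?u] unfolding place_def by (simp_all split: if_splits)
	have off: "eval w z (set_va 20 ?u t) (Get (Num 6) (Var 20) [+] Get (Num 5) (Var 19)) = place inp e" using a t b sm unfolding place_def by (simp add: ev)
	have oe: "eval w z (set_va 20 ?u t) (Cnd (Var 19 [mod] Num 2) (Var 19 [+] Num 1) (Var 19 [+] Num 3)) = ?o" using t b sm by (simp add: ev)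
	have val: "eval w z (set_va 20 ?u t) (Get (Num 0) (Cnd (Var 19 [mod] Num 2) (Var 19 [+] Num 1) (Var 19 [+] Num 3))) = ?v" using oe a(4) b sm by (subst ev_Get) (simp_all add: ev_Num del: One_nat_def)
	have r: "run w z adj_place t = set_ar 1 (place inp e) ?v (set_va 20 ?u t)" unfolding adj_place_def using a(1) t b sm off val by (simp add: run_Put ev_Num ev_Var ev_Add ev_Get)
	have pl: "place inp f ~= place inp e" if "f < e" for f
	proof
	 assume "place inp f = place inp e"
	 moreover have "f < 2 * (inp ! 1)" "e < 2 * (inp ! 1)" using that e m by simp_all
	 ultimately have "f = e" by (metis place_inj)
	 with that show False by simp
	qed
	have H': "ALL y. y ~: {11, 19, 20, 21} --> va t y = va s y" "ALL q. q ~= 1 --> ar t q = ar s2 q"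
		"ALL f<e. ar t 1 (place inp f) = src inp (mate f)" "ALL x. x ~: place inp ` {..<e} --> ar t 1 x = 0" using H by blast+
	show "?H (Suc e) (run w z adj_place t)" unfolding r using H' pl by (simp add: less_Suc_eq lessThan_Suc)
 qed
 then obtain t3 where t3: "?H (2 * m) t3" "run w z (each_end adj_place) s2 = set_va 11 m t3" by blast
 have "s' = set_va 11 m t3" unfolding s' c_adj_def using t1(2) t2(2) t3(2) by (simp add: s2_def)
 thus ?thesis using t3(1) s2 by auto
qed

lemma wf_c_adj: "wf_cmd q_vars c_adj"
 by (simp add: c_adj_def each_end_def adj_count_def adj_place_def q_vars_def)

lemma cost_c_adj:
 assumes "v 7 <= C * n" "v 8 <= C * n"
 shows "cost v c_adj <= (100 + 1000 * C) * (n + 1)"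
proof -
 have "cost v c_adj <= 10 + 500 * v 7 + 100 * v 8" by (simp add: c_adj_def each_end_def adj_count_def adj_place_def)
 also have "... <= 10 + 500 * (C * n) + 100 * (C * n)" using assms by (intro add_mono mult_left_mono) auto
 also have "... <= (100 + 1000 * C) * (n + 1)" by (simp add: algebra_simps)
 finally show ?thesis .
qed

section \<open>Cutting adjacency lists into chunks\<close>

lemma sum_div_mod:
 fixes f :: "nat => nat => nat"
 assumes "0 < b"
 shows "(\<Sum>k<a * b. f (k div b) (k mod b)) = (\<Sum>i<a. \<Sum>j<b. f i j)"
proof -
 have "bij_betw (%(i, j). i * b + j) ({..<a} \<times> {..<b}) {..<a * b}"
 proof (rule bij_betwI[where g = "%k. (k div b, k mod b)"])
	show "(%(i, j). i * b + j) : {..<a} \<times> {..<b} \<rightarrow> {..<a * b}"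
	proof safe
	 fix i j assume "i < a" "j < b"
	 hence "i * b + j < Suc i * b" by simp
	 moreover have "Suc i * b <= a * b" by (rule mult_le_mono1) (use \<open>i < a\<close> in simp)
	 ultimately show "i * b + j < a * b" by linarith
	qed
 qed (use assms in \<open>auto simp: less_mult_imp_div_less\<close>)
 from sum.reindex_bij_betw[OF this, of "%k. f (k div b) (k mod b)"]
 have "(\<Sum>k<a * b. f (k div b) (k mod b)) =
	 (\<Sum>x\<in>{..<a} \<times> {..<b}. f ((case x of (i, j) => i * b + j) div b) ((case x of (i, j) => i * b + j) mod b))" by (rule sym)
 also have "... = (\<Sum>x\<in>{..<a} \<times> {..<b}. case x of (i, j) => f i j)" by (intro sum.cong refl) auto
 finally show ?thesis by (simp add: sum.cartesian_product)
qed

lemma sum_chunks: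
 fixes f :: "nat => nat"
 shows "(\<Sum>c<k. \<Sum>x\<in>{max s (c * h)..<min e (c * h + h)}. f x) = (\<Sum>x\<in>{s..<min e (k * h)}. f x)"
proof (induction k)
 case (Suc k)
 have "(\<Sum>x\<in>{s..<min e (k * h)}. f x) + (\<Sum>x\<in>{max s (k * h)..<min e (k * h + h)}. f x) = (\<Sum>x\<in>{s..<min e (k * h)} \<union> {max s (k * h)..<min e (k * h + h)}. f x)" by (rule sum.union_disjoint[symmetric]) auto
 also have "{s..<min e (k * h)} \<union> {max s (k * h)..<min e (k * h + h)} = {s..<min e (Suc k * h)}" by auto
 finally show ?case using Suc by simp
qed simp

text \<open>The lists have up to \<open>2 * n\<close> entries in total, but an array has only
  \<open>n\<close>. So each call joins two chunks of length \<open>n div 2\<close>, number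
  \<open>kp div 8\<close> for the first end of an edge and \<open>kp mod 8\<close> for the second.
  Eight chunks suffice because \<open>n >= 2\<close>, and this gives the 64 kinds of calls.\<close>

definition X_h :: aexp where "X_h = Var 3 [div] Num 2"
definition X_c :: aexp where "X_c = (Var 13 [div] Num 8) [*] X_h"
definition X_d :: aexp where "X_d = (Var 13 [mod] Num 8) [*] X_h"
definition X_u :: aexp where "X_u = Get (Num 0) (Num 2 [+] Num 2 [*] Var 12)"
definition X_v :: aexp where "X_v = Get (Num 0) (Num 3 [+] Num 2 [*] Var 12)"
definition X_lo :: "aexp => aexp => aexp" where
 "X_lo u c = Cnd (Get (Num 6) u [<] c) c (Get (Num 6) u)"
definition X_hi :: "aexp => aexp => aexp" where
 "X_hi u c = Cnd (Get (Num 6) (u [+] Num 1) [<] c [+] X_h) (Get (Num 6) (u [+] Num 1)) (c [+] X_h)"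
text \<open>Both lists must meet their chunks; otherwise the call has nothing to contribute for this
  edge and a dummy query is sent.\<close>

definition X_ok :: aexp where
 "X_ok = Cnd (X_lo X_u X_c [<] X_hi X_u X_c) (X_lo X_v X_d [<] X_hi X_v X_d) (Num 0)"
definition X_array :: aexp where
 "X_array = Cnd (Var 11 [<] X_h) (Get (Num 1) (X_c [+] Var 11))
	(Cnd (Var 11 [<] X_h [+] X_h) (Get (Num 1) (X_d [+] Var 11 [-] X_h)) (Num 0))"
text \<open>The second chunk stands behind the first, so its positions are shifted by
  \<open>n div 2\<close>. This makes the two ranges disjoint even where the lists or chunks
  coincide.\<close>

definition X_query :: "aexp list" where
 "X_query = [Cnd X_ok (X_lo X_u X_c [-] X_c [+] Num 1) (Num 1), Cnd X_ok (X_hi X_u X_c [-] X_c) (Num 1),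
	Cnd X_ok (X_lo X_v X_d [-] X_d [+] X_h [+] Num 1) (Num 2), Cnd X_ok (X_hi X_v X_d [-] X_d [+] X_h) (Num 2)]"
definition X_acc :: aexp where
 "X_acc = Cnd X_ok (Var 16 [+] Var 15) (Var 16)"

lemma sum_shift:
 fixes f :: "nat => nat"
 assumes "a <= l" "l <= h"
 shows "(\<Sum>i\<in>{l - a + k..<h - a + k}. f i) = (\<Sum>x\<in>{l..<h}. f (x - a + k))"
 by (rule sum.reindex_bij_witness[where i = "%x. x - a + k" and j = "%i. i + a - k"]) (use assms in auto)

lemma sum_chunk_pairs:
 fixes g :: "nat => nat => nat"
 assumes "e <= k * h" "e' <= k * h"
 shows "(\<Sum>c<k. \<Sum>d<k. \<Sum>x\<in>{max s (c * h)..<min e (c * h + h)}. \<Sum>y\<in>{max s' (d * h)..<min e' (d * h + h)}. g x y) =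
	(\<Sum>x\<in>{s..<e}. \<Sum>y\<in>{s'..<e'}. g x y)"
proof -
 have "(\<Sum>d<k. \<Sum>x\<in>{max s (c * h)..<min e (c * h + h)}. \<Sum>y\<in>{max s' (d * h)..<min e' (d * h + h)}. g x y) =
	 (\<Sum>x\<in>{max s (c * h)..<min e (c * h + h)}. \<Sum>y\<in>{s'..<e'}. g x y)" for c
 proof -
	have "(\<Sum>d<k. \<Sum>x\<in>{max s (c * h)..<min e (c * h + h)}. \<Sum>y\<in>{max s' (d * h)..<min e' (d * h + h)}. g x y) =
		(\<Sum>x\<in>{max s (c * h)..<min e (c * h + h)}. \<Sum>d<k. \<Sum>y\<in>{max s' (d * h)..<min e' (d * h + h)}. g x y)" by (rule sum.swap)
	thus ?thesis using assms(2) by (simp add: sum_chunks min.absorb1)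
 qed
 thus ?thesis using assms(1) by (simp add: sum_chunks min.absorb1)
qed

theorem triangles_to_two_range:
 assumes solver: "solvable_in_time (two_range_query (=) alp bet) T" and lb: "linear_bounds alp bet"
 shows "\<exists>T' \<in> soft_O T. solvable_in_time edge_triangle_counting T'"
proof -
 let ?C = "4 :: nat"
 show ?thesis
 proof (rule gquery_reduction[OF solver[unfolded two_range_query_gquery] lb, where k = 1 and C = ?C and K = 64
		and ?c1.0 = c_adj and ea = X_array and es = X_query and ms = "[1, 1, 2, 2]" and eacc = X_acc and ?d0.0 = "1000"
		and ?a1.0 = "100 + 1000 * ?C" and ?e1.0 = 0])
	show "\<exists>epl>0. \<forall>\<^sub>F N in sequentially. epl * real N <= T N" using lower_bound2[OF solver lb] by simp
	show "cost v c_adj <= (100 + 1000 * ?C) * (n + 1) * (lg n + 1) ^ 0"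
	 if "v 3 = n" "v 4 = lg n" "v 7 <= ?C * n" "v 8 <= ?C * n" "v 17 <= 2 * n + 2" for n v using cost_c_adj[OF that(3,4)] by simp
	show "2 <= length inp & inp ! 1 = N & length out = inp ! 1 & inp ! 0 <= ?C * N & inp ! 1 <= ?C * N & length inp <= ?C * (N + 1)"
	 if Q: "edge_triangle_counting w N inp out" for w N inp out
	proof -
	 obtain E where "graph_input inp out E" "inp ! 1 = N" using triangle_graph_input[OF Q] by blast
	 thus ?thesis by (simp add: graph_input_def Let_def)
	qed
 next
	fix e w z N n inp out s0 s1
	assume Q: "edge_triangle_counting w N inp out" and e: "1000 <= e" and n: "N <= n" "2 <= n"
	 and z: "z = e * lg n" "4 * z <= w" and s0: "q_start w z n inp s0" and s1: "s1 = run w z c_adj s0"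
	obtain E where g: "graph_input inp out E" and m: "inp ! 1 = N" using triangle_graph_input[OF Q] by blast
	let ?src = "src inp" and ?f = "first inp"
	have gi: "length inp = 2 + 2 * N" "inp ! 0 <= 2 * N" "!!e. e < 2 * N ==> 1 <= ?src e & ?src e <= inp ! 0" using g m by (auto simp: graph_input_def Let_def)
	have zw: "pow2 z <= pow2 w" using z by (intro pow2_mono) auto
	have p2: "100 * (n + 2) ^ 2 <= pow2 z" by (rule poly_le_pow2[OF _ z(1)]) (use e in simp)
	have "100 * (n + 2) <= 100 * (n + 2) ^ 2" by (intro mult_left_mono) (auto simp: power2_eq_square)
	hence zn: "100 * n + 200 <= pow2 z" using p2 by simp
	have nn: "4 * (n * n) < pow2 w"
	proof -
	 have "4 * (n * n) < 100 * (n + 2) ^ 2" by (simp add: power2_eq_square algebra_simps)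
	 with p2 zw show ?thesis by linarith
	qed
	have v0: "va s0 7 = N" "va s0 8 = inp ! 0" "va s0 3 = n" "ar s0 = start_ar inp" using s0 m by (simp_all add: q_start_def)
	have "8 * N + 100 <= pow2 z" using zn n by linarith
	note ra = run_adj[OF g m[symmetric] v0(1,2,4) this zw s1]
	define h where "h = n div 2"
	have h: "h + h <= n" "2 * N <= 8 * h" "h <= n" using n by (auto simp: h_def)
	define D where "D x = ar s1 1 x" for x
	have placeD: "D (place inp e) = ?src (mate e)" if "e < 2 * N" for e using ra that by (simp add: D_def)
	have D_le: "D x <= 2 * n" for x
	proof (cases "x : place inp ` {..<2 * N}")
	 case True
	 then obtain e where "e < 2 * N" "x = place inp e" by auto
	 thus ?thesis using placeD[of e] mate(1)[of e N] gi(2) gi(3)[of "mate e"] n by simp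
	next
	 case False
	 thus ?thesis using ra by (simp add: D_def)
	qed
	have fl: "?f u <= 2 * N" for u using first_le[of inp u] m by simp
	define u v where "u j = ?src (2 * j)" and "v j = ?src (2 * j + 1)" for j
	define c d where "c kp = kp div 8 * h" and "d kp = kp mod 8 * h" for kp
	define l1 h1 l2 h2 where "l1 kp j = max (?f (u j)) (c kp)" and "h1 kp j = min (?f (Suc (u j))) (c kp + h)"
	 and "l2 kp j = max (?f (v j)) (d kp)" and "h2 kp j = min (?f (Suc (v j))) (d kp + h)" for kp j
	define ok where "ok kp j \<longleftrightarrow> l1 kp j < h1 kp j & l2 kp j < h2 kp j" for kp j
	define fa where "fa kp i = (if i < h then D (c kp + i) else if i < h + h then D (d kp + i - h) else 0)" for kp i
	\<comment> \<open>The bounds \<open>l1\<close>, \<open>h1\<close>, \<open>l2\<close>,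
	  \<open>h2\<close> are half-open and count from 0. In the 1-based closed ranges of a query only
	  the left ends change by one.\<close>
	define fq where "fq kp j = (if ok kp j then [l1 kp j - c kp + 1, h1 kp j - c kp, l2 kp j - d kp + h + 1, h2 kp j - d kp + h] else [1, 1, 2, 2])" for kp j
	define W where "W kp j = (\<Sum>x\<in>{l1 kp j..<h1 kp j}. \<Sum>y\<in>{l2 kp j..<h2 kp j}. of_bool (D x = D y) :: nat)" for kp j
	define R where "R kp j = (\<Sum>kp'<kp. W kp' j)" for kp j
	have cd: "c kp <= 4 * n" "d kp <= 4 * n" if "kp < 64" for kp
	proof -
	 have "kp div 8 <= 8" "kp mod 8 <= 8" using that by auto
	 hence "c kp <= 8 * h" "d kp <= 8 * h" unfolding c_def d_def by (auto intro: mult_le_mono1)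
	 thus "c kp <= 4 * n" "d kp <= 4 * n" using h(1) by linarith+
	qed
	have lh: "c kp <= l1 kp j" "h1 kp j <= c kp + h" "d kp <= l2 kp j" "h2 kp j <= d kp + h" for kp j by (simp_all add: l1_def h1_def l2_def h2_def)
	have fqv: "valid2 n (fq kp j)" for kp j using lh[of kp j] h n unfolding fq_def ok_def valid2_def by (auto simp: numeral_2_eq_2 numeral_3_eq_3)
	have ansW: "pairs2 (=) (map (%i. int (fa kp i)) [0..<n]) (fq kp j) = W kp j" if ok: "ok kp j" for kp j
	proof -
	 let ?A = "%i. map (%i. int (fa kp i)) [0..<n] ! i"
	 have le: "l1 kp j <= h1 kp j" "l2 kp j <= h2 kp j" using ok by (auto simp: ok_def)
	 have "pairs2 (=) (map (%i. int (fa kp i)) [0..<n]) (fq kp j) =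
		 across (rel (=) ?A) (l1 kp j - c kp + 1) (h1 kp j - c kp + 1) (l2 kp j - d kp + (h + 1)) (h2 kp j - d kp + (h + 1))" unfolding pairs2_across using ok by (simp add: fq_def numeral_2_eq_2 numeral_3_eq_3)
	 also have "... = (\<Sum>x\<in>{l1 kp j..<h1 kp j}. \<Sum>y\<in>{l2 kp j..<h2 kp j}. rel (=) ?A (x - c kp + 1) (y - d kp + (h + 1)))" unfolding across_def by (simp only: sum_shift[OF lh(1) le(1)] sum_shift[OF lh(3) le(2)])
	 also have "... = W kp j" unfolding W_def
	 proof (intro sum.cong refl)
		fix x y assume x: "x : {l1 kp j..<h1 kp j}" and y: "y : {l2 kp j..<h2 kp j}"
		hence "x - c kp < h" "c kp <= x" "y - d kp < h" "d kp <= y" using lh[of kp j] by auto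
		moreover from this have "fa kp (x - c kp) = D x" "fa kp (y - d kp + h) = D y" by (auto simp: fa_def)
		ultimately show "rel (=) ?A (x - c kp + 1) (y - d kp + (h + 1)) = of_bool (D x = D y)" using h(1) unfolding rel_def by simp
	 qed
	 finally show ?thesis .
	qed
	have W0: "W kp j = 0" if "\<not> ok kp j" for kp j using that by (auto simp: W_def ok_def)
	\<comment> \<open>The sum over all pairs of chunks removes the cuts.\<close>
	have R64: "R 64 j = (\<Sum>x\<in>{?f (u j)..<?f (Suc (u j))}. \<Sum>y\<in>{?f (v j)..<?f (Suc (v j))}. of_bool (D x = D y))" for j
	proof -
	 have "R 64 j = (\<Sum>kp<8 * 8. W kp j)" by (simp add: R_def)
	 also have "... = (\<Sum>a<8. \<Sum>b<8. \<Sum>x\<in>{max (?f (u j)) (a * h)..<min (?f (Suc (u j))) (a * h + h)}.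
		 \<Sum>y\<in>{max (?f (v j)) (b * h)..<min (?f (Suc (v j))) (b * h + h)}. of_bool (D x = D y))" unfolding W_def l1_def h1_def l2_def h2_def c_def d_def
		by (rule sum_div_mod[where f = "%a b. \<Sum>x\<in>{max (?f (u j)) (a * h)..<min (?f (Suc (u j))) (a * h + h)}.
		 \<Sum>y\<in>{max (?f (v j)) (b * h)..<min (?f (Suc (v j))) (b * h + h)}. of_bool (D x = D y)"]) simp
	 also have "... = (\<Sum>x\<in>{?f (u j)..<?f (Suc (u j))}. \<Sum>y\<in>{?f (v j)..<?f (Suc (v j))}. of_bool (D x = D y))" by (rule sum_chunk_pairs) (use fl h(2) order_trans in blast)+
	 finally show ?thesis .
	qed
	\<comment> \<open>\<open>place_bij\<close> translates positions in the concatenated lists back into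
	  directed edges.\<close>
	have out: "R 64 j = out ! j" if j: "j < N" for j
	proof -
	 have D': "D (place inp e) = ?src (mate e)" if "e : out_edges inp w" for e w using placeD[of e] that m by (simp add: out_edges_def)
	 have "R 64 j = (\<Sum>e\<in>out_edges inp (u j). \<Sum>y\<in>{?f (v j)..<?f (Suc (v j))}. of_bool (D (place inp e) = D y))" unfolding R64 by (rule sum.reindex_bij_betw[OF place_bij, symmetric])
	 also have "... = (\<Sum>e\<in>out_edges inp (u j). \<Sum>f\<in>out_edges inp (v j). of_bool (D (place inp e) = D (place inp f)))" by (intro sum.cong refl sum.reindex_bij_betw[OF place_bij, symmetric])
	 also have "... = (\<Sum>e\<in>out_edges inp (u j). \<Sum>f\<in>out_edges inp (v j). of_bool (?src (mate e) = ?src (mate f)))" by (intro sum.cong refl) (simp add: D')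
	 also have "... = out ! j" using common_neighbours[OF g _ u_def v_def] j m by simp
	 finally show ?thesis .
	qed
	have R_le: "R kp j <= 4 * (n * n)" if "kp <= 64" for kp j
	proof -
	 have "R kp j <= R 64 j" unfolding R_def using that by (intro sum_mono2) auto
	 also have "... <= (\<Sum>x\<in>{?f (u j)..<?f (Suc (u j))}. \<Sum>y\<in>{?f (v j)..<?f (Suc (v j))}. 1)" unfolding R64 by (intro sum_mono) simp
	 also have "... <= (2 * n) * (2 * n)"
	 proof -
		have fd: "?f a - ?f b <= 2 * n" for a b using fl[of a] n by linarith
		have "(?f (Suc (u j)) - ?f (u j)) * (?f (Suc (v j)) - ?f (v j)) <= (2 * n) * (2 * n)" by (intro mult_le_mono fd)
		thus ?thesis by (simp only: sum_constant card_atLeastLessThan mult_1_right of_nat_id)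
	 qed
	 finally show ?thesis by simp
	qed
	have bgv: "va s 3 = n" "ar s 0 = start_ar inp 0" "ar s 1 = D" "!!x. 1 <= x ==> x <= inp ! 0 + 1 ==> ar s 6 x = ?f x"
	 if "q_background s1 s" for s using that ra v0 unfolding q_background_def q_vars_def D_def by (auto simp: fun_eq_iff)
	have evc: "eval w z s X_h = h" "eval w z s X_c = c kp" "eval w z s X_d = d kp"
	 if s: "q_background s1 s" "kp < 64" "va s 13 = kp" for s kp
	proof -
	 have "n < pow2 w" "2 < pow2 w" "8 < pow2 w" "kp < pow2 w" "c kp < pow2 w" "d kp < pow2 w" using zn zw s cd[OF s(2)] by linarith+
	 thus 1: "eval w z s X_h = h" and "eval w z s X_c = c kp" "eval w z s X_d = d kp" using bgv(1)[OF s(1)] s(3) by (simp_all add: X_h_def X_c_def X_d_def ev c_def d_def h_def)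
	qed
	have evq: "eval w z s (X_lo X_u X_c) = l1 kp j" "eval w z s (X_hi X_u X_c) = h1 kp j"
		"eval w z s (X_lo X_v X_d) = l2 kp j" "eval w z s (X_hi X_v X_d) = h2 kp j"
		"(eval w z s X_ok ~= 0) = ok kp j"
	 if s: "q_background s1 s" "kp < 64" "va s 13 = kp" "j < N" "va s 12 = j" for s kp j
	proof -
	 note b = bgv[OF s(1)] and ec = evc[OF s(1,2,3)]
	 have uv: "1 <= u j" "u j <= inp ! 0" "1 <= v j" "v j <= inp ! 0" using gi(3)[of "2 * j"] gi(3)[of "2 * j + 1"] s(4) by (auto simp: u_def v_def)
	 have sm: "2 < pow2 w" "3 < pow2 w" "6 < pow2 w" "6 < pow2 z" "1 < pow2 w" "0 < pow2 z" "0 < pow2 w" "j < pow2 w" "2 * j < pow2 w" "2 + 2 * j < pow2 w" "3 + 2 * j < pow2 w"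
		 "2 + 2 * j < pow2 z" "3 + 2 * j < pow2 z" "u j < pow2 w" "v j < pow2 w" "u j < pow2 z" "v j < pow2 z" "u j + 1 < pow2 w" "v j + 1 < pow2 w"
		 "u j + 1 < pow2 z" "v j + 1 < pow2 z" "c kp + h < pow2 w" "d kp + h < pow2 w" using zn zw s(4) n uv gi(2) cd[OF s(2)] h(3) by linarith+
	 have fw: "?f x < pow2 w" for x using fl[of x] zn zw n by linarith
	 have "ar s 0 (2 + 2 * j) = u j" "ar s 0 (3 + 2 * j) = v j" using b(2) gi(1) s(4) by (simp_all add: start_ar_def u_def v_def src_def numeral_3_eq_3)
	 hence eu: "eval w z s X_u = u j" "eval w z s X_v = v j" unfolding X_u_def X_v_def using sm s(5) by (simp_all add: ev)
	 have S: "eval w z s (Get (Num 6) X_u) = ?f (u j)" "eval w z s (Get (Num 6) X_v) = ?f (v j)"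
		 "eval w z s (Get (Num 6) (X_u [+] Num 1)) = ?f (Suc (u j))" "eval w z s (Get (Num 6) (X_v [+] Num 1)) = ?f (Suc (v j))" using eu sm fw b(4)[of "u j"] b(4)[of "v j"] b(4)[of "u j + 1"] b(4)[of "v j + 1"] uv by (simp_all add: ev)
	 have ch: "eval w z s (X_c [+] X_h) = c kp + h" "eval w z s (X_d [+] X_h) = d kp + h" using ec sm by (simp_all add: ev_Add)
	 show r: "eval w z s (X_lo X_u X_c) = l1 kp j" "eval w z s (X_hi X_u X_c) = h1 kp j"
		"eval w z s (X_lo X_v X_d) = l2 kp j" "eval w z s (X_hi X_v X_d) = h2 kp j" unfolding X_lo_def X_hi_def eval.simps(5) ev_Less S ch ec l1_def h1_def l2_def h2_def by auto
	 have n0: "eval w z s (Num 0) = 0" using sm by (simp add: ev_Num)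
	 show "(eval w z s X_ok ~= 0) = ok kp j" unfolding X_ok_def eval.simps(5) ev_Less r ok_def n0 by simp
	qed
	have q_len: "\<forall>q\<ge>16. ar s1 q = (%_. 0)" "ar s1 7 = (%_. 0)" using ra v0 by (auto simp: start_ar_def)
	moreover have "eval w z s X_array = fa kp i & fa kp i <= 2 * n"
	 if s: "q_background s1 s" "kp < 64" "va s 13 = kp" "i < n" "va s 11 = i" for s kp i
	proof -
	 note b = bgv[OF s(1)] and ec = evc[OF s(1,2,3)]
	 have sm: "1 < pow2 z" "1 < pow2 w" "0 < pow2 w" "i < pow2 w" "c kp + i < pow2 w" "d kp + i < pow2 w" "c kp + i < pow2 z" "d kp + i - h < pow2 z" "h + h < pow2 w" using zn zw s(4) cd[OF s(2)] h(1) by linarith+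
	 have "D x < pow2 w" for x using D_le[of x] zn zw by linarith
	 hence "eval w z s X_array = fa kp i" unfolding X_array_def using b(3) ec sm s(5) by (simp add: ev fa_def)
	 thus ?thesis using D_le by (simp add: fa_def)
	qed
	moreover have "map (eval w z s) X_query = fq kp j"
	 if s: "q_background s1 s" "kp < 64" "va s 13 = kp" "j < N" "va s 12 = j" for s kp j
	proof -
	 note ec = evc[OF s(1,2,3)] and eq = evq[OF s]
	 have sm: "2 < pow2 w" "1 < pow2 w" "l1 kp j - c kp + 1 < pow2 w" "l2 kp j - d kp + h < pow2 w" "l2 kp j - d kp + h + 1 < pow2 w" "h2 kp j - d kp + h < pow2 w" if "ok kp j"
		using that zn zw cd[OF s(2)] h(3) lh[of kp j] unfolding ok_def by linarith+
	 have sm': "2 < pow2 w" "1 < pow2 w" using zn zw by linarith+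
	 show ?thesis
	 proof (cases "ok kp j")
		case True
		hence "c kp <= h1 kp j" "d kp <= h2 kp j" "eval w z s X_ok ~= 0" using lh[of kp j] eq(5) by (auto simp: ok_def)
		thus ?thesis using True sm[OF True] ec eq(1-4) lh[of kp j] by (simp add: X_query_def fq_def eval.simps(5) ev_Sub ev_Add ev_Num)
	 next
		case False
		hence "eval w z s X_ok = 0" using eq(5) by auto
		thus ?thesis using False sm' by (simp add: X_query_def fq_def eval.simps(5) ev_Num)
	 qed
	qed
	moreover have "eval w z s X_acc = R (Suc kp) j"
	 if s: "q_background s1 s" "kp < 64" "va s 13 = kp" "j < N" "va s 12 = j"
		"va s 15 = pairs2 (=) (map (%i. int (fa kp i)) [0..<n]) (fq kp j)" "va s 16 = R kp j" for s kp j
	proof -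
	 have RS: "R (Suc kp) j = R kp j + W kp j" by (simp add: R_def)
	 have b: "R kp j + W kp j < pow2 w" "R kp j < pow2 w" "W kp j < pow2 w" using R_le[of "Suc kp" j] RS s(2) nn by linarith+
	 show ?thesis
	 proof (cases "ok kp j")
		case True
		hence "eval w z s X_ok ~= 0" using evq(5)[OF s(1-5)] by auto
		thus ?thesis using s(6,7) b RS ansW[OF True] by (simp add: X_acc_def eval.simps(5) ev_Add ev_Var)
	 next
		case False
		hence "eval w z s X_ok = 0" using evq(5)[OF s(1-5)] by auto
		thus ?thesis using s(7) b RS W0[OF False] by (simp add: X_acc_def eval.simps(5) ev_Var)
	 qed
	qed
	moreover have "R 0 j = 0 & R 64 j = out ! j" if "j < N" for j using out[OF that] by (simp add: R_def)
	ultimately have "q_correct valid2 (pairs2 (=)) 64 w z n inp out X_array X_query X_acc s1 fa fq R" unfolding q_correct_def m using fqv by blast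
	thus "EX fa fq R. q_correct valid2 (pairs2 (=)) 64 w z n inp out X_array X_query X_acc s1 fa fq R" by blast
 qed (use wf_c_adj in \<open>simp_all add: pairs2_le valid_set valid2_def X_query_def numeral_2_eq_2 numeral_3_eq_3\<close>)
qed

section \<open>Answering range queries by counting triangles\<close>

definition tally :: "nat => aexp => aexp => aexp => cmd" where
 "tally p r g e = For 11 p (Ite g (Asg 13 e ;; Put r (Var 13) (Get r (Var 13) [+] Num 1)) Nop)"

lemma run_tally:
 assumes v: "va s p = m" "m + 1 < pow2 w" and r: "ro < pow2 z" "pow2 z <= pow2 w"
	and exps: "!!i t. i < m ==> va t 11 = i ==> (ALL y. y ~: {11, 13} --> va t y = va s y) ==> (ALL q. q ~= ro --> ar t q = ar s q) ==>
	 eval w z t r = ro & (eval w z t g ~= 0 \<longleftrightarrow> G i) & (G i --> eval w z t e = k i)"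
	and k: "!!i. i < m ==> G i ==> k i < pow2 z"
	and fresh: "ar s ro = (%_. 0)" and s': "s' = run w z (tally p r g e) s"
 shows "(ALL y. y ~: {11, 13} --> va s' y = va s y) & (ALL q. q ~= ro --> ar s' q = ar s q) &
	ar s' ro = (%kp. \<Sum>i<m. of_bool (G i & k i = kp))"
proof -
 let ?c = "Ite g (Asg 13 e ;; Put r (Var 13) (Get r (Var 13) [+] Num 1)) Nop"
 let ?I = "%i t. (ALL y. y ~: {11, 13} --> va t y = va s y) & (ALL q. q ~= ro --> ar t q = ar s q) &
	ar t ro = (%kp. \<Sum>i<i. of_bool (G i & k i = kp))"
 have "EX t. ?I (va s p) t & run w z (For 11 p ?c) s = set_va 11 (va s p) t"
 proof (rule run_For_inv)
	show "?I 0 s" using fresh by simp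
 next
	fix i and t :: ast assume i: "i < va s p" and I: "?I i t"
	let ?t = "set_va 11 i t"
	have im: "i < m" using i v by simp
	note ev0 = exps[OF im, of ?t]
	show "?I (Suc i) (run w z ?c ?t)"
	proof (cases "G i")
	 case False
	 hence "eval w z ?t g = 0" using ev0 I by auto
	 with I False show ?thesis by simp
	next
	 case True
	 hence g: "eval w z ?t g ~= 0" "eval w z ?t e = k i" using ev0 I by auto
	 let ?u = "set_va 13 (k i) ?t"
	 have re: "eval w z ?u r = ro" using exps[OF im, of ?u] I by auto
	 have "(\<Sum>i'<i. of_bool (G i' & k i' = k i) :: nat) <= i" using sum_bounded_above[of "{..<i}" "%i'. of_bool (G i' & k i' = k i)" "1::nat"] by simp
	 hence b: "ar ?u ro (k i) + 1 < pow2 w" "k i < pow2 w" "1 < pow2 w" using I v im k[OF im True] r by simp_all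
	 have "run w z ?c ?t = set_ar ro (k i) (ar t ro (k i) + 1) ?u" using g re b k[OF im True] r by (simp add: run_Put ev)
	 thus ?thesis using I True by (auto simp: fun_eq_iff)
	qed
 qed
 thus ?thesis unfolding s' tally_def using v by auto
qed

text \<open>Row \<open>ro + 4\<close> maps an edge key to its number plus one, so that 0 means
  absent; row \<open>ro + 5\<close> lists the keys. A key is entered once however often it occurs,
  because the graph must be simple.\<close>

definition emit :: "nat => aexp => aexp => cmd" where
 "emit p g e = For 11 p (Ite g (Asg 13 e ;; Ite (Get (Var 2 [+] Num 4) (Var 13)) Nop
	(Put (Var 2 [+] Num 5) (Var 29) (Var 13) ;; Asg 29 (Var 29 [+] Num 1) ;;
	 Put (Var 2 [+] Num 4) (Var 13) (Var 29))) Nop)"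

text \<open>Rows \<open>ro + 4\<close> and \<open>ro + 5\<close> are inverse bijections, up to the
  shift by one, between the keys in \<open>S\<close> and the numbers below variable 29.\<close>

definition emitted :: "nat => nat set => ast => bool" where
 "emitted ro S t \<longleftrightarrow> (ALL e<va t 29. ar t (ro + 5) e : S & ar t (ro + 4) (ar t (ro + 5) e) = e + 1) &
	(ALL kp. kp ~: S --> ar t (ro + 4) kp = 0) & (\<forall>kp\<in>S. EX e<va t 29. ar t (ro + 5) e = kp)"

lemma emitted_pos: "emitted ro S t ==> ar t (ro + 4) kp ~= 0 \<longleftrightarrow> kp : S"
 unfolding emitted_def by (metis Suc_eq_plus1 nat.distinct(1))

lemma emitted_le: "emitted ro S t ==> ar t (ro + 4) kp <= va t 29"
 unfolding emitted_def by (metis Suc_eq_plus1 Suc_leI le0)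

lemma emitted_insert:
 assumes "emitted ro S t" "kp ~: S" "va t' 29 = va t 29 + 1"
	"ar t' (ro + 4) = (ar t (ro + 4))(kp := va t 29 + 1)" "ar t' (ro + 5) = (ar t (ro + 5))(va t 29 := kp)"
 shows "emitted ro (insert kp S) t'"
proof -
 let ?m = "va t 29"
 have 1: "!!e. e < ?m ==> ar t (ro + 5) e : S & ar t (ro + 4) (ar t (ro + 5) e) = e + 1"
	and 2: "!!kp. kp ~: S ==> ar t (ro + 4) kp = 0" and 3: "!!kp. kp : S ==> EX e<?m. ar t (ro + 5) e = kp"
	using assms(1) unfolding emitted_def by blast+
 show ?thesis unfolding emitted_def
 proof (intro conjI ballI allI impI)
	fix e assume e: "e < va t' 29"
	have "ar t (ro + 5) e ~= kp" if "e < ?m" using 1[OF that] assms(2) by auto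
	thus "ar t' (ro + 5) e : insert kp S" "ar t' (ro + 4) (ar t' (ro + 5) e) = e + 1" using e assms(3-5) 1[of e] by (auto simp: less_Suc_eq)
 next
	fix x assume "x : insert kp S"
	then consider "x = kp" | e where "e < ?m" "ar t (ro + 5) e = x" using 3 by blast
	thus "EX e<va t' 29. ar t' (ro + 5) e = x"
	proof cases
	 case 1
	 thus ?thesis using assms(3,5) by (intro exI[of _ ?m]) simp
	next
	 case 2
	 thus ?thesis using assms(3,5) by (intro exI[of _ e]) simp
	qed
 qed (use 2 assms in auto)
qed

text \<open>The last conclusion protects the padding keys, which already stand in row
  \<open>ro + 5\<close> when the first real key is entered.\<close>

lemma run_emit:
 assumes v: "va s p = m" "va s 2 = ro" and r: "va s 29 + m + 1 < pow2 z" "ro + 5 < pow2 z" "pow2 z <= pow2 w"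
	and exps: "!!i t. i < m ==> va t 11 = i ==> (ALL y. y ~: {11, 13, 29} --> va t y = va s y) ==>
	 (ALL q. q ~: {ro + 4, ro + 5} --> ar t q = ar s q) ==>
	 (eval w z t g ~= 0 \<longleftrightarrow> G i) & (G i --> eval w z t e = k i)"
	and k: "!!i. i < m ==> G i ==> k i < pow2 z"
	and S: "emitted ro S s" and s': "s' = run w z (emit p g e) s"
 shows "(ALL y. y ~: {11, 13, 29} --> va s' y = va s y) & (ALL q. q ~: {ro + 4, ro + 5} --> ar s' q = ar s q) &
	emitted ro (S \<union> k ` {i. i < m & G i}) s' &
	va s 29 <= va s' 29 & va s' 29 <= va s 29 + m & (\<forall>e\<ge>va s' 29. ar s' (ro + 5) e = ar s (ro + 5) e)"
proof -
 let ?c2 = "Put (Var 2 [+] Num 5) (Var 29) (Var 13) ;; Asg 29 (Var 29 [+] Num 1) ;; Put (Var 2 [+] Num 4) (Var 13) (Var 29)"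
 let ?c1 = "Asg 13 e ;; Ite (Get (Var 2 [+] Num 4) (Var 13)) Nop (?c2)"
 let ?c = "Ite g (?c1) Nop"
 let ?I = "%i t. (ALL y. y ~: {11, 13, 29} --> va t y = va s y) & (ALL q. q ~: {ro + 4, ro + 5} --> ar t q = ar s q) &
	emitted ro (S \<union> k ` {j. j < i & G j}) t & va s 29 <= va t 29 & va t 29 <= va s 29 + i & (\<forall>e\<ge>va t 29. ar t (ro + 5) e = ar s (ro + 5) e)"
 have em_cong: "emitted ro S' t' = emitted ro S' t" if "va t' 29 = va t 29" "ar t' = ar t" for S' t t' using that by (simp add: emitted_def)
 have "EX t. ?I (va s p) t & run w z (For 11 p ?c) s = set_va 11 (va s p) t"
 proof (rule run_For_inv)
	show "?I 0 s" using S by simp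
 next
	fix i and t :: ast assume i: "i < va s p" and I: "?I i t"
	let ?t = "set_va 11 i t" and ?S = "S \<union> k ` {j. j < i & G j}"
	have im: "i < m" using i v by simp
	note ev0 = exps[OF im, of ?t]
	show "?I (Suc i) (run w z ?c ?t)"
	proof (cases "G i")
	 case False
	 hence "eval w z ?t g = 0" using ev0 I by auto
	 moreover have "{j. j < Suc i & G j} = {j. j < i & G j}" using False by (auto simp: less_Suc_eq)
	 ultimately show ?thesis using I em_cong[of ?t t] by simp
	next
	 case True
	 hence g: "eval w z ?t g ~= 0" "eval w z ?t e = k i" using ev0 I by auto
	 have S': "S \<union> k ` {j. j < Suc i & G j} = insert (k i) ?S" using True by (auto simp: less_Suc_eq)
	 let ?u = "set_va 13 (k i) ?t"
	 have em: "emitted ro ?S ?u" using I em_cong[of ?u t] by simp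
	 have kz: "k i < pow2 z" by (rule k[OF im True])
	 have vu: "va ?u 2 = ro" "va ?u 13 = k i" "va ?u 29 = va t 29" using I v by simp_all
	 have b: "va t 29 + 1 < pow2 z" "va t 29 + 1 < pow2 w" "k i < pow2 w" "ro + 5 < pow2 w" "ro + 4 < pow2 z" "ro + 4 < pow2 w"
		"4 < pow2 w" "5 < pow2 w" "ro < pow2 w" "va t 29 < pow2 w" "1 < pow2 w" "va t 29 < pow2 z" using I r kz im by linarith+
	 have tab: "eval w z ?u (Get (Var 2 [+] Num 4) (Var 13)) = ar ?u (ro + 4) (k i)" using vu b kz emitted_le[OF em, of "k i"] by (simp add: ev)
	 have c: "run w z ?c ?t = (if k i : ?S then ?u else run w z ?c2 ?u)" using g tab emitted_pos[OF em, of "k i"] by simp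
	 show ?thesis
	 proof (cases "k i : ?S")
		case True
		hence "run w z ?c ?t = ?u" using c by simp
		moreover have "insert (k i) ?S = ?S" using True by blast
		ultimately show ?thesis unfolding S' using I em by simp
	 next
		case False
		let ?v = "set_ar (ro + 4) (k i) (va t 29 + 1) (set_va 29 (va t 29 + 1) (set_ar (ro + 5) (va t 29) (k i) ?u))"
		have c2: "run w z ?c2 ?u = ?v" using vu b kz r by (simp add: run_Put ev)
		have c': "run w z ?c ?t = ?v" unfolding c c2 using False by (simp only: if_False)
		have "emitted ro (insert (k i) ?S) ?v" by (rule emitted_insert[OF em False]) simp_all
		thus ?thesis unfolding S' c' using I by simp
	 qed
	qed
 qed
 then obtain t where t: "?I m t" "s' = set_va 11 m t" unfolding s' emit_def using v by auto
 thus ?thesis using em_cong[of s' t] by simp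
qed

text \<open>The base in which two vertex keys are packed. Real vertex keys are below
  \<open>3 * (n + 2)\<close>, those of padding vertices at most
  \<open>3 * (2 * n + 1) + 1\<close>.\<close>

definition W_exp :: aexp where
 "W_exp = Num 6 [*] Var 3 [+] Num 8"

text \<open>Vertices are numbered 1, 2, ... in the order of their first occurrence. So exactly the
  ends of edges become vertices, as the problem forbids isolated ones and wants an initial segment
  of numbers.\<close>

definition relabel_step :: cmd where
 "relabel_step =
	Asg 13 (Get (Var 2 [+] Num 5) (Var 19 [div] Num 2)) ;;
	Asg 13 (Cnd (Var 19 [mod] Num 2) (Var 13 [mod] W_exp) (Var 13 [div] W_exp)) ;;
	Ite (Get (Var 2 [+] Num 1) (Var 13)) Nop
	 (Asg 30 (Var 30 [+] Num 1) ;; Put (Var 2 [+] Num 1) (Var 13) (Var 30)) ;;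
	Put (Var 2) (Num 2 [+] Var 19) (Get (Var 2 [+] Num 1) (Var 13))"

definition end_key :: "nat => (nat => nat) => nat => nat" where
 "end_key W k e = (if odd e then k (e div 2) mod W else k (e div 2) div W)"

lemma run_relabel:
 assumes v: "va s 3 = n" "va s 2 = ro" "va s 30 = 0" and b: "ro + 5 < pow2 z" "6 * n + 8 < pow2 z" "pow2 z <= pow2 w"
	and k: "!!i. i < n ==> ar s (ro + 5) i = k i & k i < pow2 z"
	and fresh: "ar s ro = (%_. 0)" "ar s (ro + 1) = (%_. 0)"
	and f: "f = end_key (6 * n + 8) k"
	and s': "s' = run w z (For 11 3 (Asg 19 (Num 2 [*] Var 11) ;; relabel_step ;; Asg 19 (Num 2 [*] Var 11 [+] Num 1) ;; relabel_step)) s"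
 obtains l nv where "ALL y. y ~: {11, 13, 19, 30} --> va s' y = va s y" "ALL q. q ~: {ro, ro + 1} --> ar s' q = ar s q"
	"va s' 30 = nv" "nv <= 2 * n" "inj_on l (f ` {..<2 * n})" "l ` f ` {..<2 * n} = {1..nv}"
	"!!i. ar s' ro i = (if 2 <= i & i < 2 + 2 * n then l (f (i - 2)) else 0)"
proof -
 let ?l = "%t. ar t (ro + 1)"
 let ?H = "%e (t::ast). (ALL y. y ~: {11, 13, 19, 30} --> va t y = va s y) & (ALL q. q ~: {ro, ro + 1} --> ar t q = ar s q) &
	va t 30 <= e & inj_on (?l t) (f ` {..<e}) & ?l t ` f ` {..<e} = {1..va t 30} &
	(ALL kp. kp ~: f ` {..<e} --> ?l t kp = 0) & (ALL i. ar t ro i = (if 2 <= i & i < 2 + e then ?l t (f (i - 2)) else 0))"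
 have "EX t. ?H (2 * n) t & s' = set_va 11 n t" unfolding s'
 proof (rule run_pairs)
	show "?H 0 s" using v fresh by simp
	show "va s 3 = n" "11 ~: assigned relabel_step" "2 * n + 1 < pow2 w" using v b by (simp_all add: relabel_step_def)
	show "?H e (set_va 11 x t) & ?H e (set_va 19 x t)" if "?H e t" for e and t :: ast and x using that by simp
 next
	fix e and t :: ast assume e: "e < 2 * n" and H: "?H e t" and t: "va t 19 = e"
	have H1: "ALL y. y ~: {11, 13, 19, 30} --> va t y = va s y" "ALL q. q ~: {ro, ro + 1} --> ar t q = ar s q"
	 and nv: "va t 30 <= e" and inj: "inj_on (?l t) (f ` {..<e})" and im: "?l t ` f ` {..<e} = {1..va t 30}"
	 and z0: "!!kp. kp ~: f ` {..<e} ==> ?l t kp = 0" and out: "!!i. ar t ro i = (if 2 <= i & i < 2 + e then ?l t (f (i - 2)) else 0)"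
	 using H by blast+
	have e2: "e div 2 < n" using e by linarith
	have vt: "va t 2 = ro" "va t 3 = n" "ar t (ro + 5) (e div 2) = k (e div 2)" using H1 v k[OF e2] by simp_all
	have kz: "k (e div 2) < pow2 z" using k[OF e2] by simp
	have bs: "e + 2 < pow2 z" "e + 2 < pow2 w" "e < pow2 w" "2 < pow2 w" "ro + 5 < pow2 w" "ro + 1 < pow2 w" "ro + 1 < pow2 z" "5 < pow2 w" "1 < pow2 w"
	 "ro < pow2 w" "ro < pow2 z" "k (e div 2) < pow2 w" "6 * n + 8 < pow2 w" "6 * n < pow2 w" "n < pow2 w" "8 < pow2 w" "6 < pow2 w"
	 "va t 30 + 1 < pow2 w" "va t 30 < pow2 w" "e div 2 < pow2 z" using b e nv kz by linarith+
	have fz: "f e < pow2 z" unfolding f end_key_def using kz by (auto intro: le_less_trans[OF mod_less_eq_dividend] le_less_trans[OF div_le_dividend])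
	have fw: "f e < pow2 w" using fz b by linarith
	let ?t = "set_va 13 (f e) t"
	have k13: "run w z (Asg 13 (Get (Var 2 [+] Num 5) (Var 19 [div] Num 2))) t = set_va 13 (k (e div 2)) t" using vt t bs b by (simp add: ev)
	have We: "eval w z (set_va 13 (k (e div 2)) t) W_exp = 6 * n + 8" using vt bs by (simp add: W_exp_def ev)
	have par: "e mod 2 ~= 0 \<longleftrightarrow> odd e" by (simp add: odd_iff_mod_2_eq_one)
	have f13: "run w z (Asg 13 (Cnd (Var 19 [mod] Num 2) (Var 13 [mod] W_exp) (Var 13 [div] W_exp))) (set_va 13 (k (e div 2)) t) = ?t" using t bs We by (simp add: ev f end_key_def odd_iff_mod_2_eq_one set_va_def)
	have lle: "?l t kp <= va t 30" for kp
	proof (cases "kp : f ` {..<e}")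
	 case True
	 hence "?l t kp : {1..va t 30}" unfolding im[symmetric] by (rule imageI)
	 thus ?thesis by simp
	next
	 case False
	 from z0[OF this] show ?thesis by simp
	qed
	have lpos: "?l t kp ~= 0 \<longleftrightarrow> kp : f ` {..<e}" for kp
	proof
	 assume "kp : f ` {..<e}"
	 hence "?l t kp : {1..va t 30}" unfolding im[symmetric] by (rule imageI)
	 thus "?l t kp ~= 0" by simp
	next
	 assume "?l t kp ~= 0"
	 thus "kp : f ` {..<e}" by (rule contrapos_np) (rule z0)
	qed
	have lw: "?l t kp < pow2 w" for kp using lle[of kp] bs by linarith
	have lab: "eval w z ?t (Get (Var 2 [+] Num 1) (Var 13)) = ?l t (f e)" using vt bs fz fw lw by (simp add: ev)
	let ?c = "Ite (Get (Var 2 [+] Num 1) (Var 13)) Nop (Asg 30 (Var 30 [+] Num 1) ;; Put (Var 2 [+] Num 1) (Var 13) (Var 30))"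
	let ?P = "Put (Var 2) (Num 2 [+] Var 19) (Get (Var 2 [+] Num 1) (Var 13))"
	have r: "run w z relabel_step t = run w z ?P (run w z ?c ?t)" unfolding relabel_step_def using k13 f13 by simp
	have Sc: "f ` {..<Suc e} = insert (f e) (f ` {..<e})" by (simp add: lessThan_Suc)
	show "?H (Suc e) (run w z relabel_step t)"
	proof (cases "f e : f ` {..<e}")
	 case True
	 have ne: "?l t (f e) ~= 0" using True lpos by blast
	 have "run w z ?c ?t = ?t" using lab ne by simp
	 moreover have "run w z ?P ?t = set_ar ro (2 + e) (?l t (f e)) ?t" using lab vt bs t by (subst run_Put) (simp_all add: ev_Var ev_Num ev_Add)
	 ultimately have r': "run w z relabel_step t = set_ar ro (2 + e) (?l t (f e)) ?t" using r by simp
	 have ins: "f ` {..<Suc e} = f ` {..<e}" using True Sc by auto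
	 have out': "((ar t ro)(2 + e := ?l t (f e))) i = (if 2 <= i & i < 2 + Suc e then ?l t (f (i - 2)) else 0)" for i using out[of i] by auto
	 show ?thesis unfolding r' ins using H1 nv inj im z0 out' by simp
	next
	 case False
	 have l0: "?l t (f e) = 0" using z0[OF False] .
	 let ?u = "set_ar (ro + 1) (f e) (va t 30 + 1) (set_va 30 (va t 30 + 1) ?t)"
	 have "run w z ?c ?t = ?u" using lab l0 vt bs fz fw by (simp add: run_Put ev)
	 moreover have "eval w z ?u (Get (Var 2 [+] Num 1) (Var 13)) = va t 30 + 1" using vt bs fz fw by (simp add: ev)
	 hence "run w z ?P ?u = set_ar ro (2 + e) (va t 30 + 1) ?u" using vt bs t by (subst run_Put) (simp_all add: ev_Var ev_Num ev_Add)
	 ultimately have r': "run w z relabel_step t = set_ar ro (2 + e) (va t 30 + 1) ?u" using r by simp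
	 have old: "?l t kp < va t 30 + 1" for kp using lle[of kp] by simp
	 have fne: "f j ~= f e" if "j < e" for j using False that by (metis imageI lessThan_iff)
	 have cg: "((?l t)(f e := va t 30 + 1)) ` f ` {..<e} = ?l t ` f ` {..<e}" using fne by (intro image_cong refl) auto
	 have inj': "inj_on ((?l t)(f e := va t 30 + 1)) (f ` {..<Suc e})" unfolding Sc
	 proof (rule inj_on_insert[THEN iffD2], intro conjI)
		show "inj_on ((?l t)(f e := va t 30 + 1)) (f ` {..<e})" using inj fne by (subst inj_on_cong[of _ _ "?l t"]) auto
		have "va t 30 + 1 ~: ?l t ` f ` {..<e}" unfolding im by simp
		thus "((?l t)(f e := va t 30 + 1)) (f e) ~: ((?l t)(f e := va t 30 + 1)) ` (f ` {..<e} - {f e})" using False cg by simp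
	 qed
	 have im': "((?l t)(f e := va t 30 + 1)) ` f ` {..<Suc e} = {1..va t 30 + 1}" unfolding Sc image_insert cg im by auto
	 have z0': "((?l t)(f e := va t 30 + 1)) kp = 0" if "kp ~: f ` {..<Suc e}" for kp using that z0[of kp] unfolding Sc by auto
	 have out': "((ar t ro)(2 + e := va t 30 + 1)) i = (if 2 <= i & i < 2 + Suc e then ((?l t)(f e := va t 30 + 1)) (f (i - 2)) else 0)" for i
	 proof (cases "2 <= i & i < 2 + e")
		case True
		hence "i - 2 < e" "i ~= 2 + e" by linarith+
		thus ?thesis using out[of i] fne[of "i - 2"] True by simp
	 qed (use out[of i] in auto)
	 show ?thesis unfolding r' using H1 nv inj' im' z0' out' by simp
	qed
 qed
 then obtain t where t: "?H (2 * n) t" "s' = set_va 11 n t" by blast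
 show thesis by (rule that[of "va t 30" "?l t"]) (use t in simp_all)
qed

lemma concat_pairs: "concat (map (%i. [g (2 * i), g (2 * i + 1)]) [0..<n]) = map g [0..<2 * n]"
 by (induction n) auto

text \<open>
 An edge with end keys \<open>p\<close> and \<open>q\<close> is given by the number \<open>p * W + q\<close>. The residue of a key
 modulo 3 tells in which of the three parts of the graph the vertex is; edges are oriented towards
 the part with the higher number.
\<close>

lemma relabelled_graph:
 assumes f: "f = end_key W k" and k: "inj_on k {..<n}" "!!i. i < n ==> k i div W mod 3 < k i mod W mod 3"
	and l: "inj_on l (f ` {..<2 * n})" "l ` f ` {..<2 * n} = {1..nv}"
	and X: "X = [nv, n] @ map (%e. l (f e)) [0..<2 * n]"
 obtains Y where "edge_triangle_counting z n X Y" "length Y = n"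
	"!!i x y. i < n ==> k i = 3 * x * W + (3 * y + 1) ==> 3 * y + 1 < W ==> Y ! i =
	 card {u. 3 * u + 2 < W & 3 * x * W + (3 * u + 2) : k ` {..<n} & (3 * y + 1) * W + (3 * u + 2) : k ` {..<n}}"
proof -
 define a where "a = (%i. k i div W)"
 define b where "b = (%i. k i mod W)"
 define nodes where "nodes = f ` {..<2 * n}"
 define E' where "E' = (%i. {a i, b i}) ` {..<n}"
 define es where "es = map (%i. (l (f (2 * i)), l (f (2 * i + 1)))) [0..<n]"
 define E where "E = (`) l ` E'"
 have ab: "f (2 * i) = a i" "f (2 * i + 1) = b i" for i by (simp_all add: f end_key_def a_def b_def)
 have mod3: "a i mod 3 < b i mod 3" if "i < n" for i using k(2)[OF that] by (simp add: a_def b_def)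
 have kab: "k i = a i * W + b i" for i by (simp add: a_def b_def)
 have nd: "a i : nodes" "b i : nodes" if "i < n" for i
 proof -
	have "f (2 * i) : nodes" "f (2 * i + 1) : nodes" using that by (auto simp: nodes_def)
	thus "a i : nodes" "b i : nodes" by (simp_all only: ab)
 qed
 have li: "inj_on l nodes" using l(1) by (simp add: nodes_def)
 have edges: "map (%(u, v). {u, v}) es = map (%i. l ` {a i, b i}) [0..<n]" by (simp add: es_def ab del: One_nat_def add_Suc_right)
 have Eset: "set (map (%(u, v). {u, v}) es) = E" unfolding edges E_def E'_def set_map image_image by (simp add: atLeast0LessThan)
 have X': "X = [nv, n] @ concat (map (%(u, v). [u, v]) es)" unfolding X es_def using concat_pairs[of "%e. l (f e)" n] by (simp add: comp_def)
 have card2: "card (l ` {a i, b i}) = 2" if "i < n" for i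
 proof -
	have "a i ~= b i" using mod3[OF that] by auto
	moreover have "card (l ` {a i, b i}) = card {a i, b i}" by (rule card_image, rule inj_on_subset[OF li]) (use nd[OF that] in auto)
	ultimately show ?thesis by simp
 qed
 have sub: "{a i, b i} <= nodes" if "i < n" for i using nd[OF that] by simp
 have simple: "simple_graph {1..nv} E" unfolding simple_graph_def E_def E'_def
 proof (intro conjI ballI)
	fix e assume "e : (`) l ` (%i. {a i, b i}) ` {..<n}"
	then obtain i where i: "i < n" "e = l ` {a i, b i}" by blast
	have "l ` {a i, b i} <= l ` nodes" using sub[OF i(1)] by (rule image_mono)
	thus "e <= {1..nv}" "card e = 2" using i card2 l(2) by (simp_all only: nodes_def)
 qed simp
 have no_iso: "no_isolated_vertices {1..nv} E" unfolding no_isolated_vertices_def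
 proof
	fix v assume "v : {1..nv}"
	then obtain e where e: "e < 2 * n" "v = l (f e)" unfolding l(2)[symmetric] by blast
	have i: "e div 2 < n" using e by linarith
	have "f e : {a (e div 2), b (e div 2)}" by (simp add: f end_key_def a_def b_def)
	hence "v : l ` {a (e div 2), b (e div 2)}" unfolding e(2) by (rule imageI)
	moreover have "{a (e div 2), b (e div 2)} : E'" unfolding E'_def by (rule image_eqI[of _ _ "e div 2"]) (use i in simp_all)
	hence "l ` {a (e div 2), b (e div 2)} : E" unfolding E_def by (rule imageI)
	ultimately show "\<exists>e\<in>E. v : e" by (rule bexI)
 qed
 \<comment> \<open>The class modulo 3 increases along an edge, so the undirected edge determines its
   orientation and hence its key.\<close>
 have orient: "a i = a j & b i = b j" if "i < n" "j < n" "{a i, b i} = {a j, b j}" for i j using that(3) mod3[OF that(1)] mod3[OF that(2)] by (auto simp: doubleton_eq_iff)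
 have inj: "inj_on (%i. l ` {a i, b i}) {..<n}"
 proof (rule inj_onI)
	fix i j assume ij: "i : {..<n}" "j : {..<n}" "l ` {a i, b i} = l ` {a j, b j}"
	have "{a i, b i} = {a j, b j}" using inj_on_image_eq_iff[OF li sub[of i] sub[of j]] ij by auto
	hence "k i = k j" using orient ij unfolding kab by (metis lessThan_iff)
	thus "i = j" using k(1) ij by (simp add: inj_on_def)
 qed
 have dist: "distinct (map (%(u, v). {u, v}) es)" unfolding edges distinct_map using inj by (simp add: atLeast0LessThan)
 define Y where "Y = map (triangles_at E) (map (%(u, v). {u, v}) es)"
 have P: "edge_triangle_counting z n X Y" unfolding edge_triangle_counting_def Let_def by (rule exI[of _ nv], rule exI[of _ es], unfold Eset, intro conjI)
	 (use simple no_iso dist X' in \<open>simp_all add: Y_def es_def\<close>)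
 have lift: "{l p, v} : E \<longleftrightarrow> (\<exists>r\<in>nodes. v = l r & {p, r} : E')" if p: "p : nodes" for p v
 proof
	assume "{l p, v} : E"
	then obtain i where i: "i < n" "{l p, v} = l ` {a i, b i}" unfolding E_def E'_def by blast
	have c: "card {l p, v} = 2" using card2[OF i(1)] i(2) by simp
	hence ne: "l p ~= v" by auto
	have "v : l ` {a i, b i}" "l p : l ` {a i, b i}" unfolding i(2)[symmetric] by simp_all
	then obtain r where r: "r : {a i, b i}" "v = l r" by blast
	have "p : {a i, b i}" using inj_on_image_mem_iff[OF li p sub[OF i(1)]] \<open>l p : l ` {a i, b i}\<close> by simp
	moreover have "p ~= r" using ne r by auto
	ultimately have "{p, r} = {a i, b i}" using r(1) by auto
	hence "{p, r} : E'" using i(1) by (auto simp: E'_def)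
	moreover have "r : nodes" using r(1) sub[OF i(1)] by auto
	ultimately show "\<exists>r\<in>nodes. v = l r & {p, r} : E'" using r(2) by blast
 next
	assume "\<exists>r\<in>nodes. v = l r & {p, r} : E'"
	then obtain r where r: "v = l r" "{p, r} : E'" by blast
	hence "l ` {p, r} : E" unfolding E_def by blast
	thus "{l p, v} : E" using r(1) by simp
 qed
 have E'_iff: "{p, r} : E' \<longleftrightarrow> (EX i<n. a i = p & b i = r) | (EX i<n. a i = r & b i = p)" for p r unfolding E'_def by (auto simp: doubleton_eq_iff)
 have edge_iff: "p * W + q : k ` {..<n} \<longleftrightarrow> (EX i<n. a i = p & b i = q)" if "q < W" for p q
 proof
	assume "p * W + q : k ` {..<n}"
	then obtain i where i: "i < n" "k i = p * W + q" by auto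
	hence "a i = p" "b i = q" using that by (simp_all add: a_def b_def)
	with i(1) show "EX i<n. a i = p & b i = q" by blast
 next
	assume "EX i<n. a i = p & b i = q"
	then obtain i where "i < n" "a i = p" "b i = q" by blast
	hence "k i = p * W + q" using kab[of i] by simp
	with \<open>i < n\<close> show "p * W + q : k ` {..<n}" by (metis imageI lessThan_iff)
 qed
 show thesis
 proof (rule that[OF P])
	show "length Y = n" by (simp add: Y_def es_def)
	fix i x y assume i: "i < n" "k i = 3 * x * W + (3 * y + 1)" "3 * y + 1 < W"
	let ?p = "3 * x" and ?q = "3 * y + 1"
	have "(p * W + ?q) div W = p" "(p * W + ?q) mod W = ?q" for p using i(3) by (simp_all del: add_Suc_right One_nat_def add_2_eq_Suc')
	hence pq: "a i = ?p" "b i = ?q" by (simp_all only: a_def b_def i(2))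
	have bW: "b j < W" for j using i(3) by (simp add: b_def)
	have ne: "l ?p ~= l ?q" using card2[OF i(1)] unfolding pq by (auto simp: card_insert_if)
	have "Y ! i = triangles_at E {l ?p, l ?q}" using i(1) unfolding Y_def edges by (simp add: pq)
	also have "... = card {v. {l ?p, v} : E & {l ?q, v} : E}"
	proof (rule triangles_at_eq)
	 show "card e = 2" if "e : E" for e using simple that by (simp add: simple_graph_def)
	 have "l ` {?p, ?q} : E"
	 proof -
		have "{?p, ?q} : E'" unfolding E'_def by (rule image_eqI[of _ _ i]) (use i(1) pq in simp_all)
		thus ?thesis unfolding E_def by (rule imageI)
	 qed
	 thus "{l ?p, l ?q} : E" by simp
	 show "finite E" by (simp add: E_def E'_def)
	qed (rule ne)
	also have "{v. {l ?p, v} : E & {l ?q, v} : E} = l ` {r : nodes. {?p, r} : E' & {?q, r} : E'}"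
	proof -
	 have n: "?p : nodes" "?q : nodes" using nd[OF i(1)] pq by simp_all
	 show ?thesis unfolding lift[OF n(1)] lift[OF n(2)] using li by (auto simp: inj_on_def)
	qed
	also have "card ... = card {r : nodes. {?p, r} : E' & {?q, r} : E'}" by (rule card_image, rule inj_on_subset[OF li]) auto
	also have "{r : nodes. {?p, r} : E' & {?q, r} : E'} = (%u. 3 * u + 2) `
		{u. 3 * u + 2 < W & 3 * x * W + (3 * u + 2) : k ` {..<n} & (3 * y + 1) * W + (3 * u + 2) : k ` {..<n}}"
	proof (intro set_eqI iffI)
	 \<comment> \<open>A common neighbour is forced into class 2: no edge enters class 0, so the one
	   from \<open>?p\<close> ends in \<open>r\<close> and \<open>r\<close> is not of class 0; then the
	   edge with \<open>?q\<close> also ends in \<open>r\<close>.\<close>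
	 fix r assume r: "r : {r : nodes. {?p, r} : E' & {?q, r} : E'}"
	 have "\<not> (EX i<n. a i = r & b i = ?p)" using mod3 by fastforce
	 then obtain j where j: "j < n" "a j = ?p" "b j = r" using r unfolding E'_iff by blast
	 have r0: "r mod 3 ~= 0" using mod3[OF j(1)] j by auto
	 have "\<not> (EX i<n. a i = r & b i = ?q)"
	 proof
		assume "EX i<n. a i = r & b i = ?q"
		then obtain i where "i < n" "a i = r" "b i = ?q" by blast
		hence "r mod 3 < ?q mod 3" using mod3[of i] by simp
		moreover have "?q mod 3 = 1" by presburger
		ultimately show False using r0 by simp
	 qed
	 then obtain j' where j': "j' < n" "a j' = ?q" "b j' = r" using r unfolding E'_iff by blast
	 have "?q mod 3 < r mod 3" using mod3[OF j'(1)] j' by simp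
	 moreover have "?q mod 3 = 1" by presburger
	 ultimately have "r mod 3 = 2" by linarith
	 then obtain u where u: "r = 3 * u + 2" by (metis add.commute mult_div_mod_eq)
	 have rW: "r < W" using bW[of j] j by simp
	 have "?p * W + r : k ` {..<n}" "?q * W + r : k ` {..<n}" unfolding edge_iff[OF rW] using j j' by blast+
	 with u rW show "r : (%u. 3 * u + 2) `
		{u. 3 * u + 2 < W & 3 * x * W + (3 * u + 2) : k ` {..<n} & (3 * y + 1) * W + (3 * u + 2) : k ` {..<n}}" by blast
	next
	 fix r assume "r : (%u. 3 * u + 2) `
		{u. 3 * u + 2 < W & 3 * x * W + (3 * u + 2) : k ` {..<n} & (3 * y + 1) * W + (3 * u + 2) : k ` {..<n}}"
	 then obtain u where u: "r = 3 * u + 2" "r < W" "?p * W + r : k ` {..<n}" "?q * W + r : k ` {..<n}" by blast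
	 then obtain j j' where j: "j < n" "a j = ?p" "b j = r" and j': "j' < n" "a j' = ?q" "b j' = r" unfolding edge_iff[OF u(2)] by blast
	 thus "r : {r : nodes. {?p, r} : E' & {?q, r} : E'}" unfolding E'_iff using nd[OF j(1)] by auto
	qed
	also have "card ... = card {u. 3 * u + 2 < W & 3 * x * W + (3 * u + 2) : k ` {..<n} & (3 * y + 1) * W + (3 * u + 2) : k ` {..<n}}" by (rule card_image) (simp add: inj_on_def)
	finally show "Y ! i = card {u. 3 * u + 2 < W & 3 * x * W + (3 * u + 2) : k ` {..<n} & (3 * y + 1) * W + (3 * u + 2) : k ` {..<n}}" .
 qed
qed

section \<open>Edge keys and padding edges\<close>

definition pk :: "nat => nat => nat => nat" where
 "pk n p q = p * (6 * n + 8) + q"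

lemma pk_simps:
 assumes "q < 6 * n + 8"
 shows "pk n p q div (6 * n + 8) = p" "pk n p q mod (6 * n + 8) = q"
 using assms by (simp_all add: pk_def)

lemma pk_inj: "q < 6 * n + 8 ==> q' < 6 * n + 8 ==> pk n p q = pk n p' q' \<longleftrightarrow> p = p' & q = q'"
 by (metis pk_simps)

lemma pk_lt:
 assumes "p < 6 * n + 8" "q < 6 * n + 8"
 shows "pk n p q < (6 * n + 8) * (6 * n + 8)"
proof -
 have "pk n p q < Suc p * (6 * n + 8)" using assms(2) by (simp add: pk_def)
 also have "... <= (6 * n + 8) * (6 * n + 8)" using assms(1) by (intro mult_le_mono1) simp
 finally show ?thesis .
qed

lemma emitted_card:
 assumes "emitted ro S t" "finite S"
 shows "va t 29 <= card S"
proof -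
 have "inj_on (ar t (ro + 5)) {..<va t 29}" using assms(1) unfolding emitted_def by (intro inj_onI) (metis add_right_cancel lessThan_iff)
 moreover have "ar t (ro + 5) ` {..<va t 29} <= S" using assms(1) unfolding emitted_def by blast
 ultimately show ?thesis using card_inj_on_le[OF _ _ assms(2)] by fastforce
qed

text \<open>Padding edges are disjoint from each other and from all real vertices. They bring the
  number of edges to exactly \<open>n\<close> without creating a triangle.\<close>

definition pad_key :: "nat => nat => nat" where
 "pad_key n e = pk n (3 * (n + 2 + e)) (3 * (n + 2 + e) + 1)"

definition pad_exp :: aexp where
 "pad_exp = Num 3 [*] (Var 3 [+] Num 2 [+] Var 11) [*] W_exp [+] (Num 3 [*] (Var 3 [+] Num 2 [+] Var 11) [+] Num 1)"

text \<open>A simple graph has no multiplicities. An edge that occurs \<open>c\<close> times is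
  instead present in the calls for those bits of \<open>c\<close> that are 1; the tally of row
  \<open>r\<close> supplies \<open>c\<close> and variable \<open>b\<close> the position of the
  bit.\<close>

definition bit_guard :: "aexp => nat => nat => aexp => aexp" where
 "bit_guard g r b k = Cnd g (Get (Var 2 [+] Num r) k [>>] Var b [mod] Num 2) (Num 0)"

text \<open>The row of keys is first filled with padding and then overwritten from the left by the
  real edges, which leaves exactly \<open>n\<close> keys.\<close>

definition build :: "aexp => aexp => aexp => aexp => aexp => aexp => cmd" where
 "build gq kq g1 k1 g2 k2 =
	For 11 3 (Put (Var 2 [+] Num 5) (Var 11) pad_exp) ;;
	tally 8 (Var 2 [+] Num 2) g1 k1 ;; tally 8 (Var 2 [+] Num 3) g2 k2 ;;
	Asg 29 (Num 0) ;;
	emit 7 gq kq ;; emit 8 (bit_guard g1 2 24 k1) k1 ;; emit 8 (bit_guard g2 3 25 k2) k2 ;;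
	Asg 30 (Num 0) ;;
	For 11 3 (Asg 19 (Num 2 [*] Var 11) ;; relabel_step ;; Asg 19 (Num 2 [*] Var 11 [+] Num 1) ;; relabel_step) ;;
	Put (Var 2) (Num 0) (Var 30) ;; Put (Var 2) (Num 1) (Var 3)"

text \<open>The source of a padding edge lies beyond all real sources, so its key clashes with no
  emitted key; its target is in class 1, so it is never mistaken for an edge into class 2.\<close>

lemma padded_keys:
 assumes em: "emitted ro S t" and m: "va t 29 <= n"
	and pad: "ALL e. va t 29 <= e & e < n --> ar t (ro + 5) e = pad_key n e"
	and S: "\<forall>kp\<in>S. EX p q. kp = pk n p q & p < 3 * (n + 2) & q < 3 * (n + 2) & p mod 3 < q mod 3"
 shows "inj_on (ar t (ro + 5)) {..<n}"
	and "i < n ==> ar t (ro + 5) i div (6 * n + 8) mod 3 < ar t (ro + 5) i mod (6 * n + 8) mod 3"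
	and "i < n ==> ar t (ro + 5) i < (6 * n + 8) * (6 * n + 8)"
	and "3 * u + 2 < 6 * n + 8 ==> pk n p (3 * u + 2) : ar t (ro + 5) ` {..<n} \<longleftrightarrow> pk n p (3 * u + 2) : S"
	and "kp : S ==> EX e<n. ar t (ro + 4) kp = e + 1 & ar t (ro + 5) e = kp"
proof -
 let ?k = "ar t (ro + 5)" and ?m = "va t 29" and ?W = "6 * n + 8"
 have 1: "!!e. e < ?m ==> ?k e : S & ar t (ro + 4) (?k e) = e + 1" and 3: "!!kp. kp : S ==> EX e<?m. ?k e = kp" using em unfolding emitted_def by blast+
 have S': "kp div ?W < 3 * (n + 2)" "kp div ?W mod 3 < kp mod ?W mod 3" "kp < ?W * ?W" if "kp : S" for kp
 proof -
	from bspec[OF S that] obtain p q where pq: "kp = pk n p q" "p < 3 * (n + 2)" "q < 3 * (n + 2)" "p mod 3 < q mod 3" by blast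
	hence W: "p < ?W" "q < ?W" by simp_all
	show "kp div ?W < 3 * (n + 2)" "kp div ?W mod 3 < kp mod ?W mod 3" "kp < ?W * ?W" using pq(2-) pk_lt[OF W] unfolding pq(1) pk_simps[OF W(2)] by simp_all
 qed
 have P: "pad_key n e div ?W = 3 * (n + 2 + e)" "pad_key n e mod ?W = 3 * (n + 2 + e) + 1" "pad_key n e < ?W * ?W" if "e < n" for e
 proof -
	have W: "3 * (n + 2 + e) + 1 < ?W" "3 * (n + 2 + e) < ?W" using that by simp_all
	show "pad_key n e div ?W = 3 * (n + 2 + e)" "pad_key n e mod ?W = 3 * (n + 2 + e) + 1" "pad_key n e < ?W * ?W" unfolding pad_key_def pk_simps[OF W(1)] using pk_lt[OF W(2,1)] by simp_all
 qed
 have cs: "(i < ?m & ?k i : S & ar t (ro + 4) (?k i) = i + 1) | (?m <= i & ?k i = pad_key n i & ?k i div ?W = 3 * (n + 2 + i))" if "i < n" for i using 1[of i] pad P(1)[OF that] that by (cases "i < ?m") simp_all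
 show "inj_on ?k {..<n}"
 proof (rule inj_onI)
	fix i j assume "i : {..<n}" "j : {..<n}" and eq: "?k i = ?k j"
	hence "i < n" "j < n" by simp_all
	note ci = cs[OF this(1), unfolded eq] and cj = cs[OF this(2)]
	show "i = j"
	proof (cases "?k j : S")
	 case True
	 have "?k j div ?W ~= 3 * (n + 2 + i)" "?k j div ?W ~= 3 * (n + 2 + j)" using S'(1)[OF True] by auto
	 with ci cj have "ar t (ro + 4) (?k j) = i + 1" "ar t (ro + 4) (?k j) = j + 1" by blast+
	 thus ?thesis by simp
	next
	 case False
	 with ci cj have "?k j div ?W = 3 * (n + 2 + i)" "?k j div ?W = 3 * (n + 2 + j)" by blast+
	 thus ?thesis by simp
	qed
 qed
 show "?k i div ?W mod 3 < ?k i mod ?W mod 3" if "i < n"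
 proof -
	have "3 * (n + 2 + i) mod 3 < (3 * (n + 2 + i) + 1) mod 3" by presburger
	thus ?thesis using cs[OF that] S'(2)[of "?k i"] P[OF that] by (elim disjE conjE) simp_all
 qed
 show "?k i < ?W * ?W" if "i < n" using cs[OF that] S'(3)[of "?k i"] P(3)[OF that] by (elim disjE conjE) simp_all
 show "EX e<n. ar t (ro + 4) kp = e + 1 & ?k e = kp" if "kp : S" for kp using 3[OF that] 1 m by (metis less_le_trans)
 note ex = this
 show "pk n p (3 * u + 2) : ?k ` {..<n} \<longleftrightarrow> pk n p (3 * u + 2) : S" if u: "3 * u + 2 < ?W"
 proof
	assume "pk n p (3 * u + 2) : ?k ` {..<n}"
	then obtain i where i: "i < n" "?k i = pk n p (3 * u + 2)" by auto
	from cs[OF i(1)] show "pk n p (3 * u + 2) : S"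
	proof (elim disjE conjE)
	 assume "?k i = pad_key n i"
	 hence "3 * u + 2 = 3 * (n + 2 + i) + 1" using i P(2)[OF i(1)] pk_simps(2)[OF u, of p] by simp
	 hence False by presburger
	 thus ?thesis ..
	qed (simp add: i)
 next
	assume "pk n p (3 * u + 2) : S"
	from ex[OF this] show "pk n p (3 * u + 2) : ?k ` {..<n}" by (metis imageI lessThan_iff)
 qed
qed

lemma mem_images:
 "kp : {} \<union> f ` {i. i < m & P i} \<union> g ` {i. i < N & Q i} \<union> h ` {i. i < N & R i} \<longleftrightarrow>
	(EX i<m. P i & f i = kp) | (EX i<N. Q i & g i = kp) | (EX i<N. R i & h i = kp)" by auto

lemma ex_key_iff:
 assumes "odd (C kp) ==> EX i<N. G i & k i = kp"
 shows "(EX i<N. (G i & odd (C (k i))) & k i = kp) \<longleftrightarrow> odd (C kp)"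
 using assms by auto

text \<open>Query edges join class 0 to class 1; the two families of data edges join these classes
  to class 2. A triangle on a query edge therefore selects a vertex \<open>u\<close> of class 2 for
  which both multiplicities have the chosen bit set.\<close>

lemma run_build:
 fixes s :: ast
 assumes v: "va s 2 = ro" "va s 3 = n" "va s 7 = nq" "va s 8 = N" "N <= n" "va s 24 = b1" "va s 25 = b2" "b1 < pow2 w" "b2 < pow2 w"
	and fresh: "!!q. ro <= q ==> q <= ro + 5 ==> ar s q = (%_. 0)"
	and bounds: "ro + 5 < pow2 z" "(6 * n + 8) * (6 * n + 8) <= pow2 z" "nq + 3 * n + 8 < pow2 z" "pow2 z <= pow2 w"
	and agree: "!!t :: ast. agree t \<longleftrightarrow> (ALL y. y ~: {11, 13, 29} --> va t y = va s y) & (ALL q. q ~: {ro..ro + 5} --> ar t q = ar s q)"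
	and eq: "!!i t. i < nq ==> va t 11 = i ==> agree t ==> (eval w z t gq ~= 0 \<longleftrightarrow> Gq i) & (Gq i --> eval w z t kq = pk n (3 * xq i) (3 * yq i + 1))"
	and e1: "!!i t. i < N ==> va t 11 = i ==> agree t ==> (eval w z t g1 ~= 0 \<longleftrightarrow> G1 i) & (G1 i --> eval w z t k1 = pk n (3 * x1 i) (3 * u1 i + 2))"
	and e2: "!!i t. i < N ==> va t 11 = i ==> agree t ==> (eval w z t g2 ~= 0 \<longleftrightarrow> G2 i) & (G2 i --> eval w z t k2 = pk n (3 * y2 i + 1) (3 * u2 i + 2))"
	and lab: "!!i. i < nq ==> xq i <= n + 1 & yq i <= n + 1" "!!i. i < N ==> x1 i <= n + 1 & u1 i <= n + 1 & y2 i <= n + 1 & u2 i <= n + 1"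
	and few: "card {i. i < nq & Gq i} + card {i. i < N & G1 i} + card {i. i < N & G2 i} <= n"
	and s': "s' = run w z (build gq kq g1 k1 g2 k2) s"
 obtains X Y where "edge_triangle_counting z n X Y" "length Y = n" "set X <= {..<pow2 z}"
	"ALL y. y ~: {11, 13, 19, 29, 30} --> va s' y = va s y" "ALL q. q ~: {ro..ro + 5} --> ar s' q = ar s q"
	"!!i. ar s' ro i = (if i < length X then X ! i else 0)"
	"!!j. j < nq ==> Gq j ==> EX e<n. ar s' (ro + 4) (pk n (3 * xq j) (3 * yq j + 1)) = e + 1 & Y ! e =
	 (\<Sum>u<n + 2. of_bool (odd ((\<Sum>i<N. of_bool (G1 i & x1 i = xq j & u1 i = u)) div pow2 b1)) *
				 of_bool (odd ((\<Sum>i<N. of_bool (G2 i & y2 i = yq j & u2 i = u)) div pow2 b2)))"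
proof -
 let ?W = "6 * n + 8"
 let ?kq = "%i. pk n (3 * xq i) (3 * yq i + 1)" and ?k1 = "%i. pk n (3 * x1 i) (3 * u1 i + 2)" and ?k2 = "%i. pk n (3 * y2 i + 1) (3 * u2 i + 2)"
 have WZ: "?W < pow2 z"
 proof -
	have "?W * 1 < ?W * ?W" by (rule mult_strict_left_mono) simp_all
	thus ?thesis using bounds(2) by (metis less_le_trans mult.right_neutral)
 qed
 have b: "ro + 5 < pow2 w" "ro < pow2 w" "5 < pow2 w" "4 < pow2 w" "3 < pow2 w" "2 < pow2 w" "1 < pow2 w" "0 < pow2 w" "n < pow2 w" "N + 1 < pow2 w" "n < pow2 z"
	"ro + 2 < pow2 z" "ro + 3 < pow2 z" "ro + 2 < pow2 w" "ro + 3 < pow2 w" "?W < pow2 w" "8 < pow2 w" "6 < pow2 w" "6 * n < pow2 w" "ro < pow2 z" "1 < pow2 z" "0 < pow2 z" using bounds WZ v(5) by linarith+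
 have key_lt: "pk n p q < pow2 z" if "p < ?W" "q < ?W" for p q using pk_lt[OF that] bounds(2) by (rule less_le_trans)
 have kz: "!!i. i < nq ==> ?kq i < pow2 z" "!!i. i < N ==> ?k1 i < pow2 z" "!!i. i < N ==> ?k2 i < pow2 z" using lab by (auto intro!: key_lt simp del: One_nat_def add_Suc_right add_2_eq_Suc') fastforce+
 have ag: "agree t" if "agree t'" "ALL y. y ~: {11, 13, 29} --> va t y = va t' y" "ALL q. q ~: Q --> ar t q = ar t' q" "Q <= {ro..ro + 5}"
	for t t' :: ast and Q using that unfolding agree by (metis subsetD)
 define t0 where "t0 = set_va 11 n (fill (ro + 5) 0 n (pad_key n) s)"
 have t0: "run w z (For 11 3 (Put (Var 2 [+] Num 5) (Var 11) pad_exp)) s = t0" unfolding t0_def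
 proof (rule run_fill)
	fix i and t :: ast assume i: "i < n" "ALL y. y ~= 11 --> va t y = va s y" "va t 11 = i"
	have W: "eval w z t W_exp = ?W" using i v b by (simp add: W_exp_def ev)
	have x: "3 * (n + 2 + i) < ?W" "3 * (n + 2 + i) + 1 < ?W" using i by simp_all
	have 3: "eval w z t (Num 3 [*] (Var 3 [+] Num 2 [+] Var 11)) = 3 * (n + 2 + i)"
	proof -
	 have "n + 2 + i < pow2 w" "n + 2 < pow2 w" "i < pow2 w" "3 * (n + 2 + i) < pow2 w" using x b i by linarith+
	 thus ?thesis using i v b by (simp add: ev)
	qed
	have pl: "pk n (3 * (n + 2 + i)) (3 * (n + 2 + i) + 1) < pow2 w" using key_lt[OF x] bounds(4) by (rule less_le_trans)
	have 4: "eval w z t (Num 3 [*] (Var 3 [+] Num 2 [+] Var 11) [*] W_exp) = 3 * (n + 2 + i) * ?W" using 3 W pl by (subst ev_Mul) (simp_all only: 3 W pk_def)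
	have 5: "eval w z t (Num 3 [*] (Var 3 [+] Num 2 [+] Var 11) [+] Num 1) = 3 * (n + 2 + i) + 1" using x b by (subst ev_Add) (simp_all only: 3 ev_Num)
	have "eval w z t pad_exp = pad_key n i" unfolding pad_exp_def pad_key_def pk_def using pl by (subst ev_Add) (simp_all only: 4 5 pk_def)
	moreover have "i < pow2 w" using i b by linarith
	ultimately show "eval w z t (Var 2 [+] Num 5) = ro + 5 & eval w z t (Var 11) = 0 + i & eval w z t pad_exp = pad_key n i" using i v b by (simp add: ev)
 qed (use v bounds b in auto)
 have a0: "agree t0" by (simp add: agree t0_def)
 have ar0: "!!q. ro <= q ==> q <= ro + 4 ==> ar t0 q = (%_. 0)" "!!e. e < n ==> ar t0 (ro + 5) e = pad_key n e" using fresh by (auto simp: t0_def)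
 define t1 where "t1 = run w z (tally 8 (Var 2 [+] Num 2) g1 k1) t0"
 have av: "va t y = va s y" if "agree t" "y ~: {11, 13, 29}" for t y using that by (simp add: agree)
 have t1: "(ALL y. y ~: {11, 13} --> va t1 y = va t0 y) & (ALL q. q ~= ro + 2 --> ar t1 q = ar t0 q) &
	ar t1 (ro + 2) = (%kp. \<Sum>i<N. of_bool (G1 i & ?k1 i = kp))"
 proof (rule run_tally[OF _ _ _ _ _ _ _ t1_def])
	fix i and t :: ast assume i: "i < N" "va t 11 = i" "ALL y. y ~: {11, 13} --> va t y = va t0 y" "ALL q. q ~= ro + 2 --> ar t q = ar t0 q"
	hence "agree t" by (intro ag[OF a0, of _ "{ro + 2}"]) auto
	thus "eval w z t (Var 2 [+] Num 2) = ro + 2 & (eval w z t g1 ~= 0 \<longleftrightarrow> G1 i) & (G1 i --> eval w z t k1 = ?k1 i)" using e1[OF i(1,2)] av[of t 2] v b by (simp add: ev)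
 qed (use av[OF a0] v b kz ar0 bounds in simp_all)
 have a1: "agree t1" using t1 by (intro ag[OF a0, of _ "{ro + 2}"]) auto
 define t2 where "t2 = run w z (tally 8 (Var 2 [+] Num 3) g2 k2) t1"
 have t2: "(ALL y. y ~: {11, 13} --> va t2 y = va t1 y) & (ALL q. q ~= ro + 3 --> ar t2 q = ar t1 q) &
	ar t2 (ro + 3) = (%kp. \<Sum>i<N. of_bool (G2 i & ?k2 i = kp))"
 proof (rule run_tally[OF _ _ _ _ _ _ _ t2_def])
	fix i and t :: ast assume i: "i < N" "va t 11 = i" "ALL y. y ~: {11, 13} --> va t y = va t1 y" "ALL q. q ~= ro + 3 --> ar t q = ar t1 q"
	hence "agree t" by (intro ag[OF a1, of _ "{ro + 3}"]) auto
	thus "eval w z t (Var 2 [+] Num 3) = ro + 3 & (eval w z t g2 ~= 0 \<longleftrightarrow> G2 i) & (G2 i --> eval w z t k2 = ?k2 i)" using e2[OF i(1,2)] av[of t 2] v b by (simp add: ev)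
 qed (use av[OF a1] v b kz ar0 t1 bounds in simp_all)
 have a2: "agree t2" using t2 by (intro ag[OF a1, of _ "{ro + 3}"]) auto
 define t3 where "t3 = set_va 29 0 t2"
 have a3: "agree t3" "ar t3 = ar t2" "va t3 29 = 0" using a2 by (simp_all add: agree t3_def)
 let ?C1 = "%kp. \<Sum>i<N. of_bool (G1 i & ?k1 i = kp) :: nat" and ?C2 = "%kp. \<Sum>i<N. of_bool (G2 i & ?k2 i = kp) :: nat"
 have ar3: "ar t3 (ro + 2) = ?C1" "ar t3 (ro + 3) = ?C2" "ar t3 (ro + 4) = (%_. 0)" "ar t3 ro = (%_. 0)" "ar t3 (ro + 1) = (%_. 0)"
	"!!e. e < n ==> ar t3 (ro + 5) e = pad_key n e" using a3(2) t2 t1 ar0 by simp_all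
 have Cle: "?C1 kp <= N" "?C2 kp <= N" for kp using sum_bounded_above[of "{..<N}" "%i. of_bool (G1 i & ?k1 i = kp)" "1::nat"]
	 sum_bounded_above[of "{..<N}" "%i. of_bool (G2 i & ?k2 i = kp)" "1::nat"] by simp_all
 have em3: "emitted ro {} t3" using a3(3) ar3(3) by (simp add: emitted_def)
 have few': "card {i. i < nq & Gq i} + card {i. i < N & G1 i} + card {i. i < N & G2 i} <= n" by (rule few)
 define t4 where "t4 = run w z (emit 7 gq kq) t3"
 have t4: "(ALL y. y ~: {11, 13, 29} --> va t4 y = va t3 y) & (ALL q. q ~: {ro + 4, ro + 5} --> ar t4 q = ar t3 q) &
	emitted ro ({} \<union> ?kq ` {i. i < nq & Gq i}) t4 &
	va t3 29 <= va t4 29 & va t4 29 <= va t3 29 + nq & (\<forall>e\<ge>va t4 29. ar t4 (ro + 5) e = ar t3 (ro + 5) e)"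
 proof (rule run_emit[OF _ _ _ _ _ _ _ em3 t4_def])
	fix i and t :: ast assume i: "i < nq" "va t 11 = i" "ALL y. y ~: {11, 13, 29} --> va t y = va t3 y" "ALL q. q ~: {ro + 4, ro + 5} --> ar t q = ar t3 q"
	hence "agree t" by (intro ag[OF a3(1), of _ "{ro + 4, ro + 5}"]) auto
	thus "(eval w z t gq ~= 0 \<longleftrightarrow> Gq i) & (Gq i --> eval w z t kq = ?kq i)" using eq[OF i(1,2)] by blast
 qed (use av[OF a3(1)] v b kz bounds a3(3) in simp_all)
 have a4: "agree t4" using t4 by (intro ag[OF a3(1), of _ "{ro + 4, ro + 5}"]) auto
 define t5 where "t5 = run w z (emit 8 (bit_guard g1 2 24 k1) k1) t4"
 let ?B1 = "%i. G1 i & odd (?C1 (?k1 i) div pow2 b1)" and ?B2 = "%i. G2 i & odd (?C2 (?k2 i) div pow2 b2)"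
 let ?S4 = "{} \<union> ?kq ` {i. i < nq & Gq i}"
 let ?S5 = "?S4 \<union> ?k1 ` {i. i < N & ?B1 i}"
 let ?S = "?S5 \<union> ?k2 ` {i. i < N & ?B2 i}"
 have t5: "(ALL y. y ~: {11, 13, 29} --> va t5 y = va t4 y) & (ALL q. q ~: {ro + 4, ro + 5} --> ar t5 q = ar t4 q) &
	emitted ro ?S5 t5 &
	va t4 29 <= va t5 29 & va t5 29 <= va t4 29 + N & (\<forall>e\<ge>va t5 29. ar t5 (ro + 5) e = ar t4 (ro + 5) e)"
 proof (rule run_emit[OF _ _ _ _ _ _ _ _ t5_def])
	fix i and t :: ast assume i: "i < N" "va t 11 = i" "ALL y. y ~: {11, 13, 29} --> va t y = va t4 y" "ALL q. q ~: {ro + 4, ro + 5} --> ar t q = ar t4 q"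
	hence at: "agree t" by (intro ag[OF a4, of _ "{ro + 4, ro + 5}"]) auto
	note e = e1[OF i(1,2) at]
	have "va t 2 = ro" "va t 24 = b1" using av[OF at] v by simp_all
	moreover have "ar t (ro + 2) = ?C1" using i t4 ar3 by simp
	moreover have "?k1 i < pow2 z" using kz i by blast
	moreover have "?C1 (?k1 i) < pow2 w" using Cle(1)[of "?k1 i"] b by linarith
	ultimately have "G1 i ==> eval w z t (Get (Var 2 [+] Num 2) k1 [>>] Var 24 [mod] Num 2) = ?C1 (?k1 i) div pow2 b1 mod 2" using e b v by (simp add: ev del: of_bool_conj sum_of_bool_eq)
	thus "(eval w z t (bit_guard g1 2 24 k1) ~= 0 \<longleftrightarrow> ?B1 i) & (?B1 i --> eval w z t k1 = ?k1 i)" unfolding bit_guard_def using e b by (simp add: eval.simps(5) ev_Num odd_iff_mod_2_eq_one del: of_bool_conj sum_of_bool_eq)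
 qed (use av[OF a4] v b kz bounds t4 a3(3) in simp_all)
 have a5: "agree t5" using t5 by (intro ag[OF a4, of _ "{ro + 4, ro + 5}"]) auto
 define t6 where "t6 = run w z (emit 8 (bit_guard g2 3 25 k2) k2) t5"
 have t6: "(ALL y. y ~: {11, 13, 29} --> va t6 y = va t5 y) & (ALL q. q ~: {ro + 4, ro + 5} --> ar t6 q = ar t5 q) &
	emitted ro ?S t6 &
	va t5 29 <= va t6 29 & va t6 29 <= va t5 29 + N & (\<forall>e\<ge>va t6 29. ar t6 (ro + 5) e = ar t5 (ro + 5) e)"
 proof (rule run_emit[OF _ _ _ _ _ _ _ _ t6_def])
	fix i and t :: ast assume i: "i < N" "va t 11 = i" "ALL y. y ~: {11, 13, 29} --> va t y = va t5 y" "ALL q. q ~: {ro + 4, ro + 5} --> ar t q = ar t5 q"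
	hence at: "agree t" by (intro ag[OF a5, of _ "{ro + 4, ro + 5}"]) auto
	note e = e2[OF i(1,2) at]
	have "va t 2 = ro" "va t 25 = b2" using av[OF at] v by simp_all
	moreover have "ar t (ro + 3) = ?C2" using i t4 t5 ar3 by simp
	moreover have "?k2 i < pow2 z" using kz i by blast
	moreover have "?C2 (?k2 i) < pow2 w" using Cle(2)[of "?k2 i"] b by linarith
	ultimately have "G2 i ==> eval w z t (Get (Var 2 [+] Num 3) k2 [>>] Var 25 [mod] Num 2) = ?C2 (?k2 i) div pow2 b2 mod 2" using e b v by (simp add: ev del: of_bool_conj sum_of_bool_eq)
	thus "(eval w z t (bit_guard g2 3 25 k2) ~= 0 \<longleftrightarrow> ?B2 i) & (?B2 i --> eval w z t k2 = ?k2 i)" unfolding bit_guard_def using e b by (simp add: eval.simps(5) ev_Num odd_iff_mod_2_eq_one del: of_bool_conj sum_of_bool_eq)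
 qed (use av[OF a5] v b kz bounds t4 t5 a3(3) in simp_all)
 have a6: "agree t6" using t6 by (intro ag[OF a5, of _ "{ro + 4, ro + 5}"]) auto
 have fin: "finite ?S" by simp
 \<comment> \<open>Selecting by a bit and merging equal keys only removes edges, so the bound
   \<open>few\<close> on occurrences is enough.\<close>
 have cS: "card ?S <= n"
 proof -
	have "card ?S <= card (?kq ` {i. i < nq & Gq i}) + card (?k1 ` {i. i < N & ?B1 i}) + card (?k2 ` {i. i < N & ?B2 i})" by (rule order_trans[OF card_Un_le add_mono[OF _ order_refl]]) (simp add: card_Un_le)
	also have "... <= card {i. i < nq & Gq i} + card {i. i < N & ?B1 i} + card {i. i < N & ?B2 i}" by (intro add_mono card_image_le) simp_all
	also have "... <= card {i. i < nq & Gq i} + card {i. i < N & G1 i} + card {i. i < N & G2 i}" by (intro add_mono card_mono order_refl) auto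
	also note few
	finally show ?thesis .
 qed
 have em6: "emitted ro ?S t6" using t6 by blast
 have m6: "va t6 29 <= n" using emitted_card[OF em6 fin] cS by linarith
 have m45: "va t4 29 <= va t6 29" "va t5 29 <= va t6 29" using t5 t6 by simp_all
 have pad6: "ALL e. va t6 29 <= e & e < n --> ar t6 (ro + 5) e = pad_key n e" using t6 t5 t4 ar3(6) m45 by simp
 have lt: "3 * q + 2 < ?W & 3 * q + 1 < ?W & 3 * q < 3 * (n + 2) & 3 * q + 1 < 3 * (n + 2) & 3 * q + 2 < 3 * (n + 2)" if "q <= n + 1" for q using that by simp
 have m3: "(3 * q) mod 3 = 0" "(3 * q + 1) mod 3 = 1" "(3 * q + 2) mod 3 = 2" for q :: nat by presburger+
 have Sp: "\<forall>kp\<in>?S. EX p q. kp = pk n p q & p < 3 * (n + 2) & q < 3 * (n + 2) & p mod 3 < q mod 3"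
 proof
	fix kp assume "kp : ?S"
	then consider i where "i < nq" "kp = ?kq i" | i where "i < N" "kp = ?k1 i" | i where "i < N" "kp = ?k2 i" by blast
	thus "EX p q. kp = pk n p q & p < 3 * (n + 2) & q < 3 * (n + 2) & p mod 3 < q mod 3"
	proof cases
	 case (1 i)
	 show ?thesis by (rule exI, rule exI, rule conjI[OF 1(2)]) (use lab(1)[OF 1(1)] lt m3 in simp)
	next
	 case (2 i)
	 show ?thesis by (rule exI, rule exI, rule conjI[OF 2(2)]) (use lab(2)[OF 2(1)] lt m3 in simp)
	next
	 case (3 i)
	 show ?thesis by (rule exI, rule exI, rule conjI[OF 3(2)]) (use lab(2)[OF 3(1)] lt m3 in simp)
	qed
 qed
 define k where "k = ar t6 (ro + 5)"
 define S where "S = ?S"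
 have em: "emitted ro S t6" using em6 by (simp only: S_def)
 note pad = padded_keys[OF em m6 pad6 Sp[folded S_def], folded k_def]
 define f where "f = end_key ?W k"
 define t7 where "t7 = set_va 30 0 t6"
 let ?relabel = "For 11 3 (Asg 19 (Num 2 [*] Var 11) ;; relabel_step ;; Asg 19 (Num 2 [*] Var 11 [+] Num 1) ;; relabel_step)"
 define t8 where "t8 = run w z ?relabel t7"
 have v7: "va t7 3 = n" "va t7 2 = ro" "va t7 30 = 0" using av[OF a6] v by (simp_all add: t7_def)
 have k7: "ar t7 (ro + 5) i = k i & k i < pow2 z" if "i < n" for i using pad(3)[OF that] bounds(2) by (auto simp: t7_def k_def)
 have fresh7: "ar t7 ro = (%_. 0)" "ar t7 (ro + 1) = (%_. 0)" using t6 t5 t4 ar3 by (simp_all add: t7_def)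
 obtain l nv where l: "ALL y. y ~: {11, 13, 19, 30} --> va t8 y = va t7 y" "ALL q. q ~: {ro, ro + 1} --> ar t8 q = ar t7 q"
	"va t8 30 = nv" "nv <= 2 * n" "inj_on l (f ` {..<2 * n})" "l ` f ` {..<2 * n} = {1..nv}"
	"!!i. ar t8 ro i = (if 2 <= i & i < 2 + 2 * n then l (f (i - 2)) else 0)" using run_relabel[OF v7 bounds(1) WZ bounds(4) k7 fresh7 f_def t8_def] by metis
 define X where "X = [nv, n] @ map (%e. l (f e)) [0..<2 * n]"
 obtain Y where Y: "edge_triangle_counting z n X Y" "length Y = n"
	"!!i x y. i < n ==> k i = 3 * x * ?W + (3 * y + 1) ==> 3 * y + 1 < ?W ==> Y ! i =
	 card {u. 3 * u + 2 < ?W & 3 * x * ?W + (3 * u + 2) : k ` {..<n} & (3 * y + 1) * ?W + (3 * u + 2) : k ` {..<n}}"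
 proof (rule relabelled_graph[OF f_def pad(1,2) l(5,6) X_def, of z])
	fix Y assume "edge_triangle_counting z n X Y" "length Y = n"
	 "!!i x y. i < n ==> k i = 3 * x * ?W + (3 * y + 1) ==> 3 * y + 1 < ?W ==> Y ! i =
		card {u. 3 * u + 2 < ?W & 3 * x * ?W + (3 * u + 2) : k ` {..<n} & (3 * y + 1) * ?W + (3 * u + 2) : k ` {..<n}}"
	thus thesis by (rule that)
 qed
 have v8: "va t8 2 = ro" "va t8 3 = n" using l(1) v7 by simp_all
 have s'_eq: "s' = set_ar ro 1 n (set_ar ro 0 nv t8)"
 proof -
	have "s' = run w z (Put (Var 2) (Num 0) (Var 30) ;; Put (Var 2) (Num 1) (Var 3)) t8" unfolding s' build_def t8_def t7_def t6_def t5_def t4_def t3_def t2_def t1_def t0[symmetric] using b by (simp add: ev_Num)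
	moreover have "nv < pow2 w" using l(4) bounds by linarith
	ultimately show ?thesis using v8 l(3) b by (simp add: run_Put ev_Num ev_Var)
 qed
 show thesis
 proof (rule that[OF Y(1,2)])
	have "l (f e) <= nv" if "e < 2 * n" for e
	proof -
	 have "l (f e) : {1..nv}" unfolding l(6)[symmetric] using that by blast
	 thus ?thesis by simp
	qed
	hence "x <= 2 * n" if "x : set X" for x using that l(4) unfolding X_def by fastforce
	thus "set X <= {..<pow2 z}" using bounds(3) by fastforce
	show "ALL y. y ~: {11, 13, 19, 29, 30} --> va s' y = va s y" using l(1) av[OF a6] by (simp add: s'_eq t7_def)
	show "ALL q. q ~: {ro..ro + 5} --> ar s' q = ar s q" using l(2) a6 by (auto simp: s'_eq t7_def agree)
	show "ar s' ro i = (if i < length X then X ! i else 0)" for i using l(7)[of i] by (auto simp: s'_eq X_def nth_Cons' nth_append numeral_2_eq_2)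
	fix j assume j: "j < nq" "Gq j"
	let ?x = "xq j" and ?y = "yq j"
	let ?T1 = "%u. \<Sum>i<N. of_bool (G1 i & x1 i = ?x & u1 i = u) :: nat" and ?T2 = "%u. \<Sum>i<N. of_bool (G2 i & y2 i = ?y & u2 i = u) :: nat"
	have "?kq j : S" unfolding S_def using j by blast
	from pad(5)[OF this] obtain e where e: "e < n" "ar t6 (ro + 4) (?kq j) = e + 1" "k e = ?kq j" by blast
	have u2: "3 * u + 2 < ?W" if "u < n + 2" for u using that by simp
	have c1: "?C1 (pk n (3 * ?x) (3 * u + 2)) = ?T1 u" if u: "3 * u + 2 < ?W" for u
	proof (rule sum.cong[OF refl])
	 fix i assume "i : {..<N}"
	 hence "3 * u1 i + 2 < ?W" using lab(2)[of i] lt by blast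
	 thus "of_bool (G1 i & ?k1 i = pk n (3 * ?x) (3 * u + 2)) = (of_bool (G1 i & x1 i = ?x & u1 i = u) :: nat)" using u by (simp add: pk_inj del: add_2_eq_Suc')
	qed
	have c2: "?C2 (pk n (3 * ?y + 1) (3 * u + 2)) = ?T2 u" if u: "3 * u + 2 < ?W" for u
	proof (rule sum.cong[OF refl])
	 fix i assume "i : {..<N}"
	 hence "3 * u2 i + 2 < ?W" using lab(2)[of i] lt by blast
	 thus "of_bool (G2 i & ?k2 i = pk n (3 * ?y + 1) (3 * u + 2)) = (of_bool (G2 i & y2 i = ?y & u2 i = u) :: nat)" using u by (simp add: pk_inj del: add_2_eq_Suc')
	qed
	have nz: "EX i<N. P i" if "odd ((\<Sum>i<N. of_bool (P i) :: nat) div q)" for P q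
	proof (rule ccontr)
	 assume "\<not> (EX i<N. P i)"
	 hence "(\<Sum>i<N. of_bool (P i) :: nat) = 0" by (intro sum.neutral) auto
	 with that show False by simp
	qed
	\<comment> \<open>The residues modulo 3 of the two ends separate the three kinds of keys, so only
	  the first tally decides.\<close>
	have mem1: "pk n (3 * ?x) (3 * u + 2) : S \<longleftrightarrow> odd (?T1 u div pow2 b1)" if u: "3 * u + 2 < ?W" for u
	proof -
	 let ?kp = "pk n (3 * ?x) (3 * u + 2)"
	 have "?kq i ~= ?kp" if "i < nq" for i
	 proof -
		have "3 * yq i + 1 < ?W" "3 * yq i + 1 ~= 3 * u + 2" using lab(1)[OF that] lt by (blast, presburger)
		thus ?thesis using pk_inj[OF _ u] by blast
	 qed
	 moreover have "?k2 i ~= ?kp" if "i < N" for i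
	 proof -
		have "3 * u2 i + 2 < ?W" "3 * y2 i + 1 ~= 3 * ?x" using lab(2)[OF that] lt by (blast, presburger)
		thus ?thesis using pk_inj[OF _ u] by blast
	 qed
	 ultimately have A: "\<not> (EX i<nq. Gq i & ?kq i = ?kp)" "\<not> (EX i<N. ?B2 i & ?k2 i = ?kp)" by (metis, metis)
	 have "?kp : S \<longleftrightarrow> (EX i<N. (G1 i & odd (?C1 (?k1 i) div pow2 b1)) & ?k1 i = ?kp)" unfolding S_def mem_images using A by (simp only: simp_thms)
	 also have "... \<longleftrightarrow> odd (?C1 ?kp div pow2 b1)" by (rule ex_key_iff[where C = "%kp. ?C1 kp div pow2 b1"])
		 (use nz[of "%i. G1 i & ?k1 i = ?kp" "pow2 b1"] in blast)
	 finally show ?thesis unfolding c1[OF u] .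
	qed
	have mem2: "pk n (3 * ?y + 1) (3 * u + 2) : S \<longleftrightarrow> odd (?T2 u div pow2 b2)" if u: "3 * u + 2 < ?W" for u
	proof -
	 let ?kp = "pk n (3 * ?y + 1) (3 * u + 2)"
	 have "?kq i ~= ?kp" if "i < nq" for i
	 proof -
		have "3 * yq i + 1 < ?W" "3 * yq i + 1 ~= 3 * u + 2" using lab(1)[OF that] lt by (blast, presburger)
		thus ?thesis using pk_inj[OF _ u] by blast
	 qed
	 moreover have "?k1 i ~= ?kp" if "i < N" for i
	 proof -
		have "3 * u1 i + 2 < ?W" "3 * x1 i ~= 3 * ?y + 1" using lab(2)[OF that] lt by (blast, presburger)
		thus ?thesis using pk_inj[OF _ u] by blast
	 qed
	 ultimately have A: "\<not> (EX i<nq. Gq i & ?kq i = ?kp)" "\<not> (EX i<N. ?B1 i & ?k1 i = ?kp)" by (metis, metis)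
	 have "?kp : S \<longleftrightarrow> (EX i<N. (G2 i & odd (?C2 (?k2 i) div pow2 b2)) & ?k2 i = ?kp)" unfolding S_def mem_images using A by (simp only: simp_thms)
	 also have "... \<longleftrightarrow> odd (?C2 ?kp div pow2 b2)" by (rule ex_key_iff[where C = "%kp. ?C2 kp div pow2 b2"])
		 (use nz[of "%i. G2 i & ?k2 i = ?kp" "pow2 b2"] in blast)
	 finally show ?thesis unfolding c2[OF u] .
	qed
	\<comment> \<open>A set bit needs at least one occurrence, and occurrences have bounded vertex
	  numbers.\<close>
	have un: "u < n + 2" if "odd (?T1 u div pow2 b1)" for u
	proof -
	 from nz[OF that] obtain i where "i < N" "u1 i = u" by blast
	 thus ?thesis using lab(2)[of i] by auto
	qed
	have "Y ! e = card {u. 3 * u + 2 < ?W & 3 * ?x * ?W + (3 * u + 2) : k ` {..<n} & (3 * ?y + 1) * ?W + (3 * u + 2) : k ` {..<n}}" by (rule Y(3)[OF e(1)]) (use e(3) lab(1)[OF j(1)] lt in \<open>simp_all add: pk_def\<close>)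
	also have "{u. 3 * u + 2 < ?W & 3 * ?x * ?W + (3 * u + 2) : k ` {..<n} & (3 * ?y + 1) * ?W + (3 * u + 2) : k ` {..<n}} =
		{u. 3 * u + 2 < ?W & pk n (3 * ?x) (3 * u + 2) : S & pk n (3 * ?y + 1) (3 * u + 2) : S}" using pad(4) unfolding pk_def by blast
	also have "... = {u : {..<n + 2}. odd (?T1 u div pow2 b1) & odd (?T2 u div pow2 b2)}" using mem1 mem2 un u2 by blast
	also have "card ... = (\<Sum>u<n + 2. of_bool (odd (?T1 u div pow2 b1) & odd (?T2 u div pow2 b2)))" by (rule card_filter) simp
	finally have "Y ! e = (\<Sum>u<n + 2. of_bool (odd (?T1 u div pow2 b1)) * of_bool (odd (?T2 u div pow2 b2)))" by (simp only: of_bool_conj)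
	moreover have "ar s' (ro + 4) (?kq j) = e + 1" using l(2) e(2) by (simp add: s'_eq t7_def)
	ultimately show "EX e<n. ar s' (ro + 4) (?kq j) = e + 1 & Y ! e =
		(\<Sum>u<n + 2. of_bool (odd (?T1 u div pow2 b1)) * of_bool (odd (?T2 u div pow2 b2)))" using e(1) by blast
 qed
qed

section \<open>Digits, bits and sums over tasks\<close>

fun digits :: "nat => nat => nat => nat list" where
 "digits D 0 r = []"
| "digits D (Suc m) r = r mod D # digits D m (r div D)"

fun digit_sum :: "nat => nat => (nat list => nat) => nat" where
 "digit_sum D 0 f = f []"
| "digit_sum D (Suc m) f = (\<Sum>x<D. digit_sum D m (%xs. f (x # xs)))"

text \<open>Turns the single loop over \<open>D ^ m\<close> calls into an \<open>m\<close>-fold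
  nested sum.\<close>

lemma sum_digits:
 assumes "0 < D"
 shows "(\<Sum>r<D ^ m. f (digits D m r)) = digit_sum D m f"
proof (induction m arbitrary: f)
 case (Suc m)
 have "(\<Sum>r<D ^ Suc m. f (digits D (Suc m) r)) = (\<Sum>r<D ^ m * D. f (r mod D # digits D m (r div D)))" by (simp add: mult.commute)
 also have "... = (\<Sum>q<D ^ m. \<Sum>x<D. f (x # digits D m q))" by (rule sum_div_mod[OF assms, of "%q x. f (x # digits D m q)"])
 also have "... = (\<Sum>x<D. \<Sum>q<D ^ m. f (x # digits D m q))" by (rule sum.swap)
 also have "... = digit_sum D (Suc m) f" by (simp add: Suc.IH[of "%xs. f (x # xs)" for x])
 finally show ?case .
qed simp

lemma digits_8:
 "digits D 8 r = [r mod D, r div D mod D, r div D div D mod D, r div D div D div D mod D,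
	r div D div D div D div D mod D, r div D div D div D div D div D mod D,
	r div D div D div D div D div D div D mod D, r div D div D div D div D div D div D div D mod D]" by (simp add: eval_nat_numeral)

lemma digit_sum_8:
 "digit_sum D 8 f = (\<Sum>a<D. \<Sum>b<D. \<Sum>c<D. \<Sum>d<D. \<Sum>e<D. \<Sum>g<D. \<Sum>h<D. \<Sum>i<D. f [a, b, c, d, e, g, h, i])" by (simp add: eval_nat_numeral)

lemma sum_bits:
 fixes c :: nat
 shows "c < 2 ^ D ==> (\<Sum>b<D. (2::nat) ^ b * of_bool (odd (c div 2 ^ b))) = c"
proof (induction D arbitrary: c)
 case (Suc D)
 have "(\<Sum>b<Suc D. (2::nat) ^ b * of_bool (odd (c div 2 ^ b))) =
	 of_bool (odd c) + (\<Sum>b<D. 2 ^ Suc b * of_bool (odd (c div 2 ^ Suc b)))" by (subst sum.lessThan_Suc_shift) simp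
 also have "(\<Sum>b<D. (2::nat) ^ Suc b * of_bool (odd (c div 2 ^ Suc b))) = 2 * (\<Sum>b<D. 2 ^ b * of_bool (odd (c div 2 div 2 ^ b)))" unfolding sum_distrib_left by (intro sum.cong refl) (simp add: div_mult2_eq)
 also have "(\<Sum>b<D. (2::nat) ^ b * of_bool (odd (c div 2 div 2 ^ b))) = c div 2" by (rule Suc.IH) (use Suc.prems in simp)
 also have "of_bool (odd c) + 2 * (c div 2) = c" by (cases "even c") (auto elim!: evenE oddE)
 finally show ?case .
qed simp

lemma sum_swap3: "(\<Sum>t\<in>T. \<Sum>i\<in>I. \<Sum>j\<in>J. g t i j) = (\<Sum>i\<in>I. \<Sum>j\<in>J. \<Sum>t\<in>T. g t i j)"
proof -
 have "(\<Sum>t\<in>T. \<Sum>i\<in>I. \<Sum>j\<in>J. g t i j) = (\<Sum>i\<in>I. \<Sum>t\<in>T. \<Sum>j\<in>J. g t i j)" by (rule sum.swap)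
 also have "... = (\<Sum>i\<in>I. \<Sum>j\<in>J. \<Sum>t\<in>T. g t i j)" by (intro sum.cong refl sum.swap)
 finally show ?thesis .
qed

text \<open>Both multiplicities are expanded in binary; the counts of single-bit graphs, weighted by
  \<open>2 ^ b * 2 ^ b'\<close>, recombine to the product of multiplicities.\<close>

lemma sum_two_bits:
 fixes c d :: "nat => nat"
 assumes "!!u. c u < 2 ^ D" "!!u. d u < 2 ^ D"
 shows "(\<Sum>b<D. \<Sum>b'<D. 2 ^ b * 2 ^ b' * (\<Sum>u<U. of_bool (odd (c u div 2 ^ b)) * of_bool (odd (d u div 2 ^ b')))) =
	(\<Sum>u<U. c u * d u)"
proof -
 have "(\<Sum>u<U. c u * d u) = (\<Sum>u<U. (\<Sum>b<D. 2 ^ b * of_bool (odd (c u div 2 ^ b))) * (\<Sum>b'<D. 2 ^ b' * of_bool (odd (d u div 2 ^ b'))))" using sum_bits assms by simp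
 also have "... = (\<Sum>u<U. \<Sum>b<D. \<Sum>b'<D. (2 ^ b * of_bool (odd (c u div 2 ^ b))) * (2 ^ b' * of_bool (odd (d u div 2 ^ b'))))" by (simp only: sum_product)
 also have "... = (\<Sum>b<D. \<Sum>b'<D. \<Sum>u<U. (2 ^ b * of_bool (odd (c u div 2 ^ b))) * (2 ^ b' * of_bool (odd (d u div 2 ^ b'))))" by (rule sum_swap3)
 also have "... = (\<Sum>b<D. \<Sum>b'<D. 2 ^ b * 2 ^ b' * (\<Sum>u<U. of_bool (odd (c u div 2 ^ b)) * of_bool (odd (d u div 2 ^ b'))))" unfolding sum_distrib_left by (intro sum.cong refl) (simp only: ac_simps)
 finally show ?thesis ..
qed

text \<open>Summing products of multiplicities over the middle vertex \<open>u\<close> is a join: it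
  counts the pairs with the same \<open>u\<close>.\<close>

lemma sum_join:
 fixes p q f g :: "nat => nat"
 assumes "!!i. i < N ==> f i < U"
 shows "(\<Sum>u<U. (\<Sum>i<N. p i * of_bool (f i = u)) * (\<Sum>j<M. q j * of_bool (g j = u))) =
	(\<Sum>i<N. \<Sum>j<M. p i * q j * of_bool (f i = g j))"
proof -
 have "(\<Sum>u<U. (\<Sum>i<N. p i * of_bool (f i = u)) * (\<Sum>j<M. q j * of_bool (g j = u))) =
	 (\<Sum>i<N. \<Sum>j<M. \<Sum>u<U. (p i * of_bool (f i = u)) * (q j * of_bool (g j = u)))" unfolding sum_product by (rule sum_swap3)
 also have "... = (\<Sum>i<N. \<Sum>j<M. p i * q j * of_bool (f i = g j))"
 proof (intro sum.cong refl)
	fix i j assume "i : {..<N}"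
	hence fU: "f i < U" using assms by simp
	have "(\<Sum>u<U. (p i * of_bool (f i = u)) * (q j * of_bool (g j = u))) = (\<Sum>u<U. if f i = u then p i * q j * of_bool (f i = g j) else 0)" by (intro sum.cong refl) auto
	also have "... = p i * q j * of_bool (f i = g j)" using fU by (simp add: sum.delta)
	finally show "(\<Sum>u<U. (p i * of_bool (f i = u)) * (q j * of_bool (g j = u))) = p i * q j * of_bool (f i = g j)" .
 qed
 finally show ?thesis .
qed

lemma sum_classes:
 fixes p c :: "nat => nat"
 assumes "!!i. i < N ==> c i < D"
 shows "(\<Sum>a<D. \<Sum>i<N. of_bool (c i = a) * p i) = (\<Sum>i<N. p i)"
proof -
 have "(\<Sum>a<D. \<Sum>i<N. of_bool (c i = a) * p i) = (\<Sum>i<N. \<Sum>a<D. of_bool (c i = a) * p i)" by (rule sum.swap)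
 also have "... = (\<Sum>i<N. p i)"
 proof (intro sum.cong refl)
	fix i assume "i : {..<N}"
	hence "c i < D" using assms by simp
	moreover have "(\<Sum>a<D. of_bool (c i = a) * p i) = (\<Sum>a<D. if c i = a then p i else 0)" by (intro sum.cong refl) auto
	ultimately show "(\<Sum>a<D. of_bool (c i = a) * p i) = p i" by (simp add: sum.delta)
 qed
 finally show ?thesis .
qed

lemma sum_separate:
 fixes P Q :: "nat => nat => nat"
 shows "(\<Sum>k\<in>K. \<Sum>s\<in>S. \<Sum>t\<in>T. \<Sum>i\<in>I. \<Sum>j\<in>J. P s i * Q t j * R k i j) =
	(\<Sum>i\<in>I. \<Sum>j\<in>J. (\<Sum>s\<in>S. P s i) * (\<Sum>t\<in>T. Q t j) * (\<Sum>k\<in>K. R k i j))"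
proof -
 have 1: "(\<Sum>t\<in>T. \<Sum>i\<in>I. \<Sum>j\<in>J. P s i * Q t j * R k i j) = (\<Sum>i\<in>I. \<Sum>j\<in>J. P s i * (\<Sum>t\<in>T. Q t j) * R k i j)" for k s by (subst sum_swap3) (simp only: sum_distrib_left sum_distrib_right)
 have 2: "(\<Sum>s\<in>S. \<Sum>i\<in>I. \<Sum>j\<in>J. P s i * (\<Sum>t\<in>T. Q t j) * R k i j) = (\<Sum>i\<in>I. \<Sum>j\<in>J. (\<Sum>s\<in>S. P s i) * (\<Sum>t\<in>T. Q t j) * R k i j)" for k
	by (subst sum_swap3) (simp only: sum_distrib_right)
 have 3: "(\<Sum>k\<in>K. \<Sum>i\<in>I. \<Sum>j\<in>J. (\<Sum>s\<in>S. P s i) * (\<Sum>t\<in>T. Q t j) * R k i j) =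
	(\<Sum>i\<in>I. \<Sum>j\<in>J. (\<Sum>s\<in>S. P s i) * (\<Sum>t\<in>T. Q t j) * (\<Sum>k\<in>K. R k i j))" by (subst sum_swap3) (simp only: sum_distrib_left)
 show ?thesis unfolding 1 2 3 ..
qed

text \<open>
 The task of a run is given by the digits: the levels at which values, left indices and right
 indices are compared, the chunks of the queries and of the array that are dealt with, and the
 bits of the multiplicities of the two kinds of edges.
\<close>

definition task1 :: "nat => nat list => nat => bool" where
 "task1 h ds i \<longleftrightarrow> i div h = ds ! 4 & even (i div pow2 (ds ! 1))"

definition task2 :: "(nat => nat) => nat => nat list => nat => bool" where
 "task2 vl h ds i \<longleftrightarrow> i div h = ds ! 5 & even (i div pow2 (ds ! 2)) & even (vl i div pow2 (ds ! 0))"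

text \<open>The triangles on the edge for the prefixes of lengths \<open>x\<close> and
  \<open>y\<close> in one call. Left indices come from the block that is the left sibling of the one
  containing \<open>x\<close>, right indices likewise for \<open>y\<close>, and \<open>u\<close> is
  a value block in which the left entry lies and whose left sibling contains the right one.\<close>

definition common :: "(nat => nat) => nat => nat => nat => nat list => nat => nat => nat" where
 "common vl N U h ds x y =
	(\<Sum>u<U. of_bool (odd ((\<Sum>i<N. of_bool (task1 h ds i & i div pow2 (ds ! 1) + 1 = x div pow2 (ds ! 1) &
				vl i div pow2 (ds ! 0) = u)) div pow2 (ds ! 6))) *
			of_bool (odd ((\<Sum>i<N. of_bool (task2 vl h ds i & i div pow2 (ds ! 2) + 1 = y div pow2 (ds ! 2) &
				vl i div pow2 (ds ! 0) + 1 = u)) div pow2 (ds ! 7))))"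

text \<open>By \<open>less_levels\<close>, each of the conditions \<open>i < x\<close>,
  \<open>j < y\<close> and \<open>vl j < vl i\<close> is a sum over levels. Bits recombine by
  \<open>sum_two_bits\<close>, chunks of the array by \<open>sum_classes\<close>, and the three sums
  over levels then separate.\<close>

lemma sum_common:
 assumes N: "N < 2 ^ D" "!!i. i < N ==> vl i < N" "N <= U" and xy: "x <= N" "y <= N"
	and h: "!!i. i < N ==> i div h < D" and c: "c < D"
 shows "digit_sum D 8 (%ds. of_bool (c = ds ! 3) * (pow2 (ds ! 6) * pow2 (ds ! 7) * common vl N U h ds x y)) =
	(\<Sum>i<x. \<Sum>j<y. of_bool (vl j < vl i))"
proof -
 let ?P = "%s i. of_bool (even (i div 2 ^ s) & x div 2 ^ s = Suc (i div 2 ^ s)) :: nat"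
 let ?Q = "%t j. of_bool (even (j div 2 ^ t) & y div 2 ^ t = Suc (j div 2 ^ t)) :: nat"
 let ?E = "%k j. of_bool (even (vl j div 2 ^ k)) :: nat"
 let ?R = "%k i j. of_bool (even (vl j div 2 ^ k) & vl i div 2 ^ k = Suc (vl j div 2 ^ k)) :: nat"
 define T1 where "T1 = (%k s a u. \<Sum>i<N. of_bool (i div h = a) * (?P s i * of_bool (vl i div 2 ^ k = u)))"
 define T2 where "T2 = (%k t b u. \<Sum>i<N. of_bool (i div h = b) * (?Q t i * ?E k i * of_bool (Suc (vl i div 2 ^ k) = u)))"
 have T: "T1 k s a u < 2 ^ D" "T2 k t b u < 2 ^ D" for k s a u t b
 proof -
	have "T1 k s a u <= (\<Sum>i<N. 1)" "T2 k t b u <= (\<Sum>i<N. 1)" unfolding T1_def T2_def by (intro sum_mono; simp)+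
	thus "T1 k s a u < 2 ^ D" "T2 k t b u < 2 ^ D" using N(1) by simp_all
 qed
 have cm: "common vl N U h [k, s, t, d, a, b, e, f] x y =
	 (\<Sum>u<U. of_bool (odd (T1 k s a u div 2 ^ e)) * of_bool (odd (T2 k t b u div 2 ^ f)))" for k s t d a b e f
 proof -
	have "(\<Sum>i<N. of_bool (task1 h [k, s, t, d, a, b, e, f] i & i div pow2 s + 1 = x div pow2 s & vl i div pow2 k = u)) = T1 k s a u" for u unfolding T1_def task1_def pow2_def by (intro sum.cong refl) auto
	moreover have "(\<Sum>i<N. of_bool (task2 vl h [k, s, t, d, a, b, e, f] i & i div pow2 t + 1 = y div pow2 t & vl i div pow2 k + 1 = u)) = T2 k t b u" for u unfolding T2_def task2_def pow2_def by (intro sum.cong refl) auto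
	ultimately show ?thesis unfolding common_def by (simp add: pow2_def)
 qed
 have join: "(\<Sum>a<D. \<Sum>b<D. \<Sum>u<U. T1 k s a u * T2 k t b u) = (\<Sum>i<N. \<Sum>j<N. ?P s i * ?Q t j * ?R k i j)" for k s t
 proof -
	have "(\<Sum>a<D. \<Sum>b<D. \<Sum>u<U. T1 k s a u * T2 k t b u) = (\<Sum>u<U. \<Sum>a<D. \<Sum>b<D. T1 k s a u * T2 k t b u)" by (rule sum_swap3[symmetric])
	also have "... = (\<Sum>u<U. (\<Sum>a<D. T1 k s a u) * (\<Sum>b<D. T2 k t b u))" by (simp only: sum_product)
	also have "... = (\<Sum>u<U. (\<Sum>i<N. ?P s i * of_bool (vl i div 2 ^ k = u)) * (\<Sum>j<N. ?Q t j * ?E k j * of_bool (Suc (vl j div 2 ^ k) = u)))" unfolding T1_def T2_def by (simp only: sum_classes[of N "%i. i div h" D, OF h])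
	also have "... = (\<Sum>i<N. \<Sum>j<N. ?P s i * (?Q t j * ?E k j) * of_bool (vl i div 2 ^ k = Suc (vl j div 2 ^ k)))"
	proof (rule sum_join)
	 fix i assume "i < N"
	 have "vl i div 2 ^ k <= vl i" by simp
	 thus "vl i div 2 ^ k < U" using N(2)[OF \<open>i < N\<close>] N(3) by linarith
	qed
	also have "... = (\<Sum>i<N. \<Sum>j<N. ?P s i * ?Q t j * ?R k i j)" by (intro sum.cong refl) (simp add: of_bool_conj)
	finally show ?thesis .
 qed
 have "digit_sum D 8 (%ds. of_bool (c = ds ! 3) * (pow2 (ds ! 6) * pow2 (ds ! 7) * common vl N U h ds x y)) =
	(\<Sum>k<D. \<Sum>s<D. \<Sum>t<D. \<Sum>d<D. \<Sum>a<D. \<Sum>b<D. \<Sum>e<D. \<Sum>f<D. of_bool (c = d) *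
	 (2 ^ e * 2 ^ f * (\<Sum>u<U. of_bool (odd (T1 k s a u div 2 ^ e)) * of_bool (odd (T2 k t b u div 2 ^ f)))))" unfolding digit_sum_8 cm by (simp add: pow2_def)
 also have "... = (\<Sum>k<D. \<Sum>s<D. \<Sum>t<D. \<Sum>d<D. of_bool (c = d) * (\<Sum>a<D. \<Sum>b<D. \<Sum>u<U. T1 k s a u * T2 k t b u))" unfolding sum_distrib_left[symmetric] sum_two_bits[OF T] ..
 also have "... = (\<Sum>k<D. \<Sum>s<D. \<Sum>t<D. \<Sum>a<D. \<Sum>b<D. \<Sum>u<U. T1 k s a u * T2 k t b u)"
 proof -
	have "(\<Sum>d<D. of_bool (c = d) * X) = X" for X :: nat
	proof -
	 have "(\<Sum>d<D. of_bool (c = d) * X) = (\<Sum>d<D. if c = d then X else 0)" by (intro sum.cong refl) auto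
	 thus ?thesis using c by (simp add: sum.delta)
	qed
	thus ?thesis by (simp only:)
 qed
 also have "... = (\<Sum>i<N. \<Sum>j<N. (\<Sum>s<D. ?P s i) * (\<Sum>t<D. ?Q t j) * (\<Sum>k<D. ?R k i j))" unfolding join by (rule sum_separate)
 also have "... = (\<Sum>i<N. \<Sum>j<N. of_bool (i < x) * of_bool (j < y) * of_bool (vl j < vl i))"
 proof (intro sum.cong refl)
	fix i j assume ij: "i : {..<N}" "j : {..<N}"
	have l: "x < 2 ^ D" "y < 2 ^ D" "vl i < 2 ^ D" using xy N ij by (auto intro: le_less_trans less_trans)
	show "(\<Sum>s<D. ?P s i) * (\<Sum>t<D. ?Q t j) * (\<Sum>k<D. ?R k i j) = of_bool (i < x) * of_bool (j < y) * of_bool (vl j < vl i)" by (simp only: less_levels[OF l(1)] less_levels[OF l(2)] less_levels[OF l(3)])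
 qed
 also have "... = (\<Sum>i<x. \<Sum>j<N. of_bool (i < x) * of_bool (j < y) * of_bool (vl j < vl i))" by (rule sum.mono_neutral_right) (use xy in auto)
 also have "... = (\<Sum>i<x. \<Sum>j<y. of_bool (vl j < vl i))" by (rule sum.cong[OF refl], rule sum.mono_neutral_cong_right) (use xy in auto)
 finally show ?thesis .
qed

lemma inclusion_exclusion:
 fixes g :: "nat => nat => nat"
 assumes "a <= b" "c <= d"
 shows "across g a b c d + ((\<Sum>i<a. \<Sum>j<d. g i j) + (\<Sum>i<b. \<Sum>j<c. g i j)) = (\<Sum>i<b. \<Sum>j<d. g i j) + (\<Sum>i<a. \<Sum>j<c. g i j)"
proof -
 have s: "(\<Sum>i<b. f i) = (\<Sum>i<a. f i) + (\<Sum>i\<in>{a..<b}. f i)" "(\<Sum>i<d. f i) = (\<Sum>i<c. f i) + (\<Sum>i\<in>{c..<d}. f i)" for f :: "nat => nat"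
	using assms by (simp_all add: sum.atLeastLessThan_concat lessThan_atLeast0)
 show ?thesis unfolding across_def by (simp add: s sum.distrib)
qed

text \<open>Inclusion-exclusion over the corners of a rectangle of index pairs, with 0-based prefix
  lengths. The negative corners stand on the left because all values are naturals.\<close>

lemma pairs2_rank:
 assumes q: "valid2 (length A) q"
 shows "pairs2 (>) A q + ((\<Sum>i<q ! 0 - 1. \<Sum>j<q ! 3. of_bool (rank A j < rank A i)) + (\<Sum>i<q ! 1. \<Sum>j<q ! 2 - 1. of_bool (rank A j < rank A i))) =
	(\<Sum>i<q ! 1. \<Sum>j<q ! 3. of_bool (rank A j < rank A i)) + (\<Sum>i<q ! 0 - 1. \<Sum>j<q ! 2 - 1. of_bool (rank A j < rank A i))"
proof -
 let ?g = "%i j. of_bool (rank A j < rank A i) :: nat"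
 have v: "1 <= q ! 0" "q ! 0 <= q ! 1" "q ! 1 < q ! 2" "q ! 2 <= q ! 3" "q ! 3 <= length A" using q by (auto simp: valid2_def)
 have sh: "(\<Sum>i\<in>{Suc a..<Suc b}. f i) = (\<Sum>i\<in>{a..<b}. f (Suc i))" for a b and f :: "nat => nat" by (rule sum.shift_bounds_Suc_ivl)
 have S: "q ! 0 = Suc (q ! 0 - 1)" "q ! 2 = Suc (q ! 2 - 1)" using v by linarith+
 have "pairs2 (>) A q = across (rel (>) (%i. A ! i)) (Suc (q ! 0 - 1)) (Suc (q ! 1)) (Suc (q ! 2 - 1)) (Suc (q ! 3))" unfolding pairs2_across using S by metis
 also have "... = across ?g (q ! 0 - 1) (q ! 1) (q ! 2 - 1) (q ! 3)" unfolding across_def sh rel_def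
 proof (intro sum.cong refl)
	fix i j assume "i : {q ! 0 - 1..<q ! 1}" "j : {q ! 2 - 1..<q ! 3}"
	hence "i < length A" "j < length A" using v by auto
	from rank_less_iff[OF this(2,1)] show "of_bool (A ! (Suc i - 1) > A ! (Suc j - 1)) = ?g i j" by simp
 qed
 finally show ?thesis using inclusion_exclusion[of "q ! 0 - 1" "q ! 1" "q ! 2 - 1" "q ! 3" ?g] v by simp
qed

section \<open>Programs for the tasks\<close>

definition t_params :: "nat => cmd" where
 "t_params C =
	Asg 7 (Get (Num 0) (Num 1)) ;; Asg 8 (Get (Num 0) (Num 0)) ;; Asg 9 (Var 3 [div] Num 4) ;;
	Asg 10 (Var 4 [+] Num C) ;;
	Asg 6 (Num 4 [*] Var 10 [*] Var 10 [*] Var 10 [*] Var 10 [*] Var 10 [*] Var 10 [*] Var 10 [*] Var 10) ;;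
	Asg 17 (Num 1 [<<] Var 4)"

text \<open>The call number modulo 4 selects the corner. The digits of the quotient in base
  \<open>D\<close>, lowest first, go to variables 21, 22, 23, 26, 27, 28, 24, 25. Each call owns
  eight rows from \<open>8 * r + 32\<close> on, where \<open>r\<close> is its number; rows below 32
  are shared.\<close>

definition t_decode :: cmd where
 "t_decode =
	Asg 2 (Num 8 [*] Var 5 [+] Num 32) ;;
	Asg 20 (Var 5 [mod] Num 4) ;; Asg 12 (Var 5 [div] Num 4) ;;
	Asg 21 (Var 12 [mod] Var 10) ;; Asg 12 (Var 12 [div] Var 10) ;;
	Asg 22 (Var 12 [mod] Var 10) ;; Asg 12 (Var 12 [div] Var 10) ;;
	Asg 23 (Var 12 [mod] Var 10) ;; Asg 12 (Var 12 [div] Var 10) ;;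
	Asg 26 (Var 12 [mod] Var 10) ;; Asg 12 (Var 12 [div] Var 10) ;;
	Asg 27 (Var 12 [mod] Var 10) ;; Asg 12 (Var 12 [div] Var 10) ;;
	Asg 28 (Var 12 [mod] Var 10) ;; Asg 12 (Var 12 [div] Var 10) ;;
	Asg 24 (Var 12 [mod] Var 10) ;; Asg 12 (Var 12 [div] Var 10) ;;
	Asg 25 (Var 12 [mod] Var 10)"

text \<open>\<open>QC 4 k\<close> with the loop variable 11 in place of variable 12 as the number of
  the query.\<close>

definition QL :: "nat => aexp" where
 "QL k = Get (Num 0) (Num (2 + k) [+] Var 8 [+] Num 4 [*] Var 11)"

definition pk_exp :: "aexp => aexp => aexp" where
 "pk_exp p q = p [*] W_exp [+] q"

definition t_gq :: aexp where
 "t_gq = (Var 11 [div] Var 9 [=] Var 26)"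

definition t_x :: aexp where
 "t_x = Cnd (Var 20 [<] Num 2) (QL 1) (QL 0 [-] Num 1)"

definition t_y :: aexp where
 "t_y = Cnd (Var 20 [mod] Num 2) (QL 2 [-] Num 1) (QL 3)"

definition t_kq :: aexp where
 "t_kq = pk_exp (Num 3 [*] (t_x [>>] Var 22)) (Num 3 [*] (t_y [>>] Var 23) [+] Num 1)"

definition t_g1 :: aexp where
 "t_g1 = Cnd (Var 11 [div] Var 9 [=] Var 27) ((Var 11 [>>] Var 22) [mod] Num 2 [=] Num 0) (Num 0)"

text \<open>The index end names the right sibling of the block of the entry, since this is the block
  that a prefix ending there looks up. In \<open>t_k2\<close> the value block is shifted in the same
  way, because its entry is the smaller one of the pair.\<close>

definition t_k1 :: aexp where
 "t_k1 = pk_exp (Num 3 [*] (Var 11 [>>] Var 22 [+] Num 1)) (Num 3 [*] (Get (Num 1) (Var 11) [>>] Var 21) [+] Num 2)"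

definition t_g2 :: aexp where
 "t_g2 = Cnd (Var 11 [div] Var 9 [=] Var 28)
	(Cnd ((Var 11 [>>] Var 23) [mod] Num 2) (Num 0) ((Get (Num 1) (Var 11) [>>] Var 21) [mod] Num 2 [=] Num 0)) (Num 0)"

definition t_k2 :: aexp where
 "t_k2 = pk_exp (Num 3 [*] (Var 11 [>>] Var 23 [+] Num 1) [+] Num 1) (Num 3 [*] (Get (Num 1) (Var 11) [>>] Var 21 [+] Num 1) [+] Num 2)"

text \<open>Corners 0 and 3 count positively and are collected in row 7, corners 1 and 2 negatively
  in row 16. Two rows avoid signed accumulators.\<close>

definition t_sign :: aexp where
 "t_sign = Cnd (Var 20 [mod] Num 3) (Num 16) (Num 7)"

text \<open>An answer has the weight of the two bits of its call, \<open>2 ^ b1 * 2 ^ b2\<close>.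
  Its position is one less than the number stored under the key of the query edge.\<close>

definition t_collect :: "aexp => aexp => cmd" where
 "t_collect g e = For 11 7 (Ite g (Asg 13 e ;; Asg 12 t_sign ;;
	Put (Var 12) (Var 11) (Get (Var 12) (Var 11) [+] (Num 1 [<<] Var 24 [<<] Var 25) [*]
	 Get (Var 2) (Get (Var 2 [+] Num 4) (Var 13) [-] Num 1))) Nop)"

definition t_final :: cmd where
 "t_final = For 11 7 (Put (Num 0) (Var 11) (Get (Num 7) (Var 11) [-] Get (Num 16) (Var 11)))"

definition t_build :: cmd where
 "t_build = t_decode ;; build t_gq t_kq t_g1 t_k1 t_g2 t_k2"

lemma wf_t: "wf_cmd {0, 1, 3, 4} (t_params C)" "wf_cmd q_vars t_build" "wf_cmd q_vars (t_collect t_gq t_kq)" "wf_cmd q_vars t_final"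
 "5 ~: assigned t_build" "5 ~: assigned (t_collect t_gq t_kq)" "q_vars <= {0, 1, 3, 4} \<union> assigned (t_params C)"
 by (auto simp: t_params_def t_build_def t_decode_def build_def tally_def emit_def relabel_step_def t_collect_def t_final_def q_vars_def)

lemma run_t_params:
 assumes inp: "2 <= length inp" "inp ! 0 < pow2 w" "inp ! 1 < pow2 w"
	and b: "n < pow2 w" "4 * (lg n + C) ^ 8 < pow2 w" "0 < C" "pow2 (lg n) < pow2 w" "1 < pow2 z" "4 < pow2 w"
 shows "run w z (t_params C) (start z n inp) =
	(|va = (%_. 0)(0 := z, 1 := 2 ^ z - 1, 3 := n, 4 := lg n, 7 := inp ! 1, 8 := inp ! 0, 9 := n div 4,
	 10 := lg n + C, 6 := 4 * (lg n + C) ^ 8, 17 := pow2 (lg n)),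
	ar = start_ar inp|)"
proof -
 let ?D = "lg n + C"
 have le: "4 * ?D ^ i < pow2 w" if "i <= 8" for i
 proof -
	have "?D ^ i <= ?D ^ 8" using that b by (intro power_increasing) auto
	with b(2) show ?thesis by linarith
 qed
 have D: "?D < pow2 w" "lg n < pow2 w" "C < pow2 w" using le[of 1] by auto
 define s where "s = (|va = (%_. 0)(0 := z, 1 := 2 ^ z - 1, 3 := n, 4 := lg n, 7 := inp ! 1, 8 := inp ! 0, 9 := n div 4,
	 10 := lg n + C), ar = start_ar inp|)"
 have "inp ~= []" using inp by auto
 hence s: "run w z (Asg 7 (Get (Num 0) (Num 1)) ;; Asg 8 (Get (Num 0) (Num 0)) ;; Asg 9 (Var 3 [div] Num 4) ;;
	 Asg 10 (Var 4 [+] Num C)) (start z n inp) = s" using inp b D unfolding s_def by (simp add: ev start_def start_ar_def set_va_def)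
 have m: "eval w z s (e [*] Var 10) = 4 * ?D ^ Suc i" if "eval w z s e = 4 * ?D ^ i" "Suc i <= 8" for e i using le[OF that(2)] D that(1) by (subst ev_Mul) (simp_all add: ev_Var s_def mult_ac)
 have "eval w z s (Num 4) = 4 * ?D ^ 0" using b by (simp add: ev_Num)
 from m[OF m[OF m[OF m[OF m[OF m[OF m[OF m[OF this]]]]]]]]
 have e6: "eval w z s (Num 4 [*] Var 10 [*] Var 10 [*] Var 10 [*] Var 10 [*] Var 10 [*] Var 10 [*] Var 10 [*] Var 10) = 4 * ?D ^ 8" by (simp add: eval_nat_numeral)
 have "run w z (t_params C) (start z n inp) = run w z (Asg 17 (Num 1 [<<] Var 4)) (set_va 6 (4 * ?D ^ 8) s)" unfolding t_params_def using s e6 by simp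
 also have "... = set_va 17 (pow2 (lg n)) (set_va 6 (4 * ?D ^ 8) s)" using b D by (simp add: ev s_def)
 finally show ?thesis by (simp add: s_def set_va_def)
qed

lemma run_t_decode:
 assumes "va s 5 = r" "va s 10 = D" "8 * r + 32 < pow2 w" "D < pow2 w" "ds = digits D 8 (r div 4)" and s': "s' = run w z t_decode s"
 shows "ar s' = ar s & (ALL y. y ~: {2, 12, 20, 21, 22, 23, 24, 25, 26, 27, 28} --> va s' y = va s y) & va s' 2 = 8 * r + 32 &
	va s' 20 = r mod 4 & va s' 21 = ds ! 0 & va s' 22 = ds ! 1 & va s' 23 = ds ! 2 & va s' 26 = ds ! 3 & va s' 27 = ds ! 4 &
	va s' 28 = ds ! 5 & va s' 24 = ds ! 6 & va s' 25 = ds ! 7"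
proof -
 have r: "r < pow2 w" "8 < pow2 w" "4 < pow2 w" "32 < pow2 w" "8 * r < pow2 w" using assms(3) by linarith+
 have lt: "x div k < pow2 w" "x mod k < pow2 w" if "x < pow2 w" for x k using le_less_trans[OF div_le_dividend that] le_less_trans[OF mod_less_eq_dividend that] by blast+
 have step: "run w z (Asg x (Var 12 [mod] Var 10) ;; Asg 12 (Var 12 [div] Var 10) ;; c) t =
	 run w z c (set_va 12 (y div D) (set_va x (y mod D) t))"
	if "va t 12 = y" "va t 10 = D" "y < pow2 w" "x ~= 10" "x ~= 12" for t :: ast and x y c using that assms(4) by (simp add: ev)
 define q0 where "q0 = r div 4"
 define q1 where "q1 = q0 div D"
 define q2 where "q2 = q1 div D"
 define q3 where "q3 = q2 div D"
 define q4 where "q4 = q3 div D"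
 define q5 where "q5 = q4 div D"
 define q6 where "q6 = q5 div D"
 define q7 where "q7 = q6 div D"
 have q: "q0 < pow2 w" "q1 < pow2 w" "q2 < pow2 w" "q3 < pow2 w" "q4 < pow2 w" "q5 < pow2 w" "q6 < pow2 w" "q7 < pow2 w" unfolding q7_def q6_def q5_def q4_def q3_def q2_def q1_def q0_def by (intro lt r)+
 note fold = q1_def[symmetric] q2_def[symmetric] q3_def[symmetric] q4_def[symmetric] q5_def[symmetric] q6_def[symmetric] q7_def[symmetric]
 define s1 where "s1 = set_va 12 q0 (set_va 20 (r mod 4) (set_va 2 (8 * r + 32) s))"
 have v1: "va s1 12 = q0" "va s1 10 = D" using assms(2) by (simp_all add: s1_def)
 have 1: "run w z (Asg 2 (Num 8 [*] Var 5 [+] Num 32) ;; Asg 20 (Var 5 [mod] Num 4) ;; Asg 12 (Var 5 [div] Num 4) ;; c) s = run w z c s1" for c using assms(1-3) r by (simp add: ev s1_def q0_def)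
 have last: "run w z (Asg 25 (Var 12 [mod] Var 10)) t = set_va 25 (q7 mod D) t" if "va t 12 = q7" "va t 10 = D" for t using that q assms(4) by (simp add: ev)
 have "s' = set_va 25 (q7 mod D) (set_va 12 q7 (set_va 24 (q6 mod D) (set_va 12 q6 (set_va 28 (q5 mod D) (set_va 12 q5
	 (set_va 27 (q4 mod D) (set_va 12 q4 (set_va 26 (q3 mod D) (set_va 12 q3 (set_va 23 (q2 mod D) (set_va 12 q2
	 (set_va 22 (q1 mod D) (set_va 12 q1 (set_va 21 (q0 mod D) s1))))))))))))))" unfolding s' t_decode_def 1 by (simp add: step[where y = q0] step[where y = q1] step[where y = q2] step[where y = q3] step[where y = q4]
		step[where y = q5] step[where y = q6] last q v1 fold del: run.simps)
 moreover have "digits D 8 q0 = [q0 mod D, q1 mod D, q2 mod D, q3 mod D, q4 mod D, q5 mod D, q6 mod D, q7 mod D]" unfolding digits_8 fold ..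
 ultimately show ?thesis unfolding assms(5) q0_def[symmetric] by (simp add: s1_def)
qed

lemma ev_pk:
 assumes "eval w z t p = P" "eval w z t q = Q" "P < 6 * n + 8" "Q < 6 * n + 8" "va t 3 = n"
	and b: "(6 * n + 8) * (6 * n + 8) <= pow2 w"
 shows "eval w z t (pk_exp p q) = pk n P Q"
proof -
 have W: "6 * n + 8 < pow2 w"
 proof -
	have "(6 * n + 8) * 1 < (6 * n + 8) * (6 * n + 8)" by (rule mult_strict_left_mono) simp_all
	with b show ?thesis by (metis less_le_trans mult.right_neutral)
 qed
 hence "n < pow2 w" "8 < pow2 w" "6 < pow2 w" "6 * n < pow2 w" by linarith+
 hence We: "eval w z t W_exp = 6 * n + 8" using W assms(5) by (simp add: W_exp_def ev)
 have "pk n P Q < pow2 w" using pk_lt[OF assms(3,4)] b by (rule less_le_trans)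
 hence s: "P * (6 * n + 8) + Q < pow2 w" by (simp only: pk_def)
 hence m: "eval w z t (p [*] W_exp) = P * (6 * n + 8)" using assms(1) We add_lessD1[OF s] by (subst ev_Mul) (simp_all only:)
 show ?thesis unfolding pk_exp_def pk_def using s m assms(2) by (subst ev_Add) (simp_all only:)
qed

text \<open>With \<open>lim_y\<close>, the corners 0 to 3 are \<open>(r1, r2)\<close>,
  \<open>(r1, l2 - 1)\<close>, \<open>(l1 - 1, r2)\<close> and \<open>(l1 - 1, l2 - 1)\<close>, read
  as lengths of prefixes.\<close>

definition lim_x :: "nat => nat list => nat" where
 "lim_x sg q = (if sg < 2 then q ! 1 else q ! 0 - 1)"

definition lim_y :: "nat => nat list => nat" where
 "lim_y sg q = (if odd sg then q ! 2 - 1 else q ! 3)"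

lemma ev_QL:
 assumes c: "compressed 4 w z n inp A qs s1" and bg: "q_background s1 s"
	and j: "va s 11 = j" "j < length qs" "k < 4" and lt: "qs ! j ! k <= n"
 shows "eval w z s (QL k) = qs ! j ! k"
proof -
 have "q_background s1 (set_va 12 j s)" using bg by (simp add: q_background_def q_vars_def)
 from ev_QC[OF c this _ j(2,3) lt] have "eval w z (set_va 12 j s) (QC 4 k) = qs ! j ! k" by simp
 moreover have "eval w z (set_va 12 j s) (QC 4 k) = eval w z s (QL k)" using j(1) by (simp add: QC_def QL_def eval.simps)
 ultimately show ?thesis by simp
qed

lemma run_t_collect:
 assumes v: "va s 7 = nq" "va s 2 = ro" "va s 24 = b1" "va s 25 = b2" "va s 20 = sg" "sg < 4"
	and bounds: "ro + 4 < pow2 z" "16 < ro" "pow2 z <= pow2 w" "nq < pow2 z" "pow2 b1 * pow2 b2 < pow2 w" "b1 < pow2 w" "b2 < pow2 w" "pow2 b1 < pow2 w"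
	and exps: "!!j t. j < nq ==> va t 11 = j ==> (ALL y. y ~: {11, 12, 13} --> va t y = va s y) ==> (ALL q. q ~: {7, 16} --> ar t q = ar s q) ==>
	 (eval w z t g ~= 0 \<longleftrightarrow> G j) & (G j --> eval w z t e = k j)"
	and k: "!!j. j < nq ==> G j ==> k j < pow2 z & ar s (ro + 4) (k j) = p j + 1 & p j + 1 < pow2 z & ar s ro (p j) = y j & y j < pow2 w"
	and sums: "!!j. j < nq ==> G j ==> ar s R j + pow2 b1 * pow2 b2 * y j < pow2 w"
	and R: "R = (if sg mod 3 = 0 then 7 else 16)"
	and s': "s' = run w z (t_collect g e) s"
 shows "(ALL y. y ~: {11, 12, 13} --> va s' y = va s y) & (ALL q. q ~= R --> ar s' q = ar s q) &
	(ALL j<nq. ar s' R j = ar s R j + of_bool (G j) * (pow2 b1 * pow2 b2 * y j))"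
proof -
 let ?c1 = "Asg 13 e ;; Asg 12 t_sign ;;
	Put (Var 12) (Var 11) (Get (Var 12) (Var 11) [+] (Num 1 [<<] Var 24 [<<] Var 25) [*]
	 Get (Var 2) (Get (Var 2 [+] Num 4) (Var 13) [-] Num 1))"
 let ?c = "Ite g (?c1) Nop"
 let ?I = "%i t. (ALL y. y ~: {11, 12, 13} --> va t y = va s y) & (ALL q. q ~= R --> ar t q = ar s q) &
	(ALL j<nq. ar t R j = ar s R j + of_bool (j < i & G j) * (pow2 b1 * pow2 b2 * y j))"
 have R': "R = 7 | R = 16" unfolding R by simp
 have "EX t. ?I (va s 7) t & run w z (For 11 7 ?c) s = set_va 11 (va s 7) t"
 proof (rule run_For_inv)
	show "?I 0 s" by simp
 next
	fix i and t :: ast assume i: "i < va s 7" and I: "?I i t"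
	let ?t = "set_va 11 i t"
	have im: "i < nq" using i v by simp
	have ev0: "(eval w z ?t g ~= 0 \<longleftrightarrow> G i) & (G i --> eval w z ?t e = k i)" by (rule exps[OF im]) (use I R' in auto)
	show "?I (Suc i) (run w z ?c ?t)"
	proof (cases "G i")
	 case False
	 hence "run w z ?c ?t = ?t" using ev0 by simp
	 with I False show ?thesis by (auto simp: less_Suc_eq)
	next
	 case True
	 note ki = k[OF im True] and si = sums[OF im True]
	 let ?u = "set_va 12 R (set_va 13 (k i) ?t)"
	 have b: "ro < pow2 w" "ro + 4 < pow2 w" "4 < pow2 w" "ro < pow2 z" "R < pow2 z" "R < pow2 w" "16 < pow2 w" "7 < pow2 w" "3 < pow2 w" "2 < pow2 w" "1 < pow2 w"
		"i < pow2 z" "i < pow2 w" "k i < pow2 w" "p i + 1 < pow2 w" "p i < pow2 z" using bounds R' ki im by linarith+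
	 have sgn: "eval w z (set_va 13 (k i) ?t) t_sign = R" using I v b R by (simp add: t_sign_def ev)
	 have vu: "va ?u 2 = ro" "va ?u 13 = k i" "va ?u 12 = R" "va ?u 11 = i" "va ?u 24 = b1" "va ?u 25 = b2" using I v by simp_all
	 have au: "ar ?u (ro + 4) (k i) = p i + 1" "ar ?u ro (p i) = y i" "ar ?u R i = ar s R i" using I ki bounds(2) R' im by auto
	 have m: "eval w z ?u (Num 1 [<<] Var 24 [<<] Var 25) = pow2 b1 * pow2 b2" using vu b bounds by (simp add: ev)
	 have y: "eval w z ?u (Get (Var 2) (Get (Var 2 [+] Num 4) (Var 13) [-] Num 1)) = y i"
	 proof -
		have 1: "eval w z ?u (Var 2 [+] Num 4) = ro + 4" "eval w z ?u (Var 13) = k i" "eval w z ?u (Var 2) = ro" "eval w z ?u (Num 1) = 1" using vu b by (simp_all add: ev)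
		hence "eval w z ?u (Get (Var 2 [+] Num 4) (Var 13)) = p i + 1" using au b ki bounds by (subst ev_Get) (simp_all only:)
		hence "eval w z ?u (Get (Var 2 [+] Num 4) (Var 13) [-] Num 1) = p i" using 1 by (subst ev_Sub) simp_all
		thus ?thesis using 1 au b ki by (subst ev_Get) (simp_all only:)
	 qed
	 have my: "eval w z ?u ((Num 1 [<<] Var 24 [<<] Var 25) [*] Get (Var 2) (Get (Var 2 [+] Num 4) (Var 13) [-] Num 1)) = pow2 b1 * pow2 b2 * y i"
	 proof -
		have "pow2 b1 * pow2 b2 * y i < pow2 w" using si by linarith
		thus ?thesis by (subst ev_Mul) (simp_all only: m y)
	 qed
	 have old: "eval w z ?u (Get (Var 12) (Var 11)) = ar s R i" using vu au b si by (simp add: ev)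
	 have val: "eval w z ?u (Get (Var 12) (Var 11) [+] (Num 1 [<<] Var 24 [<<] Var 25) [*]
		Get (Var 2) (Get (Var 2 [+] Num 4) (Var 13) [-] Num 1)) = ar s R i + pow2 b1 * pow2 b2 * y i" using my old si by (subst ev_Add) (simp_all only:)
	 have "run w z ?c ?t = set_ar R i (ar s R i + pow2 b1 * pow2 b2 * y i) ?u" using ev0 True sgn val vu b by (simp add: run_Put ev_Var)
	 thus ?thesis using I True im by (auto simp: less_Suc_eq)
	qed
 qed
 then obtain t where "?I nq t" "s' = set_va 11 nq t" unfolding s' t_collect_def using v by auto
 thus ?thesis by auto
qed

lemma run_t_final:
 assumes "va s 7 = nq" "nq <= pow2 z" "16 < pow2 z" "pow2 z <= pow2 w"
	"!!j. j < nq ==> ar s 7 j < pow2 w & ar s 16 j <= ar s 7 j"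
 shows "ALL j<nq. ar (run w z t_final s) 0 j = ar s 7 j - ar s 16 j"
proof -
 have "run w z t_final s = set_va 11 nq (fill 0 0 nq (%j. ar s 7 j - ar s 16 j) s)" unfolding t_final_def
 proof (rule run_fill)
	fix i and t :: ast assume i: "i < nq" "va t 11 = i" "ALL q. q ~= 0 --> ar t q = ar s q"
	have b: "i < pow2 z" "i < pow2 w" "7 < pow2 w" "16 < pow2 w" "7 < pow2 z" "ar s 7 i < pow2 w" "ar s 16 i < pow2 w" "0 < pow2 w" using assms(2-5) i(1) assms(5)[OF i(1)] by linarith+
	show "eval w z t (Num 0) = 0 & eval w z t (Var 11) = 0 + i &
		eval w z t (Get (Num 7) (Var 11) [-] Get (Num 16) (Var 11)) = ar s 7 i - ar s 16 i" using i assms(3) b assms(5)[OF i(1)] by (simp add: ev)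
 qed (use assms in auto)
 thus ?thesis by simp
qed

lemma digits_nth_less: "0 < D ==> i < m ==> digits D m r ! i < D"
proof (induction m arbitrary: i r)
 case (Suc m)
 thus ?case by (cases i) auto
qed simp

text \<open>Applied with \<open>h = n div 4\<close> to the queries and to the two families of data
  edges, so that all edges of a call fit into \<open>n\<close>.\<close>

lemma card_chunk:
 assumes "0 < (h::nat)" "!!i. i < m ==> P i ==> i div h = a"
 shows "card {i. i < m & P i} <= h"
proof -
 have "{i. i < m & P i} <= {a * h..<a * h + h}"
 proof
	fix i assume "i : {i. i < m & P i}"
	hence "i div h = a" using assms by simp
	hence "a * h <= i" "i < a * h + h" using div_times_less_eq_dividend[of i h] dividend_less_div_times[OF assms(1), of i] by auto
	thus "i : {a * h..<a * h + h}" by simp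
 qed
 from card_mono[OF _ this] show ?thesis by simp
qed

definition task_query :: "nat => nat list => nat => bool" where
 "task_query h ds j \<longleftrightarrow> j div h = ds ! 3"

definition contrib :: "int list => nat list list => nat => nat => nat => nat list => nat => nat" where
 "contrib A qs n h sg ds j = of_bool (task_query h ds j) * (pow2 (ds ! 6) * pow2 (ds ! 7) *
	common (rank A) (length A) (n + 2) h ds (lim_x sg (qs ! j)) (lim_y sg (qs ! j)))"

lemma lim_le:
 assumes "valid2 N q"
 shows "lim_x sg q <= N" "lim_y sg q <= N"
 using assms by (auto simp: valid2_def lim_x_def lim_y_def)

lemma ev_tasks:
 fixes t :: ast
 assumes c: "compressed 4 w z n inp A qs s1" and bg: "q_background s1 t" and val: "\<forall>q\<in>set qs. valid2 (length A) q"
	and W: "(6 * n + 8) * (6 * n + 8) <= pow2 z"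
	and v: "va t 9 = h" "va t 20 = sg" "va t 21 = ds ! 0" "va t 22 = ds ! 1" "va t 23 = ds ! 2"
	 "va t 26 = ds ! 3" "va t 27 = ds ! 4" "va t 28 = ds ! 5" "va t 11 = i"
	and lt: "h < pow2 w" "sg < 4" "ALL i<8. ds ! i < pow2 w"
 shows "i < length qs ==> (eval w z t t_gq ~= 0 \<longleftrightarrow> task_query h ds i) &
	 eval w z t t_kq = pk n (3 * (lim_x sg (qs ! i) div pow2 (ds ! 1))) (3 * (lim_y sg (qs ! i) div pow2 (ds ! 2)) + 1)"
	and "i < length A ==> (eval w z t t_g1 ~= 0 \<longleftrightarrow> task1 h ds i) &
	 eval w z t t_k1 = pk n (3 * (i div pow2 (ds ! 1) + 1)) (3 * (rank A i div pow2 (ds ! 0)) + 2)"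
	and "i < length A ==> (eval w z t t_g2 ~= 0 \<longleftrightarrow> task2 (rank A) h ds i) &
	 eval w z t t_k2 = pk n (3 * (i div pow2 (ds ! 2) + 1) + 1) (3 * (rank A i div pow2 (ds ! 0) + 1) + 2)"
proof -
 note b = compressed_bg[OF c bg]
 have W': "(6 * n + 8) * (6 * n + 8) <= pow2 w" using W b(14) by linarith
 have sm: "n < pow2 w" "n + 2 < pow2 w" "4 < pow2 w" "3 < pow2 w" "2 < pow2 w" "1 < pow2 w" "1 < pow2 z" "0 < pow2 w" "3 * n + 10 < pow2 w" "n < pow2 z" "length qs <= pow2 w" using b(11,13,14) by linarith+
 have dw: "ds ! 0 < pow2 w" "ds ! 1 < pow2 w" "ds ! 2 < pow2 w" "ds ! 3 < pow2 w" "ds ! 4 < pow2 w" "ds ! 5 < pow2 w" using lt(3) by simp_all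
 have vd: "eval w z t (Var 9) = h" "eval w z t (Var 20) = sg" "eval w z t (Var 21) = ds ! 0" "eval w z t (Var 22) = ds ! 1"
	"eval w z t (Var 23) = ds ! 2" "eval w z t (Var 26) = ds ! 3" "eval w z t (Var 27) = ds ! 4" "eval w z t (Var 28) = ds ! 5"
	"eval w z t (Num 1) = 1" "eval w z t (Num 2) = 2" "eval w z t (Num 3) = 3" "eval w z t (Num 0) = 0" using v dw lt sm by (simp_all add: ev)
 have tri: "eval w z t (Num 3 [*] e) = 3 * x" if "eval w z t e = x" "x <= n + 2" for e x
 proof -
	have "3 * x < pow2 w" using that sm by linarith
	thus ?thesis by (subst ev_Mul) (simp_all only: that(1) vd)
 qed
 have plus: "eval w z t (e [+] Num k) = x + k" if "eval w z t e = x" "x <= 3 * n + 6" "k <= 2" for e x k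
 proof -
	have k: "k < pow2 w" "x + k < pow2 w" using that sm by linarith+
	thus ?thesis using that(1) by (subst ev_Add) (simp_all only: ev_Num)
 qed
 have shr: "eval w z t (e [>>] Var y) = x div pow2 d & x div pow2 d <= x" if "eval w z t e = x" "eval w z t (Var y) = d" for e x y d using that by (simp add: ev_Shr)
 show "(eval w z t t_gq ~= 0 \<longleftrightarrow> task_query h ds i) &
	 eval w z t t_kq = pk n (3 * (lim_x sg (qs ! i) div pow2 (ds ! 1))) (3 * (lim_y sg (qs ! i) div pow2 (ds ! 2)) + 1)"
	if i: "i < length qs"
 proof -
	let ?q = "qs ! i"
	have vq: "valid2 (length A) ?q" using val i by simp
	hence q: "1 <= ?q ! 0" "?q ! 0 <= n" "?q ! 1 <= n" "1 <= ?q ! 2" "?q ! 2 <= n" "?q ! 3 <= n" using b(9) by (auto simp: valid2_def)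
	have iw: "eval w z t (Var 11) = i" using i sm v(9) by (simp add: ev_Var)
	have "?q ! k <= n" if "k < 4" for k
	proof -
	 have "k = 0 | k = 1 | k = 2 | k = 3" using that by linarith
	 thus ?thesis using q by auto
	qed
	hence QL: "eval w z t (QL k) = ?q ! k" if "k < 4" for k using ev_QL[OF c bg v(9) i that] that by simp
	have x: "eval w z t t_x = lim_x sg ?q" unfolding t_x_def lim_x_def using QL q vd sm by (simp add: eval.simps(5) ev_Less ev_Sub ev_Num)
	have y: "eval w z t t_y = lim_y sg ?q" unfolding t_y_def lim_y_def using QL q vd sm by (simp add: eval.simps(5) ev_Mod ev_Sub ev_Num odd_iff_mod_2_eq_one)
	note X = shr[OF x vd(4)] and Y = shr[OF y vd(5)]
	have le: "lim_x sg ?q <= n" "lim_y sg ?q <= n" using lim_le[OF vq] b(9) by (meson order_trans)+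
	have k: "eval w z t t_kq = pk n (3 * (lim_x sg ?q div pow2 (ds ! 1))) (3 * (lim_y sg ?q div pow2 (ds ! 2)) + 1)" unfolding t_kq_def
	proof (rule ev_pk[OF tri[OF conjunct1[OF X]] plus[OF tri[OF conjunct1[OF Y]]] _ _ b(1) W'])
	qed (use X Y le in linarith)+
	have "eval w z t t_gq = of_bool (i div h = ds ! 3)" unfolding t_gq_def using iw vd sm by (simp add: ev_Equal ev_Div)
	with k show ?thesis by (simp add: task_query_def)
 qed
 have bd: "3 * (a + 1) < 6 * n + 8 & 3 * a < 6 * n + 8 & 3 * a + 2 < 6 * n + 8 & 3 * (a + 1) + 1 < 6 * n + 8 & 3 * (a + 1) + 2 < 6 * n + 8 &
	 a <= n + 2 & a + 1 <= n + 2 & a <= 3 * n + 6 & 3 * a <= 3 * n + 6 & 3 * (a + 1) <= 3 * n + 6" if "a <= n" for a using that by simp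
 have par: "eval w z t (e [mod] Num 2 [=] Num 0) = of_bool (even x)" "eval w z t (e [mod] Num 2) = x mod 2" if "eval w z t e = x" for e x using that vd sm by (simp_all add: ev_Equal ev_Mod even_iff_mod_2_eq_zero)
 have rank: "eval w z t (Get (Num 1) (Var 11)) = rank A i" "rank A i < n" "eval w z t (Var 11) = i" "i < n" if i: "i < length A"
 proof -
	show iv: "eval w z t (Var 11) = i" and "i < n" and r: "rank A i < n" using i sm v(9) b(9) rank_less[OF i] by (simp_all add: ev_Var)
	show "eval w z t (Get (Num 1) (Var 11)) = rank A i" using iv vd b(5)[OF i] r \<open>i < n\<close> sm by (subst ev_Get) simp_all
 qed
 show "(eval w z t t_g1 ~= 0 \<longleftrightarrow> task1 h ds i) &
	 eval w z t t_k1 = pk n (3 * (i div pow2 (ds ! 1) + 1)) (3 * (rank A i div pow2 (ds ! 0)) + 2)" if i: "i < length A"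
 proof
	note r = rank[OF i]
	note X = shr[OF r(3) vd(4)] and Y = shr[OF r(1) vd(3)]
	show "eval w z t t_k1 = pk n (3 * (i div pow2 (ds ! 1) + 1)) (3 * (rank A i div pow2 (ds ! 0)) + 2)" unfolding t_k1_def
	proof (rule ev_pk[OF tri[OF plus[OF conjunct1[OF X]]] plus[OF tri[OF conjunct1[OF Y]]] _ _ b(1) W'])
	qed (use bd[OF le_trans[OF conjunct2[OF X]]] bd[OF le_trans[OF conjunct2[OF Y]]] r in simp_all)
	show "eval w z t t_g1 ~= 0 \<longleftrightarrow> task1 h ds i" unfolding t_g1_def task1_def using r(3) vd sm par(1)[OF conjunct1[OF X]] by (simp add: eval.simps(5) ev_Equal ev_Div)
 qed
 show "(eval w z t t_g2 ~= 0 \<longleftrightarrow> task2 (rank A) h ds i) &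
	 eval w z t t_k2 = pk n (3 * (i div pow2 (ds ! 2) + 1) + 1) (3 * (rank A i div pow2 (ds ! 0) + 1) + 2)" if i: "i < length A"
 proof
	note r = rank[OF i]
	note X = shr[OF r(3) vd(5)] and Y = shr[OF r(1) vd(3)]
	show "eval w z t t_k2 = pk n (3 * (i div pow2 (ds ! 2) + 1) + 1) (3 * (rank A i div pow2 (ds ! 0) + 1) + 2)" unfolding t_k2_def
	proof (rule ev_pk[OF plus[OF tri[OF plus[OF conjunct1[OF X]]]] plus[OF tri[OF plus[OF conjunct1[OF Y]]]] _ _ b(1) W'])
	qed (use bd[OF le_trans[OF conjunct2[OF X]]] bd[OF le_trans[OF conjunct2[OF Y]]] r in simp_all)
	show "eval w z t t_g2 ~= 0 \<longleftrightarrow> task2 (rank A) h ds i" unfolding t_g2_def task2_def using r(3) vd sm par(2)[OF conjunct1[OF X]] par(1)[OF conjunct1[OF Y]] by (simp add: eval.simps(5) ev_Equal ev_Div mod_2_eq_odd)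
 qed
qed

text \<open>\<open>R\<close> is the accumulator row for the sign of the corner. That the sums stay
  below the word limit is a premise for the single call; it is discharged later from the totals over
  all calls.\<close>

lemma run_task:
 fixes s :: ast
 assumes c: "compressed 4 w z n inp A qs s1" and bg: "q_background s1 s" and val: "\<forall>q\<in>set qs. valid2 (length A) q"
	and fresh: "\<forall>q\<ge>8 * r + 32. ar s q = (%_. 0)"
	and v: "va s1 9 = h" "va s1 10 = D" "va s 5 = r" and h: "h = n div 4" "4 <= n" and D: "0 < D" "D < pow2 w"
	and bounds: "(6 * n + 8) * (6 * n + 8) <= pow2 z" "8 * r + 38 < pow2 z" "length qs + 3 * n + 8 < pow2 z" "pow2 D * pow2 D < pow2 w"
	and ds: "ds = digits D 8 (r div 4)" and sg: "sg = r mod 4" and R: "R = (if sg mod 3 = 0 then 7 else 16)"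
	and s': "s' = run w z t_build s"
 obtains X Y where "edge_triangle_counting z n X Y" "set X <= {..<pow2 z}" "va s' 2 = 8 * r + 32"
	"!!i. ar s' (8 * r + 32) i = (if i < length X then X ! i else 0)"
	"!!f s''. ALL i<length Y. f i = Y ! i ==> s'' = run w z (t_collect t_gq t_kq) (s'(|ar := (ar s')(8 * r + 32 := f)|)) ==>
	 ALL j<length qs. ar s R j + contrib A qs n h sg ds j < pow2 w ==>
	 q_background s1 s'' & (\<forall>q\<ge>8 * r + 40. ar s'' q = (%_. 0)) &
	 (ALL j<length qs. ar s'' R j = ar s R j + contrib A qs n h sg ds j) & (\<forall>q\<in>{7, 16} - {R}. ar s'' q = ar s q)"
proof -
 let ?ro = "8 * r + 32" and ?N = "length A" and ?nq = "length qs"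
 note b = compressed_bg[OF c bg]
 have zw: "pow2 z <= pow2 w" by (rule b(14))
 define d where "d = run w z t_decode s"
 have vs: "va s 9 = h" "va s 10 = D" using bg v by (auto simp: q_background_def q_vars_def)
 have d8: "ds ! i < D" if "i < 8" for i unfolding ds by (rule digits_nth_less[OF D(1) that])
 have dw: "ALL i<8. ds ! i < pow2 w" using d8 D(2) by (meson less_trans)
 have d: "ar d = ar s & (ALL y. y ~: {2, 12, 20, 21, 22, 23, 24, 25, 26, 27, 28} --> va d y = va s y) & va d 2 = ?ro &
	va d 20 = r mod 4 & va d 21 = ds ! 0 & va d 22 = ds ! 1 & va d 23 = ds ! 2 & va d 26 = ds ! 3 & va d 27 = ds ! 4 &
	va d 28 = ds ! 5 & va d 24 = ds ! 6 & va d 25 = ds ! 7" by (rule run_t_decode[OF v(3) vs(2) _ D(2) ds d_def]) (use bounds zw in linarith)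
 have vd: "va d 2 = ?ro" "va d 3 = n" "va d 7 = ?nq" "va d 8 = ?N" "va d 9 = h" "va d 20 = sg" "va d 21 = ds ! 0" "va d 22 = ds ! 1" "va d 23 = ds ! 2"
	"va d 26 = ds ! 3" "va d 27 = ds ! 4" "va d 28 = ds ! 5" "va d 24 = ds ! 6" "va d 25 = ds ! 7" using d b vs sg by simp_all
 have s'd: "s' = run w z (build t_gq t_kq t_g1 t_k1 t_g2 t_k2) d" unfolding s' t_build_def d_def by simp
 have hw: "h < pow2 w" "sg < 4" using b(11,14) h sg by simp_all
 have bgt: "q_background s1 t" if "ALL y. y ~: {2, 5, 11, 12, 13, 19, 29, 30} --> va t y = va d y" "ALL q<16. q ~= 7 --> ar t q = ar s q" for t :: ast using that bg d unfolding q_background_def q_vars_def by auto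
 note tasks = ev_tasks[OF c _ val bounds(1) _ _ _ _ _ _ _ _ _ hw dw]
 let ?agree = "%t :: ast. (ALL y. y ~: {11, 13, 29} --> va t y = va d y) & (ALL q. q ~: {?ro..?ro + 5} --> ar t q = ar d q)"
 have ab: "q_background s1 t" if "?agree t" for t by (rule bgt) (use that d in auto)
 let ?x = "%j. lim_x sg (qs ! j) div pow2 (ds ! 1)" and ?y = "%j. lim_y sg (qs ! j) div pow2 (ds ! 2)"
 let ?key = "%j. pk n (3 * ?x j) (3 * ?y j + 1)"
 have div_le: "x div k <= n" if "x <= n" for x k using div_le_dividend[of x k] that by linarith
 have lim: "lim_x sg (qs ! j) <= n" "lim_y sg (qs ! j) <= n" if "j < ?nq" for j using lim_le[of ?N "qs ! j" sg] val that b(9) by (meson nth_mem order_trans)+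
 have h0: "0 < h" "3 * h <= n" using h by simp_all
 obtain X Y where XY: "edge_triangle_counting z n X Y" "length Y = n" "set X <= {..<pow2 z}"
	"ALL y. y ~: {11, 13, 19, 29, 30} --> va s' y = va d y" "ALL q. q ~: {?ro..?ro + 5} --> ar s' q = ar d q"
	"!!i. ar s' ?ro i = (if i < length X then X ! i else 0)"
	"!!j. j < ?nq ==> task_query h ds j ==> EX e<n. ar s' (?ro + 4) (?key j) = e + 1 &
	 Y ! e = common (rank A) ?N (n + 2) h ds (lim_x sg (qs ! j)) (lim_y sg (qs ! j))"
 proof (rule run_build[where s = d and ro = ?ro and n = n and nq = ?nq and N = ?N and ?b1.0 = "ds ! 6" and ?b2.0 = "ds ! 7" and w = w and z = z
		and agree = ?agree and gq = t_gq and kq = t_kq and ?g1.0 = t_g1 and ?k1.0 = t_k1 and ?g2.0 = t_g2 and ?k2.0 = t_k2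
		and Gq = "task_query h ds" and ?G1.0 = "task1 h ds" and ?G2.0 = "task2 (rank A) h ds" and xq = ?x and yq = ?y
		and ?x1.0 = "%i. i div pow2 (ds ! 1) + 1" and ?u1.0 = "%i. rank A i div pow2 (ds ! 0)"
		and ?y2.0 = "%i. i div pow2 (ds ! 2) + 1" and ?u2.0 = "%i. rank A i div pow2 (ds ! 0) + 1" and s' = s'])
	show "ar d q = (%_. 0)" if "?ro <= q" "q <= ?ro + 5" for q using fresh d that by simp
	show "(eval w z t t_gq ~= 0 \<longleftrightarrow> task_query h ds i) & (task_query h ds i --> eval w z t t_kq = ?key i)"
	 if "i < ?nq" "va t 11 = i" "?agree t" for i and t :: ast using tasks(1)[OF ab[OF that(3)] _ _ _ _ _ _ _ _ that(2,1)] that(3) vd by simp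
	show "(eval w z t t_g1 ~= 0 \<longleftrightarrow> task1 h ds i) &
		(task1 h ds i --> eval w z t t_k1 = pk n (3 * (i div pow2 (ds ! 1) + 1)) (3 * (rank A i div pow2 (ds ! 0)) + 2))"
	 if "i < ?N" "va t 11 = i" "?agree t" for i and t :: ast using tasks(2)[OF ab[OF that(3)] _ _ _ _ _ _ _ _ that(2,1)] that(3) vd by simp
	show "(eval w z t t_g2 ~= 0 \<longleftrightarrow> task2 (rank A) h ds i) &
		(task2 (rank A) h ds i --> eval w z t t_k2 = pk n (3 * (i div pow2 (ds ! 2) + 1) + 1) (3 * (rank A i div pow2 (ds ! 0) + 1) + 2))"
	 if "i < ?N" "va t 11 = i" "?agree t" for i and t :: ast using tasks(3)[OF ab[OF that(3)] _ _ _ _ _ _ _ _ that(2,1)] that(3) vd by simp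
	show "?x i <= n + 1 & ?y i <= n + 1" if "i < ?nq" for i using div_le lim[OF that] by (meson le_add1 order_trans)
	show "i div pow2 (ds ! 1) + 1 <= n + 1 & rank A i div pow2 (ds ! 0) <= n + 1 & i div pow2 (ds ! 2) + 1 <= n + 1 & rank A i div pow2 (ds ! 0) + 1 <= n + 1"
	 if "i < ?N" for i
	proof -
	 have "i <= n" "rank A i <= n" using that rank_less[OF that] b(9) by linarith+
	 thus ?thesis using div_le[of i] div_le[of "rank A i"] by (simp add: le_SucI)
	qed
	have "card {i. i < ?nq & task_query h ds i} <= h" "card {i. i < ?N & task1 h ds i} <= h" "card {i. i < ?N & task2 (rank A) h ds i} <= h" by (rule card_chunk[OF h0(1)], simp add: task_query_def task1_def task2_def)+
	thus "card {i. i < ?nq & task_query h ds i} + card {i. i < ?N & task1 h ds i} + card {i. i < ?N & task2 (rank A) h ds i} <= n" using h0(2) by linarith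
 next
	fix X Y assume a: "edge_triangle_counting z n X Y" "length Y = n" "set X <= {..<pow2 z}"
	 "ALL y. y ~: {11, 13, 19, 29, 30} --> va s' y = va d y" "ALL q. q ~: {?ro..?ro + 5} --> ar s' q = ar d q"
	 "!!i. ar s' ?ro i = (if i < length X then X ! i else 0)"
	 "!!j. j < ?nq ==> task_query h ds j ==> EX e<n. ar s' (?ro + 4) (?key j) = e + 1 & Y ! e =
	 (\<Sum>u<n + 2. of_bool (odd ((\<Sum>i<?N. of_bool (task1 h ds i & i div pow2 (ds ! 1) + 1 = ?x j & rank A i div pow2 (ds ! 0) = u)) div pow2 (ds ! 6))) *
				 of_bool (odd ((\<Sum>i<?N. of_bool (task2 (rank A) h ds i & i div pow2 (ds ! 2) + 1 = ?y j & rank A i div pow2 (ds ! 0) + 1 = u)) div pow2 (ds ! 7))))"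
	show thesis by (rule that[OF a(1-6)]) (use a(7) in \<open>simp only: common_def\<close>)
 next
	show "va d 2 = ?ro" "va d 3 = n" "va d 7 = ?nq" "va d 8 = ?N" "?N <= n" "va d 24 = ds ! 6" "va d 25 = ds ! 7" by (fact vd b(9))+
	show "ds ! 6 < pow2 w" "ds ! 7 < pow2 w" using dw by simp_all
	show "?ro + 5 < pow2 z" "?nq + 3 * n + 8 < pow2 z" using bounds by linarith+
	show "(6 * n + 8) * (6 * n + 8) <= pow2 z" "pow2 z <= pow2 w" "s' = run w z (build t_gq t_kq t_g1 t_k1 t_g2 t_k2) d" by (fact bounds(1) zw s'd)+
	show "?agree t \<longleftrightarrow> (ALL y. y ~: {11, 13, 29} --> va t y = va d y) & (ALL q. q ~: {?ro..?ro + 5} --> ar t q = ar d q)" for t :: ast by (rule refl)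
 qed
 show thesis
 proof (rule that[OF XY(1,3) _ XY(6)])
	show "va s' 2 = ?ro" using XY(4) vd by simp
	fix f s'' assume f: "ALL i<length Y. f i = Y ! i" and s'': "s'' = run w z (t_collect t_gq t_kq) (s'(|ar := (ar s')(?ro := f)|))"
	 and sums: "ALL j<?nq. ar s R j + contrib A qs n h sg ds j < pow2 w"
	let ?s = "s'(|ar := (ar s')(?ro := f)|)" and ?p = "%j. ar s' (?ro + 4) (?key j) - 1"
	have R': "R = 7 | R = 16" unfolding R by simp
	have ars: "ar ?s q = ar s q" if "q ~: {?ro..?ro + 5}" for q using XY(5) d that by auto
	have low: "ar ?s q = ar s q" if "q < 16" for q by (rule ars) (use that in simp)
	have arR: "ar ?s R = ar s R" by (rule ars) (use R' in auto)
	have co: "contrib A qs n h sg ds j = pow2 (ds ! 6) * pow2 (ds ! 7) * f (?p j) & ar s' (?ro + 4) (?key j) = ?p j + 1 & ?p j < n"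
	 if "j < ?nq" "task_query h ds j" for j
	proof -
	 from XY(7)[OF that] obtain e where "e < n" "ar s' (?ro + 4) (?key j) = e + 1"
		"Y ! e = common (rank A) ?N (n + 2) h ds (lim_x sg (qs ! j)) (lim_y sg (qs ! j))" by blast
	 thus ?thesis using f XY(2) that(2) by (simp add: contrib_def)
	qed
	have p2: "pow2 (ds ! 6) * pow2 (ds ! 7) < pow2 w" "pow2 (ds ! 6) < pow2 w"
	proof -
	 have "pow2 (ds ! 6) * pow2 (ds ! 7) <= pow2 D * pow2 D" using d8[of 6] d8[of 7] by (intro mult_le_mono pow2_mono) simp_all
	 thus "pow2 (ds ! 6) * pow2 (ds ! 7) < pow2 w" using bounds(4) by linarith
	 moreover have "pow2 (ds ! 6) * 1 <= pow2 (ds ! 6) * pow2 (ds ! 7)" by (intro mult_le_mono2) (simp add: pow2_def)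
	 ultimately show "pow2 (ds ! 6) < pow2 w" by linarith
	qed
	have col: "(ALL y. y ~: {11, 12, 13} --> va s'' y = va ?s y) & (ALL q. q ~= R --> ar s'' q = ar ?s q) &
	 (ALL j<?nq. ar s'' R j = ar ?s R j + of_bool (task_query h ds j) * (pow2 (ds ! 6) * pow2 (ds ! 7) * f (?p j)))"
	proof (rule run_t_collect[where sg = sg and k = ?key and p = ?p and ro = ?ro and z = z and w = w and g = t_gq and e = t_kq])
	 show "va ?s 7 = ?nq" "va ?s 2 = ?ro" "va ?s 24 = ds ! 6" "va ?s 25 = ds ! 7" "va ?s 20 = sg" "sg < 4" using XY(4) vd hw by simp_all
	 show "?ro + 4 < pow2 z" "16 < ?ro" "pow2 z <= pow2 w" "?nq < pow2 z" using bounds zw by linarith+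
	 show "(eval w z t t_gq ~= 0 \<longleftrightarrow> task_query h ds j) & (task_query h ds j --> eval w z t t_kq = ?key j)"
		if j: "j < ?nq" "va t 11 = j" "ALL y. y ~: {11, 12, 13} --> va t y = va ?s y" "ALL q. q ~: {7, 16} --> ar t q = ar ?s q" for j and t :: ast
	 proof -
		have "q_background s1 t"
		proof (rule bgt)
		 show "ALL q<16. q ~= 7 --> ar t q = ar s q"
		 proof (intro allI impI)
			fix q :: nat assume q: "q < 16" "q ~= 7"
			hence "ar t q = ar ?s q" using j(4) by blast
			thus "ar t q = ar s q" using low[OF q(1)] by simp
		 qed
		qed (use j(3) XY(4) in simp)
		from tasks(1)[OF this _ _ _ _ _ _ _ _ j(2,1)] j(3) XY(4) vd show ?thesis by simp
	 qed
	 fix j assume j: "j < ?nq" "task_query h ds j"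
	 note C = co[OF j]
	 have "3 * ?x j < 6 * n + 8" "3 * ?y j + 1 < 6 * n + 8" using div_le[OF lim(1)[OF j(1)], of "pow2 (ds ! 1)"] div_le[OF lim(2)[OF j(1)], of "pow2 (ds ! 2)"] by linarith+
	 hence kz: "?key j < pow2 z" using pk_lt bounds(1) less_le_trans by blast
	 have sj: "ar s R j + pow2 (ds ! 6) * pow2 (ds ! 7) * f (?p j) < pow2 w" using sums j(1) C by metis
	 thus "ar ?s R j + pow2 (ds ! 6) * pow2 (ds ! 7) * f (?p j) < pow2 w" unfolding arR .
	 have "1 * f (?p j) <= pow2 (ds ! 6) * pow2 (ds ! 7) * f (?p j)" by (intro mult_le_mono1) (simp add: pow2_def)
	 hence fw: "f (?p j) < pow2 w" using sj by linarith
	 have "?p j + 1 < pow2 z" using C bounds(3) by linarith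
	 thus "?key j < pow2 z & ar ?s (?ro + 4) (?key j) = ?p j + 1 & ?p j + 1 < pow2 z & ar ?s ?ro (?p j) = f (?p j) & f (?p j) < pow2 w" using kz fw C by simp
	qed (use p2 dw R s'' in simp_all)
	have "q_background s1 s''"
	proof (rule bgt)
	 show "ALL q<16. q ~= 7 --> ar s'' q = ar s q"
	 proof (intro allI impI)
		fix q :: nat assume q: "q < 16" "q ~= 7"
		hence "q ~= R" using R' by auto
		hence "ar s'' q = ar ?s q" by (rule conjunct1[OF conjunct2[OF col], rule_format])
		thus "ar s'' q = ar s q" using low[OF q(1)] by simp
	 qed
	qed (use col XY(4) in simp)
	moreover have "ar s'' q = (%_. 0)" if "q >= 8 * r + 40" for q
	proof -
	 have "ar s'' q = ar ?s q" using col R' that by auto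
	 also have "... = ar s q" by (rule ars) (use that in simp)
	 finally show ?thesis using fresh that by simp
	qed
	moreover have "ar s'' R j = ar s R j + contrib A qs n h sg ds j" if "j < ?nq" for j
	proof (cases "task_query h ds j")
	 case True
	 thus ?thesis using col that arR co[OF that True] by simp
	next
	 case False
	 thus ?thesis using col that arR by (simp add: contrib_def)
	qed
	moreover have "ar s'' q = ar s q" if "q : {7, 16} - {R}" for q
	proof -
	 have "ar s'' q = ar ?s q" using col that by auto
	 also have "... = ar s q" by (rule ars) (use that in auto)
	 finally show ?thesis .
	qed
	ultimately show "q_background s1 s'' & (\<forall>q\<ge>8 * r + 40. ar s'' q = (%_. 0)) &
	 (ALL j<?nq. ar s'' R j = ar s R j + contrib A qs n h sg ds j) & (\<forall>q\<in>{7, 16} - {R}. ar s'' q = ar s q)" by blast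
 qed
qed

section \<open>Totals over all tasks\<close>

definition acc :: "int list => nat list list => nat => nat => nat => bool => nat => nat => nat" where
 "acc A qs n h D pos r j = (\<Sum>r'<r. of_bool ((r' mod 4 mod 3 = 0) = pos) * contrib A qs n h (r' mod 4) (digits D 8 (r' div 4)) j)"

text \<open>The call number splits into corner and digits, and for a fixed corner the sum over all
  digits is the one evaluated by \<open>sum_common\<close>.\<close>

lemma acc_total:
 assumes N: "length A <= n" "n < 2 ^ D" and q: "valid2 (length A) (qs ! j)"
	and h: "ALL i<length A. i div h < D" "j div h < D"
 shows "acc A qs n h D pos (4 * D ^ 8) j = (\<Sum>sg<4. of_bool ((sg mod 3 = 0) = pos) *
	(\<Sum>i<lim_x sg (qs ! j). \<Sum>i'<lim_y sg (qs ! j). of_bool (rank A i' < rank A i)))"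
proof -
 have D: "0 < D" using h(2) by simp
 have "acc A qs n h D pos (4 * D ^ 8) j = (\<Sum>r<D ^ 8 * 4. of_bool ((r mod 4 mod 3 = 0) = pos) * contrib A qs n h (r mod 4) (digits D 8 (r div 4)) j)" by (simp only: acc_def mult.commute)
 also have "... = (\<Sum>q<D ^ 8. \<Sum>sg<4. of_bool ((sg mod 3 = 0) = pos) * contrib A qs n h sg (digits D 8 q) j)" by (rule sum_div_mod[of 4 "%q sg. of_bool ((sg mod 3 = 0) = pos) * contrib A qs n h sg (digits D 8 q) j"]) simp
 also have "... = (\<Sum>sg<4. \<Sum>q<D ^ 8. of_bool ((sg mod 3 = 0) = pos) * contrib A qs n h sg (digits D 8 q) j)" by (rule sum.swap)
 also have "... = (\<Sum>sg<4. of_bool ((sg mod 3 = 0) = pos) * (\<Sum>q<D ^ 8. contrib A qs n h sg (digits D 8 q) j))" by (simp only: sum_distrib_left)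
 also have "... = (\<Sum>sg<4. of_bool ((sg mod 3 = 0) = pos) *
	(\<Sum>i<lim_x sg (qs ! j). \<Sum>i'<lim_y sg (qs ! j). of_bool (rank A i' < rank A i)))"
 proof (rule sum.cong[OF refl])
	fix sg :: nat
	have "(\<Sum>q<D ^ 8. contrib A qs n h sg (digits D 8 q) j) = digit_sum D 8 (%ds. contrib A qs n h sg ds j)" by (rule sum_digits[OF D, of "%ds. contrib A qs n h sg ds j"])
	also have "... = (\<Sum>i<lim_x sg (qs ! j). \<Sum>i'<lim_y sg (qs ! j). of_bool (rank A i' < rank A i))" unfolding contrib_def task_query_def by (rule sum_common) (use N q lim_le h rank_less in auto)
	finally show "of_bool ((sg mod 3 = 0) = pos) * (\<Sum>q<D ^ 8. contrib A qs n h sg (digits D 8 q) j) =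
		of_bool ((sg mod 3 = 0) = pos) * (\<Sum>i<lim_x sg (qs ! j). \<Sum>i'<lim_y sg (qs ! j). of_bool (rank A i' < rank A i))" by (rule arg_cong)
 qed
 finally show ?thesis .
qed

lemma sum_lessThan_4: "(\<Sum>sg<4. f sg) = f 0 + f 1 + f 2 + f (3::nat)"
 by (simp add: eval_nat_numeral)

text \<open>The second claim, together with monotonicity in the number of calls, bounds every
  intermediate accumulator and so excludes overflow.\<close>

lemma acc_answer:
 assumes N: "length A <= n" "n < 2 ^ D" and q: "valid2 (length A) (qs ! j)"
	and h: "ALL i<length A. i div h < D" "j div h < D"
 shows "acc A qs n h D True (4 * D ^ 8) j = acc A qs n h D False (4 * D ^ 8) j + pairs2 (>) A (qs ! j)"
	and "acc A qs n h D pos (4 * D ^ 8) j <= 2 * (n * n)"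
proof -
 let ?B = "%x y. \<Sum>i<x. \<Sum>i'<y. of_bool (rank A i' < rank A i) :: nat"
 let ?q = "qs ! j"
 note t = acc_total[OF assms]
 have T: "acc A qs n h D True (4 * D ^ 8) j = ?B (?q ! 1) (?q ! 3) + ?B (?q ! 0 - 1) (?q ! 2 - 1)"
	"acc A qs n h D False (4 * D ^ 8) j = ?B (?q ! 1) (?q ! 2 - 1) + ?B (?q ! 0 - 1) (?q ! 3)" unfolding t sum_lessThan_4 by (simp_all add: lim_x_def lim_y_def del: sum_of_bool_eq)
 show "acc A qs n h D True (4 * D ^ 8) j = acc A qs n h D False (4 * D ^ 8) j + pairs2 (>) A (qs ! j)" unfolding T using pairs2_rank[OF q] by linarith
 have B: "?B x y <= n * n" if "x <= n" "y <= n" for x y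
 proof -
	have "?B x y <= (\<Sum>i<x. \<Sum>i'<y. 1)" by (intro sum_mono) simp
	also have "... = x * y" by simp
	also have "... <= n * n" by (rule mult_le_mono[OF that])
	finally show ?thesis .
 qed
 have le: "?q ! 1 <= n" "?q ! 3 <= n" "?q ! 0 - 1 <= n" "?q ! 2 - 1 <= n" using q N(1) by (auto simp: valid2_def)
 have "acc A qs n h D True (4 * D ^ 8) j <= 2 * (n * n)" "acc A qs n h D False (4 * D ^ 8) j <= 2 * (n * n)" unfolding T using B le by (metis add_mono mult_2)+
 thus "acc A qs n h D pos (4 * D ^ 8) j <= 2 * (n * n)" by (cases pos) simp_all
qed

lemma acc_Suc:
 "acc A qs n h D pos (Suc r) j = acc A qs n h D pos r j + of_bool ((r mod 4 mod 3 = 0) = pos) * contrib A qs n h (r mod 4) (digits D 8 (r div 4)) j" by (simp add: acc_def)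

lemma acc_mono: "r <= r' ==> acc A qs n h D pos r j <= acc A qs n h D pos r' j"
 unfolding acc_def by (rule sum_mono2) auto

lemma cost_t:
 "cost v (t_params C) <= 300" "cost v t_build <= 5000 * (v 3 + v 7 + v 8 + 1)"
 "cost v (t_collect t_gq t_kq) <= 5000 * (v 3 + v 7 + v 8 + 1)" "cost v t_final <= 5000 * (v 3 + v 7 + v 8 + 1)"
 by (simp_all add: t_params_def t_build_def t_decode_def build_def tally_def emit_def relabel_step_def t_collect_def t_final_def
	 bit_guard_def pad_exp_def W_exp_def t_gq_def t_kq_def t_x_def t_y_def t_g1_def t_k1_def t_g2_def t_k2_def pk_exp_def QL_def t_sign_def)

theorem inversions_to_triangles:
 assumes solver: "solvable_in_time edge_triangle_counting T"
 shows "\<exists>T' \<in> soft_O T. solvable_in_time (two_range_query (>) alp bet) T'"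
proof -
 obtain epl where eps: "0 < epl" "\<forall>\<^sub>F N in sequentially. epl * real N <= T N" using triangle_lower_bound[OF solver] by blast
 obtain C where size: "!!w N inp out. gquery 4 valid2 (pairs2 (>)) alp bet w N inp out ==> 2 <= length inp & inp ! 0 = N & length out = inp ! 1 &
	inp ! 0 <= C * N & inp ! 1 <= C * N & length inp <= C * (N + 1)" using gquery_size[of 4 valid2 "pairs2 (>)" alp bet] by (metis zero_less_numeral)
 \<comment> \<open>\<open>D = lg n + c\<close> must exceed every digit. Levels and bits stay below
   \<open>lg n\<close>; since \<open>n <= 7 * (n div 4)\<close>, the array has at most 7 chunks and
   the queries at most \<open>7 * C\<close>.\<close>
 define c where "c = 7 * C + 8"
 define P8 where "P8 = (c + 1) ^ 8"
 \<comment> \<open>The summands provide for key sizes and input length, for the rows of all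
   \<open>4 * D ^ 8\<close> calls with eight rows each, and for the weights
   \<open>2 ^ b1 * 2 ^ b2\<close>.\<close>
 define G where "G = 1000 + C + 40 * P8 + 4 * pow2 (2 * c)"
 define a where "a = 2300 + 1000 * C + 10000 * (C + 1) + 4 * P8"
 show ?thesis unfolding two_range_query_gquery
 proof (rule reduction[OF solver eps, where k = 0 and Q = "gquery 4 valid2 (pairs2 (>)) alp bet" and V = q_vars and ?d0.0 = "G + C + 408" and ?n0.0 = 4
		and a = a and e = 8 and ?c0.0 = "t_params c" and ?c1.0 = c_compress and ?c2.0 = t_build and ?c3.0 = "t_collect t_gq t_kq" and ?c4.0 = t_final])
	fix w N inp out assume "gquery 4 valid2 (pairs2 (>)) alp bet w N inp out"
	from size[OF this] show "0 < length inp & inp ! 0 = N" by auto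
 next
	show "5 ~: q_vars" "{0, 1, 3, 4, 6} <= q_vars" by (auto simp: q_vars_def)
 next
	fix e w z N n inp out s0
	assume Q: "gquery 4 valid2 (pairs2 (>)) alp bet w N inp out" and e: "G + C + 408 <= e" and n: "n = max N 4" and z: "z = e * lg n" and zw: "4 * z <= w"
	 and s0: "s0 = run w z (t_params c) (start z n inp)"
	note sz = size[OF Q]
	let ?Z = "pow2 z" and ?W = "pow2 w" and ?nq = "inp ! 1"
	define D where "D = lg n + c"
	define h where "h = n div 4"
	have nn: "N <= n" "4 <= n" "2 <= n" by (auto simp: n)
	have h: "0 < h" "n <= 7 * h"
	proof -
	 show "0 < h" using nn by (simp add: h_def div_greater_zero_iff)
	 moreover have "n <= 4 * h + 3" unfolding h_def by linarith
	 ultimately show "n <= 7 * h" by linarith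
	qed
	have poly: "b * (n + 2) ^ k <= ?Z" if "b <= G" "k <= 8" for b k
	proof -
	 have "b * (n + 2) ^ k <= G * (n + 2) ^ 8" using that by (intro mult_le_mono power_increasing) auto
	 also have "... <= ?Z" by (rule poly_le_pow2[OF _ z]) (use e in simp)
	 finally show ?thesis .
	qed
	have P: "pow2 (lg n) <= 2 * n + 2" "n + 2 <= pow2 (lg n)" using lg_le[of n] lg_ge[of n] by (simp_all add: pow2_def)
	have ZW: "?Z < ?W"
	proof -
	 have "0 < e * lg n" using e lg_pos[of n] by (simp add: G_def)
	 hence "z < w" using z zw by linarith
	 thus ?thesis by (simp add: pow2_def)
	qed
	have n2: "1000 * (n + 2) ^ 2 <= ?Z" by (rule poly) (simp_all add: G_def)
	have sq: "(n + 2) ^ 2 = n * n + 4 * n + 4" by (simp add: power2_eq_square algebra_simps)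
	have W2: "(6 * n + 8) * (6 * n + 8) <= ?Z"
	proof -
	 have "(6 * n + 8) * (6 * n + 8) <= 1000 * (n * n + 4 * n + 4)" by (simp add: algebra_simps)
	 thus ?thesis using n2 unfolding sq by linarith
	qed
	have n1: "1000 * n + 2000 <= ?Z"
	proof -
	 have "1000 * n + 2000 <= 1000 * (n * n + 4 * n + 4)" by simp
	 thus ?thesis using n2 unfolding sq by linarith
	qed
	have nnZ: "2 * (n * n) < ?Z" using n2 unfolding sq by simp
	have D8: "40 * D ^ 8 <= ?Z" "8 <= D" "D <= D ^ 8"
	proof -
	 have "D <= (c + 1) * (n + 2)" using lg_le_self[of n] by (simp add: D_def algebra_simps)
	 hence "D ^ 8 <= ((c + 1) * (n + 2)) ^ 8" by (rule power_mono) simp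
	 hence "D ^ 8 <= P8 * (n + 2) ^ 8" by (simp only: power_mult_distrib P8_def)
	 hence "40 * D ^ 8 <= 40 * P8 * (n + 2) ^ 8" by simp
	 also have "... <= ?Z" by (rule poly) (simp_all add: G_def)
	 finally show "40 * D ^ 8 <= ?Z" .
	 show "8 <= D" by (simp add: D_def c_def)
	 thus "D <= D ^ 8" by (intro self_le_power) simp_all
	qed
	have DD: "pow2 D * pow2 D < ?W"
	proof -
	 have "pow2 D * pow2 D = pow2 (lg n) * pow2 (lg n) * pow2 (2 * c)" by (simp add: D_def mult_2 pow2_add)
	 also have "... <= (2 * (n + 2)) * (2 * (n + 2)) * pow2 (2 * c)" using P by (intro mult_le_mono) auto
	 also have "... = 4 * pow2 (2 * c) * (n + 2) ^ 2" by (simp add: power2_eq_square)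
	 also have "... <= ?Z" by (rule poly) (simp_all add: G_def)
	 finally show ?thesis using ZW by linarith
	qed
	have len: "length inp <= ?Z" "C * n + 3 * n + 8 < ?Z"
	proof -
	 have "(1000 + C) * (n + 2) ^ 1 <= ?Z" by (rule poly) (simp_all add: G_def)
	 hence Z: "1000 * n + 2000 + C * n + 2 * C <= ?Z" by (simp add: algebra_simps)
	 moreover have "C * (N + 1) <= C * n + C" using nn by (simp add: algebra_simps)
	 ultimately show "length inp <= ?Z" using sz by linarith
	 show "C * n + 3 * n + 8 < ?Z" using Z by linarith
	qed
	have CN: "C * N <= C * n" using nn by simp
	have nq: "?nq <= C * n" "inp ! 0 <= C * n" using sz CN by linarith+
	have s0_eq: "s0 = (|va = (%_. 0)(0 := z, 1 := 2 ^ z - 1, 3 := n, 4 := lg n, 7 := ?nq, 8 := inp ! 0, 9 := n div 4,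
	 10 := D, 6 := 4 * D ^ 8, 17 := pow2 (lg n)), ar = start_ar inp|)" unfolding s0 D_def
	proof (rule run_t_params)
	 show "2 <= length inp" using sz by simp
	 show "inp ! 0 < ?W" "?nq < ?W" "n < ?W" "pow2 (lg n) < ?W" "1 < ?Z" "4 < ?W" using nq len(2) ZW P n1 by linarith+
	 show "4 * (lg n + c) ^ 8 < ?W" using D8(1) ZW unfolding D_def[symmetric] by linarith
	 show "0 < c" by (simp add: c_def)
	qed
	have v0: "va s0 0 = z" "va s0 1 = 2 ^ z - 1" "va s0 3 = n" "va s0 4 = lg n" "va s0 7 = ?nq" "va s0 8 = inp ! 0" "va s0 9 = h"
	 "va s0 10 = D" "va s0 6 = 4 * D ^ 8" "va s0 17 = pow2 (lg n)" "ar s0 = start_ar inp" by (simp_all add: s0_eq h_def)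
	have qs0: "q_start w z n inp s0" by (simp add: q_start_def v0)
	define s1 where "s1 = run w z c_compress s0"
	have e400: "C + 400 <= e" using e by simp
	from run_compressed[OF Q _ e400 nn(1,3) z zw qs0 s1_def] sz obtain A qs where cp: "compressed 4 w z n inp A qs s1" "length A = N"
		"out = map (pairs2 (>) A) qs" "\<forall>q\<in>set qs. valid2 N q" "?nq = length qs" "ALL q. q ~: {1, 2, 3} --> ar s1 q = start_ar inp q" by metis
	have vs1: "\<forall>p\<in>q_vars. va s1 p = va s0 p" unfolding s1_def by (simp add: run_va_param[OF wf_c_compress])
	have v1: "va s1 9 = h" "va s1 10 = D" using vs1 v0 by (auto simp: q_vars_def)
	have val: "\<forall>q\<in>set qs. valid2 (length A) q" using cp(2,4) by simp
	have nD: "n < 2 ^ D"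
	proof -
	 have "n < 2 ^ lg n" using lg_ge[of n] by linarith
	 also have "... <= 2 ^ D" by (intro power_increasing) (simp_all add: D_def)
	 finally show ?thesis .
	qed
	have chunks: "ALL i<length A. i div h < D" "j div h < D" if "j < ?nq" for j
	proof -
	 show "ALL i<length A. i div h < D"
	 proof (intro allI impI)
		fix i assume "i < length A"
		hence "i < 7 * h" using cp(2) nn(1) h(2) by linarith
		hence "i div h < 7" by (rule less_mult_imp_div_less)
		thus "i div h < D" using D8(2) by linarith
	 qed
	 have "C * n <= C * (7 * h)" using h(2) by (rule mult_le_mono2)
	 also have "... = 7 * C * h" by simp
	 finally have "j < 7 * C * h" using that nq(1) by linarith
	 hence "j div h < 7 * C" by (rule less_mult_imp_div_less)
	 thus "j div h < D" by (simp add: D_def c_def)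
	qed
	let ?K = "4 * D ^ 8"
	let ?acc = "acc A qs n h D"
	have total: "?acc True ?K j = ?acc False ?K j + out ! j" "?acc pos ?K j <= 2 * (n * n)" if j: "j < ?nq" for j pos
	proof -
	 have "length A <= n" "valid2 (length A) (qs ! j)" using cp(2,5) nn(1) val j by simp_all
	 note t = acc_answer[OF this(1) nD this(2) chunks(1)[OF j] chunks(2)[OF j]]
	 show "?acc True ?K j = ?acc False ?K j + out ! j" "?acc pos ?K j <= 2 * (n * n)" using t cp(3,5) j by simp_all
	qed
	have acc_lt: "?acc pos r j < ?W" if "j < ?nq" "r <= ?K" for pos r j using acc_mono[OF that(2), of A qs n h D pos j] total(2)[OF that(1), of pos] nnZ ZW by linarith
	\<comment> \<open>As in the generic reduction to queries, but with eight rows per call and one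
	  accumulator row for each sign.\<close>
	let ?I = "%r s. q_background s1 s & (\<forall>q\<ge>8 * r + 32. ar s q = (%_. 0)) &
		(ALL j<?nq. ar s 7 j = ?acc True r j & ar s 16 j = ?acc False r j)"
	have pieces: "correct_pieces edge_triangle_counting q_vars w z n c_compress t_build (t_collect t_gq t_kq) t_final s0 out" unfolding correct_pieces_def s1_def[symmetric]
	proof (rule exI[of _ ?I], intro conjI allI impI; (elim conjE)?)
	 show "q_background s1 s1" by (simp add: q_background_def)
	 show "ar s1 q = (%_. 0)" if "8 * 0 + 32 <= q" for q using cp(6) that by (simp add: start_ar_def)
	 show "ar s1 7 j = ?acc True 0 j" "ar s1 16 j = ?acc False 0 j" for j using cp(6) by (simp_all add: start_ar_def acc_def)
	next
	 fix r s assume r: "r < va s0 6" and bg: "q_background s1 s" and fresh: "\<forall>q\<ge>8 * r + 32. ar s q = (%_. 0)"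
		and ac: "ALL j<?nq. ar s 7 j = ?acc True r j & ar s 16 j = ?acc False r j"
	 have rK: "r < ?K" using r v0 by simp
	 define t where "t = set_va 5 r s"
	 have bgt: "q_background s1 t" "\<forall>q\<ge>8 * r + 32. ar t q = (%_. 0)" "va t 5 = r" "ar t = ar s" using bg fresh by (simp_all add: t_def q_background_def q_vars_def)
	 define R :: nat where "R = (if r mod 4 mod 3 = 0 then 7 else 16)"
	 have b: "0 < D" "D < ?W" "8 * r + 38 < ?Z" "length qs + 3 * n + 8 < ?Z" using D8 ZW rK len(2) nq(1) cp(5) by linarith+
	 obtain X Y where XY: "edge_triangle_counting z n X Y" "set X <= {..<?Z}" "va (run w z t_build t) 2 = 8 * r + 32"
		"!!i. ar (run w z t_build t) (8 * r + 32) i = (if i < length X then X ! i else 0)"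
		"!!f s''. ALL i<length Y. f i = Y ! i ==>
		 s'' = run w z (t_collect t_gq t_kq) ((run w z t_build t)(|ar := (ar (run w z t_build t))(8 * r + 32 := f)|)) ==>
		 ALL j<length qs. ar t R j + contrib A qs n h (r mod 4) (digits D 8 (r div 4)) j < ?W ==>
		 q_background s1 s'' & (\<forall>q\<ge>8 * r + 40. ar s'' q = (%_. 0)) &
		 (ALL j<length qs. ar s'' R j = ar t R j + contrib A qs n h (r mod 4) (digits D 8 (r div 4)) j) & (\<forall>q\<in>{7, 16} - {R}. ar s'' q = ar t q)"
		by (rule run_task[OF cp(1) bgt(1) val bgt(2) v1 bgt(3) h_def nn(2) b(1,2) W2 b(3,4) DD refl refl R_def refl]) (rule that)
	 have sums: "ALL j<length qs. ar t R j + contrib A qs n h (r mod 4) (digits D 8 (r div 4)) j < ?W"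
	 proof (intro allI impI)
		fix j assume "j < length qs"
		hence j: "j < ?nq" using cp(5) by simp
		have "ar t R j + contrib A qs n h (r mod 4) (digits D 8 (r div 4)) j = ?acc (r mod 4 mod 3 = 0) (r + 1) j" using ac j bgt(4) by (auto simp: acc_Suc R_def)
		also have "... < ?W" by (rule acc_lt[OF j]) (use rK in simp)
		finally show "ar t R j + contrib A qs n h (r mod 4) (digits D 8 (r div 4)) j < ?W" .
	 qed
	 show "EX X Y. let s' = run w z t_build (set_va 5 r s) in
		edge_triangle_counting z n X Y & set X <= {..<2 ^ z} & va s' 2 < 2 ^ z &
		(ALL i<2 ^ z. ar s' (va s' 2) i = (if i < length X then X ! i else 0)) &
		(ALL f. (ALL i<length Y. f i = Y ! i) -->
		 ?I (r + 1) (set_va 5 (r + 1) (run w z (t_collect t_gq t_kq) (s'(|ar := (ar s')(va s' 2 := f)|)))))" unfolding t_def[symmetric]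
	 proof (rule exI[of _ X], rule exI[of _ Y], unfold Let_def, intro conjI allI impI)
		show "va (run w z t_build t) 2 < 2 ^ z" "set X <= {..<2 ^ z}" using XY(2,3) b(3) by (simp_all add: pow2_def)
		show "ar (run w z t_build t) (va (run w z t_build t) 2) i = (if i < length X then X ! i else 0)" for i using XY(3,4) by simp
		fix f assume f: "ALL i<length Y. f i = Y ! i"
		let ?s = "run w z (t_collect t_gq t_kq) ((run w z t_build t)(|ar := (ar (run w z t_build t))(va (run w z t_build t) 2 := f)|))"
		have res: "q_background s1 ?s" "\<forall>q\<ge>8 * r + 40. ar ?s q = (%_. 0)"
		 "ALL j<length qs. ar ?s R j = ar t R j + contrib A qs n h (r mod 4) (digits D 8 (r div 4)) j" "\<forall>q\<in>{7, 16} - {R}. ar ?s q = ar t q" using XY(5)[OF f refl sums] XY(3) by simp_all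
		show "q_background s1 (set_va 5 (r + 1) ?s)" using res(1) by (simp add: q_background_def q_vars_def)
		show "ar (set_va 5 (r + 1) ?s) q = (%_. 0)" if "8 * (r + 1) + 32 <= q" for q using res(2) that by simp
		fix j assume j: "j < ?nq"
		note a1 = res(3)[rule_format, of j] and a2 = ac[rule_format, OF j]
		show "ar (set_va 5 (r + 1) ?s) 7 j = ?acc True (r + 1) j" using a1 a2 res(4) j cp(5) bgt(4) by (cases "r mod 4 mod 3 = 0") (simp_all add: acc_Suc R_def)
		show "ar (set_va 5 (r + 1) ?s) 16 j = ?acc False (r + 1) j" using a1 a2 res(4) j cp(5) bgt(4) by (cases "r mod 4 mod 3 = 0") (simp_all add: acc_Suc R_def)
	 qed (rule XY(1))
	next
	 fix s i assume pa: "params_agree q_vars (va s0) s" and i: "i < length out"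
		and ac: "ALL j<?nq. ar s 7 j = ?acc True (va s0 6) j & ar s 16 j = ?acc False (va s0 6) j"
	 let ?s = "set_va 5 (va s0 6) s"
	 have "ALL j<?nq. ar (run w z t_final ?s) 0 j = ar ?s 7 j - ar ?s 16 j"
	 proof (rule run_t_final)
		show "va ?s 7 = ?nq" using pa v0 by (simp add: params_agree_def q_vars_def)
		show "?nq <= ?Z" "16 < ?Z" "?Z <= ?W" using nq len(2) n1 ZW by linarith+
		show "ar ?s 7 j < ?W & ar ?s 16 j <= ar ?s 7 j" if "j < ?nq" for j using ac that total(1)[OF that] acc_lt[OF that order_refl, of True] v0 by simp
	 qed
	 thus "ar (run w z t_final ?s) 0 i = out ! i" using ac i total(1)[of i] sz v0 by simp
	qed
	have M: "X <= X * (lg n + 1) ^ 8" for X by simp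
	have vN: "va s0 3 + va s0 7 + va s0 8 + 1 <= (2 * C + 2) * (n + 1)" using nq v0 by (simp add: algebra_simps)
	have big: "5000 * (va s0 3 + va s0 7 + va s0 8 + 1) <= a * (n + 1)"
	proof -
	 have "5000 * (va s0 3 + va s0 7 + va s0 8 + 1) <= 5000 * ((2 * C + 2) * (n + 1))" using vN by (rule mult_le_mono2)
	 also have "... = 10000 * (C + 1) * (n + 1)" by (simp add: algebra_simps)
	 also have "... <= a * (n + 1)" by (intro mult_le_mono1) (simp add: a_def)
	 finally show ?thesis .
	qed
	show "length inp <= 2 ^ z & length out <= 2 ^ z & (\<forall>p\<in>q_vars. va s0 p < 2 ^ w) &
		va s0 6 <= a * (lg n + 1) ^ 8 & cost (va (start z n inp)) (t_params c) <= a * (n + 1) * (lg n + 1) ^ 8 &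
		(\<forall>c \<in> {c_compress, t_build, t_collect t_gq t_kq, t_final}. cost (va s0) c <= a * (n + 1) * (lg n + 1) ^ 8) &
		correct_pieces edge_triangle_counting q_vars w z n c_compress t_build (t_collect t_gq t_kq) t_final s0 out"
	proof (intro conjI)
	 show "length inp <= 2 ^ z" "length out <= 2 ^ z" using len sz nq unfolding pow2_def by linarith+
	 have "z < ?Z" "2 ^ z - 1 < ?Z" "lg n < pow2 (lg n)" by (simp_all add: pow2_def)
	 hence "z < ?W" "2 ^ z - 1 < ?W" "n < ?W" "lg n < ?W" "?nq < ?W" "inp ! 0 < ?W" "h < ?W" "D < ?W" "?K < ?W" "pow2 (lg n) < ?W" using ZW n1 P nq len(2) D8 h_def by linarith+
	 thus "\<forall>p\<in>q_vars. va s0 p < 2 ^ w" using v0 by (simp add: q_vars_def pow2_def)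
	 have "D <= (c + 1) * (lg n + 1)" by (simp add: D_def algebra_simps)
	 hence "D ^ 8 <= ((c + 1) * (lg n + 1)) ^ 8" by (rule power_mono) simp
	 also have "... = P8 * (lg n + 1) ^ 8" by (simp only: power_mult_distrib P8_def)
	 finally have "?K <= 4 * P8 * (lg n + 1) ^ 8" by simp
	 also have "... <= a * (lg n + 1) ^ 8" by (intro mult_le_mono1) (simp add: a_def)
	 finally show "va s0 6 <= a * (lg n + 1) ^ 8" using v0 by simp
	 have "cost (va (start z n inp)) (t_params c) <= 300" by (rule cost_t)
	 also have "... <= a * (n + 1)" by (simp add: a_def)
	 also note M
	 finally show "cost (va (start z n inp)) (t_params c) <= a * (n + 1) * (lg n + 1) ^ 8" .
	 have 1: "cost (va s0) c_compress <= a * (n + 1) * (lg n + 1) ^ 8"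
	 proof -
		have "cost (va s0) c_compress <= (2000 + 1000 * C) * (n + 1) * (lg n + 1)" by (rule cost_c_compress) (use v0 P nq in simp_all)
		also have "... <= a * (n + 1) * (lg n + 1) ^ 8" by (intro mult_le_mono self_le_power) (simp_all add: a_def)
		finally show ?thesis .
	 qed
	 have "cost (va s0) t_build <= a * (n + 1) * (lg n + 1) ^ 8"
		"cost (va s0) (t_collect t_gq t_kq) <= a * (n + 1) * (lg n + 1) ^ 8"
		"cost (va s0) t_final <= a * (n + 1) * (lg n + 1) ^ 8" by (rule order_trans[OF order_trans[OF cost_t(2) big] M] order_trans[OF order_trans[OF cost_t(3) big] M]
			order_trans[OF order_trans[OF cost_t(4) big] M])+
	 with 1 show "\<forall>c \<in> {c_compress, t_build, t_collect t_gq t_kq, t_final}. cost (va s0) c <= a * (n + 1) * (lg n + 1) ^ 8" by simp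
	qed (rule pieces)
 qed (use wf_t wf_c_compress in simp_all)
qed

section \<open>The cycle of reductions\<close>

definition transfers :: "problem => problem => bool" where
 "transfers P Q \<longleftrightarrow> (ALL T. solvable_in_time P T --> (\<exists>T' \<in> soft_O T. solvable_in_time Q T'))"

lemma transfers_refl: "transfers P P"
proof -
 have "T : O(%N. T N * ln (real N) ^ 0)" for T :: "nat => real" by simp
 hence "T : soft_O T" for T unfolding soft_O_def by blast
 thus ?thesis unfolding transfers_def by blast
qed

lemma transfers_trans: "transfers P Q ==> transfers Q R ==> transfers P R"
 unfolding transfers_def using soft_O_trans by metis

text \<open>The density chosen for the problems passed through on the way along the cycle.\<close>

lemma linear_bounds_1: "linear_bounds 1 1"
 unfolding linear_bounds_def
proof (intro conjI always_eventually allI)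
 show "\<exists>q::nat. 1 * real n <= real q & real q <= 1 * real n" for n by (rule exI[of _ n]) simp
qed simp

text \<open>The densities of the problem to be solved are arbitrary, because any linear number of
  queries can be batched. Only the problem whose solver is called must have instances of all large
  sizes.\<close>

lemma transfers_cycle:
 assumes "linear_bounds alp bet"
 shows "transfers edge_triangle_counting (two_range_query (>) alp' bet')"
	and "transfers (two_range_query (>) alp bet) (range_query (>) alp' bet')"
	and "transfers (range_query (>) alp bet) (range_query (=) alp' bet')"
	and "transfers (range_query (=) alp bet) (two_range_query (=) alp' bet')"
	and "transfers (two_range_query (=) alp bet) edge_triangle_counting"
 using inversions_to_triangles inversions_to_two_range[OF _ assms] equal_to_inversions[OF _ assms]
	two_range_to_range[OF _ assms] triangles_to_two_range[OF _ assms] unfolding transfers_def by blast+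

lemma five_problems_cases:
 assumes "P : five_problems alp bet"
 obtains "P = edge_triangle_counting" | "P = range_query (=) alp bet" | "P = two_range_query (=) alp bet"
	| "P = range_query (>) alp bet" | "P = two_range_query (>) alp bet" using assms unfolding five_problems_def range_eq_pairs_query_def two_range_eq_pairs_query_def
	range_inversions_query_def two_range_inversions_query_def by blast

text \<open>Triangle counting serves as hub because it has no densities. Paths to and from it may
  use density 1 in between, so the densities of two query problems need not match.\<close>

lemma transfers_triangles:
 assumes lb: "linear_bounds alp bet" and P: "P : five_problems alp bet"
 shows "transfers P edge_triangle_counting" "transfers edge_triangle_counting P"
proof -
 note c = transfers_cycle[OF lb] and c1 = transfers_cycle[OF linear_bounds_1]
 have 1: "transfers (two_range_query (=) alp bet) edge_triangle_counting" by (rule c)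
 have 2: "transfers (range_query (=) alp bet) edge_triangle_counting" by (rule transfers_trans[OF c(4) c1(5)])
 have 3: "transfers (range_query (>) alp bet) edge_triangle_counting" by (rule transfers_trans[OF c(3) transfers_trans[OF c1(4) c1(5)]])
 have 4: "transfers (two_range_query (>) alp bet) edge_triangle_counting" by (rule transfers_trans[OF c(2) transfers_trans[OF c1(3) transfers_trans[OF c1(4) c1(5)]]])
 show "transfers P edge_triangle_counting" using P by (rule five_problems_cases) (use 1 2 3 4 transfers_refl in simp_all)
 have 5: "transfers edge_triangle_counting (two_range_query (>) alp' bet')" for alp' bet' by (rule c)
 have 6: "transfers edge_triangle_counting (range_query (>) alp' bet')" for alp' bet' by (rule transfers_trans[OF 5 c1(2)])
 have 7: "transfers edge_triangle_counting (range_query (=) alp' bet')" for alp' bet' by (rule transfers_trans[OF 6 c1(3)])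
 have 8: "transfers edge_triangle_counting (two_range_query (=) alp' bet')" for alp' bet' by (rule transfers_trans[OF 7 c1(4)])
 show "transfers edge_triangle_counting P" using P by (rule five_problems_cases) (use 5 6 7 8 transfers_refl in simp_all)
qed

theorem theorem1:
  fixes T :: "nat \<Rightarrow> real" and \<alpha> \<beta> \<alpha>' \<beta>' :: real and P Q :: problem
  assumes "linear_bounds \<alpha> \<beta>" and "linear_bounds \<alpha>' \<beta>'"
    and "P \<in> five_problems \<alpha> \<beta>" and "Q \<in> five_problems \<alpha>' \<beta>'"
    and "solvable_in_time P T"
  shows "\<exists>T' \<in> soft_O T. solvable_in_time Q T'"
  using transfers_trans[OF transfers_triangles(1)[OF assms(1,3)] transfers_triangles(2)[OF assms(2,4)]] assms(5)
  unfolding transfers_def by blast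

end
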